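(* Let $\lambda_0$ denote the largest eigenvalue of $\Xi_\infty$. Then under conditions C.1, C.2, C.3, C.4, C.5 (listed in the context), for any $\lambda>\lambda_0$, there exists a constant $C_4\in(0,\infty)$, depending only on $s,d,\lambda,\rho,\kappa$, such that for all $n\ge2$, $$E\big(1+\|S_n\|^{s_0}\big)\mathbb{1}\big(\|S_n\|>[(s-2)\lambda\log n]^{1/2}\big)\le C_4\,b^{-(s-2)/2}(\log n)^{-2}.$$
   Context: Setting. $\{X_i\}_{i\in\mathbb{Z}}$ is a (possibly nonstationary) sequence of $\mathbb{R}^{d_0}$-valued random vectors on a probability space $(\Omega,\mathcal{F},P)$ with $EX_i=0$. $\ell\equiv\ell_n\in[1,n]$ is an integer; $\chi_{i,\ell}=(X_i,\ldots,X_{i+\ell-1})'$; $Y_{in}=f_{in}(\chi_{i,\ell})$, $i,n\in\mathbb{N}$, where $f_{in}:\mathbb{R}^{d_0\ell}\to\mathbb{R}^{d_1}$ are Borel measurable and $EY_{in}=0$. Put $d=d_0+d_1$ ($d_0,d_1\in\mathbb{N}$), $b=\lceil n/\ell\rceil$ and $$S_n=\Big(\tfrac{1}{\sqrt n}\sum_{i=1}^nX_i',\ \tfrac{1}{\sqrt{n\ell}}\sum_{i=1}^nY_{in}'\Big)'.$$ $\{\mathcal{D}_j\}_{j\in\mathbb{Z}}$ is a given collection of sub-$\sigma$-fields of $\mathcal{F}$ and $\mathcal{D}_p^q=\sigma\langle\mathcal{D}_j:j\in\mathbb{Z},\,p\le j\le q\rangle$, $-\infty\le p<q\le\infty$. For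 $k=1,\ldots,b$: $\bar X_{kn}=\ell^{-1}\sum_{i=(k-1)\ell+1}^{k\ell\wedge n}X_i$, $\bar Y_{kn}=\ell^{-1}\sum_{i=(k-1)\ell+1}^{k\ell\wedge n}Y_{in}$, $W_{kn}=(\sqrt\ell\,\bar X_{kn}',\bar Y_{kn}')'$. $\|\cdot\|$ is the Euclidean norm; $'$ is transpose; $\mathbb{1}(B)$ is the indicator of $B$; $s_0=2\lfloor s/2\rfloor$. Conditions ($\ell,b$ depend on $n$; "depending on $\kappa$" refers to the constants $\kappa$ in these conditions). C.1: There is $\kappa\in(0,1)$ such that $\kappa\log n<\ell<\kappa^{-1}n^{1-\kappa}$ for all $n>\kappa^{-1}$. C.2: (i) There are $\rho\in(0,\infty)$ and an integer $s\ge3$ such that $\max\{Eh_s(\|\bar Y_{kn}\|),Eh_s(\|\sqrt\ell\bar X_{kn}\|)\}\le\rho$ for all $1\le k\le b$, $n\ge1$, where $h_s(u)=u^s[\log(1+u)]^{\alpha(s)}$, $u\ge0$, $\alpha(s)=2s^2$. (ii) $EX_i=0=EY_{in}$ for all $i,n\ge1$; $\lim_{n\to\infty}\mathrm{Cov}(S_n)=\Xi_\infty$ exists and is nonsingular; and there is $\kappa\in(0,1)$ such that $\inf_{\|t\|=1}t'\,\mathrm{Cov}(\sum_{j=j_0+1}^{j_0+m}W_{jn})\,t>\kappa m$ for all integers $j_0,m,n$ with $0\le j_0\le b-m$, $\kappa^{-1}\le m\le\sqrt b$, $n\ge\kappa^{-1}$. C.3: There is $\kappa\in(0,1)$ such that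 for $m,n>\kappa^{-1}$ and $j\ge1$, $1\le i\le n$, there exist a $\mathcal{D}_{j-m}^{j+m}$-measurable $X_{j,m}^\dagger$ and a $\mathcal{D}_{i-m}^{i+m+\ell}$-measurable $Y_{in,m}^\dagger$ with $\max\{E\|X_j-X_{j,m}^\dagger\|,\ \ell^{-1}E\|Y_{in}-Y_{in,m}^\dagger\|\}\le\kappa^{-1}\exp(-\kappa m)$. C.4: There is $\kappa\in(0,1)$ such that for all $m\in\mathbb{N}$, $\sup\{|P(A\cap B)-P(A)P(B)|:A\in\mathcal{D}_{-\infty}^i,B\in\mathcal{D}_{i+m}^\infty,i\in\mathbb{Z}\}\le\kappa^{-1}\exp(-\kappa m)$. C.5: There is $\kappa\in(0,1)$ such that for all positive integers $i,j,k,r,m$ with $i<k<r<j$ and $m>\kappa^{-1}$, and all $A\in\mathcal{D}_i^j$, $E|P(A|\mathcal{D}_p:p\notin[k,r])-P(A|\mathcal{D}_p:p\in[i-m,k)\cup(r,j+m])|\le\kappa^{-1}\exp(-\kappa m)$.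
   Formalization: The constant C_4 may depend also on Ξ_∞ and on a null sequence bounding ‖Cov(S_n)−Ξ_∞‖ for all n≥1 (every process has one); with dependence only on s,d,λ,ρ,κ the claim fails, e.g. for independent Gaussian X_i whose variance drops after a late index N. *)

theory Defs
  imports "HOL-Probability.Probability"
begin

(* Conventions.  A collection of sub-sigma-fields is a family D of measures of which only the
   measurable sets matter.  The block length is a function l of n.  The domain R^(d0 * l n) of
   f i n is the product of l n copies of R^d0 with the product sigma-algebra.  Bounds on
   expectations of nonnegative variables not known to be integrable are stated with the
   nonnegative integral, so that they include finiteness. *)

definition stack :: "real^'p \<Rightarrow> real^'q \<Rightarrow> real^('p + 'q)" where
  "stack x y = (\<chi> c. case c of Inl a \<Rightarrow> x $ a | Inr a \<Rightarrow> y $ a)"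

(* Only used for square-integrable Z: the moment bound in cond_C2 makes all block averages, and
   hence Ssum and the sums of Wblock, square-integrable. *)
definition cov_mat :: "'w measure \<Rightarrow> ('w \<Rightarrow> real^'n) \<Rightarrow> real^'n^'n" where
  "cov_mat M Z = (\<chi> i j. \<integral>\<omega>. (Z \<omega> $ i - (\<integral>\<xi>. Z \<xi> $ i \<partial>M)) * (Z \<omega> $ j - (\<integral>\<xi>. Z \<xi> $ j \<partial>M)) \<partial>M)"

definition eigenval :: "real^'n^'n \<Rightarrow> real \<Rightarrow> bool" where
  "eigenval A \<mu> \<longleftrightarrow> (\<exists>v. v \<noteq> 0 \<and> A *v v = \<mu> *s v)"

definition largest_eigenval :: "real^'n^'n \<Rightarrow> real \<Rightarrow> bool" where
  "largest_eigenval A \<mu> \<longleftrightarrow> eigenval A \<mu> \<and> (\<forall>\<nu>. eigenval A \<nu> \<longrightarrow> \<nu> \<le> \<mu>)"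

definition gen_field :: "'w measure \<Rightarrow> (int \<Rightarrow> 'w measure) \<Rightarrow> int set \<Rightarrow> 'w measure" where
  "gen_field M D J = sigma (space M) (\<Union>j\<in>J. sets (D j))"

definition window :: "(int \<Rightarrow> 'w \<Rightarrow> real^'p) \<Rightarrow> nat \<Rightarrow> nat \<Rightarrow> 'w \<Rightarrow> nat \<Rightarrow> real^'p" where
  "window X L i \<omega> = (\<lambda>k\<in>{..<L}. X (int i + int k) \<omega>)"

definition Yvar ::
  "(int \<Rightarrow> 'w \<Rightarrow> real^'p) \<Rightarrow> (nat \<Rightarrow> nat) \<Rightarrow> (nat \<Rightarrow> nat \<Rightarrow> (nat \<Rightarrow> real^'p) \<Rightarrow> real^'q)
    \<Rightarrow> nat \<Rightarrow> nat \<Rightarrow> 'w \<Rightarrow> real^'q" where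
  "Yvar X l f i n \<omega> = f i n (window X (l n) i \<omega>)"

definition block_setting ::
  "'w measure \<Rightarrow> (int \<Rightarrow> 'w \<Rightarrow> real^'p) \<Rightarrow> (int \<Rightarrow> 'w measure) \<Rightarrow> (nat \<Rightarrow> nat)
    \<Rightarrow> (nat \<Rightarrow> nat \<Rightarrow> (nat \<Rightarrow> real^'p) \<Rightarrow> real^'q) \<Rightarrow> bool" where
  "block_setting M X D l f \<longleftrightarrow>
     prob_space M \<and>
     (\<forall>i. X i \<in> borel_measurable M \<and> integrable M (X i) \<and> (\<integral>\<omega>. X i \<omega> \<partial>M) = 0) \<and>
     (\<forall>j. subalgebra M (D j)) \<and>
     (\<forall>n\<ge>1. 1 \<le> l n \<and> l n \<le> n) \<and>
     (\<forall>i\<ge>1. \<forall>n\<ge>1. f i n \<in> borel_measurable (Pi\<^sub>M {..<l n} (\<lambda>_. borel)) \<and>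
        integrable M (Yvar X l f i n) \<and> (\<integral>\<omega>. Yvar X l f i n \<omega> \<partial>M) = 0)"

definition nblocks :: "(nat \<Rightarrow> nat) \<Rightarrow> nat \<Rightarrow> nat" where
  "nblocks l n = nat \<lceil>real n / real (l n)\<rceil>"

definition Ssum ::
  "(int \<Rightarrow> 'w \<Rightarrow> real^'p) \<Rightarrow> (nat \<Rightarrow> nat) \<Rightarrow> (nat \<Rightarrow> nat \<Rightarrow> (nat \<Rightarrow> real^'p) \<Rightarrow> real^'q)
    \<Rightarrow> nat \<Rightarrow> 'w \<Rightarrow> real^('p + 'q)" where
  "Ssum X l f n \<omega> =
     stack ((1 / sqrt (real n)) *\<^sub>R (\<Sum>i=1..n. X (int i) \<omega>))
           ((1 / sqrt (real n * real (l n))) *\<^sub>R (\<Sum>i=1..n. Yvar X l f i n \<omega>))"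

definition Xbar :: "(int \<Rightarrow> 'w \<Rightarrow> real^'p) \<Rightarrow> (nat \<Rightarrow> nat) \<Rightarrow> nat \<Rightarrow> nat \<Rightarrow> 'w \<Rightarrow> real^'p" where
  "Xbar X l k n \<omega> =
     (1 / real (l n)) *\<^sub>R (\<Sum>i = (k - 1) * l n + 1 .. min (k * l n) n. X (int i) \<omega>)"

definition Ybar ::
  "(int \<Rightarrow> 'w \<Rightarrow> real^'p) \<Rightarrow> (nat \<Rightarrow> nat) \<Rightarrow> (nat \<Rightarrow> nat \<Rightarrow> (nat \<Rightarrow> real^'p) \<Rightarrow> real^'q)
    \<Rightarrow> nat \<Rightarrow> nat \<Rightarrow> 'w \<Rightarrow> real^'q" where
  "Ybar X l f k n \<omega> =
     (1 / real (l n)) *\<^sub>R (\<Sum>i = (k - 1) * l n + 1 .. min (k * l n) n. Yvar X l f i n \<omega>)"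

definition Wblock ::
  "(int \<Rightarrow> 'w \<Rightarrow> real^'p) \<Rightarrow> (nat \<Rightarrow> nat) \<Rightarrow> (nat \<Rightarrow> nat \<Rightarrow> (nat \<Rightarrow> real^'p) \<Rightarrow> real^'q)
    \<Rightarrow> nat \<Rightarrow> nat \<Rightarrow> 'w \<Rightarrow> real^('p + 'q)" where
  "Wblock X l f k n \<omega> = stack (sqrt (real (l n)) *\<^sub>R Xbar X l k n \<omega>) (Ybar X l f k n \<omega>)"

definition hfun :: "nat \<Rightarrow> real \<Rightarrow> real" where
  "hfun s u = u ^ s * (ln (1 + u)) ^ (2 * s\<^sup>2)"

definition cond_C1 :: "real \<Rightarrow> (nat \<Rightarrow> nat) \<Rightarrow> bool" where
  "cond_C1 \<kappa> l \<longleftrightarrow>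
     (\<forall>n. real n > 1 / \<kappa> \<longrightarrow>
        \<kappa> * ln (real n) < real (l n) \<and> real (l n) < (1 / \<kappa>) * real n powr (1 - \<kappa>))"

definition cond_C2 ::
  "nat \<Rightarrow> real \<Rightarrow> real \<Rightarrow> real^('p + 'q)^('p + 'q) \<Rightarrow> 'w measure \<Rightarrow> (int \<Rightarrow> 'w \<Rightarrow> real^'p)
    \<Rightarrow> (nat \<Rightarrow> nat) \<Rightarrow> (nat \<Rightarrow> nat \<Rightarrow> (nat \<Rightarrow> real^'p) \<Rightarrow> real^'q) \<Rightarrow> bool" where
  "cond_C2 s \<rho> \<kappa> \<Xi> M X l f \<longleftrightarrow>
     (\<forall>n\<ge>1. \<forall>k\<in>{1..nblocks l n}.
        max (\<integral>\<^sup>+\<omega>. ennreal (hfun s (norm (Ybar X l f k n \<omega>))) \<partial>M)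
            (\<integral>\<^sup>+\<omega>. ennreal (hfun s (norm (sqrt (real (l n)) *\<^sub>R Xbar X l k n \<omega>))) \<partial>M)
          \<le> ennreal \<rho>) \<and>
     (\<forall>i\<ge>1. \<forall>n\<ge>1. (\<integral>\<omega>. X (int i) \<omega> \<partial>M) = 0 \<and> (\<integral>\<omega>. Yvar X l f i n \<omega> \<partial>M) = 0) \<and>
     (\<lambda>n. cov_mat M (Ssum X l f n)) \<longlonglongrightarrow> \<Xi> \<and> invertible \<Xi> \<and>
     (\<forall>j\<^sub>0 m n. j\<^sub>0 + m \<le> nblocks l n \<longrightarrow> 1 / \<kappa> \<le> real m \<longrightarrow>
        real m \<le> sqrt (real (nblocks l n)) \<longrightarrow> real n \<ge> 1 / \<kappa> \<longrightarrow>
        (INF t\<in>{t. norm t = 1}.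
           t \<bullet> (cov_mat M (\<lambda>\<omega>. \<Sum>j = j\<^sub>0 + 1 .. j\<^sub>0 + m. Wblock X l f j n \<omega>) *v t)) > \<kappa> * real m)"

definition cond_C3 ::
  "real \<Rightarrow> 'w measure \<Rightarrow> (int \<Rightarrow> 'w \<Rightarrow> real^'p) \<Rightarrow> (int \<Rightarrow> 'w measure) \<Rightarrow> (nat \<Rightarrow> nat)
    \<Rightarrow> (nat \<Rightarrow> nat \<Rightarrow> (nat \<Rightarrow> real^'p) \<Rightarrow> real^'q) \<Rightarrow> bool" where
  "cond_C3 \<kappa> M X D l f \<longleftrightarrow>
     (\<forall>(m::nat) (n::nat) (j::nat) (i::nat).
        real m > 1 / \<kappa> \<longrightarrow> real n > 1 / \<kappa> \<longrightarrow> 1 \<le> j \<longrightarrow> 1 \<le> i \<longrightarrow> i \<le> n \<longrightarrow>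
        (\<exists>Xd Yd.
           Xd \<in> borel_measurable (gen_field M D {int j - int m .. int j + int m}) \<and>
           Yd \<in> borel_measurable (gen_field M D {int i - int m .. int i + int m + int (l n)}) \<and>
           max (\<integral>\<^sup>+\<omega>. ennreal (norm (X (int j) \<omega> - Xd \<omega>)) \<partial>M)
               (ennreal (1 / real (l n)) * (\<integral>\<^sup>+\<omega>. ennreal (norm (Yvar X l f i n \<omega> - Yd \<omega>)) \<partial>M))
             \<le> ennreal ((1 / \<kappa>) * exp (- \<kappa> * real m))))"

definition cond_C4 :: "real \<Rightarrow> 'w measure \<Rightarrow> (int \<Rightarrow> 'w measure) \<Rightarrow> bool" where
  "cond_C4 \<kappa> M D \<longleftrightarrow>
     (\<forall>m::nat. 1 \<le> m \<longrightarrow>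
        Sup {\<bar>measure M (A \<inter> B) - measure M A * measure M B\<bar> | A B i.
               A \<in> sets (gen_field M D {..i}) \<and> B \<in> sets (gen_field M D {i + int m ..})}
          \<le> (1 / \<kappa>) * exp (- \<kappa> * real m))"

definition cond_C5 :: "real \<Rightarrow> 'w measure \<Rightarrow> (int \<Rightarrow> 'w measure) \<Rightarrow> bool" where
  "cond_C5 \<kappa> M D \<longleftrightarrow>
     (\<forall>(i::int) j k r m. 0 < i \<longrightarrow> i < k \<longrightarrow> k < r \<longrightarrow> r < j \<longrightarrow> 0 < m \<longrightarrow>
        real_of_int m > 1 / \<kappa> \<longrightarrow>
        (\<forall>A \<in> sets (gen_field M D {i..j}).
           (\<integral>\<omega>. \<bar>real_cond_exp M (gen_field M D (- {k..r})) (indicator A) \<omega>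
                - real_cond_exp M (gen_field M D ({i - m..<k} \<union> {r<..j + m})) (indicator A) \<omega>\<bar> \<partial>M)
             \<le> (1 / \<kappa>) * exp (- \<kappa> * real_of_int m)))"

(* Not a restriction on a single process: the convergence required in cond_C2 gives such a null
   sequence delta for every process (the norms themselves).  It names the speed at which Cov(S_n)
   approaches Xi, so that one constant can serve all processes with the same parameters, Xi and
   delta.  A constant uniform in Xi and delta as well does not exist:
   nothing else bounds the n from which Cov(S_n) is close to Xi, nor keeps the largest
   eigenvalue of Xi away from lambda. *)
definition cov_rate ::
  "(nat \<Rightarrow> real) \<Rightarrow> real^('p + 'q)^('p + 'q) \<Rightarrow> 'w measure \<Rightarrow> (int \<Rightarrow> 'w \<Rightarrow> real^'p)
    \<Rightarrow> (nat \<Rightarrow> nat) \<Rightarrow> (nat \<Rightarrow> nat \<Rightarrow> (nat \<Rightarrow> real^'p) \<Rightarrow> real^'q) \<Rightarrow> bool" where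
  "cov_rate \<delta> \<Xi> M X l f \<longleftrightarrow> (\<forall>n\<ge>1. norm (cov_mat M (Ssum X l f n) - \<Xi>) \<le> \<delta> n)"

end

theory Submission
  imports Defs "HOL-Real_Asymp.Real_Asymp"
begin

text \<open>
  Write S_n as a \<Sum>_k W_k with a = (l/n)^(1/2), a sum over the b blocks, where a^2 \<le> 2/b.
  By the approximation condition, \<open>W_k\<close> is close in mean to a variable that only
  depends on the fields \<open>D_j\<close> with j in a window around block k, and by strong mixing
  two windows that are r blocks apart are independent up to an error exp(-const r l)
  (\<open>block_approx_exists\<close>). As l exceeds a multiple of log n, a constant gap already
  makes this error smaller than a prescribed power of n.

  Let c = 2^m0 be just below b^(1/2)/log n. A large value of S_n has one of two sources
  (\<open>tail_moment_split\<close>).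

  The first is the sum of the clipped blocks. Finitely many directions \<theta> cover the unit
  sphere, so that it suffices to bound the tail of a \<Sum>_k clip c (\<theta> \<bullet> W_k). Cut
  the blocks into long groups of constant length separated by short ones. At the scale that
  matters, the exponent t B_j of a group sum is uniformly small, so that E exp(t B_j) \<le> 1 + t
  E B_j + (1+o(1)) t^2 E B_j^2/2; as the variances of the long groups add up to nearly the
  variance of \<theta> \<bullet> S_n, the tail at k (log n)^(1/2) is at most a multiple of
  n^(-k^2/(2\<lambda>2)) for any \<lambda>2 > \<lambda>0
  (\<open>clipped_sum_moderate_deviation\<close>). Since \<lambda> > \<lambda>0, this beats
  n^(-(s-2)/2) by a power of n at the level of the theorem. The product of the exponentials is
  much too large to replace its expectation by the product of expectations at the price of a
  mixing error. It is therefore stopped at the first partial sum above the threshold, where it is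
  only a power of n (\<open>weak_indep_exponential_tail\<close>).

  The second source is the excess Z = \<Sum>_k |W_k| 1(|W_k| > c). For even s its moment of order
  s0 = s uses up all available moments, and the mixing error of a fixed gap is too large against
  values of arbitrary size. Instead, Z is cut into the dyadic levels 2^m < |W_k|. At level m a gap
  proportional to m makes the mixing error smaller than 2^(-ms), so that the moments of the number
  of exceedances are of the order of their mean (\<open>weak_indep_count_moment\<close>). The
  factor [log(1+u)]^(2s^2) in the moment condition pays for the polynomial weights in m that this
  costs (\<open>excess_moment\<close>).

  For the finitely many remaining n crude moment bounds suffice
  (\<open>tail_moment_crude\<close>).
\<close>

section \<open>Covariances under strong mixing\<close>

definition alpha_mix :: "'w measure \<Rightarrow> 'w measure \<Rightarrow> 'w measure \<Rightarrow> real \<Rightarrow> bool" where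
  "alpha_mix M P Q \<alpha> \<longleftrightarrow> subalgebra M P \<and> subalgebra M Q \<and>
     (\<forall>A\<in>sets P. \<forall>B\<in>sets Q. \<bar>measure M (A \<inter> B) - measure M A * measure M B\<bar> \<le> \<alpha>)"

lemma integrable_unit_bounded:
  fixes \<phi> :: "'w \<Rightarrow> real"
  assumes "prob_space M" "\<phi> \<in> borel_measurable M" "\<And>x. \<bar>\<phi> x\<bar> \<le> C"
  shows "integrable M \<phi>"
proof -
  interpret prob_space M by fact
  show ?thesis by (rule integrable_const_bound[of _ C]) (use assms in auto)
qed

text \<open>
  Among all weights \<phi> with values in [0,1] that are measurable for \<open>P\<close>, the
  integral of \<phi>\<zeta> is largest for the indicator of the event where the conditional
  expectation of \<zeta> is positive.
\<close>

lemma integral_times_le_of_sets: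
  fixes \<zeta> \<phi> :: "'w \<Rightarrow> real"
  assumes M: "prob_space M" and sub: "subalgebra M P" and \<zeta>: "integrable M \<zeta>"
    and bd: "\<And>A. A \<in> sets P \<Longrightarrow> (\<integral>x. indicator A x * \<zeta> x \<partial>M) \<le> \<alpha>"
    and \<phi>: "\<phi> \<in> borel_measurable P" "\<And>x. 0 \<le> \<phi> x" "\<And>x. \<phi> x \<le> 1"
  shows "(\<integral>x. \<phi> x * \<zeta> x \<partial>M) \<le> \<alpha>"
proof -
  interpret prob_space M by fact
  interpret finite_measure_subalgebra M P by unfold_locales (rule sub)
  define e where "e = real_cond_exp M P \<zeta>"
  have eP: "e \<in> borel_measurable P" by (simp add: e_def)
  have ei: "integrable M e" unfolding e_def using \<zeta> by auto
  have \<phi>M: "\<phi> \<in> borel_measurable M" using \<phi>(1) sub measurable_from_subalg by blast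
  have i1: "integrable M (\<lambda>x. \<phi> x * \<zeta> x)"
    by (rule Bochner_Integration.integrable_bound[OF \<zeta>])
       (use \<phi>M \<zeta> \<phi>(2,3) in \<open>auto simp: abs_mult intro!: mult_left_le_one_le\<close>)
  define A where "A = {x\<in>space P. e x > 0}"
  have A: "A \<in> sets P" unfolding A_def using eP by measurable
  have AM: "A \<in> sets M" using A sub by (auto simp: subalgebra_def)
  have spc: "space P = space M" using sub by (auto simp: subalgebra_def)
  have i2: "integrable M (\<lambda>x. indicator A x * \<zeta> x)"
    using integrable_mult_indicator[OF AM \<zeta>] by simp
  have "(\<integral>x. \<phi> x * \<zeta> x \<partial>M) = (\<integral>x. \<phi> x * e x \<partial>M)"
    unfolding e_def using real_cond_exp_intg(2)[OF i1 \<phi>(1)] \<zeta> by auto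
  also have "\<dots> \<le> (\<integral>x. indicator A x * e x \<partial>M)"
  proof (rule integral_mono)
    show "integrable M (\<lambda>x. \<phi> x * e x)"
      unfolding e_def using real_cond_exp_intg(1)[OF i1 \<phi>(1)] \<zeta> by auto
    show "integrable M (\<lambda>x. indicator A x * e x)"
      using integrable_mult_indicator[OF AM ei] by simp
    fix x assume x: "x \<in> space M"
    show "\<phi> x * e x \<le> indicator A x * e x"
    proof (cases "e x > 0")
      case True
      then have "x \<in> A" using x spc by (auto simp: A_def)
      then show ?thesis using True \<phi>(3)[of x] by simp
    next
      case False
      then have "x \<notin> A" by (auto simp: A_def)
      then show ?thesis using False \<phi>(2)[of x] by (simp add: mult_nonneg_nonpos)
    qed
  qed
  also have "\<dots> = (\<integral>x. indicator A x * \<zeta> x \<partial>M)"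
    unfolding e_def using real_cond_exp_intg(2)[OF i2 borel_measurable_indicator[OF A]] \<zeta> by auto
  also have "\<dots> \<le> \<alpha>" by (rule bd[OF A])
  finally show ?thesis .
qed

lemma integral_times_abs_le_of_sets:
  fixes \<zeta> \<phi> :: "'w \<Rightarrow> real"
  assumes M: "prob_space M" and sub: "subalgebra M P" and \<zeta>: "integrable M \<zeta>"
    and bd: "\<And>A. A \<in> sets P \<Longrightarrow> \<bar>\<integral>x. indicator A x * \<zeta> x \<partial>M\<bar> \<le> \<alpha>"
    and \<phi>: "\<phi> \<in> borel_measurable P" "\<And>x. 0 \<le> \<phi> x" "\<And>x. \<phi> x \<le> 1"
  shows "\<bar>\<integral>x. \<phi> x * \<zeta> x \<partial>M\<bar> \<le> \<alpha>"
proof -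
  have "(\<integral>x. \<phi> x * \<zeta> x \<partial>M) \<le> \<alpha>"
    by (rule integral_times_le_of_sets[OF M sub \<zeta> _ \<phi>]) (use bd in \<open>auto simp: abs_le_iff\<close>)
  moreover have "(\<integral>x. \<phi> x * - \<zeta> x \<partial>M) \<le> \<alpha>"
    by (rule integral_times_le_of_sets[OF M sub _ _ \<phi>]) (use \<zeta> bd in \<open>auto simp: abs_le_iff\<close>)
  ultimately show ?thesis by (simp add: abs_le_iff)
qed

text \<open>
  The extremal argument applies twice: first to the factor \<psi> against a centred indicator from
  \<open>P\<close>, then to \<phi> against the centred \<psi>. In this way no factor beyond
  \<alpha> arises.
\<close>

lemma alpha_mix_covariance_unit:
  fixes \<phi> \<psi> :: "'w \<Rightarrow> real"
  assumes M: "prob_space M" and mix: "alpha_mix M P Q \<alpha>"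
    and \<phi>: "\<phi> \<in> borel_measurable P" "\<And>x. 0 \<le> \<phi> x" "\<And>x. \<phi> x \<le> 1"
    and \<psi>: "\<psi> \<in> borel_measurable Q" "\<And>x. 0 \<le> \<psi> x" "\<And>x. \<psi> x \<le> 1"
  shows "\<bar>(\<integral>x. \<phi> x * \<psi> x \<partial>M) - (\<integral>x. \<phi> x \<partial>M) * (\<integral>x. \<psi> x \<partial>M)\<bar> \<le> \<alpha>"
proof -
  interpret prob_space M by fact
  have sub: "subalgebra M P" "subalgebra M Q" using mix by (auto simp: alpha_mix_def)
  have \<phi>M: "\<phi> \<in> borel_measurable M" and \<psi>M: "\<psi> \<in> borel_measurable M"
    using \<phi>(1) \<psi>(1) sub measurable_from_subalg by blast+
  have i\<phi>: "integrable M \<phi>" by (rule integrable_unit_bounded[OF M \<phi>M, of 1]) (use \<phi> in auto)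
  have i\<psi>: "integrable M \<psi>" by (rule integrable_unit_bounded[OF M \<psi>M, of 1]) (use \<psi> in auto)
  have ev: "\<bar>\<integral>x. \<psi> x * (indicator A x - prob A) \<partial>M\<bar> \<le> \<alpha>" if A: "A \<in> sets P" for A
  proof (rule integral_times_abs_le_of_sets[OF M sub(2) _ _ \<psi>])
    have AM: "A \<in> sets M" using A sub by (auto simp: subalgebra_def)
    show "integrable M (\<lambda>x. indicator A x - prob A)"
      using AM by (auto simp: emeasure_eq_measure)
    fix B assume B: "B \<in> sets Q"
    have BM: "B \<in> sets M" using B sub by (auto simp: subalgebra_def)
    have "(\<integral>x. indicator B x * (indicator A x - prob A) \<partial>M)
        = (\<integral>x. indicator (A \<inter> B) x - prob A * indicator B x \<partial>M)"
      by (rule Bochner_Integration.integral_cong) (auto simp: indicator_def)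
    also have "\<dots> = prob (A \<inter> B) - prob A * prob B"
      using AM BM by (subst Bochner_Integration.integral_diff)
         (auto simp: emeasure_eq_measure intro!: integrable_real_indicator)
    finally show "\<bar>\<integral>x. indicator B x * (indicator A x - prob A) \<partial>M\<bar> \<le> \<alpha>"
      using mix A B by (auto simp: alpha_mix_def)
  qed
  have "\<bar>\<integral>x. \<phi> x * (\<psi> x - expectation \<psi>) \<partial>M\<bar> \<le> \<alpha>"
  proof (rule integral_times_abs_le_of_sets[OF M sub(1) _ _ \<phi>])
    show "integrable M (\<lambda>x. \<psi> x - expectation \<psi>)" using i\<psi> by auto
    fix A assume A: "A \<in> sets P"
    have AM: "A \<in> sets M" using A sub by (auto simp: subalgebra_def)
    have iA: "integrable M (\<lambda>x. indicator A x * \<psi> x)"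
      using integrable_mult_indicator[OF AM i\<psi>] by simp
    have "(\<integral>x. indicator A x * (\<psi> x - expectation \<psi>) \<partial>M)
       = (\<integral>x. indicator A x * \<psi> x - indicator A x * expectation \<psi> \<partial>M)"
      by (simp add: algebra_simps)
    also have "\<dots> = (\<integral>x. indicator A x * \<psi> x \<partial>M) - prob A * expectation \<psi>"
      using AM iA by (subst Bochner_Integration.integral_diff) (auto simp: emeasure_eq_measure)
    also have "\<dots> = (\<integral>x. indicator A x * \<psi> x - prob A * \<psi> x \<partial>M)"
      using iA i\<psi> by (subst Bochner_Integration.integral_diff) auto
    also have "\<dots> = (\<integral>x. \<psi> x * (indicator A x - prob A) \<partial>M)"
      by (simp add: algebra_simps)
    finally show "\<bar>\<integral>x. indicator A x * (\<psi> x - expectation \<psi>) \<partial>M\<bar> \<le> \<alpha>"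
      using ev[OF A] by simp
  qed
  moreover have "(\<integral>x. \<phi> x * (\<psi> x - expectation \<psi>) \<partial>M)
     = (\<integral>x. \<phi> x * \<psi> x - \<phi> x * expectation \<psi> \<partial>M)" by (simp add: algebra_simps)
  moreover have "\<dots> = (\<integral>x. \<phi> x * \<psi> x \<partial>M) - expectation \<phi> * expectation \<psi>"
  proof (subst Bochner_Integration.integral_diff)
    show "integrable M (\<lambda>x. \<phi> x * \<psi> x)"
      by (rule integrable_unit_bounded[OF M, of _ 1])
         (use \<phi>M \<psi>M \<phi> \<psi> in \<open>auto simp: abs_mult intro!: mult_le_one\<close>)
  qed (use i\<phi> in auto)
  ultimately show ?thesis by simp
qed

lemma alpha_mix_covariance:
  fixes \<phi> \<psi> :: "'w \<Rightarrow> real"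
  assumes M: "prob_space M" and mix: "alpha_mix M P Q \<alpha>"
    and \<phi>: "\<phi> \<in> borel_measurable P" "\<And>x. a \<le> \<phi> x" "\<And>x. \<phi> x \<le> a + h"
    and \<psi>: "\<psi> \<in> borel_measurable Q" "\<And>x. c \<le> \<psi> x" "\<And>x. \<psi> x \<le> c + k"
    and hk: "h > 0" "k > 0"
  shows "\<bar>(\<integral>x. \<phi> x * \<psi> x \<partial>M) - (\<integral>x. \<phi> x \<partial>M) * (\<integral>x. \<psi> x \<partial>M)\<bar> \<le> h * k * \<alpha>"
proof -
  interpret prob_space M by fact
  have sub: "subalgebra M P" "subalgebra M Q" using mix by (auto simp: alpha_mix_def)
  define f where "f = (\<lambda>x. (\<phi> x - a) / h)"
  define g where "g = (\<lambda>x. (\<psi> x - c) / k)"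
  have f: "f \<in> borel_measurable P" "\<And>x. 0 \<le> f x" "\<And>x. f x \<le> 1"
    using \<phi> hk by (auto simp: f_def divide_simps algebra_simps)
  have g: "g \<in> borel_measurable Q" "\<And>x. 0 \<le> g x" "\<And>x. g x \<le> 1"
    using \<psi> hk by (auto simp: g_def divide_simps algebra_simps)
  have fM: "f \<in> borel_measurable M" and gM: "g \<in> borel_measurable M"
    using f(1) g(1) sub measurable_from_subalg by blast+
  have fi: "integrable M f" by (rule integrable_unit_bounded[OF M fM, of 1]) (use f in auto)
  have gi: "integrable M g" by (rule integrable_unit_bounded[OF M gM, of 1]) (use g in auto)
  have fgi: "integrable M (\<lambda>x. f x * g x)"
      by (rule integrable_unit_bounded[OF M, of _ 1])
         (use fM gM f g in \<open>auto simp: abs_mult intro!: mult_le_one\<close>)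
  have e: "\<phi> = (\<lambda>x. a + h * f x)" "\<psi> = (\<lambda>x. c + k * g x)" using hk by (auto simp: f_def g_def)
  have e1: "expectation \<phi> = a + h * expectation f" "expectation \<psi> = c + k * expectation g"
    unfolding e using fi gi by (auto simp: prob_space)
  have "(\<integral>x. \<phi> x * \<psi> x \<partial>M) = (\<integral>x. a*c + a*k * g x + h*c* f x + h*k*(f x * g x) \<partial>M)"
    unfolding e by (simp add: algebra_simps)
  also have "\<dots> = a*c + a*k * expectation g + h*c* expectation f + h*k* (\<integral>x. f x * g x \<partial>M)"
    using fi gi fgi by (simp add: prob_space)
  finally have "(\<integral>x. \<phi> x * \<psi> x \<partial>M) - expectation \<phi> * expectation \<psi>
     = h*k*((\<integral>x. f x * g x \<partial>M) - expectation f * expectation g)"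
    unfolding e1 by (simp add: algebra_simps)
  then show ?thesis
    using alpha_mix_covariance_unit[OF M mix f g] hk by (simp add: abs_mult)
qed

section \<open>Exponential tails and counts for weakly independent sequences\<close>

text \<open>
  Every term is nearly independent of the terms before it, the form of independence that a
  recursion over the terms consumes and that any family of blocks with gaps supplies.
\<close>

definition weak_indep_seq :: "'w measure \<Rightarrow> (nat \<Rightarrow> 'w \<Rightarrow> real) \<Rightarrow> nat \<Rightarrow> real \<Rightarrow> bool" where
  "weak_indep_seq M B J \<alpha> \<longleftrightarrow> (\<forall>j<J. \<exists>P Q. alpha_mix M P Q \<alpha> \<and>
      (\<forall>i<j. B i \<in> borel_measurable P) \<and> B j \<in> borel_measurable Q)"

lemma weak_indep_seq_measurable:
  assumes "weak_indep_seq M B J \<alpha>" "j < J"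
  shows "B j \<in> borel_measurable M"
  using assms measurable_from_subalg unfolding weak_indep_seq_def alpha_mix_def by blast

text \<open>
  Let T_j be the partial sums. The process \<psi>_j equals exp(t T_j) until a partial sum exceeds
  z and is frozen at exp(tz) from then on. Before the crossing exp(t T_j) is at most exp(tz), so
  that one more factor costs a mixing error of at most exp(tz + t\<beta>)\<alpha>, however many
  terms there are. Each step multiplies the expectation of \<psi>_j by at most m_j, and Markov's
  inequality for \<psi>_J bounds the tail.
\<close>

lemma weak_indep_exponential_tail:
  fixes B :: "nat \<Rightarrow> 'w \<Rightarrow> real"
  assumes M: "prob_space M" and w: "weak_indep_seq M B J \<alpha>" and \<alpha>: "\<alpha> \<ge> 0"
    and bd: "\<And>j x. j < J \<Longrightarrow> \<bar>B j x\<bar> \<le> \<beta>" and t: "t \<ge> 0" and z: "z \<ge> 0"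
    and m: "\<And>j. j < J \<Longrightarrow> (\<integral>x. exp (t * B j x) \<partial>M) \<le> m j" "\<And>j. j < J \<Longrightarrow> 1 \<le> m j"
  shows "measure M {x\<in>space M. (\<Sum>j<J. B j x) > z}
    \<le> (\<Prod>j<J. m j) * (exp (- (t * z)) + real J * \<alpha> * exp (t * \<beta>))"
proof -
  interpret prob_space M by fact
  define T where "T = (\<lambda>j x. \<Sum>i<j. B i x)"
  define K where "K = (\<lambda>j x. \<forall>i\<in>{..j}. T i x \<le> z)"
  define \<psi> where "\<psi> = (\<lambda>j x. if K j x then exp (t * T j x) else exp (t * z))"
  have \<psi>0: "0 \<le> \<psi> j x" for j x by (auto simp: \<psi>_def)
  have \<psi>1: "\<psi> j x \<le> exp (t * z)" for j x
    using t by (auto simp: \<psi>_def K_def intro!: mult_left_mono)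
  have \<psi>M: "\<psi> j \<in> borel_measurable N" if "\<And>i. i < j \<Longrightarrow> B i \<in> borel_measurable N" for j N
  proof -
    have T[measurable]: "T i \<in> borel_measurable N" if "i \<in> {..j}" for i
      unfolding T_def using that \<open>\<And>i. i < j \<Longrightarrow> B i \<in> borel_measurable N\<close> by (auto intro!: borel_measurable_sum)
    have [measurable]: "T j \<in> borel_measurable N" by (rule T) auto
    have [measurable]: "Measurable.pred N (K j)" unfolding K_def
      by (intro pred_intros_finite) (auto simp: )
    show ?thesis unfolding \<psi>_def by measurable
  qed
  \<comment> \<open>before the crossing \<psi>_j is the bounded weight \<phi> from the past, afterwards it stays constant\<close>
  have step: "expectation (\<psi> (Suc j)) \<le> m j * expectation (\<psi> j) + exp (t * z) * exp (t * \<beta>) * \<alpha>"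
    if j: "j < J" for j
  proof -
    obtain P Q where PQ: "alpha_mix M P Q \<alpha>" "\<And>i. i < j \<Longrightarrow> B i \<in> borel_measurable P"
      "B j \<in> borel_measurable Q" using w j unfolding weak_indep_seq_def by blast
    define \<phi> where "\<phi> = (\<lambda>x. if K j x then \<psi> j x else 0)"
    define g where "g = (\<lambda>x. exp (t * B j x))"
    have \<beta>: "\<beta> \<ge> 0" using bd[OF j, of undefined] by linarith
    have gQ: "g \<in> borel_measurable Q" unfolding g_def using PQ(3) by measurable
    have g0: "0 \<le> g x" for x by (auto simp: g_def)
    have g1: "g x \<le> 0 + exp (t * \<beta>)" for x
      using bd[OF j, of x] t by (auto simp: g_def abs_le_iff intro!: mult_left_mono)
    have T[measurable]: "T i \<in> borel_measurable P" if "i \<in> {..j}" for i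
      unfolding T_def using that PQ(2) by (auto intro!: borel_measurable_sum)
    have [measurable]: "Measurable.pred P (K j)" unfolding K_def
      by (intro pred_intros_finite) auto
    have [measurable]: "\<psi> j \<in> borel_measurable P" by (rule \<psi>M) (rule PQ)
    have \<phi>P: "\<phi> \<in> borel_measurable P" unfolding \<phi>_def by measurable
    have \<phi>0: "0 \<le> \<phi> x" for x using \<psi>0 by (auto simp: \<phi>_def)
    have \<phi>1: "\<phi> x \<le> 0 + exp (t * z)" for x using \<psi>1 by (auto simp: \<phi>_def)
    have sub: "subalgebra M P" "subalgebra M Q" using PQ by (auto simp: alpha_mix_def)
    have \<phi>M[measurable]: "\<phi> \<in> borel_measurable M" and gM[measurable]: "g \<in> borel_measurable M"
      using \<phi>P gQ sub measurable_from_subalg by blast+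
    have \<psi>jM[measurable]: "\<psi> j \<in> borel_measurable M" "\<psi> (Suc j) \<in> borel_measurable M"
      using \<psi>M weak_indep_seq_measurable[OF w] j by auto
    have i\<phi>: "integrable M \<phi>" by (rule integrable_unit_bounded[OF M \<phi>M, of "exp (t*z)"]) (use \<phi>0 \<phi>1 in auto)
    have ig: "integrable M g" by (rule integrable_unit_bounded[OF M gM, of "exp (t*\<beta>)"]) (use g0 g1 in auto)
    have i\<psi>: "integrable M (\<psi> j)" "integrable M (\<psi> (Suc j))"
      by (rule integrable_unit_bounded[OF M _, of _ "exp (t*z)"]; use \<psi>0 \<psi>1 \<psi>jM in simp)+
    have i\<phi>g: "integrable M (\<lambda>x. \<phi> x * g x)"
      by (rule integrable_unit_bounded[OF M, of _ "exp (t*z) * exp (t*\<beta>)"])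
         (use \<phi>0 \<phi>1 g0 g1 in \<open>auto simp: abs_mult intro!: mult_mono\<close>)
    have cov: "\<bar>(\<integral>x. \<phi> x * g x \<partial>M) - expectation \<phi> * expectation g\<bar> \<le> exp (t * z) * exp (t * \<beta>) * \<alpha>"
      by (rule alpha_mix_covariance[OF M PQ(1) \<phi>P \<phi>0 \<phi>1 gQ g0 g1]) auto
    have "expectation (\<psi> (Suc j)) \<le> expectation (\<lambda>x. \<phi> x * g x + (\<psi> j x - \<phi> x))"
    proof (rule integral_mono)
      fix x
      show "\<psi> (Suc j) x \<le> \<phi> x * g x + (\<psi> j x - \<phi> x)"
      proof (cases "K j x")
        case True
        have e: "\<phi> x * g x = exp (t * T (Suc j) x)"
          using True by (simp add: \<phi>_def \<psi>_def g_def T_def ring_distribs exp_add)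
        show ?thesis
        proof (cases "T (Suc j) x \<le> z")
          case T: True
          then have "K (Suc j) x" using True by (auto simp: K_def le_Suc_eq)
          then show ?thesis using True e by (simp add: \<psi>_def \<phi>_def)
        next
          case False
          then have "t * z \<le> t * T (Suc j) x" using t by (auto intro!: mult_left_mono)
          moreover have "\<not> K (Suc j) x" using False by (auto simp: K_def)
          ultimately show ?thesis using True e by (simp add: \<psi>_def \<phi>_def)
        qed
      next
        case False
        then have "\<not> K (Suc j) x" by (auto simp: K_def)
        then show ?thesis using False by (simp add: \<psi>_def \<phi>_def)
      qed
    qed (use i\<phi> ig i\<psi> i\<phi>g in auto)
    also have "\<dots> = (\<integral>x. \<phi> x * g x \<partial>M) + (expectation (\<psi> j) - expectation \<phi>)"
      using i\<phi> i\<psi> i\<phi>g by simp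
    also have "\<dots> \<le> expectation \<phi> * expectation g + exp (t * z) * exp (t * \<beta>) * \<alpha>
        + (expectation (\<psi> j) - expectation \<phi>)" using cov by linarith
    also have "expectation \<phi> * expectation g \<le> expectation \<phi> * m j"
      using m(1)[OF j] by (intro mult_left_mono) (auto simp: g_def intro!: integral_nonneg_AE \<phi>0)
    also have "expectation (\<psi> j) - expectation \<phi> \<le> m j * (expectation (\<psi> j) - expectation \<phi>)"
    proof -
      have "expectation \<phi> \<le> expectation (\<psi> j)"
        by (rule integral_mono) (use i\<phi> i\<psi> \<psi>0 in \<open>auto simp: \<phi>_def\<close>)
      then show ?thesis using m(2)[OF j] mult_right_mono[of 1 "m j" "expectation (\<psi> j) - expectation \<phi>"] by simp
    qed
    finally show ?thesis by (simp add: algebra_simps)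
  qed
  have ind: "expectation (\<psi> j) \<le> (\<Prod>i<j. m i) * (1 + real j * \<alpha> * (exp (t * z) * exp (t * \<beta>)))"
    if "j \<le> J" for j using that
  proof (induction j)
    case 0
    have "\<psi> 0 = (\<lambda>x. 1)" using z by (auto simp: \<psi>_def K_def T_def)
    then show ?case by (simp add: prob_space)
  next
    case (Suc j)
    let ?E = "exp (t * z) * exp (t * \<beta>)"
    have p1: "1 \<le> (\<Prod>i<Suc j. m i)" using m(2) Suc.prems by (intro prod_ge_1) auto
    have "expectation (\<psi> (Suc j)) \<le> m j * expectation (\<psi> j) + ?E * \<alpha>" using step Suc by simp
    also have "\<dots> \<le> m j * ((\<Prod>i<j. m i) * (1 + real j * \<alpha> * ?E)) + (\<Prod>i<Suc j. m i) * (?E * \<alpha>)"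
    proof (rule add_mono)
      show "m j * expectation (\<psi> j) \<le> m j * ((\<Prod>i<j. m i) * (1 + real j * \<alpha> * ?E))"
        using Suc m(2)[of j] by (intro mult_left_mono) auto
      show "?E * \<alpha> \<le> (\<Prod>i<Suc j. m i) * (?E * \<alpha>)"
        using mult_right_mono[OF p1, of "?E * \<alpha>"] \<alpha> by simp
    qed
    also have "\<dots> = (\<Prod>i<Suc j. m i) * (1 + real (Suc j) * \<alpha> * ?E)"
      by (simp add: algebra_simps)
    finally show ?case .
  qed
  have \<psi>JM[measurable]: "\<psi> J \<in> borel_measurable M" using \<psi>M weak_indep_seq_measurable[OF w] by auto
  have TJM[measurable]: "T J \<in> borel_measurable M" unfolding T_def
    using weak_indep_seq_measurable[OF w] by (auto intro!: borel_measurable_sum)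
  have iJ: "integrable M (\<psi> J)" by (rule integrable_unit_bounded[OF M _, of _ "exp (t*z)"]) (use \<psi>0 \<psi>1 in auto)
  have "exp (t * z) * prob {x\<in>space M. T J x > z} = (\<integral>x. exp (t * z) * indicator {x\<in>space M. T J x > z} x \<partial>M)"
    by simp
  also have "\<dots> \<le> expectation (\<psi> J)"
  proof (rule integral_mono)
    fix x assume "x \<in> space M"
    show "exp (t * z) * indicator {x\<in>space M. T J x > z} x \<le> \<psi> J x"
    proof (cases "T J x > z")
      case True
      then have "\<not> K J x" by (auto simp: K_def not_le)
      then show ?thesis by (simp add: \<psi>_def indicator_def)
    next
      case False
      then show ?thesis using \<psi>0[of J x] by simp
    qed
  qed (use iJ in \<open>auto simp: emeasure_eq_measure\<close>)
  also have "\<dots> \<le> (\<Prod>i<J. m i) * (1 + real J * \<alpha> * (exp (t * z) * exp (t * \<beta>)))" by (rule ind) simp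
  finally have "exp (- (t*z)) * (exp (t * z) * prob {x\<in>space M. T J x > z})
     \<le> exp (- (t*z)) * ((\<Prod>i<J. m i) * (1 + real J * \<alpha> * (exp (t * z) * exp (t * \<beta>))))"
    by (intro mult_left_mono) auto
  moreover have "exp (- (t*z)) * (exp (t * z) * u) = u" for u
    by (simp flip: mult.assoc exp_add)
  moreover have "exp (- (t*z)) * ((\<Prod>i<J. m i) * (1 + real J * \<alpha> * (exp (t * z) * exp (t * \<beta>))))
      = (\<Prod>i<J. m i) * (exp (- (t*z)) + exp (- (t*z)) * (exp (t * z) * (real J * \<alpha> * exp (t * \<beta>))))"
    by (simp add: algebra_simps)
  ultimately show ?thesis by (simp add: T_def)
qed

text \<open>
  The power N_j^s of the count grows by 2^s(1 + N_j^s) at most, and only on an event of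
  probability at most \<open>p\<close> that is nearly independent of N_j. As long as the moment is
  at most 1, it therefore grows by no more than a multiple of \<open>p\<close> and the mixing
  error in each step, and the smallness assumption keeps it below 1.
\<close>

lemma weak_indep_count_moment:
  fixes e :: "nat \<Rightarrow> 'w \<Rightarrow> real"
  assumes M: "prob_space M" and w: "weak_indep_seq M e J \<alpha>" and \<alpha>: "\<alpha> \<ge> 0"
    and e01: "\<And>j x. j < J \<Longrightarrow> e j x = 0 \<or> e j x = 1"
    and p: "\<And>j. j < J \<Longrightarrow> (\<integral>x. e j x \<partial>M) \<le> p"
    and small: "2 * 2 ^ s * (real J * p + real J * (\<alpha> * (1 + real J ^ s))) \<le> 1" and s: "s \<ge> 1"
  shows "(\<integral>x. (\<Sum>j<J. e j x) ^ s \<partial>M) \<le> 2 * 2 ^ s * (real J * p + real J * (\<alpha> * (1 + real J ^ s)))"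
proof -
  interpret prob_space M by fact
  define N where "N = (\<lambda>j x. \<Sum>i<j. e i x)"
  define d where "d = 2 * 2 ^ s * (p + \<alpha> * (1 + real J ^ s))"
  have em: "e j \<in> borel_measurable M" if "j < J" for j using weak_indep_seq_measurable[OF w that] .
  have N0: "0 \<le> N j x" if "j \<le> J" for j x
    unfolding N_def using that e01 by (intro sum_nonneg) (metis lessThan_iff order.refl order_less_le_trans zero_le_one)
  have e1: "e j x \<le> 1" "0 \<le> e j x" if "j < J" for j x using e01[OF that, of x] by auto
  have NJ: "N j x \<le> real J" if "j \<le> J" for j x
  proof -
    have "N j x \<le> (\<Sum>i<j. 1)" unfolding N_def using that e1 by (intro sum_mono) auto
    also have "\<dots> \<le> real J" using that by simp
    finally show ?thesis .
  qed
  have NsJ: "N j x ^ s \<le> real J ^ s" if "j \<le> J" for j x by (intro power_mono NJ N0 that)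
  have NM[measurable]: "N j \<in> borel_measurable M" if "j \<le> J" for j
    unfolding N_def using that em by (auto intro!: borel_measurable_sum)
  have iN: "integrable M (\<lambda>x. N j x ^ s)" if "j \<le> J" for j
    by (rule integrable_unit_bounded[OF M, of _ "real J ^ s"]) (use that N0 NsJ NM in auto)
  have ie: "integrable M (e j)" if "j < J" for j
    by (rule integrable_unit_bounded[OF M em[OF that], of 1]) (use e1[OF that] in auto)
  have ieN: "integrable M (\<lambda>x. (1 + N j x ^ s) * e j x)" if "j < J" for j
  proof (rule integrable_unit_bounded[OF M])
    show "\<bar>(1 + N j x ^ s) * e j x\<bar> \<le> (1 + real J ^ s) * 1" for x
      unfolding abs_mult using that N0[of j x] NsJ[of j x] e1[of j x] by (intro mult_mono) auto
  qed (use that NM em in auto)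
  have step: "(\<integral>x. N (Suc j) x ^ s \<partial>M) \<le> (\<integral>x. N j x ^ s \<partial>M)
       + 2 ^ s * (p * (1 + (\<integral>x. N j x ^ s \<partial>M)) + \<alpha> * (1 + real J ^ s))" if j: "j < J" for j
  proof -
    obtain P Q where PQ: "alpha_mix M P Q \<alpha>" "\<And>i. i < j \<Longrightarrow> e i \<in> borel_measurable P"
      "e j \<in> borel_measurable Q" using w j unfolding weak_indep_seq_def by blast
    have NP[measurable]: "N j \<in> borel_measurable P" unfolding N_def using PQ(2) by (auto intro!: borel_measurable_sum)
    have cov: "\<bar>(\<integral>x. (1 + N j x ^ s) * e j x \<partial>M) - (\<integral>x. 1 + N j x ^ s \<partial>M) * (\<integral>x. e j x \<partial>M)\<bar>
        \<le> (1 + real J ^ s) * 1 * \<alpha>"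
      by (rule alpha_mix_covariance[OF M PQ(1), where a = 0 and c = 0])
         (use j N0[of j] NsJ[of j] PQ(3) e1 in \<open>auto simp: add_pos_nonneg\<close>)
    have "(\<integral>x. N (Suc j) x ^ s \<partial>M) \<le> (\<integral>x. N j x ^ s + 2 ^ s * ((1 + N j x ^ s) * e j x) \<partial>M)"
    proof (rule integral_mono)
      fix x
      show "N (Suc j) x ^ s \<le> N j x ^ s + 2 ^ s * ((1 + N j x ^ s) * e j x)"
      proof (cases "e j x = 0")
        case True then show ?thesis by (simp add: N_def)
      next
        case False
        then have e: "e j x = 1" using e01[OF j] by auto
        have n0: "0 \<le> N j x" using N0 j by auto
        have "(N j x + 1) ^ s \<le> 2 ^ s * (1 + N j x ^ s)"
        proof (cases "N j x \<le> 1")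
          case True
          then have "(N j x + 1) ^ s \<le> 2 ^ s" using n0 by (intro power_mono) auto
          also have "\<dots> \<le> 2 ^ s * (1 + N j x ^ s)" using n0 by simp
          finally show ?thesis .
        next
          case False
          then have "(N j x + 1) ^ s \<le> (2 * N j x) ^ s" using n0 by (intro power_mono) auto
          also have "\<dots> \<le> 2 ^ s * (1 + N j x ^ s)" by (simp add: power_mult_distrib)
          finally show ?thesis .
        qed
        moreover have "0 \<le> N j x ^ s" using n0 by simp
        ultimately show ?thesis using e by (simp add: N_def)
      qed
    qed (use iN j ieN in auto)
    also have "\<dots> = (\<integral>x. N j x ^ s \<partial>M) + 2 ^ s * (\<integral>x. (1 + N j x ^ s) * e j x \<partial>M)"
      using iN j ieN by simp
    also have "(\<integral>x. (1 + N j x ^ s) * e j x \<partial>M) \<le> (\<integral>x. 1 + N j x ^ s \<partial>M) * (\<integral>x. e j x \<partial>M) + (1 + real J ^ s) * \<alpha>"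
      using cov by (simp add: abs_le_iff)
    also have "(\<integral>x. 1 + N j x ^ s \<partial>M) * (\<integral>x. e j x \<partial>M) \<le> (\<integral>x. 1 + N j x ^ s \<partial>M) * p"
      using p[OF j] N0[of j] j by (intro mult_left_mono integral_nonneg_AE) auto
    also have "(\<integral>x. 1 + N j x ^ s \<partial>M) = 1 + (\<integral>x. N j x ^ s \<partial>M)" using iN j by (simp add: prob_space)
    finally show ?thesis by (simp add: algebra_simps)
  qed
  have p0: "0 \<le> p" if "J > 0"
    using p[of 0] that e1[of 0] Bochner_Integration.integral_nonneg[of M "e 0"] by (meson dual_order.trans)
  have d0: "0 \<le> d" if "J > 0" using p0 \<alpha> that by (auto simp: d_def)
  have Jd: "real J * d = 2 * 2 ^ s * (real J * p + real J * (\<alpha> * (1 + real J ^ s)))"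
    by (simp add: d_def algebra_simps)
  have "(\<integral>x. N j x ^ s \<partial>M) \<le> real j * d" if "j \<le> J" for j using that
  proof (induction j)
    case 0 then show ?case using s by (simp add: N_def power_0_left)
  next
    case (Suc j)
    have J: "J > 0" using Suc by auto
    have "real j * d \<le> real J * d" using d0 J Suc.prems by (intro mult_right_mono) auto
    then have le1: "(\<integral>x. N j x ^ s \<partial>M) \<le> 1" using Suc small Jd by auto
    have "p * (1 + (\<integral>x. N j x ^ s \<partial>M)) \<le> p * 2"
      using le1 p0 J by (intro mult_left_mono) auto
    moreover have "0 \<le> \<alpha> * (1 + real J ^ s)" using \<alpha> by simp
    ultimately have "p * (1 + (\<integral>x. N j x ^ s \<partial>M)) + \<alpha> * (1 + real J ^ s) \<le> p * 2 + 2 * (\<alpha> * (1 + real J ^ s))"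
      by linarith
    then have "2 ^ s * (p * (1 + (\<integral>x. N j x ^ s \<partial>M)) + \<alpha> * (1 + real J ^ s)) \<le> 2 ^ s * (p * 2 + 2 * (\<alpha> * (1 + real J ^ s)))"
      by (rule mult_left_mono) simp
    also have "\<dots> = d" by (simp add: d_def algebra_simps)
    finally have "2 ^ s * (p * (1 + (\<integral>x. N j x ^ s \<partial>M)) + \<alpha> * (1 + real J ^ s)) \<le> d" .
    then show ?case using step[of j] Suc by (simp add: algebra_simps)
  qed
  from this[of J] show ?thesis using Jd by (simp add: N_def)
qed

section \<open>Approximation of blocks by separated fields\<close>

text \<open>
  The fields carry integer indices, because the past that precedes the first group of blocks sits
  at an index before 1.
\<close>

definition block_approx ::
  "'w measure \<Rightarrow> nat \<Rightarrow> (nat \<Rightarrow> 'w \<Rightarrow> 'a::euclidean_space) \<Rightarrow> (nat \<Rightarrow> 'w \<Rightarrow> 'a) \<Rightarrow> nat \<Rightarrow> real \<Rightarrow> bool" where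
  "block_approx M b W V g \<eta> \<longleftrightarrow> (\<exists>Past Fut.
     (\<forall>k\<in>{1..b}. V k \<in> borel_measurable M \<and>
        (\<integral>\<^sup>+\<omega>. ennreal (norm (W k \<omega> - V k \<omega>)) \<partial>M) \<le> ennreal \<eta> \<and>
        (\<forall>i. int k \<le> i \<longrightarrow> V k \<in> borel_measurable (Past i)) \<and>
        (\<forall>j. j \<le> int k \<longrightarrow> V k \<in> borel_measurable (Fut j))) \<and>
     (\<forall>i j. i + int g \<le> j \<longrightarrow> alpha_mix M (Past i) (Fut j) \<eta>))"

lemma block_approxE:
  assumes "block_approx M b W V g \<eta>"
  obtains Past Fut where
    "\<And>k. k \<in> {1..b} \<Longrightarrow> V k \<in> borel_measurable M"
    "\<And>k. k \<in> {1..b} \<Longrightarrow> (\<integral>\<^sup>+\<omega>. ennreal (norm (W k \<omega> - V k \<omega>)) \<partial>M) \<le> ennreal \<eta>"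
    "\<And>k i. k \<in> {1..b} \<Longrightarrow> int k \<le> i \<Longrightarrow> V k \<in> borel_measurable (Past i)"
    "\<And>k j. k \<in> {1..b} \<Longrightarrow> j \<le> int k \<Longrightarrow> V k \<in> borel_measurable (Fut j)"
    "\<And>i j. i + int g \<le> j \<Longrightarrow> alpha_mix M (Past i) (Fut j) \<eta>"
proof -
  from assms obtain Past Fut where
    1: "\<forall>k\<in>{1..b}. V k \<in> borel_measurable M \<and>
        (\<integral>\<^sup>+\<omega>. ennreal (norm (W k \<omega> - V k \<omega>)) \<partial>M) \<le> ennreal \<eta> \<and>
        (\<forall>i. int k \<le> i \<longrightarrow> V k \<in> borel_measurable (Past i)) \<and>
        (\<forall>j. j \<le> int k \<longrightarrow> V k \<in> borel_measurable (Fut j))"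
    and 2: "\<forall>i j. i + int g \<le> j \<longrightarrow> alpha_mix M (Past i) (Fut j) \<eta>"
    unfolding block_approx_def by (elim exE conjE)
  show thesis by (rule that[of Past Fut]) (use 1 2 in simp_all)
qed

lemma block_approx_inner:
  assumes "block_approx M b W V g \<eta>" "norm \<theta> \<le> 1" "\<And>k. k \<in> {1..b} \<Longrightarrow> W k \<in> borel_measurable M"
  shows "block_approx M b (\<lambda>k \<omega>. \<theta> \<bullet> W k \<omega>) (\<lambda>k \<omega>. \<theta> \<bullet> V k \<omega>) g \<eta>"
proof -
  obtain Past Fut where PF:
    "\<And>k. k \<in> {1..b} \<Longrightarrow> V k \<in> borel_measurable M"
    "\<And>k. k \<in> {1..b} \<Longrightarrow> (\<integral>\<^sup>+\<omega>. ennreal (norm (W k \<omega> - V k \<omega>)) \<partial>M) \<le> ennreal \<eta>"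
    "\<And>k i. k \<in> {1..b} \<Longrightarrow> int k \<le> i \<Longrightarrow> V k \<in> borel_measurable (Past i)"
    "\<And>k j. k \<in> {1..b} \<Longrightarrow> j \<le> int k \<Longrightarrow> V k \<in> borel_measurable (Fut j)"
    "\<And>i j. i + int g \<le> j \<Longrightarrow> alpha_mix M (Past i) (Fut j) \<eta>"
    by (rule block_approxE[OF assms(1)], rule that)
  have "(\<integral>\<^sup>+\<omega>. ennreal (norm (\<theta> \<bullet> W k \<omega> - \<theta> \<bullet> V k \<omega>)) \<partial>M) \<le> ennreal \<eta>" if k: "k \<in> {1..b}" for k
  proof -
    have "(\<integral>\<^sup>+\<omega>. ennreal (norm (\<theta> \<bullet> W k \<omega> - \<theta> \<bullet> V k \<omega>)) \<partial>M) \<le> (\<integral>\<^sup>+\<omega>. ennreal (norm (W k \<omega> - V k \<omega>)) \<partial>M)"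
    proof (intro nn_integral_mono ennreal_leI)
      fix \<omega>
      have "norm (\<theta> \<bullet> W k \<omega> - \<theta> \<bullet> V k \<omega>) = \<bar>\<theta> \<bullet> (W k \<omega> - V k \<omega>)\<bar>" by (simp add: inner_diff_right)
      also have "\<dots> \<le> norm \<theta> * norm (W k \<omega> - V k \<omega>)" by (rule Cauchy_Schwarz_ineq2)
      also have "\<dots> \<le> norm (W k \<omega> - V k \<omega>)" using assms(2) by (simp add: mult_left_le_one_le)
      finally show "norm (\<theta> \<bullet> W k \<omega> - \<theta> \<bullet> V k \<omega>) \<le> norm (W k \<omega> - V k \<omega>)" .
    qed
    then show ?thesis using PF(2)[OF k] by simp
  qed
  moreover have "(\<lambda>\<omega>. \<theta> \<bullet> V k \<omega>) \<in> borel_measurable N" if "V k \<in> borel_measurable N" for k N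
    using that by measurable
  ultimately show ?thesis unfolding block_approx_def using PF(1,3-5)
    by (intro exI[of _ Past] exI[of _ Fut] conjI ballI allI impI) simp_all
qed

text \<open>
  The number f j is a lower bound for the indices in group j that lies at least g above every
  earlier group, and so separates the past of the group from it.
\<close>

lemma weak_indep_seq_blocks:
  fixes h :: "'a::euclidean_space \<Rightarrow> real"
  assumes app: "block_approx M b W V g \<eta>" and I: "\<And>j. j < J \<Longrightarrow> I j \<subseteq> {1..b}"
    and sep: "\<And>i j k. i < j \<Longrightarrow> j < J \<Longrightarrow> k \<in> I i \<Longrightarrow> int k + int g \<le> f j"
    and f: "\<And>j k. j < J \<Longrightarrow> k \<in> I j \<Longrightarrow> f j \<le> int k"
    and h: "h \<in> borel_measurable borel"
  shows "weak_indep_seq M (\<lambda>j x. \<Sum>k\<in>I j. h (V k x)) J \<eta>"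
proof -
  obtain Past Fut where PF:
    "\<And>k i. k \<in> {1..b} \<Longrightarrow> int k \<le> i \<Longrightarrow> V k \<in> borel_measurable (Past i)"
    "\<And>k j. k \<in> {1..b} \<Longrightarrow> j \<le> int k \<Longrightarrow> V k \<in> borel_measurable (Fut j)"
    "\<And>i j. i + int g \<le> j \<Longrightarrow> alpha_mix M (Past i) (Fut j) \<eta>"
    by (rule block_approxE[OF app], rule that)
  have hV: "(\<lambda>x. h (V k x)) \<in> borel_measurable N" if "V k \<in> borel_measurable N" for k N
    using measurable_compose[OF that h] .
  show ?thesis unfolding weak_indep_seq_def
  proof (intro allI impI)
    fix j assume j: "j < J"
    have "alpha_mix M (Past (f j - int g)) (Fut (f j)) \<eta>" by (rule PF(3)) simp
    moreover have "(\<lambda>x. \<Sum>k\<in>I i. h (V k x)) \<in> borel_measurable (Past (f j - int g))" if "i < j" for i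
    proof (intro borel_measurable_sum hV)
      fix k assume k: "k \<in> I i"
      show "V k \<in> borel_measurable (Past (f j - int g))"
        using k I[of i] sep[OF that j k] that j by (intro PF(1)) auto
    qed
    moreover have "(\<lambda>x. \<Sum>k\<in>I j. h (V k x)) \<in> borel_measurable (Fut (f j))"
      using I[OF j] f[OF j] by (intro borel_measurable_sum hV PF(2)) auto
    ultimately show "\<exists>P Q. alpha_mix M P Q \<eta> \<and> (\<forall>i<j. (\<lambda>x. \<Sum>k\<in>I i. h (V k x)) \<in> borel_measurable P) \<and>
        (\<lambda>x. \<Sum>k\<in>I j. h (V k x)) \<in> borel_measurable Q" by blast
  qed
qed

section \<open>Clipped variables\<close>

definition clip :: "real \<Rightarrow> real \<Rightarrow> real" where "clip c x = max (- c) (min c x)"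

lemma clip_bound: "c \<ge> 0 \<Longrightarrow> \<bar>clip c x\<bar> \<le> c" by (auto simp: clip_def)
lemma clip_lipschitz: "c \<ge> 0 \<Longrightarrow> \<bar>clip c x - clip c y\<bar> \<le> \<bar>x - y\<bar>" by (auto simp: clip_def)
lemma clip_le: "c \<ge> 0 \<Longrightarrow> \<bar>clip c x\<bar> \<le> \<bar>x\<bar>" by (auto simp: clip_def)
lemma clip_diff_le: "c \<ge> 0 \<Longrightarrow> \<bar>x - clip c x\<bar> \<le> \<bar>x\<bar>" by (auto simp: clip_def)
lemma clip_eq: "\<bar>x\<bar> \<le> c \<Longrightarrow> clip c x = x" by (auto simp: clip_def)
lemma clip_measurable[measurable]: "clip c \<in> borel_measurable borel"
  unfolding clip_def by measurable

lemma clip_diff_power: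
  assumes "c > 0" shows "\<bar>x - clip c x\<bar> * c ^ m \<le> \<bar>x\<bar> ^ Suc m"
proof (cases "\<bar>x\<bar> \<le> c")
  case True then show ?thesis by (simp add: clip_eq)
next
  case False
  then have "\<bar>x - clip c x\<bar> * c ^ m \<le> \<bar>x\<bar> * \<bar>x\<bar> ^ m"
    using assms clip_diff_le[of c x] by (intro mult_mono power_mono) auto
  then show ?thesis by simp
qed

lemma exp_le_quadratic:
  fixes x :: real assumes "\<bar>x\<bar> \<le> \<beta>" shows "exp x \<le> 1 + x + x\<^sup>2 / 2 * exp \<beta>"
proof -
  obtain t where t: "\<bar>t\<bar> \<le> \<bar>x\<bar>" "exp x = (\<Sum>m<2. (x ^ m) / fact m) + (exp t / fact 2) * x ^ 2"
    using Maclaurin_exp_le[of x 2] by blast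
  have "exp t \<le> exp \<beta>" using t(1) assms by simp
  then have "(exp t / fact 2) * x ^ 2 \<le> (exp \<beta> / fact 2) * x ^ 2"
    by (intro mult_right_mono divide_right_mono) auto
  moreover have "x\<^sup>2 / 2 * exp \<beta> = (exp \<beta> / fact 2) * x ^ 2" by simp
  moreover have "(\<Sum>m<2. (x ^ m) / fact m) = 1 + x" by (simp add: numeral_2_eq_2)
  ultimately show ?thesis using t(2) by linarith
qed

lemma sq_sum_le:
  fixes f :: "nat \<Rightarrow> real" assumes "finite I"
  shows "(\<Sum>k\<in>I. f k)\<^sup>2 \<le> real (card I) * (\<Sum>k\<in>I. (f k)\<^sup>2)"
  using Cauchy_Schwarz_ineq_sum[of "\<lambda>_. 1" f I] by simp

lemma sq_add_le:
  fixes x y e :: real assumes "e > 0"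
  shows "(x + y)\<^sup>2 \<le> (1 + e) * x\<^sup>2 + (1 + 1 / e) * y\<^sup>2"
proof -
  have "0 \<le> (sqrt e * x - y / sqrt e)\<^sup>2" by simp
  also have "\<dots> = e * x\<^sup>2 + y\<^sup>2 / e - 2 * (sqrt e / sqrt e) * x * y"
    using assms by (simp add: power2_diff power_mult_distrib power_divide)
  finally have "2 * x * y \<le> e * x\<^sup>2 + y\<^sup>2 / e" using assms by simp
  then show ?thesis by (simp add: power2_sum algebra_simps)
qed

section \<open>Second moments in arrays of real blocks\<close>

text \<open>
  The blocks of a process seen in one direction. The third moments control what clipping at c
  changes: means by c^(-2) and second moments by c^(-1).
\<close>

locale real_block_array = prob_space M
  for M :: "'w measure" +
  fixes b g :: nat and w v :: "nat \<Rightarrow> 'w \<Rightarrow> real" and \<eta> M3 :: real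
  assumes wM: "k \<in> {1..b} \<Longrightarrow> w k \<in> borel_measurable M"
    and w3: "k \<in> {1..b} \<Longrightarrow> integrable M (\<lambda>x. \<bar>w k x\<bar> ^ 3)"
    and w3_le: "k \<in> {1..b} \<Longrightarrow> expectation (\<lambda>x. \<bar>w k x\<bar> ^ 3) \<le> M3"
    and w_mean: "k \<in> {1..b} \<Longrightarrow> expectation (w k) = 0"
    and app: "block_approx M b w v g \<eta>"
    and \<eta>0: "0 \<le> \<eta>" and M3: "0 \<le> M3"
begin

lemma vM: "k \<in> {1..b} \<Longrightarrow> v k \<in> borel_measurable M"
  by (rule block_approxE[OF app]) simp

lemma integrable_of_cubic_bound: assumes k: "k \<in> {1..b}" and f: "f \<in> borel_measurable M" "\<And>x. \<bar>f x\<bar> \<le> C * (1 + \<bar>w k x\<bar> ^ 3)"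
  shows "integrable M (f :: 'w \<Rightarrow> real)"
proof (rule Bochner_Integration.integrable_bound[of _ "\<lambda>x. C * (1 + \<bar>w k x\<bar> ^ 3)"])
  show "integrable M (\<lambda>x. C * (1 + \<bar>w k x\<bar> ^ 3))" using w3[OF k] by simp
  show "AE x in M. norm (f x) \<le> norm (C * (1 + \<bar>w k x\<bar> ^ 3))"
    using order_trans[OF f(2) abs_ge_self] by (intro AE_I2) simp
qed (rule f)

lemma pow_le_cube: "(y::real) \<ge> 0 \<Longrightarrow> y \<le> 1 + y ^ 3" "(y::real) \<ge> 0 \<Longrightarrow> y ^ 2 \<le> 1 + y ^ 3"
proof -
  assume y: "y \<ge> 0"
  have "y \<le> 1 + y ^ 3 \<and> y ^ 2 \<le> 1 + y ^ 3"
  proof (cases "y \<ge> 1")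
    case True
    then have "y ^ 2 \<le> y ^ 3" "y ^ 1 \<le> y ^ 3" by (intro power_increasing; simp)+
    then show ?thesis by simp
  next
    case False
    then have "y ^ 2 \<le> 1" "0 \<le> y ^ 3" using y by (auto simp: power_le_one)
    then show ?thesis using False by linarith
  qed
  then show "y \<le> 1 + y ^ 3" "y ^ 2 \<le> 1 + y ^ 3" by auto
qed

lemma wI: "k \<in> {1..b} \<Longrightarrow> integrable M (w k)"
  by (rule integrable_of_cubic_bound[of _ _ 1]) (use wM pow_le_cube in auto)

lemma w2I: "k \<in> {1..b} \<Longrightarrow> integrable M (\<lambda>x. (w k x)\<^sup>2)"
  by (rule integrable_of_cubic_bound[of _ _ 1]) (use wM pow_le_cube(2)[of "\<bar>w k _\<bar>"] in auto)

lemma w2_le: assumes k: "k \<in> {1..b}" shows "expectation (\<lambda>x. (w k x)\<^sup>2) \<le> 1 + M3"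
proof -
  have "expectation (\<lambda>x. (w k x)\<^sup>2) \<le> expectation (\<lambda>x. 1 + \<bar>w k x\<bar> ^ 3)"
    by (rule integral_mono) (use w2I w3 k pow_le_cube(2)[of "\<bar>w k _\<bar>"] in auto)
  also have "\<dots> \<le> 1 + M3" using w3 w3_le k by (simp add: prob_space)
  finally show ?thesis .
qed

lemma wwI: assumes k: "k \<in> {1..b}" "k' \<in> {1..b}" shows "integrable M (\<lambda>x. w k x * w k' x)"
proof (rule Bochner_Integration.integrable_bound[of _ "\<lambda>x. (w k x)\<^sup>2 + (w k' x)\<^sup>2"])
  show "AE x in M. norm (w k x * w k' x) \<le> norm ((w k x)\<^sup>2 + (w k' x)\<^sup>2)"
  proof (rule AE_I2)
    fix x
    have "2 * (\<bar>w k x\<bar> * \<bar>w k' x\<bar>) \<le> (w k x)\<^sup>2 + (w k' x)\<^sup>2"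
      using sum_squares_bound[of "\<bar>w k x\<bar>" "\<bar>w k' x\<bar>"] by (simp add: mult.assoc)
    moreover have "0 \<le> \<bar>w k x\<bar> * \<bar>w k' x\<bar>" by simp
    ultimately show "norm (w k x * w k' x) \<le> norm ((w k x)\<^sup>2 + (w k' x)\<^sup>2)"
      unfolding real_norm_def abs_mult by linarith
  qed
qed (use w2I wM k in auto)

lemma diffI: assumes k: "k \<in> {1..b}"
  shows "integrable M (\<lambda>x. \<bar>w k x - v k x\<bar>)" "expectation (\<lambda>x. \<bar>w k x - v k x\<bar>) \<le> \<eta>"
proof -
  have m: "(\<lambda>x. \<bar>w k x - v k x\<bar>) \<in> borel_measurable M" using wM vM k by auto
  have nn: "(\<integral>\<^sup>+x. ennreal \<bar>w k x - v k x\<bar> \<partial>M) \<le> ennreal \<eta>"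
    using app k unfolding block_approx_def by auto
  show i: "integrable M (\<lambda>x. \<bar>w k x - v k x\<bar>)"
    by (rule integrableI_nonneg[OF m]) (use nn in \<open>auto simp: le_less_trans[OF _ ennreal_less_top]\<close>)
  show "expectation (\<lambda>x. \<bar>w k x - v k x\<bar>) \<le> \<eta>"
    using nn i \<eta>0 by (simp add: nn_integral_eq_integral)
qed

abbreviation \<xi> where "\<xi> c k x \<equiv> clip c (v k x)"

lemma \<xi>I: assumes k: "k \<in> {1..b}" and c: "c \<ge> 0" shows "integrable M (\<xi> c k)"
  by (rule integrable_unit_bounded[of _ _ c]) (use vM[OF k] clip_bound[OF c] prob_space_axioms in auto)

lemma \<xi>_mean: assumes k: "k \<in> {1..b}" and c: "c > 0"
  shows "\<bar>expectation (\<xi> c k)\<bar> \<le> \<eta> + M3 / c\<^sup>2"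
proof -
  have wm[measurable]: "w k \<in> borel_measurable M" "v k \<in> borel_measurable M" using wM vM k by auto
  have "\<bar>expectation (\<xi> c k)\<bar> = \<bar>expectation (\<lambda>x. \<xi> c k x - w k x)\<bar>"
    using \<xi>I[OF k, of c] wI[OF k] w_mean[OF k] c by simp
  also have "\<dots> \<le> expectation (\<lambda>x. \<bar>\<xi> c k x - w k x\<bar>)" by (rule integral_abs_bound)
  also have "\<dots> \<le> expectation (\<lambda>x. \<bar>w k x - v k x\<bar> + \<bar>w k x\<bar> ^ 3 / c\<^sup>2)"
  proof (rule integral_mono)
    fix x
    have "\<bar>w k x - clip c (w k x)\<bar> \<le> \<bar>w k x\<bar> ^ 3 / c\<^sup>2"
      using clip_diff_power[OF c, of "w k x" 2] c by (simp add: field_simps eval_nat_numeral)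
    then show "\<bar>\<xi> c k x - w k x\<bar> \<le> \<bar>w k x - v k x\<bar> + \<bar>w k x\<bar> ^ 3 / c\<^sup>2"
      using clip_lipschitz[of c "w k x" "v k x"] c by linarith
  qed (use \<xi>I[OF k, of c] wI[OF k] w3[OF k] diffI[OF k] c in auto)
  also have "\<dots> = expectation (\<lambda>x. \<bar>w k x - v k x\<bar>) + expectation (\<lambda>x. \<bar>w k x\<bar> ^ 3) / c\<^sup>2"
    using w3[OF k] diffI[OF k] by simp
  also have "\<dots> \<le> \<eta> + M3 / c\<^sup>2"
    using w3_le[OF k] diffI(2)[OF k] by (intro add_mono divide_right_mono) auto
  finally show ?thesis .
qed

lemma \<xi>_diff2: assumes k: "k \<in> {1..b}" and c: "c > 0"
  shows "integrable M (\<lambda>x. (\<xi> c k x - w k x)\<^sup>2)"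
    "expectation (\<lambda>x. (\<xi> c k x - w k x)\<^sup>2) \<le> 4 * c * \<eta> + 2 * M3 / c"
proof -
  have wm[measurable]: "w k \<in> borel_measurable M" "v k \<in> borel_measurable M" using wM vM k by auto
  have pt: "(\<xi> c k x - w k x)\<^sup>2 \<le> 4 * c * \<bar>w k x - v k x\<bar> + 2 * \<bar>w k x\<bar> ^ 3 / c" for x
  proof -
    define A where "A = clip c (v k x) - clip c (w k x)"
    define B where "B = clip c (w k x) - w k x"
    have "\<bar>A\<bar> \<le> 2 * c" using clip_bound[of c "v k x"] clip_bound[of c "w k x"] c unfolding A_def by linarith
    moreover have "\<bar>A\<bar> \<le> \<bar>w k x - v k x\<bar>" using clip_lipschitz[of c "v k x" "w k x"] c unfolding A_def by linarith
    ultimately have "\<bar>A\<bar> * \<bar>A\<bar> \<le> (2 * c) * \<bar>w k x - v k x\<bar>" by (intro mult_mono) auto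
    then have A2: "A\<^sup>2 \<le> 2 * c * \<bar>w k x - v k x\<bar>" by (simp add: power2_eq_square)
    have "\<bar>B\<bar> * c \<le> \<bar>w k x\<bar>\<^sup>2" using clip_diff_power[OF c, of "w k x" 1] by (simp add: B_def abs_minus_commute eval_nat_numeral)
    moreover have "\<bar>B\<bar> \<le> \<bar>w k x\<bar>" using clip_diff_le[of c "w k x"] c by (simp add: B_def abs_minus_commute)
    ultimately have "(\<bar>B\<bar> * c) * \<bar>B\<bar> \<le> \<bar>w k x\<bar>\<^sup>2 * \<bar>w k x\<bar>" by (intro mult_mono) auto
    then have "B\<^sup>2 * c \<le> \<bar>w k x\<bar> ^ 3" by (simp add: power2_eq_square power3_eq_cube algebra_simps)
    then have B2: "B\<^sup>2 \<le> \<bar>w k x\<bar> ^ 3 / c" using c by (simp add: field_simps)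
    have "(A + B)\<^sup>2 \<le> 2 * A\<^sup>2 + 2 * B\<^sup>2" using sq_add_le[of 1 A B] by simp
    also have "\<dots> \<le> 2 * (2 * c * \<bar>w k x - v k x\<bar>) + 2 * (\<bar>w k x\<bar> ^ 3 / c)" using A2 B2 by linarith
    finally show ?thesis by (simp add: A_def B_def)
  qed
  have i: "integrable M (\<lambda>x. 4 * c * \<bar>w k x - v k x\<bar> + 2 * \<bar>w k x\<bar> ^ 3 / c)"
    using w3[OF k] diffI[OF k] by auto
  show i2: "integrable M (\<lambda>x. (\<xi> c k x - w k x)\<^sup>2)"
  proof (rule Bochner_Integration.integrable_bound[OF i])
    show "AE x in M. norm ((\<xi> c k x - w k x)\<^sup>2) \<le> norm (4 * c * \<bar>w k x - v k x\<bar> + 2 * \<bar>w k x\<bar> ^ 3 / c)"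
      using order_trans[OF pt abs_ge_self] by (intro AE_I2) simp
  qed auto
  have "expectation (\<lambda>x. (\<xi> c k x - w k x)\<^sup>2) \<le> expectation (\<lambda>x. 4 * c * \<bar>w k x - v k x\<bar> + 2 * \<bar>w k x\<bar> ^ 3 / c)"
    by (rule integral_mono[OF i2 i]) (use pt in auto)
  also have "\<dots> = 4 * c * expectation (\<lambda>x. \<bar>w k x - v k x\<bar>) + 2 * expectation (\<lambda>x. \<bar>w k x\<bar> ^ 3) / c"
    using w3[OF k] diffI[OF k] by simp
  also have "\<dots> \<le> 4 * c * \<eta> + 2 * M3 / c"
    using w3_le[OF k] diffI(2)[OF k] c by (intro add_mono divide_right_mono mult_left_mono) auto
  finally show "expectation (\<lambda>x. (\<xi> c k x - w k x)\<^sup>2) \<le> 4 * c * \<eta> + 2 * M3 / c" .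
qed

text \<open>
  Clip both variables at the level H. The third moments make the loss of order 1/H, whereas the
  mixing error of the clipped approximations is of order H^2\<eta>.
\<close>

lemma covariance_separated:
  assumes k: "k \<in> {1..b}" "k' \<in> {1..b}" and sep: "k + g \<le> k'" and H: "H \<ge> 1"
  shows "\<bar>expectation (\<lambda>x. w k x * w k' x)\<bar> \<le> 5 * M3 / H + 7 * H\<^sup>2 * \<eta>"
proof -
  have wm[measurable]: "w k \<in> borel_measurable M" "v k \<in> borel_measurable M"
    "w k' \<in> borel_measurable M" "v k' \<in> borel_measurable M" using wM vM k by auto
  have H0: "H > 0" "H \<ge> 0" using H by auto
  \<comment> \<open>p^2 q \<le> p^3 + q^3 bounds the loss from clipping one factor and keeping the other\<close>
  define T where "T = (\<lambda>x. (\<bar>w k x\<bar> ^ 3 + \<bar>w k' x\<bar> ^ 3) * (2 / H))"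
  have iT: "integrable M T" "expectation T \<le> 4 * M3 / H"
  proof -
    show "integrable M T" unfolding T_def using w3 k by auto
    have "expectation T = (expectation (\<lambda>x. \<bar>w k x\<bar> ^ 3) + expectation (\<lambda>x. \<bar>w k' x\<bar> ^ 3)) * (2 / H)"
      unfolding T_def using w3 k by simp
    also have "\<dots> \<le> (M3 + M3) * (2 / H)" using w3_le k H by (intro mult_right_mono add_mono) auto
    finally show "expectation T \<le> 4 * M3 / H" by simp
  qed
  have aab: "p\<^sup>2 * q \<le> p ^ 3 + q ^ 3" if "p \<ge> 0" "q \<ge> 0" for p q :: real
  proof -
    have cube: "0 \<le> p ^ 3" "0 \<le> q ^ 3" using that by auto
    show ?thesis
    proof (cases "p \<le> q")
      case True
      then have "p\<^sup>2 * q \<le> q\<^sup>2 * q" using that by (intro mult_right_mono power_mono) auto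
      also have "\<dots> = q ^ 3" by (simp add: power2_eq_square power3_eq_cube)
      finally show ?thesis using cube by linarith
    next
      case False
      then have "p\<^sup>2 * q \<le> p\<^sup>2 * p" using that by (intro mult_left_mono) auto
      also have "\<dots> = p ^ 3" by (simp add: power2_eq_square power3_eq_cube)
      finally show ?thesis using cube by linarith
    qed
  qed
  have tr: "\<bar>p - clip H p\<bar> * \<bar>q\<bar> \<le> (\<bar>p\<bar> ^ 3 + \<bar>q\<bar> ^ 3) * (1 / H)" for p q
  proof -
    have "\<bar>p - clip H p\<bar> * H \<le> \<bar>p\<bar>\<^sup>2" using clip_diff_power[OF H0(1), of p 1] by (simp add: eval_nat_numeral)
    then have "\<bar>p - clip H p\<bar> * H * \<bar>q\<bar> \<le> \<bar>p\<bar>\<^sup>2 * \<bar>q\<bar>" by (intro mult_right_mono) auto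
    also have "\<dots> \<le> \<bar>p\<bar> ^ 3 + \<bar>q\<bar> ^ 3" by (rule aab) auto
    finally show ?thesis using H0 by (simp add: field_simps)
  qed
  have pt: "\<bar>w k x * w k' x - \<xi> H k x * \<xi> H k' x\<bar>
      \<le> T x + (H * \<bar>w k x - v k x\<bar> + H * \<bar>w k' x - v k' x\<bar>)" for x
  proof -
    have a: "w k x * w k' x - \<xi> H k x * \<xi> H k' x
      = (w k x - clip H (w k x)) * w k' x + clip H (w k x) * (w k' x - clip H (w k' x))
       + (clip H (w k x) - \<xi> H k x) * clip H (w k' x) + \<xi> H k x * (clip H (w k' x) - \<xi> H k' x)"
      by (simp add: algebra_simps)
    have 1: "\<bar>(w k x - clip H (w k x)) * w k' x\<bar> \<le> (\<bar>w k x\<bar> ^ 3 + \<bar>w k' x\<bar> ^ 3) * (1 / H)"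
      unfolding abs_mult by (rule tr)
    have 2: "\<bar>clip H (w k x) * (w k' x - clip H (w k' x))\<bar> \<le> (\<bar>w k x\<bar> ^ 3 + \<bar>w k' x\<bar> ^ 3) * (1 / H)"
    proof -
      have "\<bar>clip H (w k x)\<bar> * \<bar>w k' x - clip H (w k' x)\<bar> \<le> \<bar>w k x\<bar> * \<bar>w k' x - clip H (w k' x)\<bar>"
        using clip_le[OF H0(2)] by (intro mult_right_mono) auto
      then show ?thesis using tr[of "w k' x" "w k x"] unfolding abs_mult by (simp add: mult.commute add.commute)
    qed
    have 3: "\<bar>(clip H (w k x) - \<xi> H k x) * clip H (w k' x)\<bar> \<le> \<bar>w k x - v k x\<bar> * H"
      unfolding abs_mult using clip_lipschitz[OF H0(2)] clip_bound[OF H0(2)] by (intro mult_mono) auto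
    have 4: "\<bar>\<xi> H k x * (clip H (w k' x) - \<xi> H k' x)\<bar> \<le> H * \<bar>w k' x - v k' x\<bar>"
      unfolding abs_mult using clip_lipschitz[OF H0(2)] clip_bound[OF H0(2)] H0 by (intro mult_mono) auto
    have T: "T x = (\<bar>w k x\<bar> ^ 3 + \<bar>w k' x\<bar> ^ 3) * (1 / H) + (\<bar>w k x\<bar> ^ 3 + \<bar>w k' x\<bar> ^ 3) * (1 / H)"
      by (simp add: T_def field_simps)
    have abs4: "\<bar>p + q + r + u\<bar> \<le> \<bar>p\<bar> + \<bar>q\<bar> + \<bar>r\<bar> + \<bar>u\<bar>" for p q r u :: real by simp
    have c3: "\<bar>(clip H (w k x) - \<xi> H k x) * clip H (w k' x)\<bar> \<le> H * \<bar>w k x - v k x\<bar>"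
      using 3 by (simp only: mult.commute)
    show ?thesis unfolding a
      using abs4[of "(w k x - clip H (w k x)) * w k' x" "clip H (w k x) * (w k' x - clip H (w k' x))"
        "(clip H (w k x) - \<xi> H k x) * clip H (w k' x)" "\<xi> H k x * (clip H (w k' x) - \<xi> H k' x)"] 1 2 c3 4 T
      by linarith
  qed
  have i\<xi>: "integrable M (\<xi> H k)" "integrable M (\<xi> H k')" using \<xi>I k H0 by auto
  have i\<xi>\<xi>: "integrable M (\<lambda>x. \<xi> H k x * \<xi> H k' x)"
    by (rule integrable_unit_bounded[of _ _ "H * H"])
       (use clip_bound[OF H0(2)] H0 prob_space_axioms in \<open>auto simp: abs_mult intro!: mult_mono\<close>)
  have iR: "integrable M (\<lambda>x. T x + (H * \<bar>w k x - v k x\<bar> + H * \<bar>w k' x - v k' x\<bar>))"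
    using iT diffI k by auto
  have "\<bar>expectation (\<lambda>x. w k x * w k' x) - expectation (\<lambda>x. \<xi> H k x * \<xi> H k' x)\<bar>
     = \<bar>expectation (\<lambda>x. w k x * w k' x - \<xi> H k x * \<xi> H k' x)\<bar>" using wwI[OF k] i\<xi>\<xi> by simp
  also have "\<dots> \<le> expectation (\<lambda>x. \<bar>w k x * w k' x - \<xi> H k x * \<xi> H k' x\<bar>)" by (rule integral_abs_bound)
  also have "\<dots> \<le> expectation (\<lambda>x. T x + (H * \<bar>w k x - v k x\<bar> + H * \<bar>w k' x - v k' x\<bar>))"
    by (rule integral_mono) (use wwI[OF k] i\<xi>\<xi> iR pt in auto)
  also have "\<dots> = expectation T + (H * expectation (\<lambda>x. \<bar>w k x - v k x\<bar>) + H * expectation (\<lambda>x. \<bar>w k' x - v k' x\<bar>))"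
    using iT diffI k by simp
  also have "\<dots> \<le> 4 * M3 / H + (H * \<eta> + H * \<eta>)"
    using iT(2) diffI(2) k H0 by (intro add_mono mult_left_mono) auto
  finally have s1: "\<bar>expectation (\<lambda>x. w k x * w k' x) - expectation (\<lambda>x. \<xi> H k x * \<xi> H k' x)\<bar> \<le> 4 * M3 / H + 2 * H * \<eta>" by simp
  obtain Past Fut where PF0:
    "\<And>k i. k \<in> {1..b} \<Longrightarrow> int k \<le> i \<Longrightarrow> v k \<in> borel_measurable (Past i)"
    "\<And>k j. k \<in> {1..b} \<Longrightarrow> j \<le> int k \<Longrightarrow> v k \<in> borel_measurable (Fut j)"
    "\<And>i j. i + int g \<le> j \<Longrightarrow> alpha_mix M (Past i) (Fut j) \<eta>"
    by (rule block_approxE[OF app], rule that)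
  have PF: "alpha_mix M (Past (int k)) (Fut (int k')) \<eta>"
    "v k \<in> borel_measurable (Past (int k))" "v k' \<in> borel_measurable (Fut (int k'))"
    using PF0(1)[OF k(1)] PF0(2)[OF k(2)] PF0(3)[of "int k" "int k'"] sep by auto
  have s2: "\<bar>expectation (\<lambda>x. \<xi> H k x * \<xi> H k' x) - expectation (\<xi> H k) * expectation (\<xi> H k')\<bar> \<le> (2 * H) * (2 * H) * \<eta>"
    by (rule alpha_mix_covariance[OF prob_space_axioms PF(1), where a = "-H" and c = "-H"])
       (use PF(2,3) clip_bound[OF H0(2)] H0 in \<open>auto simp: abs_le_iff clip_def\<close>)
  have s3: "\<bar>expectation (\<xi> H k) * expectation (\<xi> H k')\<bar> \<le> (\<eta> + M3 / H\<^sup>2) * H"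
  proof -
    have "\<bar>expectation (\<xi> H k')\<bar> \<le> expectation (\<lambda>x. \<bar>\<xi> H k' x\<bar>)" by (rule integral_abs_bound)
    also have "\<dots> \<le> expectation (\<lambda>x. H)"
      by (rule integral_mono) (use i\<xi> clip_bound[OF H0(2)] in auto)
    finally have "\<bar>expectation (\<xi> H k')\<bar> \<le> H" by (simp add: prob_space)
    then show ?thesis unfolding abs_mult using \<xi>_mean[OF k(1) H0(1)] H0 \<eta>0 M3 by (intro mult_mono) auto
  qed
  define m q r where "m = M3 / H" and "q = H * \<eta>" and "r = H\<^sup>2 * \<eta>"
  have qr: "q \<le> r" unfolding q_def r_def using H \<eta>0 by (intro mult_right_mono) (auto simp: power2_eq_square)
  have eqs: "(\<eta> + M3 / H\<^sup>2) * H = q + m" "4 * M3 / H = 4 * m" "5 * M3 / H = 5 * m"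
    "2 * H * \<eta> = 2 * q" "7 * H\<^sup>2 * \<eta> = 7 * r" "(2 * H) * (2 * H) * \<eta> = 4 * r"
    using H0 by (simp_all add: m_def q_def r_def field_simps power2_eq_square)
  have "\<bar>x\<bar> \<le> \<bar>x - y\<bar> + \<bar>y - u\<bar> + \<bar>u\<bar>" for x y u :: real by linarith
  from this[of "expectation (\<lambda>x. w k x * w k' x)" "expectation (\<lambda>x. \<xi> H k x * \<xi> H k' x)"
      "expectation (\<xi> H k) * expectation (\<xi> H k')"]
  show ?thesis using s1 s2 s3 qr unfolding eqs by linarith
qed

lemma sum_prodI:
  assumes "I \<subseteq> {1..b}" "I' \<subseteq> {1..b}"
  shows "integrable M (\<lambda>x. (\<Sum>k\<in>I. w k x) * (\<Sum>k\<in>I'. w k x))"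
  unfolding sum_product
  by (intro Bochner_Integration.integrable_sum wwI) (use assms in auto)

lemma expectation_sum_prod:
  assumes "I \<subseteq> {1..b}" "I' \<subseteq> {1..b}"
  shows "expectation (\<lambda>x. (\<Sum>k\<in>I. w k x) * (\<Sum>k\<in>I'. w k x)) = (\<Sum>k\<in>I. \<Sum>k'\<in>I'. expectation (\<lambda>x. w k x * w k' x))"
proof -
  have ww: "integrable M (\<lambda>x. w k x * w k' x)" if "k \<in> I" "k' \<in> I'" for k k'
    by (rule wwI) (use that assms in blast)+
  have "expectation (\<lambda>x. (\<Sum>k\<in>I. w k x) * (\<Sum>k\<in>I'. w k x)) = (\<Sum>k\<in>I. expectation (\<lambda>x. \<Sum>k'\<in>I'. w k x * w k' x))"
    unfolding sum_product by (intro Bochner_Integration.integral_sum Bochner_Integration.integrable_sum ww)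
  also have "\<dots> = (\<Sum>k\<in>I. \<Sum>k'\<in>I'. expectation (\<lambda>x. w k x * w k' x))"
    by (intro sum.cong refl Bochner_Integration.integral_sum ww)
  finally show ?thesis .
qed

text \<open>
  The mixed terms of the square are covariances of separated blocks.
\<close>

lemma second_moment_blocks:
  fixes J :: nat and I :: "nat \<Rightarrow> nat set"
  assumes I: "\<And>j. j < J \<Longrightarrow> I j \<subseteq> {1..b}"
    and sep: "\<And>i j k k'. i < j \<Longrightarrow> j < J \<Longrightarrow> k \<in> I i \<Longrightarrow> k' \<in> I j \<Longrightarrow> k + g \<le> k'"
    and card: "(\<Sum>j<J. card (I j)) \<le> b" and H: "H \<ge> 1"
  shows "\<bar>expectation (\<lambda>x. (\<Sum>j<J. \<Sum>k\<in>I j. w k x)\<^sup>2) - (\<Sum>j<J. expectation (\<lambda>x. (\<Sum>k\<in>I j. w k x)\<^sup>2))\<bar>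
    \<le> (real b)\<^sup>2 * (5 * M3 / H + 7 * H\<^sup>2 * \<eta>)"
proof -
  define \<tau> where "\<tau> = 5 * M3 / H + 7 * H\<^sup>2 * \<eta>"
  have \<tau>0: "\<tau> \<ge> 0" using H M3 \<eta>0 by (auto simp: \<tau>_def)
  define R where "R = (\<lambda>j x. \<Sum>k\<in>I j. w k x)"
  have RI: "integrable M (\<lambda>x. R i x * R j x)" if "i < J" "j < J" for i j
    unfolding R_def by (rule sum_prodI) (use I that in auto)
  have off: "\<bar>expectation (\<lambda>x. R i x * R j x)\<bar> \<le> real (card (I i)) * real (card (I j)) * \<tau>"
    if ij: "i < J" "j < J" "i \<noteq> j" for i j
  proof -
    have pair: "\<bar>expectation (\<lambda>x. w k x * w k' x)\<bar> \<le> \<tau>" if k: "k \<in> I i" "k' \<in> I j" for k k'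
    proof -
      have kb: "k \<in> {1..b}" "k' \<in> {1..b}" using I[OF ij(1)] I[OF ij(2)] k by blast+
      show ?thesis
      proof (cases "i < j")
        case True
        then show ?thesis unfolding \<tau>_def
          using covariance_separated[OF kb _ H] sep[OF _ ij(2) k] by simp
      next
        case False
        then have "j < i" using ij(3) by linarith
        then show ?thesis unfolding \<tau>_def
          using covariance_separated[OF kb(2,1) _ H] sep[OF _ ij(1) k(2,1)] by (simp add: mult.commute)
      qed
    qed
    have "expectation (\<lambda>x. R i x * R j x) = (\<Sum>k\<in>I i. \<Sum>k'\<in>I j. expectation (\<lambda>x. w k x * w k' x))"
      unfolding R_def by (rule expectation_sum_prod) (use I ij in auto)
    also have "\<bar>\<dots>\<bar> \<le> (\<Sum>k\<in>I i. \<Sum>k'\<in>I j. \<bar>expectation (\<lambda>x. w k x * w k' x)\<bar>)"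
      by (rule order_trans[OF sum_abs]) (intro sum_mono sum_abs)
    also have "\<dots> \<le> (\<Sum>k\<in>I i. \<Sum>k'\<in>I j. \<tau>)" by (intro sum_mono pair)
    also have "\<dots> = real (card (I i)) * real (card (I j)) * \<tau>" by simp
    finally show ?thesis .
  qed
  have sq: "(\<Sum>j<J. R j x)\<^sup>2 = (\<Sum>i<J. \<Sum>j<J. R i x * R j x)" for x
    by (simp add: power2_eq_square sum_product)
  have "expectation (\<lambda>x. (\<Sum>j<J. R j x)\<^sup>2) = (\<Sum>i<J. \<Sum>j<J. expectation (\<lambda>x. R i x * R j x))"
    unfolding sq using RI
    by (subst Bochner_Integration.integral_sum, auto intro!: Bochner_Integration.integrable_sum)
  also have "\<dots> = (\<Sum>i<J. \<Sum>j<J. (if i = j then expectation (\<lambda>x. (R i x)\<^sup>2) else 0)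
        + (if i = j then 0 else expectation (\<lambda>x. R i x * R j x)))"
    by (intro sum.cong refl) (auto simp: power2_eq_square)
  also have "\<dots> = (\<Sum>i<J. expectation (\<lambda>x. (R i x)\<^sup>2)) + (\<Sum>i<J. \<Sum>j<J. if i = j then 0 else expectation (\<lambda>x. R i x * R j x))"
    by (simp add: sum.distrib)
  finally have "\<bar>expectation (\<lambda>x. (\<Sum>j<J. R j x)\<^sup>2) - (\<Sum>j<J. expectation (\<lambda>x. (R j x)\<^sup>2))\<bar>
      = \<bar>\<Sum>i<J. \<Sum>j<J. if i = j then 0 else expectation (\<lambda>x. R i x * R j x)\<bar>" by simp
  also have "\<dots> \<le> (\<Sum>i<J. \<Sum>j<J. \<bar>if i = j then 0 else expectation (\<lambda>x. R i x * R j x)\<bar>)"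
    by (rule order_trans[OF sum_abs]) (intro sum_mono sum_abs)
  also have "\<dots> \<le> (\<Sum>i<J. \<Sum>j<J. real (card (I i)) * real (card (I j)) * \<tau>)"
    using off \<tau>0 by (intro sum_mono) auto
  also have "\<dots> = (\<Sum>i<J. real (card (I i))) * (\<Sum>i<J. real (card (I i))) * \<tau>"
    unfolding sum_product by (simp add: sum_distrib_right)
  also have "\<dots> \<le> real b * real b * \<tau>"
  proof -
    have "(\<Sum>i<J. real (card (I i))) \<le> real b" using card by (metis of_nat_le_iff of_nat_sum)
    then show ?thesis using \<tau>0 by (intro mult_right_mono mult_mono) (auto intro: sum_nonneg)
  qed
  finally show ?thesis by (simp add: R_def \<tau>_def power2_eq_square)
qed

lemma clipped_block_mean:
  assumes I: "I \<subseteq> {1..b}" and c: "c > 0"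
  shows "\<bar>expectation (\<lambda>x. \<Sum>k\<in>I. \<xi> c k x)\<bar> \<le> real (card I) * (\<eta> + M3 / c\<^sup>2)"
proof -
  have "expectation (\<lambda>x. \<Sum>k\<in>I. \<xi> c k x) = (\<Sum>k\<in>I. expectation (\<xi> c k))"
    using \<xi>I[of _ c] I c by (intro Bochner_Integration.integral_sum) auto
  also have "\<bar>\<dots>\<bar> \<le> (\<Sum>k\<in>I. \<bar>expectation (\<xi> c k)\<bar>)" by (rule sum_abs)
  also have "\<dots> \<le> (\<Sum>k\<in>I. \<eta> + M3 / c\<^sup>2)" using \<xi>_mean I c by (intro sum_mono) auto
  finally show ?thesis by simp
qed

text \<open>
  Clipping and approximation move each term by an amount that is small in mean square; squaring
  the sum then costs the factor 1 + e on the main part.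
\<close>

lemma clipped_block_square:
  assumes I: "I \<subseteq> {1..b}" and c: "c > 0" and e: "e > 0" and h: "card I \<le> h"
  shows "expectation (\<lambda>x. (\<Sum>k\<in>I. \<xi> c k x)\<^sup>2)
    \<le> (1 + e) * expectation (\<lambda>x. (\<Sum>k\<in>I. w k x)\<^sup>2)
      + (1 + 1 / e) * (real h * real (card I) * (4 * c * \<eta> + 2 * M3 / c))"
proof -
  have fin: "finite I" using I finite_subset by blast
  have vm[measurable]: "v k \<in> borel_measurable M" "w k \<in> borel_measurable M" if "k \<in> I" for k using vM wM I that by auto
  have iw: "integrable M (\<lambda>x. (\<Sum>k\<in>I. w k x)\<^sup>2)" using sum_prodI[OF I I] by (simp add: power2_eq_square)
  have id: "integrable M (\<lambda>x. \<Sum>k\<in>I. (\<xi> c k x - w k x)\<^sup>2)"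
    using \<xi>_diff2(1)[OF _ c] I by (intro Bochner_Integration.integrable_sum) auto
  have ix: "integrable M (\<lambda>x. (\<Sum>k\<in>I. \<xi> c k x)\<^sup>2)"
  proof (rule integrable_unit_bounded[OF prob_space_axioms])
    show "\<bar>(\<Sum>k\<in>I. \<xi> c k x)\<^sup>2\<bar> \<le> (real (card I) * c)\<^sup>2" for x
    proof -
      have "\<bar>\<Sum>k\<in>I. \<xi> c k x\<bar> \<le> (\<Sum>k\<in>I. c)"
        by (rule order_trans[OF sum_abs], rule sum_mono) (use clip_bound c in auto)
      then have "\<bar>\<Sum>k\<in>I. \<xi> c k x\<bar>\<^sup>2 \<le> (real (card I) * c)\<^sup>2" by (intro power_mono) auto
      then show ?thesis by simp
    qed
    show "(\<lambda>x. (\<Sum>k\<in>I. \<xi> c k x)\<^sup>2) \<in> borel_measurable M"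
      by (intro borel_measurable_power borel_measurable_sum) measurable
  qed
  have "expectation (\<lambda>x. (\<Sum>k\<in>I. \<xi> c k x)\<^sup>2) \<le> expectation (\<lambda>x. (1 + e) * (\<Sum>k\<in>I. w k x)\<^sup>2
      + (1 + 1 / e) * (real (card I) * (\<Sum>k\<in>I. (\<xi> c k x - w k x)\<^sup>2)))"
  proof (rule integral_mono[OF ix])
    fix x
    have "(\<Sum>k\<in>I. \<xi> c k x)\<^sup>2 = ((\<Sum>k\<in>I. w k x) + (\<Sum>k\<in>I. \<xi> c k x - w k x))\<^sup>2" by (simp add: sum_subtractf)
    also have "\<dots> \<le> (1 + e) * (\<Sum>k\<in>I. w k x)\<^sup>2 + (1 + 1 / e) * (\<Sum>k\<in>I. \<xi> c k x - w k x)\<^sup>2" by (rule sq_add_le[OF e])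
    also have "\<dots> \<le> (1 + e) * (\<Sum>k\<in>I. w k x)\<^sup>2 + (1 + 1 / e) * (real (card I) * (\<Sum>k\<in>I. (\<xi> c k x - w k x)\<^sup>2))"
      using e by (intro add_left_mono mult_left_mono sq_sum_le fin) auto
    finally show "(\<Sum>k\<in>I. \<xi> c k x)\<^sup>2 \<le> (1 + e) * (\<Sum>k\<in>I. w k x)\<^sup>2
      + (1 + 1 / e) * (real (card I) * (\<Sum>k\<in>I. (\<xi> c k x - w k x)\<^sup>2))" .
  qed (use iw id in auto)
  also have "\<dots> = (1 + e) * expectation (\<lambda>x. (\<Sum>k\<in>I. w k x)\<^sup>2)
      + (1 + 1 / e) * (real (card I) * (\<Sum>k\<in>I. expectation (\<lambda>x. (\<xi> c k x - w k x)\<^sup>2)))"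
    using iw id \<xi>_diff2(1)[OF _ c] I
    by (subst Bochner_Integration.integral_add; (subst Bochner_Integration.integral_sum[symmetric])?) auto
  also have "\<dots> \<le> (1 + e) * expectation (\<lambda>x. (\<Sum>k\<in>I. w k x)\<^sup>2)
      + (1 + 1 / e) * (real h * (\<Sum>k\<in>I. 4 * c * \<eta> + 2 * M3 / c))"
    using e h \<xi>_diff2(2)[OF _ c] I \<eta>0 M3 c
    by (intro add_left_mono mult_left_mono mult_mono sum_mono sum_nonneg) auto
  finally show ?thesis by (simp add: mult.assoc)
qed

lemma block_square_crude:
  assumes I: "I \<subseteq> {1..b}" and h: "card I \<le> h"
  shows "expectation (\<lambda>x. (\<Sum>k\<in>I. w k x)\<^sup>2) \<le> real h * real h * (1 + M3)"
proof -
  have fin: "finite I" using I finite_subset by blast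
  have iw: "integrable M (\<lambda>x. (\<Sum>k\<in>I. w k x)\<^sup>2)" using sum_prodI[OF I I] by (simp add: power2_eq_square)
  have id: "integrable M (\<lambda>x. \<Sum>k\<in>I. (w k x)\<^sup>2)"
    using w2I I by (intro Bochner_Integration.integrable_sum) auto
  have "expectation (\<lambda>x. (\<Sum>k\<in>I. w k x)\<^sup>2) \<le> expectation (\<lambda>x. real (card I) * (\<Sum>k\<in>I. (w k x)\<^sup>2))"
    by (rule integral_mono[OF iw]) (use id sq_sum_le[OF fin] in auto)
  also have "\<dots> = real (card I) * (\<Sum>k\<in>I. expectation (\<lambda>x. (w k x)\<^sup>2))"
    using w2I I by (simp, subst Bochner_Integration.integral_sum) auto
  also have "\<dots> \<le> real h * (\<Sum>k\<in>I. 1 + M3)"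
    using h w2_le I by (intro mult_mono sum_mono sum_nonneg) auto
  also have "\<dots> \<le> real h * (real h * (1 + M3))" using h M3 by (auto intro!: mult_left_mono mult_right_mono)
  finally show ?thesis by (simp add: mult.assoc)
qed

text \<open>
  The choice t = az/v0 is the optimal one for a Gaussian variable of variance v0, and the exponent
  of the tail is the Gaussian one. The assumption on \<open>\<beta>\<close> makes the exponential
  quadratic up to the factor exp \<beta>, and the second smallness assumption limits the effect of
  the means that clipping creates.
\<close>

lemma separated_family_tail:
  fixes J h :: nat and I :: "nat \<Rightarrow> nat set" and f :: "nat \<Rightarrow> int"
  assumes I: "\<And>j. j < J \<Longrightarrow> I j \<subseteq> {1..b}"
    and sep: "\<And>i j k. i < j \<Longrightarrow> j < J \<Longrightarrow> k \<in> I i \<Longrightarrow> int k + int g \<le> f j"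
    and f: "\<And>j k. j < J \<Longrightarrow> k \<in> I j \<Longrightarrow> f j \<le> int k"
    and card: "(\<Sum>j<J. card (I j)) \<le> b" and h: "\<And>j. j < J \<Longrightarrow> card (I j) \<le> h"
    and a: "a > 0" and c: "c > 0" and z: "z \<ge> 0" and v0: "v0 > 0"
    and small: "a * z / v0 * real h * c \<le> \<beta>" "a * z / v0 * (real b * (\<eta> + M3 / c\<^sup>2)) \<le> 1"
    and var: "exp \<beta> * (a\<^sup>2 * (\<Sum>j<J. expectation (\<lambda>x. (\<Sum>k\<in>I j. \<xi> c k x)\<^sup>2))) \<le> v0"
  shows "prob {x\<in>space M. a * (\<Sum>j<J. \<Sum>k\<in>I j. \<xi> c k x) > z}
    \<le> exp 1 * (exp (- (z\<^sup>2 / (2 * v0))) + real J * \<eta> * exp \<beta> * exp (z\<^sup>2 / (2 * v0)))"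
proof -
  define t where "t = a * z / v0"
  have t0: "t \<ge> 0" using a z v0 by (simp add: t_def)
  define B where "B = (\<lambda>j x. \<Sum>k\<in>I j. \<xi> c k x)"
  define S1 where "S1 = (\<lambda>j. \<bar>expectation (B j)\<bar>)"
  define S2 where "S2 = (\<lambda>j. expectation (\<lambda>x. (B j x)\<^sup>2))"
  define m where "m = (\<lambda>j. exp (t * S1 j + t\<^sup>2 / 2 * exp \<beta> * S2 j))"
  have wi: "weak_indep_seq M B J \<eta>" unfolding B_def
    by (rule weak_indep_seq_blocks[OF app, where f = f]) (use I sep f in auto)
  have BM[measurable]: "j < J \<Longrightarrow> B j \<in> borel_measurable M" for j by (rule weak_indep_seq_measurable[OF wi])
  have Bb: "\<bar>B j x\<bar> \<le> real h * c" if "j < J" for j x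
  proof -
    have "\<bar>B j x\<bar> \<le> (\<Sum>k\<in>I j. c)" unfolding B_def
      by (rule order_trans[OF sum_abs], rule sum_mono) (use clip_bound c in auto)
    also have "\<dots> \<le> real h * c" using h[OF that] c by simp
    finally show ?thesis .
  qed
  have tB: "\<bar>t * B j x\<bar> \<le> \<beta>" if "j < J" for j x
  proof -
    have "\<bar>t * B j x\<bar> \<le> t * (real h * c)" unfolding abs_mult using Bb[OF that] t0 by (auto intro!: mult_mono)
    then show ?thesis using small(1) by (simp add: t_def mult.assoc)
  qed
  have BI: "integrable M (B j)" if "j < J" for j
    by (rule integrable_unit_bounded[OF prob_space_axioms BM[OF that] Bb[OF that]])
  have B2I: "integrable M (\<lambda>x. (B j x)\<^sup>2)" if "j < J" for j
  proof (rule integrable_unit_bounded[OF prob_space_axioms])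
    show "\<bar>(B j x)\<^sup>2\<bar> \<le> (real h * c)\<^sup>2" for x using power_mono[OF Bb[OF that, of x], of 2] by simp
  qed (use that in measurable)
  have S2: "0 \<le> S2 j" "0 \<le> S1 j" for j by (auto simp: S2_def S1_def)
  have m1: "1 \<le> m j" for j using S2[of j] t0 by (simp add: m_def)
  have mE: "expectation (\<lambda>x. exp (t * B j x)) \<le> m j" if j: "j < J" for j
  proof -
    have "expectation (\<lambda>x. exp (t * B j x)) \<le> expectation (\<lambda>x. 1 + t * B j x + t\<^sup>2 / 2 * exp \<beta> * (B j x)\<^sup>2)"
    proof (rule integral_mono)
      show "integrable M (\<lambda>x. exp (t * B j x))"
      proof (rule integrable_unit_bounded[OF prob_space_axioms])
        show "\<bar>exp (t * B j x)\<bar> \<le> exp \<beta>" for x using tB[OF j, of x] by simp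
      qed (use j in measurable)
      fix x show "exp (t * B j x) \<le> 1 + t * B j x + t\<^sup>2 / 2 * exp \<beta> * (B j x)\<^sup>2"
        using exp_le_quadratic[OF tB[OF j, of x]] by (simp add: power_mult_distrib mult_ac)
    qed (use BI[OF j] B2I[OF j] in auto)
    also have "\<dots> = 1 + t * expectation (B j) + t\<^sup>2 / 2 * exp \<beta> * S2 j"
      using BI[OF j] B2I[OF j] by (simp add: prob_space S2_def)
    also have "\<dots> \<le> 1 + (t * S1 j + t\<^sup>2 / 2 * exp \<beta> * S2 j)"
      using t0 by (simp add: S1_def mult_left_mono)
    also have "\<dots> \<le> m j" unfolding m_def by (rule exp_ge_add_one_self)
    finally show ?thesis .
  qed
  have "(\<Prod>j<J. m j) = exp (\<Sum>j<J. t * S1 j + t\<^sup>2 / 2 * exp \<beta> * S2 j)" by (simp add: m_def exp_sum)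
  also have "(\<Sum>j<J. t * S1 j + t\<^sup>2 / 2 * exp \<beta> * S2 j) = t * (\<Sum>j<J. S1 j) + t\<^sup>2 / 2 * (exp \<beta> * (\<Sum>j<J. S2 j))"
    by (simp add: sum.distrib sum_distrib_left mult.assoc)
  also have "exp \<dots> \<le> exp (1 + z\<^sup>2 / (2 * v0))"
  proof -
    have "(\<Sum>j<J. S1 j) \<le> (\<Sum>j<J. real (card (I j)) * (\<eta> + M3 / c\<^sup>2))"
      unfolding S1_def B_def by (intro sum_mono clipped_block_mean) (use I c in auto)
    also have "\<dots> = real (\<Sum>j<J. card (I j)) * (\<eta> + M3 / c\<^sup>2)" by (simp add: sum_distrib_right)
    also have "\<dots> \<le> real b * (\<eta> + M3 / c\<^sup>2)" using card \<eta>0 M3 by (intro mult_right_mono) (auto simp del: of_nat_sum)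
    finally have "t * (\<Sum>j<J. S1 j) \<le> t * (real b * (\<eta> + M3 / c\<^sup>2))" using t0 by (rule mult_left_mono)
    then have 1: "t * (\<Sum>j<J. S1 j) \<le> 1" using small(2) by (simp add: t_def)
    have "t\<^sup>2 / 2 * (exp \<beta> * (\<Sum>j<J. S2 j)) = z\<^sup>2 / (2 * v0\<^sup>2) * (exp \<beta> * (a\<^sup>2 * (\<Sum>j<J. S2 j)))"
      by (simp add: t_def power_divide power_mult_distrib mult_ac)
    also have "\<dots> \<le> z\<^sup>2 / (2 * v0\<^sup>2) * v0" using var by (intro mult_left_mono) (auto simp: S2_def B_def)
    also have "\<dots> = z\<^sup>2 / (2 * v0)" using v0 by (simp add: power2_eq_square)
    finally show ?thesis using 1 by simp
  qed
  finally have prod: "(\<Prod>j<J. m j) \<le> exp (1 + z\<^sup>2 / (2 * v0))" .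
  have za: "t * (z / a) = z\<^sup>2 / v0" using a by (simp add: t_def power2_eq_square)
  have "prob {x\<in>space M. a * (\<Sum>j<J. B j x) > z} = prob {x\<in>space M. (\<Sum>j<J. B j x) > z / a}"
    using a by (simp add: field_simps)
  also have "\<dots> \<le> (\<Prod>j<J. m j) * (exp (- (t * (z / a))) + real J * \<eta> * exp (t * (real h * c)))"
    by (rule weak_indep_exponential_tail[OF prob_space_axioms wi \<eta>0 Bb t0]) (use z a mE m1 in auto)
  also have "\<dots> \<le> exp (1 + z\<^sup>2 / (2 * v0)) * (exp (- (z\<^sup>2 / v0)) + real J * \<eta> * exp \<beta>)"
  proof (rule mult_mono[OF prod])
    have "t * (real h * c) \<le> \<beta>" using small(1) by (simp add: t_def mult.assoc)
    then show "exp (- (t * (z / a))) + real J * \<eta> * exp (t * (real h * c)) \<le> exp (- (z\<^sup>2 / v0)) + real J * \<eta> * exp \<beta>"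
      unfolding za using \<eta>0 by (intro add_left_mono mult_left_mono) auto
  qed (use \<eta>0 in auto)
  also have "\<dots> = exp 1 * (exp (- (z\<^sup>2 / (2 * v0))) + real J * \<eta> * exp \<beta> * exp (z\<^sup>2 / (2 * v0)))"
  proof -
    have "exp (z\<^sup>2 / (2 * v0)) * exp (- (z\<^sup>2 / v0)) = exp (- (z\<^sup>2 / (2 * v0)))"
      using v0 by (simp flip: exp_add add: field_simps)
    then show ?thesis by (simp add: exp_add algebra_simps)
  qed
  finally show ?thesis by (simp add: B_def)
qed

end

section \<open>Long and short groups of blocks\<close>

text \<open>
  Index k stands at position k - 1, counted from 0, and each period of length p + g begins with a
  long group of length p.
\<close>

definition big_block :: "nat \<Rightarrow> nat \<Rightarrow> nat \<Rightarrow> nat \<Rightarrow> nat set" where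
  "big_block b p g j = {k\<in>{1..b}. (k - 1) div (p + g) = j \<and> (k - 1) mod (p + g) < p}"

definition small_block :: "nat \<Rightarrow> nat \<Rightarrow> nat \<Rightarrow> nat \<Rightarrow> nat set" where
  "small_block b p g j = {k\<in>{1..b}. (k - 1) div (p + g) = j \<and> p \<le> (k - 1) mod (p + g)}"

lemma big_block_range:
  assumes "k \<in> big_block b p g j" shows "j * (p + g) + 1 \<le> k" "k \<le> j * (p + g) + p"
proof -
  have "k \<ge> 1" "(k - 1) div (p + g) = j" "(k - 1) mod (p + g) < p" using assms by (auto simp: big_block_def)
  then have "k - 1 = j * (p + g) + (k - 1) mod (p + g)" by (metis div_mult_mod_eq)
  then show "j * (p + g) + 1 \<le> k" "k \<le> j * (p + g) + p"
    using \<open>k \<ge> 1\<close> \<open>(k - 1) mod (p + g) < p\<close> by linarith+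
qed

lemma small_block_range:
  assumes "k \<in> small_block b p g j" "p + g > 0"
  shows "j * (p + g) + p + 1 \<le> k" "k \<le> j * (p + g) + (p + g)"
proof -
  have *: "k \<ge> 1" "(k - 1) div (p + g) = j" "p \<le> (k - 1) mod (p + g)" using assms by (auto simp: small_block_def)
  then have "k - 1 = j * (p + g) + (k - 1) mod (p + g)" by (metis div_mult_mod_eq)
  moreover have "(k - 1) mod (p + g) < p + g" using assms(2) by simp
  ultimately show "j * (p + g) + p + 1 \<le> k" "k \<le> j * (p + g) + (p + g)" using * by linarith+
qed

lemma card_big_block: "card (big_block b p g j) \<le> p"
proof -
  have "big_block b p g j \<subseteq> {j * (p + g) + 1 .. j * (p + g) + p}" using big_block_range by fastforce
  then show ?thesis using card_mono[of "{j * (p + g) + 1 .. j * (p + g) + p}"] by fastforce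
qed

lemma card_small_block: assumes "p + g > 0" shows "card (small_block b p g j) \<le> g"
proof -
  have "small_block b p g j \<subseteq> {j * (p + g) + p + 1 .. j * (p + g) + (p + g)}"
    using small_block_range[OF _ assms] by fastforce
  then show ?thesis using card_mono[of "{j * (p + g) + p + 1 .. j * (p + g) + (p + g)}"] by fastforce
qed

lemma block_partition_sum:
  fixes f :: "nat \<Rightarrow> 'c::comm_monoid_add"
  shows "(\<Sum>k=1..b. f k) = (\<Sum>j<b div (p + g) + 1. sum f (big_block b p g j)) + (\<Sum>j<b div (p + g) + 1. sum f (small_block b p g j))"
proof -
  have "(\<Sum>k=1..b. f k) = (\<Sum>j\<in>{..<b div (p + g) + 1}. \<Sum>k\<in>{k\<in>{1..b}. (k - 1) div (p + g) = j}. f k)"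
    by (rule sum.group[symmetric]) (auto simp: less_Suc_eq_le intro!: div_le_mono)
  also have "\<dots> = (\<Sum>j\<in>{..<b div (p + g) + 1}. sum f (big_block b p g j) + sum f (small_block b p g j))"
  proof (rule sum.cong[OF refl])
    fix j
    have "{k\<in>{1..b}. (k - 1) div (p + g) = j} = big_block b p g j \<union> small_block b p g j"
      by (auto simp: big_block_def small_block_def)
    moreover have "big_block b p g j \<inter> small_block b p g j = {}" by (auto simp: big_block_def small_block_def)
    moreover have "finite (big_block b p g j)" "finite (small_block b p g j)" by (auto simp: big_block_def small_block_def)
    ultimately show "(\<Sum>k\<in>{k\<in>{1..b}. (k - 1) div (p + g) = j}. f k) = sum f (big_block b p g j) + sum f (small_block b p g j)"
      by (simp add: sum.union_disjoint)
  qed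
  finally show ?thesis by (simp only: sum.distrib)
qed

lemma sum_card_blocks:
  "(\<Sum>j<b div (p + g) + 1. card (big_block b p g j)) \<le> b" "(\<Sum>j<b div (p + g) + 1. card (small_block b p g j)) \<le> b"
  using block_partition_sum[of "\<lambda>_. 1 :: nat" b p g] by simp_all

context real_block_array begin

text \<open>
  The threshold is shared out as (1-\<epsilon>)z for the long groups, \<epsilon> z/2 for the short
  ones and \<epsilon> z/2 for the approximation error. The variance proxies
  (1-\<epsilon>)^2\<lambda>2 and (\<epsilon>/2)^2\<lambda>2 are chosen such that both group sums
  get the same exponent z^2/(2\<lambda>2). The sum R of the long groups differs from the full sum
  by the sum of the short groups, whose variance is small because they are a small fraction g/p of
  all blocks; this is the quantity G.
\<close>

lemma clipped_sum_tail:
  fixes p :: nat and a c H \<epsilon> lam1 lam2 z \<beta> :: real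
  defines "\<tau> \<equiv> 5 * M3 / H + 7 * H\<^sup>2 * \<eta>" and "\<kappa>c \<equiv> 4 * c * \<eta> + 2 * M3 / c"
    and "G \<equiv> (2 / real p + 2 / real b) * (real g * real g * (1 + M3))"
  assumes pg: "g \<ge> 1" "p \<ge> g" and b: "b \<ge> 1" and a: "a > 0" "a\<^sup>2 \<le> 2 / real b" and c: "c > 0" and H: "H \<ge> 1"
    and \<epsilon>: "0 < \<epsilon>" "\<epsilon> \<le> 1 / 2" and lam2: "lam2 > 0" and z: "z > 0"
    and D: "a\<^sup>2 * expectation (\<lambda>x. (\<Sum>k=1..b. w k x)\<^sup>2) \<le> lam1"
    and T1: "2 * a * z / (\<epsilon> * lam2) * real p * c \<le> \<beta>"
    and T2: "2 * a * z / (\<epsilon> * lam2) * (real b * (\<eta> + M3 / c\<^sup>2)) \<le> 1"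
    and vB: "exp \<beta> * ((1 + \<epsilon>) * ((1 + \<epsilon>) * lam1 + (1 + 1 / \<epsilon>) * (G + 2 * real b * \<tau>) + 2 * real b * \<tau>)
        + (1 + 1 / \<epsilon>) * (2 * real p * \<kappa>c)) \<le> (1 - \<epsilon>)\<^sup>2 * lam2"
    and vG: "exp \<beta> * (2 * G + 4 * real p * \<kappa>c) \<le> (\<epsilon> / 2)\<^sup>2 * lam2"
  shows "prob {x\<in>space M. a * (\<Sum>k=1..b. clip c (w k x)) > z}
    \<le> 2 * (exp 1 * (exp (- (z\<^sup>2 / (2 * lam2))) + (real b + 1) * \<eta> * exp \<beta> * exp (z\<^sup>2 / (2 * lam2))))
      + 2 * a * real b * \<eta> / (\<epsilon> * z)"
proof -
  define J where "J = b div (p + g) + 1"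
  define Ib where "Ib = big_block b p g"
  define Is where "Is = small_block b p g"
  have pg0: "p + g > 0" "p \<ge> 1" using pg by auto
  have Ib: "Ib j \<subseteq> {1..b}" and Is: "Is j \<subseteq> {1..b}" for j by (auto simp: Ib_def Is_def big_block_def small_block_def)
  have cb: "card (Ib j) \<le> p" "card (Is j) \<le> g" for j
    using card_big_block card_small_block pg0 by (auto simp: Ib_def Is_def)
  have cards: "(\<Sum>j<J. card (Ib j)) \<le> b" "(\<Sum>j<J. card (Is j)) \<le> b" unfolding J_def Ib_def Is_def by (rule sum_card_blocks)+
  have step: "Suc i * (p + g) \<le> j * (p + g)" if "i < j" for i j using that by (intro mult_right_mono) auto
  have sepB: "k + g \<le> j * (p + g) + 1" if "i < j" "k \<in> Ib i" for i j k
    using big_block_range[of k b p g i] that step[OF that(1)] by (simp add: Ib_def)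
  have sepS: "k + g \<le> j * (p + g) + p + 1" if "i < j" "k \<in> Is i" for i j k
    using small_block_range[of k b p g i] that step[OF that(1)] pg0 pg by (simp add: Is_def)
  have loB: "j * (p + g) + 1 \<le> k" if "k \<in> Ib j" for j k using big_block_range[of k b p g j] that by (simp add: Ib_def)
  have loS: "j * (p + g) + p + 1 \<le> k" if "k \<in> Is j" for j k using small_block_range[of k b p g j] that pg0 by (simp add: Is_def)
  have \<tau>0: "\<tau> \<ge> 0" using H M3 \<eta>0 by (auto simp: \<tau>_def)
  have \<kappa>0: "\<kappa>c \<ge> 0" using c M3 \<eta>0 by (auto simp: \<kappa>c_def)
  have split: "(\<Sum>k=1..b. f k) = (\<Sum>j<J. sum f (Ib j)) + (\<Sum>j<J. sum f (Is j))" for f :: "nat \<Rightarrow> real"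
    unfolding J_def Ib_def Is_def by (rule block_partition_sum)
  define R where "R = (\<lambda>x. \<Sum>j<J. \<Sum>k\<in>Ib j. w k x)"
  define r where "r = (\<lambda>x. \<Sum>j<J. \<Sum>k\<in>Is j. w k x)"
  define D2 where "D2 = expectation (\<lambda>x. (\<Sum>k=1..b. w k x)\<^sup>2)"
  define SR where "SR = (\<Sum>j<J. expectation (\<lambda>x. (\<Sum>k\<in>Ib j. w k x)\<^sup>2))"
  define Sr where "Sr = (\<Sum>j<J. expectation (\<lambda>x. (\<Sum>k\<in>Is j. w k x)\<^sup>2))"
  have sR: "\<bar>expectation (\<lambda>x. (R x)\<^sup>2) - SR\<bar> \<le> (real b)\<^sup>2 * \<tau>"
    unfolding R_def SR_def \<tau>_def
    by (rule second_moment_blocks[OF Ib _ cards(1) H]) (use sepB loB in \<open>meson order_trans\<close>)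
  have sr: "\<bar>expectation (\<lambda>x. (r x)\<^sup>2) - Sr\<bar> \<le> (real b)\<^sup>2 * \<tau>"
    unfolding r_def Sr_def \<tau>_def
    by (rule second_moment_blocks[OF Is _ cards(2) H]) (use sepS loS in \<open>meson order_trans\<close>)
  have Sr: "Sr \<le> real J * (real g * real g * (1 + M3))"
  proof -
    have "Sr \<le> (\<Sum>j<J. real g * real g * (1 + M3))"
      unfolding Sr_def by (intro sum_mono block_square_crude Is cb)
    then show ?thesis by simp
  qed
  have aJ: "a\<^sup>2 * real J \<le> 2 / real p + 2 / real b"
  proof -
    have "real (b div (p + g)) \<le> real b / real (p + g)" by (rule of_nat_div_le_of_nat)
    also have "\<dots> \<le> real b / real p" using pg0 by (intro divide_left_mono) auto
    finally have J: "real J \<le> real b / real p + 1" by (simp add: J_def)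
    have "a\<^sup>2 * real J \<le> 2 / real b * (real b / real p + 1)" using a J by (intro mult_mono) auto
    also have "\<dots> = 2 / real p + 2 / real b" using b pg0 by (simp add: field_simps)
    finally show ?thesis .
  qed
  have aSr: "a\<^sup>2 * Sr \<le> G"
  proof -
    have "a\<^sup>2 * Sr \<le> a\<^sup>2 * (real J * (real g * real g * (1 + M3)))" using Sr by (intro mult_left_mono) auto
    also have "\<dots> = a\<^sup>2 * real J * (real g * real g * (1 + M3))" by simp
    also have "\<dots> \<le> G" unfolding G_def using aJ M3 by (intro mult_right_mono) auto
    finally show ?thesis .
  qed
  have ab: "a\<^sup>2 * ((real b)\<^sup>2 * \<tau>) \<le> 2 * real b * \<tau>" "a\<^sup>2 * real b \<le> 2"
  proof -
    have *: "a\<^sup>2 * real b \<le> 2 / real b * real b" using a by (intro mult_right_mono) auto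
    then show "a\<^sup>2 * real b \<le> 2" using b by simp
    then have "a\<^sup>2 * real b * (real b * \<tau>) \<le> 2 * (real b * \<tau>)" using \<tau>0 by (intro mult_right_mono) auto
    then show "a\<^sup>2 * ((real b)\<^sup>2 * \<tau>) \<le> 2 * real b * \<tau>" by (simp add: power2_eq_square mult_ac)
  qed
  have iR: "integrable M (\<lambda>x. (\<Sum>j<J. \<Sum>k\<in>I j. w k x)\<^sup>2)" if "\<And>j. I j \<subseteq> {1..b}" for I
    unfolding power2_eq_square sum_product[of "\<lambda>j. \<Sum>k\<in>I j. w k _"]
    by (intro Bochner_Integration.integrable_sum sum_prodI that)
  have ER: "expectation (\<lambda>x. (R x)\<^sup>2) \<le> (1 + \<epsilon>) * D2 + (1 + 1 / \<epsilon>) * expectation (\<lambda>x. (r x)\<^sup>2)"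
  proof -
    have iD: "integrable M (\<lambda>x. (\<Sum>k=1..b. w k x)\<^sup>2)"
      using sum_prodI[of "{1..b}" "{1..b}"] by (simp add: power2_eq_square)
    have "expectation (\<lambda>x. (R x)\<^sup>2) \<le> expectation (\<lambda>x. (1 + \<epsilon>) * (\<Sum>k=1..b. w k x)\<^sup>2 + (1 + 1 / \<epsilon>) * (r x)\<^sup>2)"
    proof (rule integral_mono)
      fix x
      have "(R x)\<^sup>2 = ((\<Sum>k=1..b. w k x) + (- r x))\<^sup>2" using split[of "\<lambda>k. w k x"] by (simp add: R_def r_def)
      also have "\<dots> \<le> (1 + \<epsilon>) * (\<Sum>k=1..b. w k x)\<^sup>2 + (1 + 1 / \<epsilon>) * (- r x)\<^sup>2" by (rule sq_add_le[OF \<epsilon>(1)])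
      finally show "(R x)\<^sup>2 \<le> (1 + \<epsilon>) * (\<Sum>k=1..b. w k x)\<^sup>2 + (1 + 1 / \<epsilon>) * (r x)\<^sup>2" by simp
    qed (use iD iR[OF Ib] iR[OF Is] in \<open>auto simp: R_def r_def\<close>)
    also have "\<dots> = (1 + \<epsilon>) * D2 + (1 + 1 / \<epsilon>) * expectation (\<lambda>x. (r x)\<^sup>2)"
      using iD iR[OF Is] by (simp add: D2_def r_def)
    finally show ?thesis .
  qed
  have e1: "1 + 1 / \<epsilon> \<ge> 0" using \<epsilon> by simp
  have aER: "a\<^sup>2 * expectation (\<lambda>x. (r x)\<^sup>2) \<le> G + 2 * real b * \<tau>"
  proof -
    have "expectation (\<lambda>x. (r x)\<^sup>2) \<le> Sr + (real b)\<^sup>2 * \<tau>" using sr by linarith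
    then have "a\<^sup>2 * expectation (\<lambda>x. (r x)\<^sup>2) \<le> a\<^sup>2 * (Sr + (real b)\<^sup>2 * \<tau>)" by (intro mult_left_mono) auto
    then show ?thesis using aSr ab(1) by (simp add: distrib_left)
  qed
  have aSR: "a\<^sup>2 * SR \<le> (1 + \<epsilon>) * lam1 + (1 + 1 / \<epsilon>) * (G + 2 * real b * \<tau>) + 2 * real b * \<tau>"
  proof -
    have "SR \<le> (1 + \<epsilon>) * D2 + (1 + 1 / \<epsilon>) * expectation (\<lambda>x. (r x)\<^sup>2) + (real b)\<^sup>2 * \<tau>" using sR ER by linarith
    then have "a\<^sup>2 * SR \<le> a\<^sup>2 * ((1 + \<epsilon>) * D2 + (1 + 1 / \<epsilon>) * expectation (\<lambda>x. (r x)\<^sup>2) + (real b)\<^sup>2 * \<tau>)"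
      by (intro mult_left_mono) auto
    also have "\<dots> = (1 + \<epsilon>) * (a\<^sup>2 * D2) + (1 + 1 / \<epsilon>) * (a\<^sup>2 * expectation (\<lambda>x. (r x)\<^sup>2)) + a\<^sup>2 * ((real b)\<^sup>2 * \<tau>)"
      by (simp add: algebra_simps)
    also have "\<dots> \<le> (1 + \<epsilon>) * lam1 + (1 + 1 / \<epsilon>) * (G + 2 * real b * \<tau>) + 2 * real b * \<tau>"
      using D aER ab(1) \<epsilon> e1 by (intro add_mono mult_left_mono) (auto simp: D2_def)
    finally show ?thesis .
  qed
  have sumsq: "a\<^sup>2 * (\<Sum>j<J. expectation (\<lambda>x. (\<Sum>k\<in>I j. \<xi> c k x)\<^sup>2))
      \<le> (1 + e) * (a\<^sup>2 * (\<Sum>j<J. expectation (\<lambda>x. (\<Sum>k\<in>I j. w k x)\<^sup>2))) + (1 + 1 / e) * (2 * real p * \<kappa>c)"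
    if I: "\<And>j. I j \<subseteq> {1..b}" "\<And>j. card (I j) \<le> p" "(\<Sum>j<J. card (I j)) \<le> b" and e: "e > 0" for I e
  proof -
    have "(\<Sum>j<J. expectation (\<lambda>x. (\<Sum>k\<in>I j. \<xi> c k x)\<^sup>2))
       \<le> (\<Sum>j<J. (1 + e) * expectation (\<lambda>x. (\<Sum>k\<in>I j. w k x)\<^sup>2) + (1 + 1 / e) * (real p * real (card (I j)) * \<kappa>c))"
      unfolding \<kappa>c_def by (intro sum_mono clipped_block_square I c e)
    also have "\<dots> = (1 + e) * (\<Sum>j<J. expectation (\<lambda>x. (\<Sum>k\<in>I j. w k x)\<^sup>2))
        + (1 + 1 / e) * (real p * real (\<Sum>j<J. card (I j)) * \<kappa>c)"
      by (simp add: sum.distrib sum_distrib_left sum_distrib_right mult.assoc)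
    also have "\<dots> \<le> (1 + e) * (\<Sum>j<J. expectation (\<lambda>x. (\<Sum>k\<in>I j. w k x)\<^sup>2))
        + (1 + 1 / e) * (real p * real b * \<kappa>c)"
      using I(3) \<kappa>0 e by (intro add_left_mono mult_left_mono mult_right_mono) (auto simp del: of_nat_sum)
    finally have "a\<^sup>2 * (\<Sum>j<J. expectation (\<lambda>x. (\<Sum>k\<in>I j. \<xi> c k x)\<^sup>2)) \<le> a\<^sup>2 * ((1 + e) * (\<Sum>j<J. expectation (\<lambda>x. (\<Sum>k\<in>I j. w k x)\<^sup>2))
        + (1 + 1 / e) * (real p * real b * \<kappa>c))" by (rule mult_left_mono) simp
    also have "\<dots> = (1 + e) * (a\<^sup>2 * (\<Sum>j<J. expectation (\<lambda>x. (\<Sum>k\<in>I j. w k x)\<^sup>2))) + (1 + 1 / e) * ((a\<^sup>2 * real b) * (real p * \<kappa>c))"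
      by (simp add: algebra_simps)
    also have "\<dots> \<le> (1 + e) * (a\<^sup>2 * (\<Sum>j<J. expectation (\<lambda>x. (\<Sum>k\<in>I j. w k x)\<^sup>2))) + (1 + 1 / e) * (2 * (real p * \<kappa>c))"
      using ab(2) \<kappa>0 e by (intro add_left_mono mult_left_mono mult_right_mono) auto
    finally show ?thesis by (simp add: mult.assoc)
  qed
  define T where "T = 2 * a * z / (\<epsilon> * lam2)"
  have T0: "T \<ge> 0" using a z \<epsilon> lam2 by (simp add: T_def)
  have bq: "real b * (\<eta> + M3 / c\<^sup>2) \<ge> 0" using \<eta>0 M3 by simp
  have J1: "real J * \<eta> * exp \<beta> * u \<le> (real b + 1) * \<eta> * exp \<beta> * u" if "u \<ge> 0" for u
  proof -
    have "real J \<le> real b + 1" unfolding J_def by (simp add: div_le_dividend)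
    then show ?thesis using \<eta>0 that by (intro mult_right_mono) auto
  qed
  have tB: "a * ((1 - \<epsilon>) * z) / ((1 - \<epsilon>)\<^sup>2 * lam2) \<le> T"
  proof -
    have "a * ((1 - \<epsilon>) * z) / ((1 - \<epsilon>)\<^sup>2 * lam2) = (a * z / lam2) * (1 / (1 - \<epsilon>))"
      using \<epsilon> by (simp add: power2_eq_square)
    also have "\<dots> \<le> (a * z / lam2) * (2 / \<epsilon>)"
    proof (rule mult_left_mono)
      have "1 / (1 - \<epsilon>) \<le> 1 / \<epsilon>" using \<epsilon> by (intro divide_left_mono) auto
      also have "\<dots> \<le> 2 / \<epsilon>" using \<epsilon> by (intro divide_right_mono) auto
      finally show "1 / (1 - \<epsilon>) \<le> 2 / \<epsilon>" .
    qed (use a z lam2 in auto)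
    finally show ?thesis by (simp add: T_def mult_ac)
  qed
  have tS: "a * ((\<epsilon> / 2) * z) / ((\<epsilon> / 2)\<^sup>2 * lam2) = T" using \<epsilon> by (simp add: power2_eq_square T_def)
  have PB: "prob {x\<in>space M. a * (\<Sum>j<J. \<Sum>k\<in>Ib j. \<xi> c k x) > (1 - \<epsilon>) * z}
     \<le> exp 1 * (exp (- (z\<^sup>2 / (2 * lam2))) + (real b + 1) * \<eta> * exp \<beta> * exp (z\<^sup>2 / (2 * lam2)))"
  proof -
    have eq: "((1 - \<epsilon>) * z)\<^sup>2 / (2 * ((1 - \<epsilon>)\<^sup>2 * lam2)) = z\<^sup>2 / (2 * lam2)" using \<epsilon> by (simp add: power_mult_distrib)
    have "prob {x\<in>space M. a * (\<Sum>j<J. \<Sum>k\<in>Ib j. \<xi> c k x) > (1 - \<epsilon>) * z}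
     \<le> exp 1 * (exp (- (((1 - \<epsilon>) * z)\<^sup>2 / (2 * ((1 - \<epsilon>)\<^sup>2 * lam2)))) + real J * \<eta> * exp \<beta> * exp (((1 - \<epsilon>) * z)\<^sup>2 / (2 * ((1 - \<epsilon>)\<^sup>2 * lam2))))"
    proof (rule separated_family_tail[where h = p and f = "\<lambda>j. int (j * (p + g) + 1)"])
      show "a * ((1 - \<epsilon>) * z) / ((1 - \<epsilon>)\<^sup>2 * lam2) * real p * c \<le> \<beta>"
        using mult_right_mono[OF tB, of "real p * c"] T1 c by (simp add: T_def mult.assoc)
      show "a * ((1 - \<epsilon>) * z) / ((1 - \<epsilon>)\<^sup>2 * lam2) * (real b * (\<eta> + M3 / c\<^sup>2)) \<le> 1"
        using mult_right_mono[OF tB bq] T2 by (simp add: T_def)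
      have "a\<^sup>2 * (\<Sum>j<J. expectation (\<lambda>x. (\<Sum>k\<in>Ib j. \<xi> c k x)\<^sup>2)) \<le>
         (1 + \<epsilon>) * (a\<^sup>2 * SR) + (1 + 1 / \<epsilon>) * (2 * real p * \<kappa>c)"
        unfolding SR_def by (rule sumsq) (use Ib cb cards \<epsilon> in auto)
      also have "\<dots> \<le> (1 + \<epsilon>) * ((1 + \<epsilon>) * lam1 + (1 + 1 / \<epsilon>) * (G + 2 * real b * \<tau>) + 2 * real b * \<tau>)
          + (1 + 1 / \<epsilon>) * (2 * real p * \<kappa>c)"
        using aSR \<epsilon> by (intro add_right_mono mult_left_mono) auto
      finally show "exp \<beta> * (a\<^sup>2 * (\<Sum>j<J. expectation (\<lambda>x. (\<Sum>k\<in>Ib j. \<xi> c k x)\<^sup>2))) \<le> (1 - \<epsilon>)\<^sup>2 * lam2"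
        using vB mult_left_mono[of _ _ "exp \<beta>"] by (meson exp_ge_zero order_trans)
      show "int k + int g \<le> int (j * (p + g) + 1)" if "i < j" "k \<in> Ib i" for i j k
        using sepB[OF that] by linarith
      show "int (j * (p + g) + 1) \<le> int k" if "k \<in> Ib j" for j k using loB[OF that] by linarith
    qed (use Ib cb cards a c z lam2 \<epsilon> in auto)
    then show ?thesis unfolding eq using J1[of "exp (z\<^sup>2 / (2 * lam2))"] by (auto intro: order_trans)
  qed
  have PS: "prob {x\<in>space M. a * (\<Sum>j<J. \<Sum>k\<in>Is j. \<xi> c k x) > (\<epsilon> / 2) * z}
     \<le> exp 1 * (exp (- (z\<^sup>2 / (2 * lam2))) + (real b + 1) * \<eta> * exp \<beta> * exp (z\<^sup>2 / (2 * lam2)))"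
  proof -
    have eq: "((\<epsilon> / 2) * z)\<^sup>2 / (2 * ((\<epsilon> / 2)\<^sup>2 * lam2)) = z\<^sup>2 / (2 * lam2)" using \<epsilon> by (simp add: power_mult_distrib power_divide)
    have cp: "card (Is j) \<le> p" for j using cb(2)[of j] pg by simp
    have "prob {x\<in>space M. a * (\<Sum>j<J. \<Sum>k\<in>Is j. \<xi> c k x) > (\<epsilon> / 2) * z}
     \<le> exp 1 * (exp (- (((\<epsilon> / 2) * z)\<^sup>2 / (2 * ((\<epsilon> / 2)\<^sup>2 * lam2)))) + real J * \<eta> * exp \<beta> * exp (((\<epsilon> / 2) * z)\<^sup>2 / (2 * ((\<epsilon> / 2)\<^sup>2 * lam2))))"
    proof (rule separated_family_tail[where h = p and f = "\<lambda>j. int (j * (p + g) + p + 1)"])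
      show "a * ((\<epsilon> / 2) * z) / ((\<epsilon> / 2)\<^sup>2 * lam2) * real p * c \<le> \<beta>" unfolding tS using T1 by (simp add: T_def)
      show "a * ((\<epsilon> / 2) * z) / ((\<epsilon> / 2)\<^sup>2 * lam2) * (real b * (\<eta> + M3 / c\<^sup>2)) \<le> 1" unfolding tS using T2 by (simp add: T_def)
      have "a\<^sup>2 * (\<Sum>j<J. expectation (\<lambda>x. (\<Sum>k\<in>Is j. \<xi> c k x)\<^sup>2)) \<le>
         (1 + 1) * (a\<^sup>2 * Sr) + (1 + 1 / 1) * (2 * real p * \<kappa>c)"
        unfolding Sr_def by (rule sumsq) (use Is cp cards in auto)
      also have "\<dots> \<le> 2 * G + 4 * real p * \<kappa>c" using aSr by simp
      finally show "exp \<beta> * (a\<^sup>2 * (\<Sum>j<J. expectation (\<lambda>x. (\<Sum>k\<in>Is j. \<xi> c k x)\<^sup>2))) \<le> (\<epsilon> / 2)\<^sup>2 * lam2"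
        using vG mult_left_mono[of _ _ "exp \<beta>"] by (meson exp_ge_zero order_trans)
      show "int k + int g \<le> int (j * (p + g) + p + 1)" if "i < j" "k \<in> Is i" for i j k
        using sepS[OF that] by linarith
      show "int (j * (p + g) + p + 1) \<le> int k" if "k \<in> Is j" for j k using loS[OF that] by linarith
    qed (use Is cp cards a c z lam2 \<epsilon> in auto)
    then show ?thesis unfolding eq using J1[of "exp (z\<^sup>2 / (2 * lam2))"] by (auto intro: order_trans)
  qed
  have PD: "prob {x\<in>space M. a * (\<Sum>k=1..b. \<bar>w k x - v k x\<bar>) \<ge> (\<epsilon> / 2) * z} \<le> 2 * a * real b * \<eta> / (\<epsilon> * z)"
  proof -
    have i: "integrable M (\<lambda>x. a * (\<Sum>k=1..b. \<bar>w k x - v k x\<bar>))"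
      by (intro integrable_mult_right Bochner_Integration.integrable_sum diffI)
    have "prob {x\<in>space M. a * (\<Sum>k=1..b. \<bar>w k x - v k x\<bar>) \<ge> (\<epsilon> / 2) * z}
      \<le> expectation (\<lambda>x. a * (\<Sum>k=1..b. \<bar>w k x - v k x\<bar>)) / ((\<epsilon> / 2) * z)"
      by (rule integral_Markov_inequality_measure[where A = "{}", OF i])
         (use a z \<epsilon> in \<open>auto intro!: AE_I2 mult_nonneg_nonneg sum_nonneg\<close>)
    also have "expectation (\<lambda>x. a * (\<Sum>k=1..b. \<bar>w k x - v k x\<bar>)) = a * (\<Sum>k=1..b. expectation (\<lambda>x. \<bar>w k x - v k x\<bar>))"
      by (subst integral_mult_right_zero, subst Bochner_Integration.integral_sum) (auto intro!: diffI(1))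
    also have "\<dots> \<le> a * (\<Sum>k=1..b. \<eta>)" using diffI a by (intro mult_left_mono sum_mono) auto
    finally show ?thesis using \<epsilon> z by (simp add: divide_right_mono field_simps)
  qed
  have vm[measurable]: "v k \<in> borel_measurable M" "w k \<in> borel_measurable M" if "k \<in> {1..b}" for k using vM wM that by auto
  have mS: "(\<lambda>x. \<Sum>j<J. \<Sum>k\<in>I j. \<xi> c k x) \<in> borel_measurable M" if "\<And>j. I j \<subseteq> {1..b}" for I
  proof (intro borel_measurable_sum)
    fix j k assume "k \<in> I j"
    then have [measurable]: "v k \<in> borel_measurable M" using vM that by blast
    show "\<xi> c k \<in> borel_measurable M" by measurable
  qed
  have mD: "(\<lambda>x. \<Sum>k=1..b. \<bar>w k x - v k x\<bar>) \<in> borel_measurable M" by (intro borel_measurable_sum) measurable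
  define EB where "EB = {x\<in>space M. a * (\<Sum>j<J. \<Sum>k\<in>Ib j. \<xi> c k x) > (1 - \<epsilon>) * z}"
  define ES where "ES = {x\<in>space M. a * (\<Sum>j<J. \<Sum>k\<in>Is j. \<xi> c k x) > (\<epsilon> / 2) * z}"
  define ED where "ED = {x\<in>space M. a * (\<Sum>k=1..b. \<bar>w k x - v k x\<bar>) \<ge> (\<epsilon> / 2) * z}"
  have ev: "EB \<in> sets M" "ES \<in> sets M" "ED \<in> sets M"
    unfolding EB_def ES_def ED_def using mS[OF Ib] mS[OF Is] mD by measurable
  have "{x\<in>space M. a * (\<Sum>k=1..b. clip c (w k x)) > z} \<subseteq> (EB \<union> ES) \<union> ED"
  proof
    fix x assume x: "x \<in> {x\<in>space M. a * (\<Sum>k=1..b. clip c (w k x)) > z}"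
    have "(\<Sum>k=1..b. clip c (w k x)) \<le> (\<Sum>k=1..b. \<xi> c k x + \<bar>w k x - v k x\<bar>)"
    proof (rule sum_mono)
      fix k show "clip c (w k x) \<le> \<xi> c k x + \<bar>w k x - v k x\<bar>"
        using clip_lipschitz[of c "w k x" "v k x"] c by linarith
    qed
    also have "\<dots> = (\<Sum>j<J. \<Sum>k\<in>Ib j. \<xi> c k x) + (\<Sum>j<J. \<Sum>k\<in>Is j. \<xi> c k x) + (\<Sum>k=1..b. \<bar>w k x - v k x\<bar>)"
      unfolding sum.distrib using split[of "\<lambda>k. \<xi> c k x"] by simp
    finally have "a * (\<Sum>k=1..b. clip c (w k x)) \<le> a * \<dots>" using a by (intro mult_left_mono) auto
    then have "z < a * (\<Sum>j<J. \<Sum>k\<in>Ib j. \<xi> c k x) + a * (\<Sum>j<J. \<Sum>k\<in>Is j. \<xi> c k x) + a * (\<Sum>k=1..b. \<bar>w k x - v k x\<bar>)"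
      using x by (simp add: distrib_left)
    moreover have "z = (1 - \<epsilon>) * z + (\<epsilon> / 2) * z + (\<epsilon> / 2) * z" by (simp add: algebra_simps)
    ultimately show "x \<in> (EB \<union> ES) \<union> ED" using x unfolding EB_def ES_def ED_def by (simp, linarith)
  qed
  then have "prob {x\<in>space M. a * (\<Sum>k=1..b. clip c (w k x)) > z} \<le> prob ((EB \<union> ES) \<union> ED)"
    using ev by (intro finite_measure_mono) auto
  also have "\<dots> \<le> prob EB + prob ES + prob ED"
    using ev measure_Un_le[of EB M ES] measure_Un_le[of "EB \<union> ES" M ED] by auto
  finally show ?thesis using PB PS PD unfolding EB_def ES_def ED_def by linarith
qed

end

section \<open>A moderate deviation bound for clipped sums\<close>

text \<open>
  These are the rates at which the error terms of the moderate deviation bound vanish; the lower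
  bound \<kappa> n^\<kappa> takes the place of the number of blocks.
\<close>

lemma log_power_limits:
  fixes \<kappa> :: real
  assumes "\<kappa> > 0"
  shows "(\<lambda>n. 1 / sqrt (ln (real n))) \<longlonglongrightarrow> 0"
    and "(\<lambda>n. sqrt (ln (real n)) / real n) \<longlonglongrightarrow> 0"
    and "(\<lambda>n. sqrt (ln (real n)) * (ln (real n))\<^sup>2 / sqrt (\<kappa> * real n powr \<kappa>)) \<longlonglongrightarrow> 0"
    and "(\<lambda>n. ln (real n) / sqrt (\<kappa> * real n powr \<kappa>)) \<longlonglongrightarrow> 0"
    and "(\<lambda>n. 1 / (\<kappa> * real n powr \<kappa>)) \<longlonglongrightarrow> 0"
    and "(\<lambda>n. 1 / real n) \<longlonglongrightarrow> 0"
  using assms by (real_asymp)+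

lemma variance_slack:
  fixes lam1 lam2 :: real
  assumes "lam1 < lam2" "lam2 > 0"
  obtains \<epsilon> where "0 < \<epsilon>" "\<epsilon> \<le> 1 / 2" "(1 + \<epsilon>) * ((1 + \<epsilon>) * ((1 + \<epsilon>) * lam1)) < (1 - \<epsilon>)\<^sup>2 * lam2"
proof -
  have "((\<lambda>e. (1 - e)\<^sup>2 * lam2 - (1 + e) * ((1 + e) * ((1 + e) * lam1))) \<longlongrightarrow> (1 - 0)\<^sup>2 * lam2 - (1 + 0) * ((1 + 0) * ((1 + 0) * lam1))) (at_right 0)"
    by (intro tendsto_intros)
  then have "\<forall>\<^sub>F e in at_right 0. (1 - e)\<^sup>2 * lam2 - (1 + e) * ((1 + e) * ((1 + e) * lam1)) > 0"
    by (rule order_tendstoD(1)) (use assms in simp)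
  moreover have "\<forall>\<^sub>F e in at_right (0::real). e < 1 / 2" by (rule eventually_at_rightI[of 0 "1/2"]) auto
  moreover have "\<forall>\<^sub>F e in at_right (0::real). e > 0" by (rule eventually_at_right_less)
  ultimately have "\<forall>\<^sub>F e in at_right 0. (1 - e)\<^sup>2 * lam2 - (1 + e) * ((1 + e) * ((1 + e) * lam1)) > 0 \<and> e < 1 / 2 \<and> e > 0"
    by eventually_elim simp
  then obtain e where "(1 - e)\<^sup>2 * lam2 - (1 + e) * ((1 + e) * ((1 + e) * lam1)) > 0" "e < 1 / 2" "e > 0"
    using eventually_happens'[OF trivial_limit_at_right_real] by blast
  then show ?thesis by (intro that[of e]) auto
qed

text \<open>
  The mixing rate is n^(-A) with A = 6 + k^2/\<lambda>2: one copy of the exponent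
  k^2/(2\<lambda>2) pays for the size of the stopped exponentials, another one makes the error as
  small as the claimed tail, and n^(-6) pays for sums over blocks and pairs of blocks. The
  parameter \<epsilon> is fixed first, from the room between \<lambda>1 and \<lambda>2, then the
  length p of the long groups, and n has to be large in terms of both.
\<close>

proposition clipped_sum_moderate_deviation:
  fixes lam1 lam2 \<kappa> k M3 :: real and g :: nat
  assumes lam: "0 \<le> lam1" "lam1 < lam2" and \<kappa>: "0 < \<kappa>" and k: "0 < k" and g: "1 \<le> g" and M3: "0 \<le> M3"
  obtains C where "C > 0"
    "\<forall>\<^sub>F n in sequentially. \<forall>(M :: 'w measure) b w v a c.
       real_block_array M b g w v (real n powr - (6 + k\<^sup>2 / lam2)) M3 \<longrightarrow>
       \<kappa> * real n powr \<kappa> \<le> real b \<longrightarrow> b \<le> n \<longrightarrow> 0 < a \<longrightarrow> a\<^sup>2 \<le> 2 / real b \<longrightarrow>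
       sqrt (real b) / (2 * ln (real n)) \<le> c \<longrightarrow> c \<le> sqrt (real b) / ln (real n) \<longrightarrow>
       a\<^sup>2 * (\<integral>x. (\<Sum>j=1..b. w j x)\<^sup>2 \<partial>M) \<le> lam1 \<longrightarrow>
       measure M {x\<in>space M. a * (\<Sum>j=1..b. clip c (w j x)) > k * sqrt (ln (real n))}
         \<le> C * real n powr - (k\<^sup>2 / (2 * lam2))"
proof -
  have lam2: "lam2 > 0" using lam by simp
  obtain \<epsilon> where \<epsilon>: "0 < \<epsilon>" "\<epsilon> \<le> 1 / 2" and \<epsilon>lam: "(1 + \<epsilon>) * ((1 + \<epsilon>) * ((1 + \<epsilon>) * lam1)) < (1 - \<epsilon>)\<^sup>2 * lam2"
    using variance_slack[OF lam(2) lam2] by blast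
  define E0 where "E0 = k\<^sup>2 / (2 * lam2)"
  have E0: "E0 > 0" "k\<^sup>2 / lam2 = 2 * E0" using k lam2 by (auto simp: E0_def)
  define g2 where "g2 = real g * real g * (1 + M3)"
  have g20: "g2 \<ge> 0" using M3 by (simp add: g2_def)
  \<comment> \<open>the length of the long blocks\<close>
  have "\<forall>\<^sub>F p in sequentially. (1 + \<epsilon>) * ((1 + \<epsilon>) * ((1 + \<epsilon>) * lam1 + (1 + 1 / \<epsilon>) * (2 / real p * g2))) < (1 - \<epsilon>)\<^sup>2 * lam2"
  proof -
    have "((\<lambda>p. (1 + \<epsilon>) * ((1 + \<epsilon>) * ((1 + \<epsilon>) * lam1 + (1 + 1 / \<epsilon>) * (2 / real p * g2))))
        \<longlongrightarrow> (1 + \<epsilon>) * ((1 + \<epsilon>) * ((1 + \<epsilon>) * lam1 + (1 + 1 / \<epsilon>) * (0 * g2)))) sequentially"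
      by (intro tendsto_intros lim_const_over_n)
    then show ?thesis by (rule order_tendstoD(2)) (use \<epsilon>lam in simp)
  qed
  moreover have "\<forall>\<^sub>F p in sequentially. (1 + \<epsilon>) * (2 * (2 / real p * g2)) < (\<epsilon> / 2)\<^sup>2 * lam2"
  proof -
    have "((\<lambda>p. (1 + \<epsilon>) * (2 * (2 / real p * g2))) \<longlongrightarrow> (1 + \<epsilon>) * (2 * (0 * g2))) sequentially"
      by (intro tendsto_intros lim_const_over_n)
    then show ?thesis by (rule order_tendstoD(2)) (use \<epsilon> lam2 in simp)
  qed
  moreover have "\<forall>\<^sub>F p in sequentially. g \<le> p" by (rule eventually_ge_at_top)
  ultimately have "\<forall>\<^sub>F p in sequentially. (1 + \<epsilon>) * ((1 + \<epsilon>) * ((1 + \<epsilon>) * lam1 + (1 + 1 / \<epsilon>) * (2 / real p * g2))) < (1 - \<epsilon>)\<^sup>2 * lam2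
     \<and> (1 + \<epsilon>) * (2 * (2 / real p * g2)) < (\<epsilon> / 2)\<^sup>2 * lam2 \<and> g \<le> p" by eventually_elim simp
  then obtain p where p: "(1 + \<epsilon>) * ((1 + \<epsilon>) * ((1 + \<epsilon>) * lam1 + (1 + 1 / \<epsilon>) * (2 / real p * g2))) < (1 - \<epsilon>)\<^sup>2 * lam2"
     "(1 + \<epsilon>) * (2 * (2 / real p * g2)) < (\<epsilon> / 2)\<^sup>2 * lam2" "g \<le> p"
    using eventually_happens'[OF sequentially_bot] by blast
  define \<beta> where "\<beta> = ln (1 + \<epsilon>)"
  have \<beta>: "\<beta> > 0" "exp \<beta> = 1 + \<epsilon>" using \<epsilon> by (auto simp: \<beta>_def)
  define L where "L = (\<lambda>n. ln (real n))"
  define s where "s = (\<lambda>n. sqrt (\<kappa> * real n powr \<kappa>))"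
  define Gn where "Gn = (\<lambda>n. (2 / real p + 2 * (1 / (\<kappa> * real n powr \<kappa>))) * g2)"
  define \<tau>n where "\<tau>n = (\<lambda>n. (10 * M3 + 14) * (1 / real n))"
  define \<kappa>n where "\<kappa>n = (\<lambda>n. 4 * (1 / real n) + 4 * M3 * (L n / s n))"
  have lim1: "(\<lambda>n. 1 / sqrt (L n)) \<longlonglongrightarrow> 0" "(\<lambda>n. sqrt (L n) / real n) \<longlonglongrightarrow> 0"
     "(\<lambda>n. sqrt (L n) * (L n)\<^sup>2 / s n) \<longlonglongrightarrow> 0" "(\<lambda>n. L n / s n) \<longlonglongrightarrow> 0"
    using log_power_limits[OF \<kappa>] unfolding L_def s_def by auto
  have Gl: "Gn \<longlonglongrightarrow> (2 / real p + 2 * 0) * g2" unfolding Gn_def by (intro tendsto_intros log_power_limits[OF \<kappa>])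
  have \<tau>l: "\<tau>n \<longlonglongrightarrow> (10 * M3 + 14) * 0" unfolding \<tau>n_def by (intro tendsto_intros log_power_limits[OF \<kappa>])
  have \<kappa>l: "\<kappa>n \<longlonglongrightarrow> 4 * 0 + 4 * M3 * 0" unfolding \<kappa>n_def by (intro tendsto_intros log_power_limits[OF \<kappa>] lim1)
  have ev1: "\<forall>\<^sub>F n in sequentially. (4 * k * real p / (\<epsilon> * lam2)) * (1 / sqrt (L n)) < \<beta>"
  proof -
    have "(\<lambda>n. (4 * k * real p / (\<epsilon> * lam2)) * (1 / sqrt (L n))) \<longlonglongrightarrow> (4 * k * real p / (\<epsilon> * lam2)) * 0"
      by (intro tendsto_intros lim1)
    then show ?thesis by (rule order_tendstoD(2)) (use \<beta> in simp)
  qed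
  have ev2: "\<forall>\<^sub>F n in sequentially. (4 * k / (\<epsilon> * lam2)) * (sqrt (L n) / real n + 4 * M3 * (sqrt (L n) * (L n)\<^sup>2 / s n)) < 1"
  proof -
    have "(\<lambda>n. (4 * k / (\<epsilon> * lam2)) * (sqrt (L n) / real n + 4 * M3 * (sqrt (L n) * (L n)\<^sup>2 / s n))) \<longlonglongrightarrow> (4 * k / (\<epsilon> * lam2)) * (0 + 4 * M3 * 0)"
      by (intro tendsto_intros lim1)
    then show ?thesis by (rule order_tendstoD(2)) simp
  qed
  have ev3: "\<forall>\<^sub>F n in sequentially. (1 + \<epsilon>) * ((1 + \<epsilon>) * ((1 + \<epsilon>) * lam1 + (1 + 1 / \<epsilon>) * (Gn n + \<tau>n n) + \<tau>n n) + (1 + 1 / \<epsilon>) * (2 * real p * \<kappa>n n)) < (1 - \<epsilon>)\<^sup>2 * lam2"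
  proof -
    have "(\<lambda>n. (1 + \<epsilon>) * ((1 + \<epsilon>) * ((1 + \<epsilon>) * lam1 + (1 + 1 / \<epsilon>) * (Gn n + \<tau>n n) + \<tau>n n) + (1 + 1 / \<epsilon>) * (2 * real p * \<kappa>n n)))
       \<longlonglongrightarrow> (1 + \<epsilon>) * ((1 + \<epsilon>) * ((1 + \<epsilon>) * lam1 + (1 + 1 / \<epsilon>) * ((2 / real p + 2 * 0) * g2 + (10 * M3 + 14) * 0) + (10 * M3 + 14) * 0) + (1 + 1 / \<epsilon>) * (2 * real p * (4 * 0 + 4 * M3 * 0)))"
      by (intro tendsto_intros Gl \<tau>l \<kappa>l)
    then show ?thesis by (rule order_tendstoD(2)) (use p(1) in simp)
  qed
  have ev4: "\<forall>\<^sub>F n in sequentially. (1 + \<epsilon>) * (2 * Gn n + 4 * real p * \<kappa>n n) < (\<epsilon> / 2)\<^sup>2 * lam2"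
  proof -
    have "(\<lambda>n. (1 + \<epsilon>) * (2 * Gn n + 4 * real p * \<kappa>n n)) \<longlonglongrightarrow> (1 + \<epsilon>) * (2 * ((2 / real p + 2 * 0) * g2) + 4 * real p * (4 * 0 + 4 * M3 * 0))"
      by (intro tendsto_intros Gl \<kappa>l)
    then show ?thesis by (rule order_tendstoD(2)) (use p(2) in simp)
  qed
  define C where "C = 2 * exp 1 * 5 + 4 / (\<epsilon> * k)"
  have C: "C > 0" using \<epsilon> k by (simp add: C_def add_pos_pos)
  have main: "\<forall>\<^sub>F n in sequentially. \<forall>(M :: 'w measure) b w v a c.
       real_block_array M b g w v (real n powr - (6 + k\<^sup>2 / lam2)) M3 \<longrightarrow>
       \<kappa> * real n powr \<kappa> \<le> real b \<longrightarrow> b \<le> n \<longrightarrow> 0 < a \<longrightarrow> a\<^sup>2 \<le> 2 / real b \<longrightarrow>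
       sqrt (real b) / (2 * ln (real n)) \<le> c \<longrightarrow> c \<le> sqrt (real b) / ln (real n) \<longrightarrow>
       a\<^sup>2 * (\<integral>x. (\<Sum>j=1..b. w j x)\<^sup>2 \<partial>M) \<le> lam1 \<longrightarrow>
       measure M {x\<in>space M. a * (\<Sum>j=1..b. clip c (w j x)) > k * sqrt (ln (real n))}
         \<le> C * real n powr - (k\<^sup>2 / (2 * lam2))"
    using ev1 ev2 ev3 ev4 eventually_ge_at_top[of 3]
  proof (eventually_elim, intro allI impI)
    fix n b w v a c and M :: "'w measure"
    assume e1: "(4 * k * real p / (\<epsilon> * lam2)) * (1 / sqrt (L n)) < \<beta>"
      and e2: "(4 * k / (\<epsilon> * lam2)) * (sqrt (L n) / real n + 4 * M3 * (sqrt (L n) * (L n)\<^sup>2 / s n)) < 1"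
      and e3: "(1 + \<epsilon>) * ((1 + \<epsilon>) * ((1 + \<epsilon>) * lam1 + (1 + 1 / \<epsilon>) * (Gn n + \<tau>n n) + \<tau>n n) + (1 + 1 / \<epsilon>) * (2 * real p * \<kappa>n n)) < (1 - \<epsilon>)\<^sup>2 * lam2"
      and e4: "(1 + \<epsilon>) * (2 * Gn n + 4 * real p * \<kappa>n n) < (\<epsilon> / 2)\<^sup>2 * lam2"
      and n3: "3 \<le> n"
      and arr: "real_block_array M b g w v (real n powr - (6 + k\<^sup>2 / lam2)) M3"
      and b\<kappa>: "\<kappa> * real n powr \<kappa> \<le> real b" and bn: "b \<le> n" and a: "0 < a" "a\<^sup>2 \<le> 2 / real b"
      and c: "sqrt (real b) / (2 * ln (real n)) \<le> c" "c \<le> sqrt (real b) / ln (real n)"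
      and D: "a\<^sup>2 * (\<integral>x. (\<Sum>j=1..b. w j x)\<^sup>2 \<partial>M) \<le> lam1"
    interpret real_block_array M b g w v "real n powr - (6 + k\<^sup>2 / lam2)" M3 by (rule arr)
    define \<eta> where "\<eta> = real n powr - (6 + k\<^sup>2 / lam2)"
    have n0: "real n \<ge> 3" using n3 by simp
    have L1: "L n \<ge> 1"
    proof -
      have "exp 1 \<le> real n" using exp_le n0 by linarith
      then show ?thesis unfolding L_def using n0 by (subst ln_ge_iff) auto
    qed
    have sL: "sqrt (L n) \<ge> 1" "sqrt (L n) * sqrt (L n) = L n" using L1 by auto
    have kn: "\<kappa> * real n powr \<kappa> > 0" using \<kappa> n0 by simp
    have b1: "b \<ge> 1" using b\<kappa> kn by (cases b) auto
    have sb: "s n \<le> sqrt (real b)" "s n > 0" using b\<kappa> kn by (auto simp: s_def)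
    have sqb: "sqrt (real b) * sqrt (real b) = real b" "sqrt (real b) \<ge> 1" using b1 by auto
    have sqbn: "sqrt (real b) \<le> real n"
    proof -
      have "sqrt (real b) \<le> sqrt (real n * real n)" using bn n0 b1
        by (intro real_sqrt_le_mono) (smt (verit) mult_le_cancel_right1 of_nat_le_iff)
      then show ?thesis by simp
    qed
    have c0: "c > 0" using c(1) sqb L1 by (smt (verit) L_def divide_pos_pos)
    have cn: "c \<le> real n"
    proof -
      have "sqrt (real b) / L n \<le> sqrt (real b) / 1" using L1 by (intro divide_left_mono) auto
      then show ?thesis using c(2) sqbn by (simp add: L_def)
    qed
    have \<eta>6: "\<eta> = real n powr (- 6) * real n powr (- 2 * E0)"
      unfolding \<eta>_def E0(2) by (simp add: powr_add[symmetric])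
    have \<eta>6': "\<eta> \<le> 1 / real n ^ 6"
    proof -
      have "real n powr (- 2 * E0) \<le> 1" using E0 n0 by (simp add: powr_le_one_le powr_minus divide_simps ge_one_powr_ge_zero)
      then have "\<eta> \<le> real n powr (- 6) * 1" unfolding \<eta>6 by (intro mult_left_mono) auto
      also have "\<dots> = 1 / real n ^ 6" using n0 by (simp add: powr_minus powr_numeral divide_simps)
      finally show ?thesis .
    qed
    have \<eta>n: "\<eta> * real n ^ j \<le> 1 / real n" if "j \<le> 5" for j
    proof -
      have "\<eta> * real n ^ j \<le> 1 / real n ^ 6 * real n ^ 5"
        using \<eta>6' n0 that by (intro mult_mono power_increasing) auto
      also have "\<dots> = 1 / real n" using n0 by (simp add: eval_nat_numeral)
      finally show ?thesis .
    qed
    have \<eta>0': "\<eta> \<ge> 0" by (simp add: \<eta>_def)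
    have ab: "a * sqrt (real b) \<le> 2"
    proof -
      have "(a * sqrt (real b))\<^sup>2 = a\<^sup>2 * real b" by (simp add: power_mult_distrib)
      also have "\<dots> \<le> 2 / real b * real b" using a by (intro mult_right_mono) auto
      also have "\<dots> \<le> 2\<^sup>2" using b1 by simp
      finally show ?thesis by (rule power2_le_imp_le) simp
    qed
    define z where "z = k * sqrt (L n)"
    have z: "z > 0" "z \<ge> k" using k sL by (auto simp: z_def mult_le_cancel_left1)
    define T where "T = 2 * a * z / (\<epsilon> * lam2)"
    have T0: "T \<ge> 0" using a z \<epsilon> lam2 by (simp add: T_def)
    have Tb: "T * sqrt (real b) \<le> 4 * k / (\<epsilon> * lam2) * sqrt (L n)"
    proof -
      have "T * sqrt (real b) = (a * sqrt (real b)) * (2 * z / (\<epsilon> * lam2))" by (simp add: T_def)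
      also have "\<dots> \<le> 2 * (2 * z / (\<epsilon> * lam2))" using ab z \<epsilon> lam2 by (intro mult_right_mono) auto
      finally show ?thesis by (simp add: z_def)
    qed
    have cinv: "1 / c \<le> 2 * L n / sqrt (real b)"
      using c(1) c0 sqb L1 by (simp add: L_def field_simps)
    have "T * real p * c \<le> \<beta>"
    proof -
      have "T * real p * c \<le> T * real p * (sqrt (real b) / L n)" using c(2) T0 by (intro mult_left_mono) (auto simp: L_def)
      also have "\<dots> = (T * sqrt (real b)) * (real p / L n)" by simp
      also have "\<dots> \<le> (4 * k / (\<epsilon> * lam2) * sqrt (L n)) * (real p / L n)" using Tb L1 by (intro mult_right_mono) auto
      also have "\<dots> = (4 * k * real p / (\<epsilon> * lam2)) * (sqrt (L n) / L n)" by simp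
      also have "sqrt (L n) / L n = 1 / sqrt (L n)" using L1 by (simp add: frac_eq_eq)
      finally show ?thesis using e1 by linarith
    qed
    then have T1: "2 * a * z / (\<epsilon> * lam2) * real p * c \<le> \<beta>" by (simp add: T_def)
    have "T * (real b * (\<eta> + M3 / c\<^sup>2)) \<le> 1"
    proof -
      have "M3 / c\<^sup>2 = M3 * ((1 / c) * (1 / c))" by (simp add: power2_eq_square)
      also have "\<dots> \<le> M3 * ((2 * L n / sqrt (real b)) * (2 * L n / sqrt (real b)))"
        using cinv c0 L1 sqb M3 by (intro mult_left_mono mult_mono) auto
      also have "\<dots> = 4 * M3 * (L n)\<^sup>2 / real b" using sqb(1) by (simp add: power2_eq_square)
      finally have "real b * (\<eta> + M3 / c\<^sup>2) \<le> real b * (\<eta> + 4 * M3 * (L n)\<^sup>2 / real b)" by (intro mult_left_mono) auto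
      also have "\<dots> = sqrt (real b) * (sqrt (real b) * \<eta> + 4 * M3 * (L n)\<^sup>2 / sqrt (real b))"
      proof -
        have "real b * (\<eta> + 4 * M3 * (L n)\<^sup>2 / real b) = real b * \<eta> + 4 * M3 * (L n)\<^sup>2" using b1 by (simp add: field_simps)
        moreover have "sqrt (real b) * (sqrt (real b) * \<eta> + 4 * M3 * (L n)\<^sup>2 / sqrt (real b)) = (sqrt (real b) * sqrt (real b)) * \<eta> + 4 * M3 * (L n)\<^sup>2"
          using sqb(2) by (simp add: field_simps del: real_sqrt_mult_self)
        ultimately show ?thesis using sqb(1) by simp
      qed
      also have "\<dots> \<le> sqrt (real b) * (1 / real n + 4 * M3 * (L n)\<^sup>2 / s n)"
      proof (intro mult_left_mono add_mono)
        have "sqrt (real b) * \<eta> \<le> real n * \<eta>" using sqbn \<eta>0' by (intro mult_right_mono) auto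
        then show "sqrt (real b) * \<eta> \<le> 1 / real n" using \<eta>n[of 1] by (simp add: mult.commute)
        show "4 * M3 * (L n)\<^sup>2 / sqrt (real b) \<le> 4 * M3 * (L n)\<^sup>2 / s n"
          using sb M3 b1 by (intro divide_left_mono mult_pos_pos) auto
      qed auto
      finally have "T * (real b * (\<eta> + M3 / c\<^sup>2)) \<le> T * (sqrt (real b) * (1 / real n + 4 * M3 * (L n)\<^sup>2 / s n))"
        using T0 by (rule mult_left_mono)
      also have "\<dots> = (T * sqrt (real b)) * (1 / real n + 4 * M3 * (L n)\<^sup>2 / s n)" by simp
      also have "\<dots> \<le> (4 * k / (\<epsilon> * lam2) * sqrt (L n)) * (1 / real n + 4 * M3 * (L n)\<^sup>2 / s n)"
        using Tb sb M3 by (intro mult_right_mono) auto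
      also have "\<dots> = (4 * k / (\<epsilon> * lam2)) * (sqrt (L n) / real n + 4 * M3 * (sqrt (L n) * (L n)\<^sup>2 / s n))"
        by (simp add: algebra_simps)
      finally show ?thesis using e2 by linarith
    qed
    then have T2: "2 * a * z / (\<epsilon> * lam2) * (real b * (\<eta> + M3 / c\<^sup>2)) \<le> 1" by (simp add: T_def)
    \<comment> \<open>with this level, b times the covariance bound is of order 1/n\<close>
    define H where "H = (real n)\<^sup>2"
    have H1: "H \<ge> 1" unfolding H_def using n0 by (intro one_le_power) auto
    have G: "(2 / real p + 2 / real b) * (real g * real g * (1 + M3)) \<le> Gn n"
    proof -
      have "2 / real b \<le> 2 / (\<kappa> * real n powr \<kappa>)" using b\<kappa> kn b1 by (intro divide_left_mono) auto
      then show ?thesis unfolding Gn_def g2_def[symmetric] using g20 by (intro mult_right_mono) auto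
    qed
    have \<tau>: "2 * real b * (5 * M3 / H + 7 * H\<^sup>2 * \<eta>) \<le> \<tau>n n"
    proof -
      have "2 * real b * (5 * M3 / H + 7 * H\<^sup>2 * \<eta>) \<le> 2 * real n * (5 * M3 / H + 7 * H\<^sup>2 * \<eta>)"
        using bn H1 M3 \<eta>0' by (intro mult_right_mono) auto
      also have "\<dots> = 10 * M3 * (1 / real n) + 14 * (\<eta> * real n ^ 5)"
        using n0 by (simp add: H_def field_simps eval_nat_numeral)
      also have "\<dots> \<le> 10 * M3 * (1 / real n) + 14 * (1 / real n)" using \<eta>n[of 5] by simp
      finally show ?thesis by (simp add: \<tau>n_def algebra_simps)
    qed
    have \<kappa>c: "4 * c * \<eta> + 2 * M3 / c \<le> \<kappa>n n"
    proof -
      have "c * \<eta> \<le> real n * \<eta>" using cn \<eta>0' by (rule mult_right_mono)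
      then have 1: "c * \<eta> \<le> 1 / real n" using \<eta>n[of 1] by (simp add: mult.commute)
      have "1 / c \<le> 2 * (L n / s n)"
      proof -
        have "2 * L n / sqrt (real b) \<le> 2 * L n / s n" using sb L1 b1 by (intro divide_left_mono mult_pos_pos) auto
        then show ?thesis using cinv by simp
      qed
      then have "2 * M3 * (1 / c) \<le> 2 * M3 * (2 * (L n / s n))" using M3 by (intro mult_left_mono) auto
      then show ?thesis using 1 by (simp add: \<kappa>n_def)
    qed
    have e1e: "0 \<le> 1 + 1 / \<epsilon>" "0 \<le> 1 + \<epsilon>" using \<epsilon> by auto
    have vB: "exp \<beta> * ((1 + \<epsilon>) * ((1 + \<epsilon>) * lam1 + (1 + 1 / \<epsilon>) * ((2 / real p + 2 / real b) * (real g * real g * (1 + M3)) + 2 * real b * (5 * M3 / H + 7 * H\<^sup>2 * \<eta>)) + 2 * real b * (5 * M3 / H + 7 * H\<^sup>2 * \<eta>))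
        + (1 + 1 / \<epsilon>) * (2 * real p * (4 * c * \<eta> + 2 * M3 / c))) \<le> (1 - \<epsilon>)\<^sup>2 * lam2"
      unfolding \<beta>(2)
      by (rule order_trans[OF _ less_imp_le[OF e3]])
         (intro mult_left_mono add_mono order_refl G \<tau> \<kappa>c e1e; simp)
    have vG: "exp \<beta> * (2 * ((2 / real p + 2 / real b) * (real g * real g * (1 + M3))) + 4 * real p * (4 * c * \<eta> + 2 * M3 / c)) \<le> (\<epsilon> / 2)\<^sup>2 * lam2"
      unfolding \<beta>(2)
      by (rule order_trans[OF _ less_imp_le[OF e4]])
         (intro mult_left_mono add_mono order_refl G \<kappa>c e1e; simp)
    have z2: "z\<^sup>2 / (2 * lam2) = E0 * L n"
      using L1 by (simp add: z_def E0_def power_mult_distrib)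
    have ez: "exp (z\<^sup>2 / (2 * lam2)) = real n powr E0" "exp (- (z\<^sup>2 / (2 * lam2))) = real n powr (- E0)"
      unfolding z2 L_def using n0 by (auto simp: powr_def mult.commute)
    have tail: "prob {x\<in>space M. a * (\<Sum>j=1..b. clip c (w j x)) > z}
      \<le> 2 * (exp 1 * (exp (- (z\<^sup>2 / (2 * lam2))) + (real b + 1) * \<eta> * exp \<beta> * exp (z\<^sup>2 / (2 * lam2))))
        + 2 * a * real b * \<eta> / (\<epsilon> * z)"
      unfolding \<eta>_def
      by (rule clipped_sum_tail[where p = p and H = H and ?lam1.0 = lam1, OF g p(3) b1 a c0 H1 \<epsilon> lam2 z(1) D])
         (use T1 T2 vB vG in \<open>simp_all only: \<eta>_def\<close>)
    have P6: "real n powr (- 6) = 1 / real n ^ 6" using n0 by (simp add: powr_minus powr_numeral divide_simps)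
    have nE: "real n powr (- 2 * E0) * real n powr E0 = real n powr (- E0)" by (simp flip: powr_add)
    have E2: "real n powr (- 2 * E0) \<le> real n powr (- E0)" using E0 n0 by (intro powr_mono) auto
    have n6: "(real b + 1) / real n ^ 6 \<le> 2"
    proof -
      have "(real b + 1) \<le> 2 * real n" using bn n0 by linarith
      also have "\<dots> \<le> 2 * real n ^ 6" using power_increasing[of 1 6 "real n"] n0 by simp
      finally show ?thesis using n0 by (simp add: divide_simps)
    qed
    have t1: "(real b + 1) * \<eta> * exp \<beta> * exp (z\<^sup>2 / (2 * lam2)) \<le> 4 * real n powr (- E0)"
    proof -
      have "(real b + 1) * \<eta> * exp \<beta> * exp (z\<^sup>2 / (2 * lam2)) = ((real b + 1) / real n ^ 6) * (1 + \<epsilon>) * (real n powr (- 2 * E0) * real n powr E0)"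
        unfolding \<eta>6 ez \<beta>(2) P6 by simp
      also have "\<dots> \<le> 2 * 2 * real n powr (- E0)" unfolding nE using n6 \<epsilon> by (intro mult_right_mono mult_mono) auto
      finally show ?thesis by simp
    qed
    have t2: "2 * a * real b * \<eta> / (\<epsilon> * z) \<le> 4 / (\<epsilon> * k) * real n powr (- E0)"
    proof -
      have h1: "a * real b \<le> 2 * real n"
      proof -
        have "a * real b = (a * sqrt (real b)) * sqrt (real b)" using sqb(1) by (simp add: mult.assoc)
        also have "\<dots> \<le> 2 * real n" using ab sqbn a by (intro mult_mono) auto
        finally show ?thesis .
      qed
      have h2: "\<eta> \<le> 1 / real n ^ 6 * real n powr (- E0)" unfolding \<eta>6 P6 using E2 by (intro mult_left_mono) auto
      have "a * real b * \<eta> \<le> (2 * real n) * (1 / real n ^ 6 * real n powr (- E0))"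
        by (rule mult_mono[OF h1 h2]) (use \<eta>0' n0 in auto)
      also have "\<dots> = 2 / real n ^ 5 * real n powr (- E0)" using n0 by (simp add: eval_nat_numeral)
      also have "\<dots> \<le> 2 * real n powr (- E0)"
      proof (rule mult_right_mono)
        have "1 \<le> real n ^ 5" using n0 by (intro one_le_power) auto
        then show "2 / real n ^ 5 \<le> 2" by (simp add: divide_simps)
      qed simp
      finally have h3: "2 * (a * real b * \<eta>) \<le> 2 * (2 * real n powr (- E0))" by (rule mult_left_mono) simp
      have "2 * (a * real b * \<eta>) / (\<epsilon> * z) \<le> 2 * (2 * real n powr (- E0)) / (\<epsilon> * k)"
        by (rule frac_le[OF _ h3]) (use \<epsilon> z k in auto)
      then show ?thesis by (simp add: mult.assoc)
    qed
    have "prob {x\<in>space M. a * (\<Sum>j=1..b. clip c (w j x)) > z} \<le> 2 * (exp 1 * (real n powr (- E0) + 4 * real n powr (- E0))) + 4 / (\<epsilon> * k) * real n powr (- E0)"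
    proof -
      have "exp 1 * (exp (- (z\<^sup>2 / (2 * lam2))) + (real b + 1) * \<eta> * exp \<beta> * exp (z\<^sup>2 / (2 * lam2))) \<le> exp 1 * (real n powr (- E0) + 4 * real n powr (- E0))"
        using t1 ez(2) by (intro mult_left_mono) auto
      then show ?thesis using tail t2 by linarith
    qed
    also have "\<dots> = C * real n powr (- E0)" by (simp add: C_def algebra_simps)
    finally show "prob {x\<in>space M. a * (\<Sum>j=1..b. clip c (w j x)) > k * sqrt (ln (real n))} \<le> C * real n powr - (k\<^sup>2 / (2 * lam2))"
      by (simp add: z_def L_def E0_def)
  qed
  show ?thesis by (rule that[OF C main])
qed

section \<open>Moments of the excess over a level\<close>

lemma power_sum_le:
  fixes x :: "'i \<Rightarrow> real"
  assumes "finite A" "\<And>i. i \<in> A \<Longrightarrow> 0 \<le> x i" "u \<ge> 1"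
  shows "(\<Sum>i\<in>A. x i) ^ u \<le> real (card A) ^ u * (\<Sum>i\<in>A. x i ^ u)"
proof (cases "A = {}")
  case False
  define m where "m = Max (x ` A)"
  have m: "x i \<le> m" if "i \<in> A" for i using that assms(1) by (simp add: m_def)
  have "m \<in> x ` A" unfolding m_def using assms(1) False by (intro Max_in) auto
  then obtain j where j: "j \<in> A" "m = x j" by auto
  have "(\<Sum>i\<in>A. x i) \<le> real (card A) * m" using sum_bounded_above[of A x m] m by simp
  then have "(\<Sum>i\<in>A. x i) ^ u \<le> (real (card A) * m) ^ u" using assms(2) by (intro power_mono sum_nonneg) auto
  also have "\<dots> = real (card A) ^ u * x j ^ u" using j by (simp add: power_mult_distrib)
  also have "\<dots> \<le> real (card A) ^ u * (\<Sum>i\<in>A. x i ^ u)"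
    using assms j(1) member_le_sum[of j A "\<lambda>i. x i ^ u"] by (intro mult_left_mono) auto
  finally show ?thesis .
qed (use assms in \<open>simp add: power_0_left\<close>)

lemma sum_inverse_squares_le: "(\<Sum>m=1..N. 1 / (real m)\<^sup>2) \<le> 2"
proof -
  have "(\<Sum>m=1..Suc N. 1 / (real m)\<^sup>2) \<le> 2 - 1 / real (Suc N)" for N
  proof (induction N)
    case (Suc N)
    have "1 / (real (Suc (Suc N)))\<^sup>2 \<le> 1 / (real (Suc N) * real (Suc (Suc N)))"
      by (intro divide_left_mono) (auto simp: power2_eq_square)
    also have "\<dots> = 1 / real (Suc N) - 1 / real (Suc (Suc N))" by (simp add: field_simps)
    finally show ?case using Suc by simp
  qed simp
  from this[of N] have *: "(\<Sum>m=1..Suc N. 1 / (real m)\<^sup>2) \<le> 2 - 1 / real (Suc N)" .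
  have "0 \<le> 1 / real (Suc N)" by simp
  have "(\<Sum>m=1..N. 1 / (real m)\<^sup>2) \<le> (\<Sum>m=1..Suc N. 1 / (real m)\<^sup>2)" by simp
  then show ?thesis using * \<open>0 \<le> 1 / real (Suc N)\<close> by linarith
qed

text \<open>
  With y_i = i^2 x_i, the sum of the x_i is at most 2 max_i y_i because the inverse squares add up
  to at most 2. Unlike the bound by the number of terms, this one survives infinitely many levels.
\<close>

lemma weighted_power_sum_le:
  fixes x :: "nat \<Rightarrow> real"
  assumes "finite A" "0 \<notin> A" "\<And>i. i \<in> A \<Longrightarrow> 0 \<le> x i" "u \<ge> 1"
  shows "(\<Sum>i\<in>A. x i) ^ u \<le> 2 ^ u * (\<Sum>i\<in>A. ((real i)\<^sup>2 * x i) ^ u)"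
proof (cases "A = {}")
  case False
  define y where "y = (\<lambda>i. (real i)\<^sup>2 * x i)"
  define m where "m = Max (y ` A)"
  have m: "y i \<le> m" if "i \<in> A" for i using that assms(1) by (simp add: m_def)
  have "m \<in> y ` A" unfolding m_def using assms(1) False by (intro Max_in) auto
  then obtain j where j: "j \<in> A" "m = y j" by auto
  have y0: "0 \<le> y i" if "i \<in> A" for i using assms(3) that by (auto simp: y_def)
  have m0: "0 \<le> m" using j y0 by auto
  have "(\<Sum>i\<in>A. x i) = (\<Sum>i\<in>A. y i * (1 / (real i)\<^sup>2))"
    using assms(2) by (intro sum.cong) (auto simp: y_def)
  also have "\<dots> \<le> (\<Sum>i\<in>A. m * (1 / (real i)\<^sup>2))" using m by (intro sum_mono mult_right_mono) auto
  also have "\<dots> = m * (\<Sum>i\<in>A. 1 / (real i)\<^sup>2)" by (simp add: sum_distrib_left)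
  also have "\<dots> \<le> m * 2"
  proof (rule mult_left_mono[OF _ m0])
    have "A \<subseteq> {1..Max A}"
    proof
      fix i assume "i \<in> A"
      then have "i \<noteq> 0" using assms(2) by (intro notI) simp
      moreover have "i \<le> Max A" using \<open>i \<in> A\<close> assms(1) by simp
      ultimately show "i \<in> {1..Max A}" by simp
    qed
    then have "(\<Sum>i\<in>A. 1 / (real i)\<^sup>2) \<le> (\<Sum>i=1..Max A. 1 / (real i)\<^sup>2)" by (intro sum_mono2) auto
    then show "(\<Sum>i\<in>A. 1 / (real i)\<^sup>2) \<le> 2" using sum_inverse_squares_le[of "Max A"] by linarith
  qed
  finally have "(\<Sum>i\<in>A. x i) ^ u \<le> (m * 2) ^ u" using assms(3) by (intro power_mono sum_nonneg) auto
  also have "\<dots> = 2 ^ u * y j ^ u" using j by (simp add: power_mult_distrib)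
  also have "\<dots> \<le> 2 ^ u * (\<Sum>i\<in>A. y i ^ u)"
    using assms(1) y0 j(1) member_le_sum[of j A "\<lambda>i. y i ^ u"] by (intro mult_left_mono) auto
  finally show ?thesis by (simp add: y_def)
qed (use assms in \<open>simp add: power_0_left\<close>)

text \<open>
  The indices fall into g residue classes, in each of which consecutive members are g apart.
\<close>

lemma separated_count_moment:
  fixes V :: "nat \<Rightarrow> 'w \<Rightarrow> 'a::euclidean_space"
  assumes M: "prob_space M" and app: "block_approx M b W V g \<eta>" and g: "g \<ge> 1" and \<eta>: "\<eta> \<ge> 0"
    and tail: "\<And>k. k \<in> {1..b} \<Longrightarrow> measure M {x\<in>space M. norm (V k x) > \<tau>} \<le> \<pi>" and \<pi>: "\<pi> \<ge> 0"
    and u: "u \<ge> 1"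
    and small: "2 * 2 ^ u * (real b * \<pi> + real b * (\<eta> * (1 + real b ^ u))) \<le> 1"
  shows "(\<integral>x. (\<Sum>k=1..b. indicator {x. norm (V k x) > \<tau>} x) ^ u \<partial>M)
    \<le> real g ^ u * (real g * (2 * 2 ^ u * (real b * \<pi> + real b * (\<eta> * (1 + real b ^ u)))))"
proof -
  interpret prob_space M by fact
  define h :: "'a \<Rightarrow> real" where "h = (\<lambda>y. if norm y > \<tau> then 1 else 0)"
  have hm: "h \<in> borel_measurable borel" unfolding h_def by measurable
  define I where "I = (\<lambda>r j. {k\<in>{1..b}. k = 1 + r + j * g})"
  define e where "e = (\<lambda>r j x. \<Sum>k\<in>I r j. h (V k x))"
  define Q where "Q = 2 * 2 ^ u * (real b * \<pi> + real b * (\<eta> * (1 + real b ^ u)))"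
  have Vm[measurable]: "V k \<in> borel_measurable M" if "k \<in> {1..b}" for k
    by (rule block_approxE[OF app]) (use that in simp)
  have hVm[measurable]: "(\<lambda>x. h (V k x)) \<in> borel_measurable M" if "k \<in> {1..b}" for k
    using measurable_compose[OF Vm[OF that] hm] .
  have wi: "weak_indep_seq M (e r) b \<eta>" for r
    unfolding e_def
  proof (rule weak_indep_seq_blocks[OF app, where f = "\<lambda>j. int (1 + r + j * g)"])
    fix i j k :: nat assume "i < j" "k \<in> I r i"
    then have "k + g = 1 + r + Suc i * g" by (auto simp: I_def)
    moreover have "Suc i * g \<le> j * g" using \<open>i < j\<close> by (intro mult_right_mono) auto
    ultimately show "int k + int g \<le> int (1 + r + j * g)" by linarith
  qed (auto simp: I_def hm)
  have I_single: "I r j = {1 + r + j * g} \<or> I r j = {}" for r j by (auto simp: I_def)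
  have e01: "e r j x = 0 \<or> e r j x = 1" for r j x
  proof -
    have "e r j x = h (V (1 + r + j * g) x) \<or> e r j x = 0"
      unfolding e_def by (rule disjE[OF I_single[of r j]]) (simp_all only: sum.empty sum.insert finite.emptyI empty_iff not_False_eq_True add_0_right simp_thms)
    then show ?thesis by (cases "norm (V (1 + r + j * g) x) > \<tau>") (simp_all only: h_def if_True if_False, blast+)
  qed
  have ep: "(\<integral>x. e r j x \<partial>M) \<le> \<pi>" for r j
  proof (cases "I r j = {}")
    case False
    define k where "k = 1 + r + j * g"
    have k: "I r j = {k}" using False I_single[of r j] by (simp add: k_def)
    then have "k \<in> I r j" by simp
    then have kb: "k \<in> {1..b}" unfolding I_def by simp
    have "(\<integral>x. e r j x \<partial>M) = (\<integral>x. indicator {x\<in>space M. norm (V k x) > \<tau>} x \<partial>M)"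
      by (intro Bochner_Integration.integral_cong) (auto simp: e_def k h_def indicator_def)
    also have "\<dots> = prob {x\<in>space M. norm (V k x) > \<tau>}"
      by (simp add: Int_absorb2 Collect_restrict)
    finally show ?thesis using tail[OF kb] by simp
  qed (use \<pi> in \<open>simp add: e_def\<close>)
  have cls: "(\<integral>x. (\<Sum>j<b. e r j x) ^ u \<partial>M) \<le> Q" for r
    unfolding Q_def by (rule weak_indep_count_moment[OF M wi \<eta> e01 ep small u])
  have em[measurable]: "(\<lambda>x. \<Sum>j<b. e r j x) \<in> borel_measurable M" for r
    unfolding e_def by (intro borel_measurable_sum hVm) (auto simp: I_def)
  have e_range: "0 \<le> e r j x" "e r j x \<le> 1" for r j x using e01[of r j x] by auto
  have s_range: "0 \<le> (\<Sum>j<b. e r j x)" "(\<Sum>j<b. e r j x) \<le> real b" for r x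
    using sum_mono[of "{..<b}" "\<lambda>j. e r j x" "\<lambda>_. 1"] e_range by (simp_all add: sum_nonneg)
  have ei: "integrable M (\<lambda>x. (\<Sum>j<b. e r j x) ^ u)" for r
  proof (rule integrable_unit_bounded[OF M])
    show "\<bar>(\<Sum>j<b. e r j x) ^ u\<bar> \<le> real b ^ u" for x using s_range power_mono[OF s_range(2,1)] by simp
  qed measurable
  have decomp: "(\<Sum>k=1..b. h (V k x)) = (\<Sum>r<g. \<Sum>j<b. e r j x)" for x
  proof -
    have "(\<Sum>k=1..b. h (V k x)) = (\<Sum>r\<in>{..<g}. \<Sum>k\<in>{k\<in>{1..b}. (k - 1) mod g = r}. h (V k x))"
      by (rule sum.group[symmetric]) (use g in auto)
    also have "\<dots> = (\<Sum>r<g. \<Sum>j<b. e r j x)"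
    proof (rule sum.cong[OF refl])
      fix r assume r: "r \<in> {..<g}"
      have "(\<Sum>k\<in>{k\<in>{1..b}. (k - 1) mod g = r}. h (V k x))
         = (\<Sum>j\<in>{..<b}. \<Sum>k\<in>{k\<in>{k\<in>{1..b}. (k - 1) mod g = r}. (k - 1) div g = j}. h (V k x))"
      proof (rule sum.group[symmetric])
        show "(\<lambda>k. (k - 1) div g) ` {k\<in>{1..b}. (k - 1) mod g = r} \<subseteq> {..<b}"
        proof
          fix j assume "j \<in> (\<lambda>k. (k - 1) div g) ` {k\<in>{1..b}. (k - 1) mod g = r}"
          then obtain k where "1 \<le> k" "k \<le> b" "j = (k - 1) div g" by auto
          then have "j \<le> k - 1" by (simp add: div_le_dividend)
          then show "j \<in> {..<b}" using \<open>1 \<le> k\<close> \<open>k \<le> b\<close> by simp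
        qed
      qed auto
      also have "\<dots> = (\<Sum>j<b. e r j x)"
      proof (rule sum.cong[OF refl])
        fix j
        have "{k\<in>{k\<in>{1..b}. (k - 1) mod g = r}. (k - 1) div g = j} = I r j"
        proof (rule set_eqI)
          fix k
          have "k \<ge> 1 \<Longrightarrow> (k - 1) mod g = r \<and> (k - 1) div g = j \<longleftrightarrow> k - 1 = r + j * g"
          proof (intro iffI conjI; (elim conjE)?)
            assume "(k - 1) mod g = r" "(k - 1) div g = j"
            then show "k - 1 = r + j * g" using mod_div_mult_eq[of "k - 1" g] by simp
          next
            assume *: "k - 1 = r + j * g"
            show "(k - 1) mod g = r" "(k - 1) div g = j" unfolding * using r g by simp_all
          qed
          then show "k \<in> {k\<in>{k\<in>{1..b}. (k - 1) mod g = r}. (k - 1) div g = j} \<longleftrightarrow> k \<in> I r j"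
            by (auto simp: I_def)
        qed
        then show "(\<Sum>k\<in>{k\<in>{k\<in>{1..b}. (k - 1) mod g = r}. (k - 1) div g = j}. h (V k x)) = e r j x" by (simp add: e_def)
      qed
      finally show "(\<Sum>k\<in>{k\<in>{1..b}. (k - 1) mod g = r}. h (V k x)) = (\<Sum>j<b. e r j x)" .
    qed
    finally show ?thesis .
  qed
  have "(\<integral>x. (\<Sum>k=1..b. indicator {x. norm (V k x) > \<tau>} x) ^ u \<partial>M) = (\<integral>x. (\<Sum>r<g. \<Sum>j<b. e r j x) ^ u \<partial>M)"
    unfolding decomp[symmetric] h_def indicator_def of_bool_def by simp
  also have "\<dots> \<le> (\<integral>x. real g ^ u * (\<Sum>r<g. (\<Sum>j<b. e r j x) ^ u) \<partial>M)"
  proof (rule integral_mono)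
    show "integrable M (\<lambda>x. real g ^ u * (\<Sum>r<g. (\<Sum>j<b. e r j x) ^ u))" using ei by auto
    show *: "(\<Sum>r<g. \<Sum>j<b. e r j x) ^ u \<le> real g ^ u * (\<Sum>r<g. (\<Sum>j<b. e r j x) ^ u)" for x
      using power_sum_le[of "{..<g}" "\<lambda>r. \<Sum>j<b. e r j x" u] s_range u by simp
    show "integrable M (\<lambda>x. (\<Sum>r<g. \<Sum>j<b. e r j x) ^ u)"
    proof (rule Bochner_Integration.integrable_bound[OF \<open>integrable M (\<lambda>x. real g ^ u * (\<Sum>r<g. (\<Sum>j<b. e r j x) ^ u))\<close>])
      show "(\<lambda>x. (\<Sum>r<g. \<Sum>j<b. e r j x) ^ u) \<in> borel_measurable M" by measurable
      show "AE x in M. norm ((\<Sum>r<g. \<Sum>j<b. e r j x) ^ u) \<le> norm (real g ^ u * (\<Sum>r<g. (\<Sum>j<b. e r j x) ^ u))"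
      proof (rule AE_I2)
        fix x
        have "0 \<le> (\<Sum>r<g. \<Sum>j<b. e r j x) ^ u" by (intro zero_le_power sum_nonneg[OF s_range(1)])
        then show "norm ((\<Sum>r<g. \<Sum>j<b. e r j x) ^ u) \<le> norm (real g ^ u * (\<Sum>r<g. (\<Sum>j<b. e r j x) ^ u))"
          using *[of x] by simp
      qed
    qed
  qed
  also have "\<dots> = real g ^ u * (\<Sum>r<g. \<integral>x. (\<Sum>j<b. e r j x) ^ u \<partial>M)" using ei by simp
  also have "\<dots> \<le> real g ^ u * (\<Sum>r<g. Q)" using cls by (intro mult_left_mono sum_mono) auto
  finally show ?thesis by (simp add: Q_def)
qed

text \<open>
  If 2^m < y \<le> 2^(m+1) with m \<ge> m0, then the single term for this m on the right is
  already as large as y.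
\<close>

lemma dyadic_layer_bound:
  fixes y :: real
  assumes "y \<le> 2 ^ m1"
  shows "(if y > 2 ^ m0 then y else 0) \<le> (\<Sum>m\<in>{m0..m1}. 2 ^ (m + 1) * (if y > 2 ^ m then 1 else 0))"
proof (cases "y > 2 ^ m0")
  case True
  define n where "n = (LEAST m. y \<le> 2 ^ m)"
  have n1: "y \<le> 2 ^ n" unfolding n_def by (rule LeastI[where P = "\<lambda>m. y \<le> 2 ^ m", OF assms])
  have nm: "n \<le> m1" unfolding n_def by (rule Least_le) (rule assms)
  have "m0 < n"
  proof (rule ccontr)
    assume "\<not> m0 < n"
    then have "(2::real) ^ n \<le> 2 ^ m0" by (intro power_increasing) auto
    then show False using n1 True by linarith
  qed
  then obtain m where m: "n = Suc m" by (cases n) auto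
  have "\<not> y \<le> 2 ^ m" using not_less_Least[of m "\<lambda>m. y \<le> 2 ^ m"] m by (simp add: n_def)
  then have "y \<le> 2 ^ (m + 1) * (if y > 2 ^ m then 1 else 0)" using n1 m by simp
  also have "\<dots> \<le> (\<Sum>m\<in>{m0..m1}. 2 ^ (m + 1) * (if y > 2 ^ m then 1 else 0))"
    using \<open>m0 < n\<close> nm m by (intro member_le_sum) auto
  finally show ?thesis using True by simp
qed (auto intro!: sum_nonneg)

text \<open>
  An exceedance of 2^m by W_k is an exceedance of 2^m - 1 by V_k or a distance of at least 1
  between the two. The former is counted by classes; the latter is rare enough for the trivial
  bound by b^u.
\<close>

lemma level_count_moment:
  fixes W :: "nat \<Rightarrow> 'w \<Rightarrow> 'a::euclidean_space"
  assumes M: "prob_space M" and W_measurable: "\<And>k. k \<in> {1..b} \<Longrightarrow> W k \<in> borel_measurable M"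
    and app: "block_approx M b W V g \<eta>" and g: "g \<ge> 1" and \<eta>: "\<eta> \<ge> 0" and u: "u \<ge> 1" and b: "b \<ge> 1"
    and tail: "\<And>k. k \<in> {1..b} \<Longrightarrow> measure M {x\<in>space M. norm (W k x) > 2 ^ (m - 1)} \<le> \<rho> * \<pi>" and m: "m \<ge> 2"
    and \<eta>\<pi>: "\<eta> * (2 + real b ^ u) \<le> \<pi>" and \<rho>: "\<rho> \<ge> 0"
    and small: "2 * 2 ^ u * (real b * ((\<rho> + 1) * \<pi>)) \<le> 1"
  shows "(\<integral>\<^sup>+x. ennreal ((\<Sum>k=1..b. if norm (W k x) > 2 ^ m then 1 else 0) ^ u) \<partial>M)
    \<le> ennreal (2 ^ u * (real g ^ (u + 1) * (2 * 2 ^ u * (\<rho> + 1)) + 1) * (real b * \<pi>))"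
proof -
  interpret prob_space M by fact
  define \<tau> :: real where "\<tau> = 2 ^ m - 1"
  have Vm[measurable]: "V k \<in> borel_measurable M" if "k \<in> {1..b}" for k
    by (rule block_approxE[OF app]) (use that in simp)
  note W_measurable[measurable]
  define d where "d = (\<lambda>k x. if norm (W k x - V k x) \<ge> 1 then 1 else 0 :: real)"
  define NV where "NV = (\<lambda>x. \<Sum>k=1..b. indicator {x. norm (V k x) > \<tau>} x :: real)"
  define ND where "ND = (\<lambda>x. \<Sum>k=1..b. d k x)"
  have dm[measurable]: "d k \<in> borel_measurable M" if "k \<in> {1..b}" for k
    unfolding d_def using Vm[OF that] W_measurable[OF that] by measurable
  have di: "integrable M (d k)" if "k \<in> {1..b}" for k
    by (rule integrable_unit_bounded[OF M dm[OF that], of 1]) (simp add: d_def)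
  have Pd: "(\<integral>x. d k x \<partial>M) \<le> \<eta>" if k: "k \<in> {1..b}" for k
  proof -
    have "ennreal (\<integral>x. d k x \<partial>M) = (\<integral>\<^sup>+x. ennreal (d k x) \<partial>M)"
      by (rule nn_integral_eq_integral[symmetric, OF di[OF k]]) (simp add: d_def)
    also have "\<dots> \<le> (\<integral>\<^sup>+x. ennreal (norm (W k x - V k x)) \<partial>M)"
      by (intro nn_integral_mono ennreal_leI) (simp add: d_def)
    also have "\<dots> \<le> ennreal \<eta>" by (rule block_approxE[OF app]) (use k in simp)
    finally show ?thesis using \<eta> by (simp add: ennreal_le_iff)
  qed
  have \<pi>0: "0 \<le> \<pi>" using \<eta>\<pi> \<eta> by (meson add_nonneg_nonneg mult_nonneg_nonneg of_nat_0_le_iff order_trans zero_le_numeral zero_le_power)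
  have pw: "(2::real) ^ m = 2 * 2 ^ (m - 1)" "(2::real) ^ (m - 1) \<ge> 2 ^ 1"
    using m power_increasing[of 1 "m - 1" "2::real"] by (auto simp flip: power_Suc)
  have tailV: "prob {x\<in>space M. norm (V k x) > \<tau>} \<le> \<rho> * \<pi> + \<eta>" if k: "k \<in> {1..b}" for k
  proof -
    have [measurable]: "W k \<in> borel_measurable M" "V k \<in> borel_measurable M" using k by auto
    have E: "{x\<in>space M. norm (W k x) > 2 ^ (m - 1)} \<in> sets M" "{x\<in>space M. d k x = 1} \<in> sets M"
      using borel_measurable_eq[OF dm[OF k], of "\<lambda>_. 1"] by simp_all
    have "prob {x\<in>space M. norm (V k x) > \<tau>} \<le> prob ({x\<in>space M. norm (W k x) > 2 ^ (m - 1)} \<union> {x\<in>space M. d k x = 1})"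
    proof (rule finite_measure_mono)
      show "{x\<in>space M. norm (V k x) > \<tau>} \<subseteq> {x\<in>space M. norm (W k x) > 2 ^ (m - 1)} \<union> {x\<in>space M. d k x = 1}"
      proof
        fix x assume x: "x \<in> {x\<in>space M. norm (V k x) > \<tau>}"
        have "norm (V k x) \<le> norm (W k x) + norm (W k x - V k x)"
          using norm_triangle_ineq4[of "W k x" "W k x - V k x"] by simp
        then show "x \<in> {x\<in>space M. norm (W k x) > 2 ^ (m - 1)} \<union> {x\<in>space M. d k x = 1}"
          using x pw by (auto simp: \<tau>_def d_def)
      qed
    qed (use E in simp)
    also have "\<dots> \<le> prob {x\<in>space M. norm (W k x) > 2 ^ (m - 1)} + prob {x\<in>space M. d k x = 1}"
      by (rule measure_Un_le[OF E])
    also have "prob {x\<in>space M. d k x = 1} = (\<integral>x. indicator {x\<in>space M. d k x = 1} x \<partial>M)"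
      by (simp add: Int_absorb2 Collect_restrict)
    also have "\<dots> = (\<integral>x. d k x \<partial>M)"
      by (intro Bochner_Integration.integral_cong) (auto simp: d_def indicator_def)
    finally show ?thesis using tail[OF k] Pd[OF k] by linarith
  qed
  have le\<pi>: "real b * (\<rho> * \<pi> + \<eta>) + real b * (\<eta> * (1 + real b ^ u)) \<le> real b * ((\<rho> + 1) * \<pi>)"
  proof -
    have "real b * (\<rho> * \<pi> + \<eta>) + real b * (\<eta> * (1 + real b ^ u)) = real b * (\<rho> * \<pi> + \<eta> * (2 + real b ^ u))"
      by (simp add: algebra_simps)
    also have "\<dots> \<le> real b * (\<rho> * \<pi> + \<pi>)" using \<eta>\<pi> by (intro mult_left_mono) auto
    finally show ?thesis by (simp add: algebra_simps)
  qed
  have NVE: "(\<integral>x. NV x ^ u \<partial>M) \<le> real g ^ u * (real g * (2 * 2 ^ u * (real b * ((\<rho> + 1) * \<pi>))))"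
  proof -
    have "(\<integral>x. NV x ^ u \<partial>M) \<le> real g ^ u * (real g * (2 * 2 ^ u * (real b * (\<rho> * \<pi> + \<eta>) + real b * (\<eta> * (1 + real b ^ u)))))"
      unfolding NV_def
    proof (rule separated_count_moment[OF M app g \<eta> tailV _ u])
      show "2 * 2 ^ u * (real b * (\<rho> * \<pi> + \<eta>) + real b * (\<eta> * (1 + real b ^ u))) \<le> 1"
        by (rule order_trans[OF mult_left_mono[OF le\<pi>] small]) simp
    qed (use \<rho> \<pi>0 \<eta> in auto)
    also have "\<dots> \<le> real g ^ u * (real g * (2 * 2 ^ u * (real b * ((\<rho> + 1) * \<pi>))))"
      by (intro mult_left_mono le\<pi>) auto
    finally show ?thesis .
  qed
  have NV0: "0 \<le> NV x" "NV x \<le> real b" for x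
  proof -
    show "0 \<le> NV x" unfolding NV_def by (intro sum_nonneg) auto
    have "NV x \<le> (\<Sum>k=1..b. 1)" unfolding NV_def by (intro sum_mono) (auto simp: indicator_def)
    then show "NV x \<le> real b" by simp
  qed
  have NVm[measurable]: "NV \<in> borel_measurable M"
  proof -
    have "(\<lambda>x. indicator {x. norm (V k x) > \<tau>} x :: real) \<in> borel_measurable M" if "k \<in> {1..b}" for k
      unfolding indicator_def using Vm[OF that] by simp
    then show ?thesis unfolding NV_def by (intro borel_measurable_sum)
  qed
  have NVi: "integrable M (\<lambda>x. NV x ^ u)"
    by (rule integrable_unit_bounded[OF M, of _ "real b ^ u"]) (use NV0 power_mono[OF NV0(2,1)] in auto)
  have ND0: "0 \<le> ND x" "ND x \<le> real b" for x
  proof -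
    show "0 \<le> ND x" unfolding ND_def d_def by (intro sum_nonneg) auto
    have "ND x \<le> (\<Sum>k=1..b. 1)" unfolding ND_def by (intro sum_mono) (auto simp: d_def)
    then show "ND x \<le> real b" by simp
  qed
  have NDm[measurable]: "ND \<in> borel_measurable M" unfolding ND_def by (intro borel_measurable_sum dm)
  have NDi: "integrable M ND" unfolding ND_def by (intro Bochner_Integration.integrable_sum di)
  have NDp: "ND x ^ u \<le> real b ^ u * ND x" for x
  proof (cases "ND x < 1")
    case True
    have "ND x = 0"
    proof -
      have "d k x = 0" if "k \<in> {1..b}" for k
      proof (rule ccontr)
        assume "d k x \<noteq> 0"
        then have "1 \<le> d k x" by (auto simp: d_def split: if_splits)
        also have "d k x \<le> ND x" unfolding ND_def using that by (intro member_le_sum) (auto simp: d_def)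
        finally show False using True by simp
      qed
      then show ?thesis by (simp add: ND_def)
    qed
    then show ?thesis using u by (simp add: power_0_left)
  next
    case False
    have "ND x ^ u \<le> real b ^ u * 1" using power_mono[OF ND0(2,1)] by simp
    also have "\<dots> \<le> real b ^ u * ND x" using False by (intro mult_left_mono) auto
    finally show ?thesis .
  qed
  have NDE: "(\<integral>x. ND x \<partial>M) \<le> real b * \<eta>"
  proof -
    have "(\<integral>x. ND x \<partial>M) = (\<Sum>k=1..b. \<integral>x. d k x \<partial>M)" unfolding ND_def by (rule Bochner_Integration.integral_sum[OF di])
    also have "\<dots> \<le> (\<Sum>k=1..b. \<eta>)" by (intro sum_mono Pd)
    finally show ?thesis by simp
  qed
  have "(\<integral>\<^sup>+x. ennreal ((\<Sum>k=1..b. if norm (W k x) > 2 ^ m then 1 else 0) ^ u) \<partial>M)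
     \<le> (\<integral>\<^sup>+x. ennreal (2 ^ u * (NV x ^ u + real b ^ u * ND x)) \<partial>M)"
  proof (intro nn_integral_mono ennreal_leI)
    fix x
    have "(\<Sum>k=1..b. if norm (W k x) > 2 ^ m then 1 else 0 :: real) \<le> (\<Sum>k=1..b. indicator {x. norm (V k x) > \<tau>} x + d k x)"
    proof (rule sum_mono)
      fix k
      have "norm (W k x) \<le> norm (V k x) + norm (W k x - V k x)"
        using norm_triangle_ineq[of "V k x" "W k x - V k x"] by simp
      then show "(if norm (W k x) > 2 ^ m then 1 else 0 :: real) \<le> indicator {x. norm (V k x) > \<tau>} x + d k x"
        by (auto simp: d_def \<tau>_def indicator_def)
    qed
    also have "\<dots> = NV x + ND x" by (simp add: NV_def ND_def sum.distrib)
    finally have "(\<Sum>k=1..b. if norm (W k x) > 2 ^ m then 1 else 0 :: real) ^ u \<le> (NV x + ND x) ^ u"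
      by (intro power_mono sum_nonneg) auto
    also have "\<dots> \<le> 2 ^ u * (NV x ^ u + ND x ^ u)"
      using power_sum_le[of "{True, False}" "\<lambda>i. if i then NV x else ND x" u] u NV0 ND0 by simp
    also have "\<dots> \<le> 2 ^ u * (NV x ^ u + real b ^ u * ND x)" using NDp[of x] by (intro mult_left_mono) auto
    finally show "(\<Sum>k=1..b. if norm (W k x) > 2 ^ m then 1 else 0 :: real) ^ u \<le> 2 ^ u * (NV x ^ u + real b ^ u * ND x)" .
  qed
  also have "\<dots> = ennreal (\<integral>x. 2 ^ u * (NV x ^ u + real b ^ u * ND x) \<partial>M)"
    using NVi NDi NV0 ND0 by (intro nn_integral_eq_integral) auto
  also have "(\<integral>x. 2 ^ u * (NV x ^ u + real b ^ u * ND x) \<partial>M) = 2 ^ u * ((\<integral>x. NV x ^ u \<partial>M) + real b ^ u * (\<integral>x. ND x \<partial>M))"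
    using NVi NDi by simp
  also have "ennreal \<dots> \<le> ennreal (2 ^ u * (real g ^ u * (real g * (2 * 2 ^ u * (real b * ((\<rho> + 1) * \<pi>)))) + real b * \<pi>))"
  proof (intro ennreal_leI mult_left_mono add_mono NVE)
    have "real b ^ u * (\<integral>x. ND x \<partial>M) \<le> real b ^ u * (real b * \<eta>)" using NDE by (intro mult_left_mono) auto
    also have "\<dots> = real b * (\<eta> * real b ^ u)" by simp
    also have "\<dots> \<le> real b * \<pi>"
    proof (intro mult_left_mono)
      show "\<eta> * real b ^ u \<le> \<pi>" using \<eta>\<pi> \<eta> by (simp add: distrib_left)
    qed simp
    finally show "real b ^ u * (\<integral>x. ND x \<partial>M) \<le> real b * \<pi>" .
  qed simp
  also have "2 ^ u * (real g ^ u * (real g * (2 * 2 ^ u * (real b * ((\<rho> + 1) * \<pi>)))) + real b * \<pi>)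
     = 2 ^ u * (real g ^ (u + 1) * (2 * 2 ^ u * (\<rho> + 1)) + 1) * (real b * \<pi>)"
    by (simp add: algebra_simps)
  finally show ?thesis .
qed

text \<open>
  The order of the bound that the moment condition gives for P(|W_k| > 2^(m-1)).
\<close>

definition level_rate :: "nat \<Rightarrow> nat \<Rightarrow> real" where "level_rate s m = 1 / (2 ^ (m * s) * real m ^ (2 * s\<^sup>2))"

lemma level_rate_weight:
  assumes s: "s \<ge> 3" and u: "u \<le> s" and m: "m0 \<le> m" "m0 \<ge> 1"
  shows "real m ^ (3 * u + 1) * 2 ^ (m * u) * level_rate s m \<le> 1 / (2 ^ (m0 * (s - u)) * real m0 ^ 3) * (1 / (real m)\<^sup>2)"
proof -
  have m1: "real m \<ge> 1" using m by simp
  \<comment> \<open>3u+1 powers of m from counts and weights, three for m0^(-3) and two for summability\<close>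
  have e: "3 * u + 1 + 5 \<le> 2 * s\<^sup>2"
  proof -
    have "s * s \<ge> 3 * s" using s by (intro mult_right_mono) auto
    then show ?thesis using s u unfolding power2_eq_square by linarith
  qed
  have "real m ^ (3 * u + 1) * real m ^ 5 \<le> real m ^ (2 * s\<^sup>2)"
    unfolding power_add[symmetric] by (rule power_increasing[OF e m1])
  moreover have "real m ^ 5 = real m ^ 3 * (real m)\<^sup>2" by (simp flip: power_add)
  moreover have "real m0 ^ 3 * (real m)\<^sup>2 \<le> real m ^ 3 * (real m)\<^sup>2" using m by (intro mult_right_mono power_mono) auto
  ultimately have A: "real m ^ (3 * u + 1) * (real m0 ^ 3 * (real m)\<^sup>2) \<le> real m ^ (2 * s\<^sup>2)"
    by (smt (verit) mult_left_mono zero_le_power of_nat_0_le_iff)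
  have "(2::real) ^ (m * u) * 2 ^ (m0 * (s - u)) \<le> 2 ^ (m * u) * 2 ^ (m * (s - u))"
    using m by (intro mult_left_mono power_increasing) auto
  also have "\<dots> = 2 ^ (m * s)" using u by (simp flip: power_add add: add_mult_distrib2[symmetric])
  finally have B: "(2::real) ^ (m * u) * 2 ^ (m0 * (s - u)) \<le> 2 ^ (m * s)" .
  have "(real m ^ (3 * u + 1) * (real m0 ^ 3 * (real m)\<^sup>2)) * (2 ^ (m * u) * 2 ^ (m0 * (s - u))) \<le> real m ^ (2 * s\<^sup>2) * 2 ^ (m * s)"
    using A B by (intro mult_mono) auto
  then show ?thesis unfolding level_rate_def using m by (simp add: divide_simps) (simp add: mult_ac)
qed

text \<open>
  The layer bound writes the excess as a sum of 2^(m+1) times the number of exceedances of 2^m.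
  The gap at level m is Gm, so that the counts contribute m^(u+1) and the weights m^(2u); the
  power 2s^2 of m in \<open>level_rate\<close> outweighs both and leaves a summable series
  together with the factor m0^(-3).
\<close>

lemma excess_moment:
  fixes W :: "nat \<Rightarrow> 'w \<Rightarrow> 'a::euclidean_space"
  assumes M: "prob_space M" and W_measurable: "\<And>k. k \<in> {1..b} \<Longrightarrow> W k \<in> borel_measurable M"
    and b: "b \<ge> 1" and s: "s \<ge> 3" and u: "u \<ge> 1" "u \<le> s" and G: "G \<ge> 1" and \<rho>: "\<rho> \<ge> 0" and m0: "m0 \<ge> 2"
    and app: "\<And>m. m \<ge> m0 \<Longrightarrow> \<exists>V. block_approx M b W V (G * m) (\<eta> m)"
    and \<eta>: "\<And>m. m \<ge> m0 \<Longrightarrow> 0 \<le> \<eta> m" "\<And>m. m \<ge> m0 \<Longrightarrow> \<eta> m * (2 + real b ^ u) \<le> level_rate s m"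
    and tail: "\<And>k m. k \<in> {1..b} \<Longrightarrow> m \<ge> m0 \<Longrightarrow> measure M {x\<in>space M. norm (W k x) > 2 ^ (m - 1)} \<le> \<rho> * level_rate s m"
    and small: "\<And>m. m \<ge> m0 \<Longrightarrow> 2 * 2 ^ u * (real b * ((\<rho> + 1) * level_rate s m)) \<le> 1"
  shows "(\<integral>\<^sup>+x. ennreal ((\<Sum>k=1..b. if norm (W k x) > 2 ^ m0 then norm (W k x) else 0) ^ u) \<partial>M)
    \<le> ennreal (2 * 8 ^ u * (real G ^ (u + 1) * (2 * 2 ^ u * (\<rho> + 1)) + 1) * (real b / (2 ^ (m0 * (s - u)) * real m0 ^ 3)))"
proof -
  interpret prob_space M by fact
  define N where "N = (\<lambda>m x. \<Sum>k=1..b. if norm (W k x) > 2 ^ m then 1 else 0 :: real)"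
  define K1 where "K1 = 2 ^ u * (real G ^ (u + 1) * (2 * 2 ^ u * (\<rho> + 1)) + 1)"
  define C where "C = 1 / (2 ^ (m0 * (s - u)) * real m0 ^ 3)"
  have K10: "K1 \<ge> 0" and C0: "C \<ge> 0" using \<rho> by (auto simp: K1_def C_def)
  define f where "f = (\<lambda>m x. if m \<ge> m0 then ennreal (((real m)\<^sup>2 * (2 ^ (m + 1) * N m x)) ^ u) else 0)"
  have Nm[measurable]: "N m \<in> borel_measurable M" for m
  proof -
    have "(\<lambda>x. if norm (W k x) > 2 ^ m then 1 else 0 :: real) \<in> borel_measurable M" if "k \<in> {1..b}" for k
      using W_measurable[OF that] by measurable
    then show ?thesis unfolding N_def by (intro borel_measurable_sum)
  qed
  have N0: "0 \<le> N m x" for m x unfolding N_def by (intro sum_nonneg) auto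
  have fm: "f m \<in> borel_measurable M" for m unfolding f_def by simp
  have fI: "(\<integral>\<^sup>+x. f m x \<partial>M) \<le> ennreal (2 ^ u * K1 * real b * C * (if m \<ge> 1 then 1 / (real m)\<^sup>2 else 0))" for m
  proof (cases "m \<ge> m0")
    case True
    obtain V where V: "block_approx M b W V (G * m) (\<eta> m)" using app[OF True] by blast
    have m1: "m \<ge> 2" "real m \<ge> 1" using True m0 by auto
    have lev0: "level_rate s m \<ge> 0" by (simp add: level_rate_def)
    have "(\<integral>\<^sup>+x. ennreal (N m x ^ u) \<partial>M)
      \<le> ennreal (2 ^ u * (real (G * m) ^ (u + 1) * (2 * 2 ^ u * (\<rho> + 1)) + 1) * (real b * level_rate s m))"
      unfolding N_def
      by (rule level_count_moment[OF M W_measurable V _ _ u(1) b]) (use G m1 \<eta> True tail \<rho> small in auto)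
    also have "\<dots> \<le> ennreal (K1 * real m ^ (u + 1) * (real b * level_rate s m))"
    proof (intro ennreal_leI mult_right_mono)
      have "1 \<le> real m ^ (u + 1)" using m1 by (intro one_le_power)
      then have "2 ^ u * (real (G * m) ^ (u + 1) * (2 * 2 ^ u * (\<rho> + 1)) + 1) \<le> 2 ^ u * (real (G * m) ^ (u + 1) * (2 * 2 ^ u * (\<rho> + 1)) + real m ^ (u + 1))"
        by (intro mult_left_mono) auto
      also have "\<dots> = K1 * real m ^ (u + 1)" by (simp add: K1_def power_mult_distrib algebra_simps)
      finally show "2 ^ u * (real (G * m) ^ (u + 1) * (2 * 2 ^ u * (\<rho> + 1)) + 1) \<le> K1 * real m ^ (u + 1)" .
    qed (use lev0 in auto)
    finally have NI: "(\<integral>\<^sup>+x. ennreal (N m x ^ u) \<partial>M) \<le> ennreal (K1 * real m ^ (u + 1) * (real b * level_rate s m))" .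
    have "(\<integral>\<^sup>+x. f m x \<partial>M) = (\<integral>\<^sup>+x. ennreal (((real m)\<^sup>2 * 2 ^ (m + 1)) ^ u) * ennreal (N m x ^ u) \<partial>M)"
      using True N0 by (intro nn_integral_cong) (simp add: f_def power_mult_distrib ennreal_mult[symmetric] mult_ac)
    also have "\<dots> = ennreal (((real m)\<^sup>2 * 2 ^ (m + 1)) ^ u) * (\<integral>\<^sup>+x. ennreal (N m x ^ u) \<partial>M)"
      by (rule nn_integral_cmult) measurable
    also have "\<dots> \<le> ennreal (((real m)\<^sup>2 * 2 ^ (m + 1)) ^ u) * ennreal (K1 * real m ^ (u + 1) * (real b * level_rate s m))"
      by (intro mult_left_mono NI) auto
    also have "\<dots> = ennreal (2 ^ u * K1 * real b * (real m ^ (3 * u + 1) * 2 ^ (m * u) * level_rate s m))"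
    proof -
      have "((real m)\<^sup>2 * 2 ^ (m + 1)) ^ u * (K1 * real m ^ (u + 1) * (real b * level_rate s m))
        = 2 ^ u * K1 * real b * (real m ^ (3 * u + 1) * 2 ^ (m * u) * level_rate s m)"
      proof -
        have e1: "((real m)\<^sup>2) ^ u * real m ^ (u + 1) = real m ^ (3 * u + 1)"
          by (simp flip: power_mult power_add power_Suc)
        have e2: "((2::real) ^ (m + 1)) ^ u = 2 ^ u * 2 ^ (m * u)"
          by (simp add: power_mult_distrib power_mult)
        have e3: "((real m)\<^sup>2 * 2 ^ (m + 1)) ^ u * (K1 * real m ^ (u + 1) * (real b * level_rate s m))
          = (((real m)\<^sup>2) ^ u * real m ^ (u + 1)) * ((2 ^ (m + 1)) ^ u) * (K1 * (real b * level_rate s m))"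
          unfolding power_mult_distrib by (simp only: mult_ac)
        show ?thesis unfolding e3 e1 e2 by (simp only: mult_ac)
      qed
      then show ?thesis using K10 lev0 by (simp flip: ennreal_mult)
    qed
    also have "\<dots> \<le> ennreal (2 ^ u * K1 * real b * (C * (1 / (real m)\<^sup>2)))"
      unfolding C_def using level_rate_weight[OF s u(2) True] m0 K10 by (intro ennreal_leI mult_left_mono) auto
    finally show ?thesis using m1 by (simp add: mult.assoc)
  qed (simp add: f_def)
  have pt: "ennreal ((\<Sum>k=1..b. if norm (W k x) > 2 ^ m0 then norm (W k x) else 0) ^ u) \<le> ennreal (2 ^ u) * (\<Sum>m. f m x)" for x
  proof -
    define Y where "Y = Max ((\<lambda>k. norm (W k x)) ` {1..b})"
    obtain m1 where m1: "Y < 2 ^ m1" using real_arch_pow[of 2 Y] by auto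
    have Wle: "norm (W k x) \<le> 2 ^ m1" if "k \<in> {1..b}" for k
    proof -
      have "norm (W k x) \<le> Y" unfolding Y_def using that by (intro Max_ge) auto
      then show ?thesis using m1 by simp
    qed
    have "(\<Sum>k=1..b. if norm (W k x) > 2 ^ m0 then norm (W k x) else 0)
       \<le> (\<Sum>k=1..b. \<Sum>m\<in>{m0..m1}. 2 ^ (m + 1) * (if norm (W k x) > 2 ^ m then 1 else 0))"
      by (intro sum_mono dyadic_layer_bound Wle)
    also have "\<dots> = (\<Sum>m\<in>{m0..m1}. 2 ^ (m + 1) * N m x)"
      by (subst sum.swap) (simp add: N_def sum_distrib_left)
    finally have "(\<Sum>k=1..b. if norm (W k x) > 2 ^ m0 then norm (W k x) else 0) ^ u \<le> (\<Sum>m\<in>{m0..m1}. 2 ^ (m + 1) * N m x) ^ u"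
      by (intro power_mono sum_nonneg) auto
    also have "\<dots> \<le> 2 ^ u * (\<Sum>m\<in>{m0..m1}. ((real m)\<^sup>2 * (2 ^ (m + 1) * N m x)) ^ u)"
      by (rule weighted_power_sum_le) (use m0 N0 u in auto)
    finally have "ennreal ((\<Sum>k=1..b. if norm (W k x) > 2 ^ m0 then norm (W k x) else 0) ^ u)
        \<le> ennreal (2 ^ u * (\<Sum>m\<in>{m0..m1}. ((real m)\<^sup>2 * (2 ^ (m + 1) * N m x)) ^ u))" by (rule ennreal_leI)
    also have "\<dots> = ennreal (2 ^ u) * (\<Sum>m\<in>{m0..m1}. ennreal (((real m)\<^sup>2 * (2 ^ (m + 1) * N m x)) ^ u))"
      using N0 by (simp add: ennreal_mult sum_nonneg)
    also have "\<dots> = ennreal (2 ^ u) * (\<Sum>m\<in>{m0..m1}. f m x)" by (simp add: f_def)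
    also have "\<dots> \<le> ennreal (2 ^ u) * (\<Sum>m. f m x)" by (intro mult_left_mono sum_le_suminf) auto
    finally show ?thesis .
  qed
  have "(\<integral>\<^sup>+x. ennreal ((\<Sum>k=1..b. if norm (W k x) > 2 ^ m0 then norm (W k x) else 0) ^ u) \<partial>M)
     \<le> (\<integral>\<^sup>+x. ennreal (2 ^ u) * (\<Sum>m. f m x) \<partial>M)" by (intro nn_integral_mono pt)
  also have "\<dots> = ennreal (2 ^ u) * (\<Sum>m. \<integral>\<^sup>+x. f m x \<partial>M)"
    using fm by (subst nn_integral_cmult) (auto simp: nn_integral_suminf)
  also have "\<dots> \<le> ennreal (2 ^ u) * ennreal (2 ^ u * K1 * real b * C * 2)"
  proof (intro mult_left_mono suminf_le_const summableI)
    fix n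
    have "(\<Sum>m<n. \<integral>\<^sup>+x. f m x \<partial>M) \<le> (\<Sum>m<n. ennreal (2 ^ u * K1 * real b * C * (if m \<ge> 1 then 1 / (real m)\<^sup>2 else 0)))"
      by (intro sum_mono fI)
    also have "\<dots> = ennreal (\<Sum>m<n. 2 ^ u * K1 * real b * C * (if m \<ge> 1 then 1 / (real m)\<^sup>2 else 0))"
      using K10 C0 by (intro sum_ennreal) auto
    also have "\<dots> \<le> ennreal (2 ^ u * K1 * real b * C * 2)"
    proof (rule ennreal_leI)
      have "(\<Sum>m<n. (if m \<ge> 1 then 1 / (real m)\<^sup>2 else 0)) \<le> (\<Sum>m\<in>{..n}. (if m \<ge> 1 then 1 / (real m)\<^sup>2 else 0))"
        by (intro sum_mono2) auto
      also have "\<dots> = (\<Sum>m=1..n. 1 / (real m)\<^sup>2)"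
        by (intro sum.mono_neutral_cong_right) auto
      finally have "(\<Sum>m<n. (if m \<ge> 1 then 1 / (real m)\<^sup>2 else 0)) \<le> 2" using sum_inverse_squares_le[of n] by linarith
      then show "(\<Sum>m<n. 2 ^ u * K1 * real b * C * (if m \<ge> 1 then 1 / (real m)\<^sup>2 else 0)) \<le> 2 ^ u * K1 * real b * C * 2"
        unfolding sum_distrib_left[symmetric] using K10 C0 by (intro mult_left_mono) auto
    qed
    finally show "(\<Sum>m<n. \<integral>\<^sup>+x. f m x \<partial>M) \<le> ennreal (2 ^ u * K1 * real b * C * 2)" .
  qed auto
  also have "\<dots> = ennreal (2 * 8 ^ u * (real G ^ (u + 1) * (2 * 2 ^ u * (\<rho> + 1)) + 1) * (real b / (2 ^ (m0 * (s - u)) * real m0 ^ 3)))"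
  proof -
    have "2 ^ u * (2 ^ u * K1 * real b * C * 2) = 2 * 8 ^ u * (real G ^ (u + 1) * (2 * 2 ^ u * (\<rho> + 1)) + 1) * (real b / (2 ^ (m0 * (s - u)) * real m0 ^ 3))"
    proof -
      have "(8::real) ^ u = 2 ^ u * 2 ^ u * 2 ^ u" by (simp flip: power_mult_distrib)
      then show ?thesis by (simp add: K1_def C_def)
    qed
    then show ?thesis using K10 C0 by (simp flip: ennreal_mult)
  qed
  finally show ?thesis .
qed

section \<open>Stacked vectors, quadratic forms and the decomposition into blocks\<close>

lemma norm_stack_power2: "(norm (stack x y))\<^sup>2 = (norm x)\<^sup>2 + (norm (y :: real^'q::finite))\<^sup>2"
  for x :: "real^'p::finite"
proof -
  have "(norm (stack x y))\<^sup>2 = (\<Sum>i\<in>UNIV. (stack x y $ i)\<^sup>2)"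
    by (simp add: norm_vec_def L2_set_def sum_nonneg)
  also have "\<dots> = (\<Sum>i\<in>(UNIV :: 'p set) <+> (UNIV :: 'q set). (stack x y $ i)\<^sup>2)" by simp
  also have "\<dots> = (\<Sum>i\<in>UNIV. (x $ i)\<^sup>2) + (\<Sum>i\<in>UNIV. (y $ i)\<^sup>2)"
    by (subst sum.Plus) (simp_all add: stack_def)
  also have "\<dots> = (norm x)\<^sup>2 + (norm y)\<^sup>2" by (simp add: norm_vec_def L2_set_def sum_nonneg)
  finally show ?thesis .
qed

lemma norm_stack_le: "norm (stack x y) \<le> norm x + norm y"
  by (rule power2_le_imp_le) (simp_all add: norm_stack_power2 power2_sum)

lemma stack_scaleR: "c *\<^sub>R stack x y = stack (c *\<^sub>R x) (c *\<^sub>R y)"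
  by (simp add: stack_def vec_eq_iff split: sum.split)

lemma stack_diff: "stack x y - stack x' y' = stack (x - x') (y - y')"
  by (simp add: stack_def vec_eq_iff split: sum.split)

lemma stack_sum: "(\<Sum>k\<in>A. stack (x k) (y k)) = stack (\<Sum>k\<in>A. x k) (\<Sum>k\<in>A. y k)"
  by (simp add: stack_def vec_eq_iff split: sum.split)

lemma stack_inner: "\<theta> \<bullet> stack x y = (\<chi> i. \<theta> $ Inl i) \<bullet> x + (\<chi> i. \<theta> $ Inr i) \<bullet> y"
  for x :: "real^'p::finite" and y :: "real^'q::finite"
proof -
  have "\<theta> \<bullet> stack x y = (\<Sum>i\<in>(UNIV :: 'p set) <+> (UNIV :: 'q set). \<theta> $ i * stack x y $ i)"
    by (simp add: inner_vec_def)
  also have "\<dots> = (\<chi> i. \<theta> $ Inl i) \<bullet> x + (\<chi> i. \<theta> $ Inr i) \<bullet> y"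
    by (subst sum.Plus) (simp_all add: stack_def inner_vec_def)
  finally show ?thesis .
qed

lemma stack_measurable:
  fixes F :: "'w \<Rightarrow> real^'p::finite" and G :: "'w \<Rightarrow> real^'q::finite"
  assumes "F \<in> borel_measurable N" "G \<in> borel_measurable N"
  shows "(\<lambda>x. stack (F x) (G x)) \<in> borel_measurable N"
proof (rule borel_measurable_euclidean_space[THEN iffD2], rule ballI)
  fix i :: "real^('p + 'q)" assume "i \<in> Basis"
  show "(\<lambda>x. stack (F x) (G x) \<bullet> i) \<in> borel_measurable N"
    unfolding inner_commute[of _ i] stack_inner using assms by measurable
qed

lemma norm_matrix_vector_le:
  fixes A :: "real^'n::finite^'m::finite"
  shows "norm (A *v x) \<le> norm A * norm x"
proof -
  have "norm (A *v x) = L2_set (\<lambda>i. norm ((A *v x) $ i)) UNIV" by (simp add: norm_vec_def)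
  also have "\<dots> \<le> L2_set (\<lambda>i. norm x * norm (A $ i)) UNIV"
  proof (rule L2_set_mono)
    fix i
    have "(A *v x) $ i = A $ i \<bullet> x" by (simp add: matrix_vector_mult_def inner_vec_def)
    then show "norm ((A *v x) $ i) \<le> norm x * norm (A $ i)"
      using Cauchy_Schwarz_ineq2[of "A $ i" x] by (simp add: mult.commute)
  qed auto
  also have "\<dots> = norm A * norm x" by (subst L2_set_right_distrib[symmetric]) (simp_all add: norm_vec_def[of A] mult.commute)
  finally show ?thesis .
qed

text \<open>
  A maximiser v of the quadratic form on the sphere is an eigenvector: with m the maximum, the
  form g(y) = m|y|^2 - y \<bullet> Ay is nonnegative and vanishes at v. Along v + th with h = Av -
  mv it equals t^2 g(h) - 2t|h|^2, which is negative for small t > 0 unless h = 0.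
\<close>

lemma rayleigh_le_largest_eigenval:
  fixes A :: "real^'n::finite^'n"
  assumes sym: "transpose A = A" and ev: "largest_eigenval A \<mu>"
  shows "x \<bullet> (A *v x) \<le> \<mu> * (norm x)\<^sup>2"
proof -
  define q where "q = (\<lambda>x::real^'n. x \<bullet> (A *v x))"
  have cont: "continuous_on (sphere 0 1) q" unfolding q_def
    by (intro continuous_intros linear_continuous_on matrix_vector_mul_bounded_linear)
  obtain e :: "real^'n" where "norm e = 1" using vector_choose_size[of 1] by auto
  then have ne: "sphere (0::real^'n) 1 \<noteq> {}" by (auto simp: dist_norm intro!: exI[of _ e])
  obtain v where v: "norm v = 1" "\<And>y. norm y = 1 \<Longrightarrow> q y \<le> q v"
    using continuous_attains_sup[OF compact_sphere ne cont] by (auto simp: dist_norm)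
  define m where "m = q v"
  define g where "g = (\<lambda>y. m * (norm y)\<^sup>2 - q y)"
  have g0: "g y \<ge> 0" for y
  proof (cases "y = 0")
    case False
    have "q ((1 / norm y) *\<^sub>R y) \<le> m" unfolding m_def using False by (intro v(2)) simp
    moreover have "q ((1 / norm y) *\<^sub>R y) = q y / (norm y)\<^sup>2"
      by (simp add: q_def matrix_vector_mult_scaleR power2_eq_square)
    ultimately show ?thesis using False by (simp add: g_def divide_le_eq)
  qed (simp add: g_def q_def)
  have symv: "x \<bullet> (A *v y) = y \<bullet> (A *v x)" for x y
    by (metis dot_lmul_matrix inner_commute sym transpose_matrix_vector)
  define h where "h = A *v v - m *\<^sub>R v"
  define d where "d = (norm h)\<^sup>2"
  have exp: "g (v + t *\<^sub>R h) = t\<^sup>2 * g h - 2 * t * d" for t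
  proof -
    have n: "(norm (v + t *\<^sub>R h))\<^sup>2 = 1 + 2 * t * (v \<bullet> h) + t\<^sup>2 * (norm h)\<^sup>2"
    proof -
      have vv: "v \<bullet> v = 1" using v(1) by (simp add: norm_eq_1)
      show ?thesis
        unfolding power2_norm_eq_inner inner_add_left inner_add_right inner_scaleR_left inner_scaleR_right vv inner_commute[of h v]
        by (simp add: power2_eq_square algebra_simps)
    qed
    have qq: "q (v + t *\<^sub>R h) = m + 2 * t * (h \<bullet> (A *v v)) + t\<^sup>2 * q h"
      using symv[of v h]
      by (simp add: q_def m_def matrix_vector_right_distrib matrix_vector_mult_scaleR inner_add_left inner_add_right power2_eq_square algebra_simps)
    have "d = h \<bullet> (A *v v) - m * (v \<bullet> h)"
      unfolding d_def power2_norm_eq_inner by (subst (2) h_def) (simp add: inner_diff_right inner_commute)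
    then have hA: "h \<bullet> (A *v v) = d + m * (v \<bullet> h)" by simp
    show ?thesis unfolding g_def n qq hA by (simp add: algebra_simps)
  qed
  have "d = 0"
  proof (rule ccontr)
    assume "d \<noteq> 0"
    then have d: "d > 0" by (simp add: d_def)
    have "t\<^sup>2 * g h - 2 * t * d \<ge> 0" for t using g0 exp by metis
    from this[of "d / (g h + 1)"] have "(d / (g h + 1))\<^sup>2 * g h \<ge> 2 * (d / (g h + 1)) * d" by simp
    moreover have "(d / (g h + 1))\<^sup>2 * g h \<le> d / (g h + 1) * d"
    proof -
      have "g h / (g h + 1) \<le> 1" using g0[of h] by simp
      then have "(d * d / (g h + 1)) * (g h / (g h + 1)) \<le> (d * d / (g h + 1)) * 1" using g0[of h] d by (intro mult_left_mono) auto
      then show ?thesis by (simp add: power2_eq_square)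
    qed
    moreover have "d / (g h + 1) * d > 0" using d g0[of h] by simp
    ultimately show False by simp
  qed
  then have "A *v v = m *s v" by (simp add: d_def h_def scalar_mult_eq_scaleR)
  then have "eigenval A m" unfolding eigenval_def using v(1) by (intro exI[of _ v]) auto
  then have "m \<le> \<mu>" using ev by (simp add: largest_eigenval_def)
  then have "m * (norm x)\<^sup>2 \<le> \<mu> * (norm x)\<^sup>2" by (intro mult_right_mono) auto
  then show ?thesis using g0[of x] by (simp add: g_def q_def)
qed

lemma sphere_net:
  fixes \<epsilon> :: real
  assumes "\<epsilon> > 0"
  obtains \<Theta> :: "'a::euclidean_space set" where "finite \<Theta>" "\<And>\<theta>. \<theta> \<in> \<Theta> \<Longrightarrow> norm \<theta> = 1"
    "\<And>v. v \<noteq> 0 \<Longrightarrow> \<exists>\<theta>\<in>\<Theta>. (1 - \<epsilon>) * norm v \<le> \<theta> \<bullet> v"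
proof -
  have "\<exists>\<Theta>. finite \<Theta> \<and> \<Theta> \<subseteq> sphere (0::'a) 1 \<and> sphere 0 1 \<subseteq> (\<Union>\<theta>\<in>\<Theta>. ball \<theta> \<epsilon>)"
    using compact_imp_seq_compact[OF compact_sphere, of 0 1] seq_compact_imp_totally_bounded[of "sphere (0::'a) 1"] assms by auto
  then obtain \<Theta> :: "'a set" where \<Theta>: "finite \<Theta>" "\<Theta> \<subseteq> sphere 0 1" "sphere 0 1 \<subseteq> (\<Union>\<theta>\<in>\<Theta>. ball \<theta> \<epsilon>)" by blast
  show ?thesis
  proof (rule that[OF \<Theta>(1)])
    show "norm \<theta> = 1" if "\<theta> \<in> \<Theta>" for \<theta> using \<Theta>(2) that by auto
    fix v :: 'a assume v: "v \<noteq> 0"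
    define e where "e = (1 / norm v) *\<^sub>R v"
    have e1: "norm e = 1" using v by (simp add: e_def)
    then obtain \<theta> where \<theta>: "\<theta> \<in> \<Theta>" "norm (\<theta> - e) < \<epsilon>" using \<Theta>(3) by (force simp: dist_norm)
    have "1 - \<theta> \<bullet> e = (e - \<theta>) \<bullet> e" using e1 by (simp add: inner_diff_left norm_eq_1)
    also have "\<dots> \<le> norm (e - \<theta>) * norm e" by (rule norm_cauchy_schwarz)
    also have "\<dots> \<le> \<epsilon>" using \<theta>(2) e1 by (simp add: norm_minus_commute)
    finally have "1 - \<epsilon> \<le> \<theta> \<bullet> e" by simp
    then have "(1 - \<epsilon>) * norm v \<le> (\<theta> \<bullet> e) * norm v" by (intro mult_right_mono) auto
    also have "\<dots> = \<theta> \<bullet> v" using v by (simp add: e_def)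
    finally show "\<exists>\<theta>\<in>\<Theta>. (1 - \<epsilon>) * norm v \<le> \<theta> \<bullet> v" using \<theta>(1) by blast
  qed
qed

lemma nblocks_bounds:
  fixes l :: "nat \<Rightarrow> nat"
  assumes "1 \<le> l n" "l n \<le> n"
  shows "1 \<le> nblocks l n" "nblocks l n \<le> n" "n \<le> nblocks l n * l n"
    "real (nblocks l n) * real (l n) \<le> 2 * real n"
proof -
  define b where "b = nblocks l n"
  have l0: "real (l n) > 0" using assms by simp
  have n0: "n > 0" using assms by simp
  have c: "real b = of_int \<lceil>real n / real (l n)\<rceil>" using l0 n0 by (simp add: b_def nblocks_def)
  have lo: "real n / real (l n) \<le> real b" unfolding c by (rule le_of_int_ceiling)
  have hi: "real b < real n / real (l n) + 1" unfolding c by linarith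
  show b1: "1 \<le> nblocks l n"
  proof -
    have "0 < real n / real (l n)" using l0 n0 by simp
    then have "real b > 0" using lo by linarith
    then show ?thesis by (simp add: b_def)
  qed
  have "real n \<le> real b * real (l n)" using lo l0 by (simp add: field_simps)
  then show "n \<le> nblocks l n * l n" unfolding b_def by (metis of_nat_le_iff of_nat_mult)
  have h: "(real b - 1) * real (l n) < real n" using hi l0 by (simp add: field_simps)
  show "real (nblocks l n) * real (l n) \<le> 2 * real n"
  proof -
    have "real b * real (l n) < real n + real (l n)" using h by (simp add: algebra_simps)
    also have "\<dots> \<le> real n + real n" using assms(2) by simp
    finally show ?thesis by (simp add: b_def)
  qed
  have "real n / real (l n) \<le> real n" using assms l0 by (simp add: divide_le_eq mult_le_cancel_left1)
  then have "\<lceil>real n / real (l n)\<rceil> \<le> int n" by (simp add: ceiling_le_iff)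
  then show "nblocks l n \<le> n" unfolding nblocks_def nat_le_iff .
qed

lemma sum_over_blocks:
  fixes F :: "nat \<Rightarrow> 'c::comm_monoid_add"
  assumes "1 \<le> L" "n \<le> b * L"
  shows "(\<Sum>i=1..n. F i) = (\<Sum>k=1..b. \<Sum>i=(k - 1) * L + 1..min (k * L) n. F i)"
proof -
  have "(\<Sum>i=1..n. F i) = (\<Sum>k\<in>{1..b}. \<Sum>i\<in>{i\<in>{1..n}. (i - 1) div L + 1 = k}. F i)"
  proof (rule sum.group[symmetric])
    show "(\<lambda>i. (i - 1) div L + 1) ` {1..n} \<subseteq> {1..b}"
    proof (rule image_subsetI)
      fix i assume "i \<in> {1..n}"
      then have "i - 1 < b * L" using assms by auto
      then have "(i - 1) div L < b" by (simp add: less_mult_imp_div_less)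
      then show "(i - 1) div L + 1 \<in> {1..b}" by simp
    qed
  qed auto
  also have "\<dots> = (\<Sum>k=1..b. \<Sum>i=(k - 1) * L + 1..min (k * L) n. F i)"
  proof (rule sum.cong[OF refl])
    fix k assume k: "k \<in> {1..b}"
    have "{i\<in>{1..n}. (i - 1) div L + 1 = k} = {(k - 1) * L + 1..min (k * L) n}"
    proof (rule set_eqI)
      fix i
      obtain k' where k': "k = Suc k'" using k by (cases k) auto
      have "i \<ge> 1 \<Longrightarrow> (i - 1) div L = k' \<longleftrightarrow> k' * L + 1 \<le> i \<and> i \<le> Suc k' * L"
      proof -
        assume i: "i \<ge> 1"
        have A: "(i - 1) div L = k' \<longleftrightarrow> k' * L \<le> i - 1 \<and> i - 1 < Suc k' * L"
          using assms(1) div_nat_eqI[of L k' "i - 1"] div_times_less_eq_dividend[of "i - 1" L]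
          by (auto simp: mult.commute dividend_less_times_div)
        show ?thesis unfolding A using i by (auto simp del: mult_Suc)
      qed
      then show "i \<in> {i\<in>{1..n}. (i - 1) div L + 1 = k} \<longleftrightarrow> i \<in> {(k - 1) * L + 1..min (k * L) n}"
        unfolding k' by auto
    qed
    then show "sum F {i\<in>{1..n}. (i - 1) div L + 1 = k} = (\<Sum>i=(k - 1) * L + 1..min (k * L) n. F i)" by simp
  qed
  finally show ?thesis .
qed

lemma Ssum_eq_sum_Wblock:
  assumes "1 \<le> l n" "l n \<le> n"
  shows "Ssum X l f n \<omega> = sqrt (real (l n) / real n) *\<^sub>R (\<Sum>k=1..nblocks l n. Wblock X l f k n \<omega>)"
proof -
  have l0: "real (l n) > 0" and n0: "real n > 0" using assms by auto
  note part = sum_over_blocks[OF assms(1) nblocks_bounds(3)[of l n, OF assms]]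
  have s: "sqrt (real (l n)) * sqrt (real (l n)) = real (l n)" by simp
  have x: "sqrt (real (l n) / real n) * (sqrt (real (l n)) * (1 / real (l n))) = 1 / sqrt (real n)"
    using l0 n0 by (simp add: real_sqrt_divide)
  have y: "sqrt (real (l n) / real n) * (1 / real (l n)) = 1 / sqrt (real n * real (l n))"
    using l0 n0 s by (simp add: real_sqrt_divide real_sqrt_mult field_simps)
  show ?thesis
    unfolding Ssum_def Wblock_def Xbar_def Ybar_def stack_sum stack_scaleR part
    by (simp only: scaleR_right.sum scaleR_scaleR x y mult.assoc)
qed

section \<open>Moments of the blocks of a process\<close>

lemma hfun_nonneg: "0 \<le> u \<Longrightarrow> 0 \<le> hfun s u"
  by (simp add: hfun_def)

lemma power_le_hfun:
  assumes "0 \<le> u" "q \<le> s" shows "u ^ q \<le> 2 ^ s + hfun s u"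
proof (cases "u \<ge> 2")
  case True
  have "1 \<le> ln (1 + u)"
  proof -
    have "exp 1 \<le> 1 + u" using exp_le True by linarith
    then show ?thesis using True by (subst ln_ge_iff) auto
  qed
  then have "u ^ s * 1 \<le> u ^ s * ln (1 + u) ^ (2 * s\<^sup>2)" using assms by (intro mult_left_mono one_le_power) auto
  moreover have "u ^ q \<le> u ^ s" using True assms by (intro power_increasing) auto
  moreover have "(0::real) \<le> 2 ^ s" by simp
  ultimately show ?thesis unfolding hfun_def by linarith
next
  case False
  then have "u ^ q \<le> 2 ^ q" using assms by (intro power_mono) auto
  also have "\<dots> \<le> 2 ^ s" using assms by (intro power_increasing) auto
  finally show ?thesis using hfun_nonneg[OF assms(1), of s] by linarith
qed

lemma hfun_mono: assumes "0 \<le> u" "u \<le> v" shows "hfun s u \<le> hfun s v"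
  unfolding hfun_def using assms by (intro mult_mono power_mono) auto

text \<open>
  At u = 2^(m-2) the logarithm in \<open>hfun\<close> is at least m/8, which turns its power into
  the polynomial factor of \<open>level_rate\<close>.
\<close>

lemma inverse_level_rate_le_hfun:
  assumes "m \<ge> 3" shows "1 \<le> 4 ^ s * 8 ^ (2 * s\<^sup>2) * level_rate s m * hfun s (2 ^ (m - 2))"
proof -
  have e: "(2::real) ^ (m - 2) * 4 = 2 ^ m"
  proof -
    have "m - 2 + 2 = m" using assms by simp
    then have "(2::real) ^ (m - 2) * 2\<^sup>2 = 2 ^ m" using power_add[of "2::real" "m - 2" 2] by (simp only:)
    then show ?thesis by simp
  qed
  have "(m - 2) * ln 2 \<le> ln (1 + 2 ^ (m - 2))"
  proof -
    have "ln (2 ^ (m - 2)) \<le> ln (1 + (2::real) ^ (m - 2))" by (subst ln_le_cancel_iff) (auto simp: add_pos_pos)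
    then show ?thesis by (simp add: ln_realpow of_nat_diff)
  qed
  moreover have "real (m - 2) * (1 / 2) \<le> real (m - 2) * ln 2" using ln2_ge_two_thirds by (intro mult_left_mono) auto
  moreover have "real m \<le> 8 * (real (m - 2) * (1 / 2))" using assms by (simp add: of_nat_diff)
  ultimately have ln: "real m \<le> 8 * ln (1 + 2 ^ (m - 2))" by linarith
  have e2: "2 ^ (m * s) = (4 ^ s * (2 ^ (m - 2)) ^ s :: real)"
    unfolding power_mult e[symmetric] power_mult_distrib by (simp add: mult.commute)
  have "2 ^ (m * s) * real m ^ (2 * s\<^sup>2) \<le> 2 ^ (m * s) * (8 * ln (1 + 2 ^ (m - 2))) ^ (2 * s\<^sup>2)"
    using ln by (intro mult_left_mono power_mono) auto
  also have "2 ^ (m * s) * (8 * ln (1 + 2 ^ (m - 2))) ^ (2 * s\<^sup>2) = 4 ^ s * 8 ^ (2 * s\<^sup>2) * hfun s (2 ^ (m - 2))"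
    unfolding e2 hfun_def power_mult_distrib by (simp only: mult_ac)
  finally have "2 ^ (m * s) * real m ^ (2 * s\<^sup>2) \<le> 4 ^ s * 8 ^ (2 * s\<^sup>2) * hfun s (2 ^ (m - 2))" .
  then show ?thesis using assms by (simp add: level_rate_def field_simps)
qed

locale block_process = prob_space M
  for M :: "'w measure" +
  fixes X :: "int \<Rightarrow> 'w \<Rightarrow> real^'p::finite" and D :: "int \<Rightarrow> 'w measure" and l :: "nat \<Rightarrow> nat"
    and f :: "nat \<Rightarrow> nat \<Rightarrow> (nat \<Rightarrow> real^'p) \<Rightarrow> real^'q::finite" and s :: nat and \<rho> :: real
  assumes setting: "block_setting M X D l f" and s3: "s \<ge> 3" and \<rho>0: "\<rho> > 0"
    and moments: "\<And>n k. n \<ge> 1 \<Longrightarrow> k \<in> {1..nblocks l n} \<Longrightarrow>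
        max (\<integral>\<^sup>+\<omega>. ennreal (hfun s (norm (Ybar X l f k n \<omega>))) \<partial>M)
            (\<integral>\<^sup>+\<omega>. ennreal (hfun s (norm (sqrt (real (l n)) *\<^sub>R Xbar X l k n \<omega>))) \<partial>M) \<le> ennreal \<rho>"
begin

abbreviation W where "W n k \<equiv> Wblock X l f k n"
abbreviation nb where "nb n \<equiv> nblocks l n"

lemma l_bounds: "n \<ge> 1 \<Longrightarrow> 1 \<le> l n" "n \<ge> 1 \<Longrightarrow> l n \<le> n"
  using setting by (auto simp: block_setting_def)

lemma X_integrable: "X i \<in> borel_measurable M" "integrable M (X i)" "(\<integral>\<omega>. X i \<omega> \<partial>M) = 0"
  using setting by (auto simp: block_setting_def)

lemma Y_integrable:
  assumes "i \<ge> 1" "n \<ge> 1"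
  shows "Yvar X l f i n \<in> borel_measurable M" "integrable M (Yvar X l f i n)" "(\<integral>\<omega>. Yvar X l f i n \<omega> \<partial>M) = 0"
proof -
  show i: "integrable M (Yvar X l f i n)" "(\<integral>\<omega>. Yvar X l f i n \<omega> \<partial>M) = 0"
    using setting assms by (auto simp: block_setting_def)
  then show "Yvar X l f i n \<in> borel_measurable M" by auto
qed

lemma Xbar_integrable: "integrable M (Xbar X l k n)" "(\<integral>\<omega>. Xbar X l k n \<omega> \<partial>M) = 0"
proof -
  have i: "integrable M (\<lambda>\<omega>. \<Sum>i=(k - 1) * l n + 1..min (k * l n) n. X (int i) \<omega>)"
    by (intro Bochner_Integration.integrable_sum X_integrable)
  then show "integrable M (Xbar X l k n)" unfolding Xbar_def by (intro integrable_scaleR_right)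
  show "(\<integral>\<omega>. Xbar X l k n \<omega> \<partial>M) = 0"
    unfolding Xbar_def integral_scaleR_right using X_integrable by (subst Bochner_Integration.integral_sum) auto
qed

lemma Ybar_integrable: assumes "n \<ge> 1" shows "integrable M (Ybar X l f k n)" "(\<integral>\<omega>. Ybar X l f k n \<omega> \<partial>M) = 0"
proof -
  have Y: "integrable M (Yvar X l f i n)" "(\<integral>\<omega>. Yvar X l f i n \<omega> \<partial>M) = 0" if "i \<in> {(k - 1) * l n + 1..min (k * l n) n}" for i
    using Y_integrable[of i n] that assms by auto
  have i: "integrable M (\<lambda>\<omega>. \<Sum>i=(k - 1) * l n + 1..min (k * l n) n. Yvar X l f i n \<omega>)"
    by (intro Bochner_Integration.integrable_sum Y)
  then show "integrable M (Ybar X l f k n)" unfolding Ybar_def by (intro integrable_scaleR_right)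
  show "(\<integral>\<omega>. Ybar X l f k n \<omega> \<partial>M) = 0"
    unfolding Ybar_def integral_scaleR_right using Y by (subst Bochner_Integration.integral_sum) auto
qed

lemma W_measurable: assumes "n \<ge> 1" shows "W n k \<in> borel_measurable M"
  unfolding Wblock_def using Xbar_integrable Ybar_integrable[OF assms] by (intro stack_measurable) auto

lemma W_mean:
  assumes "n \<ge> 1" shows "integrable M (\<lambda>\<omega>. \<theta> \<bullet> W n k \<omega>)" "expectation (\<lambda>\<omega>. \<theta> \<bullet> W n k \<omega>) = 0"
  unfolding Wblock_def stack_inner using Xbar_integrable[of k n] Ybar_integrable[OF assms, of k] by auto

lemma W_norm_le: "norm (W n k \<omega>) \<le> norm (sqrt (real (l n)) *\<^sub>R Xbar X l k n \<omega>) + norm (Ybar X l f k n \<omega>)"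
  unfolding Wblock_def by (rule norm_stack_le)

lemma half_moments:
  assumes "n \<ge> 1" "k \<in> {1..nb n}"
  shows "(\<integral>\<^sup>+\<omega>. ennreal (hfun s (norm (Ybar X l f k n \<omega>))) \<partial>M) \<le> ennreal \<rho>"
    "(\<integral>\<^sup>+\<omega>. ennreal (hfun s (norm (sqrt (real (l n)) *\<^sub>R Xbar X l k n \<omega>))) \<partial>M) \<le> ennreal \<rho>"
  using moments[OF assms] by auto

lemma W_moment:
  assumes n: "n \<ge> 1" and k: "k \<in> {1..nb n}" and q: "1 \<le> q" "q \<le> s"
  shows "(\<integral>\<^sup>+\<omega>. ennreal (norm (W n k \<omega>) ^ q) \<partial>M) \<le> ennreal (2 ^ q * (2 * 2 ^ s + 2 * \<rho>))"
proof -
  define A where "A = (\<lambda>\<omega>. norm (sqrt (real (l n)) *\<^sub>R Xbar X l k n \<omega>))"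
  define B where "B = (\<lambda>\<omega>. norm (Ybar X l f k n \<omega>))"
  have mm: "A \<in> borel_measurable M" "B \<in> borel_measurable M" unfolding A_def B_def
    using Xbar_integrable[of k n] Ybar_integrable[OF n, of k] by auto
  have hm: "(\<lambda>\<omega>. hfun s (A \<omega>)) \<in> borel_measurable M" "(\<lambda>\<omega>. hfun s (B \<omega>)) \<in> borel_measurable M"
    unfolding hfun_def using mm by measurable
  have AB0: "0 \<le> A \<omega>" "0 \<le> B \<omega>" for \<omega> by (auto simp: A_def B_def)
  have split: "ennreal (p * (a + (b + c))) = ennreal p * (ennreal a + (ennreal b + ennreal c))"
    if "0 \<le> p" "0 \<le> a" "0 \<le> b" "0 \<le> c" for p a b c
    using that by (simp add: ennreal_mult)
  have "(\<integral>\<^sup>+\<omega>. ennreal (norm (W n k \<omega>) ^ q) \<partial>M) \<le> (\<integral>\<^sup>+\<omega>. ennreal (2 ^ q) * (ennreal (2 * 2 ^ s) + (ennreal (hfun s (A \<omega>)) + ennreal (hfun s (B \<omega>)))) \<partial>M)"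
  proof (rule nn_integral_mono)
    fix \<omega>
    have "norm (W n k \<omega>) ^ q \<le> (A \<omega> + B \<omega>) ^ q" unfolding A_def B_def by (intro power_mono W_norm_le) auto
    also have "\<dots> \<le> 2 ^ q * (A \<omega> ^ q + B \<omega> ^ q)"
      using power_sum_le[of "{True, False}" "\<lambda>i. if i then A \<omega> else B \<omega>" q] q AB0 by simp
    also have "\<dots> \<le> 2 ^ q * ((2 ^ s + hfun s (A \<omega>)) + (2 ^ s + hfun s (B \<omega>)))"
      using AB0 q by (intro mult_left_mono add_mono power_le_hfun) auto
    finally have "ennreal (norm (W n k \<omega>) ^ q) \<le> ennreal (2 ^ q * (2 * 2 ^ s + (hfun s (A \<omega>) + hfun s (B \<omega>))))"
      by (intro ennreal_leI) (simp add: algebra_simps)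
    also have "\<dots> = ennreal (2 ^ q) * (ennreal (2 * 2 ^ s) + (ennreal (hfun s (A \<omega>)) + ennreal (hfun s (B \<omega>))))"
      by (rule split) (use hfun_nonneg[of "A \<omega>" s] hfun_nonneg[of "B \<omega>" s] AB0 in simp_all)
    finally show "ennreal (norm (W n k \<omega>) ^ q) \<le> ennreal (2 ^ q) * (ennreal (2 * 2 ^ s) + (ennreal (hfun s (A \<omega>)) + ennreal (hfun s (B \<omega>))))" .
  qed
  also have "\<dots> = ennreal (2 ^ q) * (ennreal (2 * 2 ^ s) + ((\<integral>\<^sup>+\<omega>. ennreal (hfun s (A \<omega>)) \<partial>M) + (\<integral>\<^sup>+\<omega>. ennreal (hfun s (B \<omega>)) \<partial>M)))"
    using hm by (simp add: nn_integral_cmult nn_integral_add emeasure_space_1)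
  also have "\<dots> \<le> ennreal (2 ^ q) * (ennreal (2 * 2 ^ s) + (ennreal \<rho> + ennreal \<rho>))"
    using half_moments[OF n k] unfolding A_def B_def by (intro mult_left_mono add_mono) auto
  also have "\<dots> = ennreal (2 ^ q * (2 * 2 ^ s + 2 * \<rho>))"
    using split[of "2 ^ q" "2 * 2 ^ s" \<rho> \<rho>] \<rho>0 by simp
  finally show ?thesis .
qed

lemma tail_from_hfun:
  fixes A :: "'w \<Rightarrow> real"
  assumes A: "A \<in> borel_measurable M" "\<And>\<omega>. 0 \<le> A \<omega>" and h: "(\<integral>\<^sup>+\<omega>. ennreal (hfun s (A \<omega>)) \<partial>M) \<le> ennreal \<rho>" and m: "m \<ge> 3"
  shows "prob {\<omega>\<in>space M. A \<omega> > 2 ^ (m - 2)} \<le> \<rho> * (4 ^ s * 8 ^ (2 * s\<^sup>2)) * level_rate s m"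
proof -
  define E where "E = {\<omega>\<in>space M. A \<omega> > 2 ^ (m - 2)}"
  define y where "y = hfun s (2 ^ (m - 2))"
  have EM: "E \<in> sets M" unfolding E_def using A by measurable
  have y0: "y \<ge> 0" unfolding y_def by (rule hfun_nonneg) simp
  have "ennreal (y * prob E) = (\<integral>\<^sup>+\<omega>. ennreal y * indicator E \<omega> \<partial>M)"
    using EM y0 by (simp add: nn_integral_cmult_indicator emeasure_eq_measure ennreal_mult)
  also have "\<dots> \<le> (\<integral>\<^sup>+\<omega>. ennreal (hfun s (A \<omega>)) \<partial>M)"
    using hfun_mono[of "2 ^ (m - 2)" "A _" s]
    by (intro nn_integral_mono) (auto simp: indicator_def E_def y_def intro!: ennreal_leI)
  also have "\<dots> \<le> ennreal \<rho>" by (rule h)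
  finally have yE: "y * prob E \<le> \<rho>" using \<rho>0 by (simp add: ennreal_le_iff)
  define c where "c = 4 ^ s * 8 ^ (2 * s\<^sup>2) * level_rate s m"
  have c0: "c \<ge> 0" by (simp add: c_def level_rate_def)
  have "prob E \<le> (c * y) * prob E" using inverse_level_rate_le_hfun[OF m, of s] by (simp add: c_def y_def mult_le_cancel_right1)
  also have "\<dots> = c * (y * prob E)" by simp
  also have "\<dots> \<le> c * \<rho>" using yE c0 by (rule mult_left_mono)
  finally show ?thesis by (simp add: E_def c_def mult_ac)
qed

lemma W_tail:
  assumes n: "n \<ge> 1" and k: "k \<in> {1..nb n}" and m: "m \<ge> 3"
  shows "prob {\<omega>\<in>space M. norm (W n k \<omega>) > 2 ^ (m - 1)} \<le> 2 * \<rho> * (4 ^ s * 8 ^ (2 * s\<^sup>2)) * level_rate s m"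
proof -
  define A where "A = (\<lambda>\<omega>. norm (sqrt (real (l n)) *\<^sub>R Xbar X l k n \<omega>))"
  define B where "B = (\<lambda>\<omega>. norm (Ybar X l f k n \<omega>))"
  have mm: "A \<in> borel_measurable M" "B \<in> borel_measurable M" unfolding A_def B_def
    using Xbar_integrable[of k n] Ybar_integrable[OF n, of k] by auto
  have E: "{\<omega>\<in>space M. A \<omega> > 2 ^ (m - 2)} \<in> sets M" "{\<omega>\<in>space M. B \<omega> > 2 ^ (m - 2)} \<in> sets M"
    using mm by measurable
  have e: "(2::real) ^ (m - 1) = 2 * 2 ^ (m - 2)"
    using m power_Suc[of "2::real" "m - 2"] by (simp add: Suc_diff_Suc numeral_2_eq_2)
  have "prob {\<omega>\<in>space M. norm (W n k \<omega>) > 2 ^ (m - 1)} \<le> prob ({\<omega>\<in>space M. A \<omega> > 2 ^ (m - 2)} \<union> {\<omega>\<in>space M. B \<omega> > 2 ^ (m - 2)})"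
  proof (rule finite_measure_mono)
    show "{\<omega>\<in>space M. norm (W n k \<omega>) > 2 ^ (m - 1)} \<subseteq> {\<omega>\<in>space M. A \<omega> > 2 ^ (m - 2)} \<union> {\<omega>\<in>space M. B \<omega> > 2 ^ (m - 2)}"
    proof
      fix \<omega> assume \<omega>: "\<omega> \<in> {\<omega>\<in>space M. norm (W n k \<omega>) > 2 ^ (m - 1)}"
      have "norm (W n k \<omega>) \<le> A \<omega> + B \<omega>" unfolding A_def B_def by (rule W_norm_le)
      then show "\<omega> \<in> {\<omega>\<in>space M. A \<omega> > 2 ^ (m - 2)} \<union> {\<omega>\<in>space M. B \<omega> > 2 ^ (m - 2)}" using \<omega> e by auto
    qed
  qed (use E in auto)
  also have "\<dots> \<le> prob {\<omega>\<in>space M. A \<omega> > 2 ^ (m - 2)} + prob {\<omega>\<in>space M. B \<omega> > 2 ^ (m - 2)}"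
    by (rule measure_Un_le[OF E])
  also have "\<dots> \<le> \<rho> * (4 ^ s * 8 ^ (2 * s\<^sup>2)) * level_rate s m + \<rho> * (4 ^ s * 8 ^ (2 * s\<^sup>2)) * level_rate s m"
    by (intro add_mono tail_from_hfun mm m) (use half_moments[OF n k] in \<open>auto simp: A_def B_def\<close>)
  finally show ?thesis by (simp add: mult_ac)
qed

lemma sum_W_moment:
  assumes n: "n \<ge> 1" and q: "1 \<le> q" "q \<le> s"
  shows "(\<integral>\<^sup>+\<omega>. ennreal ((\<Sum>k=1..nb n. norm (W n k \<omega>)) ^ q) \<partial>M) \<le> ennreal (real n ^ (q + 1) * (2 ^ q * (2 * 2 ^ s + 2 * \<rho>)))"
proof -
  define K where "K = 2 ^ q * (2 * 2 ^ s + 2 * \<rho>)"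
  have K0: "K \<ge> 0" using \<rho>0 by (simp add: K_def)
  have Wm: "(\<lambda>\<omega>. norm (W n k \<omega>) ^ q) \<in> borel_measurable M" for k using W_measurable[OF n, of k] by measurable
  have bn: "nb n \<le> n" using nblocks_bounds(2)[of l n] l_bounds n by auto
  have "(\<integral>\<^sup>+\<omega>. ennreal ((\<Sum>k=1..nb n. norm (W n k \<omega>)) ^ q) \<partial>M)
     \<le> (\<integral>\<^sup>+\<omega>. ennreal (real (nb n) ^ q) * (\<Sum>k=1..nb n. ennreal (norm (W n k \<omega>) ^ q)) \<partial>M)"
  proof (rule nn_integral_mono)
    fix \<omega>
    have "(\<Sum>k=1..nb n. norm (W n k \<omega>)) ^ q \<le> real (card {1..nb n}) ^ q * (\<Sum>k=1..nb n. norm (W n k \<omega>) ^ q)"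
      by (rule power_sum_le) (use q in auto)
    then have "ennreal ((\<Sum>k=1..nb n. norm (W n k \<omega>)) ^ q) \<le> ennreal (real (nb n) ^ q * (\<Sum>k=1..nb n. norm (W n k \<omega>) ^ q))"
      by (intro ennreal_leI) simp
    also have "\<dots> = ennreal (real (nb n) ^ q) * (\<Sum>k=1..nb n. ennreal (norm (W n k \<omega>) ^ q))"
      by (simp add: ennreal_mult sum_nonneg sum_ennreal)
    finally show "ennreal ((\<Sum>k=1..nb n. norm (W n k \<omega>)) ^ q) \<le> ennreal (real (nb n) ^ q) * (\<Sum>k=1..nb n. ennreal (norm (W n k \<omega>) ^ q))" .
  qed
  also have "\<dots> = ennreal (real (nb n) ^ q) * (\<Sum>k=1..nb n. \<integral>\<^sup>+\<omega>. ennreal (norm (W n k \<omega>) ^ q) \<partial>M)"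
  proof -
    have Wm': "(\<lambda>\<omega>. ennreal (norm (W n k \<omega>) ^ q)) \<in> borel_measurable M" for k using Wm[of k] by measurable
    then have "(\<lambda>\<omega>. \<Sum>k=1..nb n. ennreal (norm (W n k \<omega>) ^ q)) \<in> borel_measurable M" by (intro borel_measurable_sum)
    then show ?thesis by (subst nn_integral_cmult) (simp_all only: nn_integral_sum[OF Wm'])
  qed
  also have "\<dots> \<le> ennreal (real (nb n) ^ q) * (\<Sum>k=1..nb n. ennreal K)"
    unfolding K_def using W_moment[OF n _ q] by (intro mult_left_mono sum_mono) auto
  also have "\<dots> = ennreal (real (nb n) ^ q * (real (nb n) * K))"
    using K0 by (simp add: ennreal_mult ennreal_of_nat_eq_real_of_nat)
  also have "\<dots> \<le> ennreal (real n ^ (q + 1) * K)"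
  proof (rule ennreal_leI)
    have "real (nb n) ^ q * (real (nb n) * K) = real (nb n) ^ (q + 1) * K" by simp
    also have "\<dots> \<le> real n ^ (q + 1) * K" using bn K0 by (intro mult_right_mono power_mono) auto
    finally show "real (nb n) ^ q * (real (nb n) * K) \<le> real n ^ (q + 1) * K" .
  qed
  finally show ?thesis by (simp add: K_def)
qed

lemma S_norm_le: assumes "n \<ge> 1" shows "norm (Ssum X l f n \<omega>) \<le> (\<Sum>k=1..nb n. norm (W n k \<omega>))"
proof -
  have l: "1 \<le> l n" "l n \<le> n" using l_bounds assms by auto
  have "norm (Ssum X l f n \<omega>) = sqrt (real (l n) / real n) * norm (\<Sum>k=1..nb n. W n k \<omega>)"
    using l by (subst Ssum_eq_sum_Wblock) auto
  also have "\<dots> \<le> 1 * (\<Sum>k=1..nb n. norm (W n k \<omega>))"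
    using l by (intro mult_mono norm_sum) (auto simp: sum_nonneg)
  finally show ?thesis by simp
qed

lemma S_measurable: assumes "n \<ge> 1" shows "Ssum X l f n \<in> borel_measurable M"
proof -
  have l: "1 \<le> l n" "l n \<le> n" using l_bounds assms by auto
  have "Ssum X l f n = (\<lambda>\<omega>. sqrt (real (l n) / real n) *\<^sub>R (\<Sum>k=1..nb n. W n k \<omega>))"
    using Ssum_eq_sum_Wblock[of l n X f] l by auto
  moreover have "(\<lambda>\<omega>. \<Sum>k=1..nb n. W n k \<omega>) \<in> borel_measurable M" using W_measurable[OF assms] by (intro borel_measurable_sum)
  ultimately show ?thesis by simp
qed

lemma S_moment:
  assumes n: "n \<ge> 1" and q: "1 \<le> q" "q \<le> s"
  shows "(\<integral>\<^sup>+\<omega>. ennreal (norm (Ssum X l f n \<omega>) ^ q) \<partial>M) \<le> ennreal (real n ^ (q + 1) * (2 ^ q * (2 * 2 ^ s + 2 * \<rho>)))"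
  by (rule order_trans[OF _ sum_W_moment[OF assms]])
     (intro nn_integral_mono ennreal_leI power_mono S_norm_le n norm_ge_zero)

lemma S_prodI: assumes n: "n \<ge> 1" shows "integrable M (\<lambda>\<omega>. Ssum X l f n \<omega> $ i * Ssum X l f n \<omega> $ j)"
proof -
  have m[measurable]: "Ssum X l f n \<in> borel_measurable M" by (rule S_measurable[OF n])
  have comp: "(\<lambda>\<omega>. Ssum X l f n \<omega> $ i) \<in> borel_measurable M" for i
    using borel_measurable_inner[OF m, of "\<lambda>_. axis i 1"] by (simp add: inner_axis)
  have i2: "integrable M (\<lambda>\<omega>. norm (Ssum X l f n \<omega>) ^ 2)"
    using S_moment[OF n, of 2] s3 by (intro integrableI_nonneg) (auto simp: le_less_trans[OF _ ennreal_less_top])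
  show ?thesis
  proof (rule Bochner_Integration.integrable_bound[OF i2])
    show "AE \<omega> in M. norm (Ssum X l f n \<omega> $ i * Ssum X l f n \<omega> $ j) \<le> norm (norm (Ssum X l f n \<omega>) ^ 2)"
      by (intro AE_I2) (auto simp: abs_mult power2_eq_square intro!: mult_mono component_le_norm_cart)
  qed (use comp in measurable)
qed

lemma inner_S: assumes "n \<ge> 1"
  shows "\<theta> \<bullet> Ssum X l f n \<omega> = sqrt (real (l n) / real n) * (\<Sum>k=1..nb n. \<theta> \<bullet> W n k \<omega>)"
  using Ssum_eq_sum_Wblock[of l n X f \<omega>] l_bounds assms by (simp add: inner_sum_right)

lemma cov_S: assumes n: "n \<ge> 1"
  shows "\<theta> \<bullet> (cov_mat M (Ssum X l f n) *v \<theta>) = expectation (\<lambda>\<omega>. (\<theta> \<bullet> Ssum X l f n \<omega>)\<^sup>2)"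
    "transpose (cov_mat M (Ssum X l f n)) = cov_mat M (Ssum X l f n)"
proof -
  define S where "S = Ssum X l f n"
  have mean: "expectation (\<lambda>\<omega>. S \<omega> $ i) = 0" for i
  proof -
    have "S \<omega> $ i = sqrt (real (l n) / real n) * (\<Sum>k=1..nb n. axis i 1 \<bullet> W n k \<omega>)" for \<omega>
      using inner_S[OF n, of "axis i 1" \<omega>] by (simp add: S_def inner_axis')
    then show ?thesis using W_mean[OF n] by (simp add: Bochner_Integration.integral_sum)
  qed
  have c: "cov_mat M S $ i $ j = expectation (\<lambda>\<omega>. S \<omega> $ i * S \<omega> $ j)" for i j
    by (simp add: cov_mat_def mean)
  show "transpose (cov_mat M (Ssum X l f n)) = cov_mat M (Ssum X l f n)"
    unfolding S_def[symmetric] by (simp add: vec_eq_iff transpose_def c mult.commute)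
  have "expectation (\<lambda>\<omega>. (\<theta> \<bullet> S \<omega>)\<^sup>2) = expectation (\<lambda>\<omega>. \<Sum>i\<in>UNIV. \<Sum>j\<in>UNIV. \<theta> $ i * \<theta> $ j * (S \<omega> $ i * S \<omega> $ j))"
    by (simp add: inner_vec_def power2_eq_square sum_product mult_ac)
  also have "\<dots> = (\<Sum>i\<in>UNIV. \<Sum>j\<in>UNIV. \<theta> $ i * \<theta> $ j * cov_mat M S $ i $ j)"
    using S_prodI[OF n] by (simp add: Bochner_Integration.integral_sum c[unfolded S_def] S_def)
  also have "\<dots> = \<theta> \<bullet> (cov_mat M S *v \<theta>)"
    by (simp add: inner_vec_def matrix_vector_mult_def sum_distrib_left mult_ac)
  finally show "\<theta> \<bullet> (cov_mat M (Ssum X l f n) *v \<theta>) = expectation (\<lambda>\<omega>. (\<theta> \<bullet> Ssum X l f n \<omega>)\<^sup>2)" by (simp add: S_def)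
qed

text \<open>
  The limit \<Xi> inherits symmetry from the covariance matrices, so that its quadratic form is at
  most its largest eigenvalue.
\<close>

lemma variance_le:
  assumes n: "n \<ge> 1" and lim: "(\<lambda>n. cov_mat M (Ssum X l f n)) \<longlonglongrightarrow> \<Xi>" and ev: "largest_eigenval \<Xi> \<mu>"
    and rate: "cov_rate \<delta> \<Xi> M X l f" and \<theta>: "norm \<theta> = 1"
  shows "expectation (\<lambda>\<omega>. (\<theta> \<bullet> Ssum X l f n \<omega>)\<^sup>2) \<le> \<mu> + \<delta> n"
proof -
  define C where "C = cov_mat M (Ssum X l f n)"
  have "transpose \<Xi> = \<Xi>"
  proof -
    have comp: "(\<lambda>n. cov_mat M (Ssum X l f n) $ i $ j) \<longlonglongrightarrow> \<Xi> $ i $ j" for i j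
      by (intro tendsto_vec_nth lim)
    have "\<Xi> $ i $ j = \<Xi> $ j $ i" for i j
    proof (rule LIMSEQ_unique[OF comp])
      show "(\<lambda>n. cov_mat M (Ssum X l f n) $ i $ j) \<longlonglongrightarrow> \<Xi> $ j $ i"
      proof (rule Lim_transform_eventually[OF comp])
        show "\<forall>\<^sub>F n in sequentially. cov_mat M (Ssum X l f n) $ j $ i = cov_mat M (Ssum X l f n) $ i $ j"
          using eventually_ge_at_top[of 1]
        proof eventually_elim
          case (elim n)
          have "cov_mat M (Ssum X l f n) $ j $ i = transpose (cov_mat M (Ssum X l f n)) $ i $ j" by (simp add: transpose_def)
          then show ?case using cov_S(2)[OF elim] by simp
        qed
      qed
    qed
    then show ?thesis by (simp add: vec_eq_iff transpose_def)
  qed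
  then have 1: "\<theta> \<bullet> (\<Xi> *v \<theta>) \<le> \<mu>" using rayleigh_le_largest_eigenval[OF _ ev, of \<theta>] \<theta> by simp
  have "\<theta> \<bullet> ((C - \<Xi>) *v \<theta>) \<le> norm \<theta> * norm ((C - \<Xi>) *v \<theta>)" by (rule norm_cauchy_schwarz)
  also have "\<dots> \<le> norm (C - \<Xi>)" using norm_matrix_vector_le[of "C - \<Xi>" \<theta>] \<theta> by simp
  also have "\<dots> \<le> \<delta> n" using rate n by (simp add: cov_rate_def C_def)
  finally have "\<theta> \<bullet> (C *v \<theta>) - \<theta> \<bullet> (\<Xi> *v \<theta>) \<le> \<delta> n" by (simp add: matrix_vector_mult_diff_rdistrib inner_diff_right)
  then show ?thesis using 1 cov_S(1)[OF n, of \<theta>] by (simp add: C_def)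
qed

lemma real_block_array_inner:
  assumes n: "n \<ge> 1" and app: "block_approx M (nb n) (W n) V g \<eta>" and \<eta>: "\<eta> \<ge> 0" and \<theta>: "norm \<theta> \<le> 1"
  shows "real_block_array M (nb n) g (\<lambda>k \<omega>. \<theta> \<bullet> W n k \<omega>) (\<lambda>k \<omega>. \<theta> \<bullet> V k \<omega>) \<eta> (2 ^ 3 * (2 * 2 ^ s + 2 * \<rho>))"
proof (unfold_locales)
  fix k assume k: "k \<in> {1..nb n}"
  have Wm[measurable]: "W n k \<in> borel_measurable M" by (rule W_measurable[OF n])
  show m: "(\<lambda>\<omega>. \<theta> \<bullet> W n k \<omega>) \<in> borel_measurable M" by measurable
  have mom: "(\<integral>\<^sup>+\<omega>. ennreal (norm (W n k \<omega>) ^ 3) \<partial>M) \<le> ennreal (2 ^ 3 * (2 * 2 ^ s + 2 * \<rho>))"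
    by (rule W_moment[OF n k]) (use s3 in auto)
  have i3: "integrable M (\<lambda>\<omega>. norm (W n k \<omega>) ^ 3)"
    using mom by (intro integrableI_nonneg) (auto simp: le_less_trans[OF _ ennreal_less_top])
  have e3: "expectation (\<lambda>\<omega>. norm (W n k \<omega>) ^ 3) \<le> 2 ^ 3 * (2 * 2 ^ s + 2 * \<rho>)"
    by (rule ennreal_le_iff[THEN iffD1, OF _ mom[unfolded nn_integral_eq_integral[OF i3 AE_I2[OF zero_le_power[OF norm_ge_zero]]]]])
       (use \<rho>0 in simp)
  have le: "\<bar>\<theta> \<bullet> W n k \<omega>\<bar> ^ 3 \<le> norm (W n k \<omega>) ^ 3" for \<omega>
  proof (rule power_mono)
    have "\<bar>\<theta> \<bullet> W n k \<omega>\<bar> \<le> norm \<theta> * norm (W n k \<omega>)" by (rule Cauchy_Schwarz_ineq2)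
    also have "\<dots> \<le> norm (W n k \<omega>)" using \<theta> by (simp add: mult_left_le_one_le)
    finally show "\<bar>\<theta> \<bullet> W n k \<omega>\<bar> \<le> norm (W n k \<omega>)" .
  qed simp
  show i: "integrable M (\<lambda>\<omega>. \<bar>\<theta> \<bullet> W n k \<omega>\<bar> ^ 3)"
    by (rule Bochner_Integration.integrable_bound[OF i3]) (use le in auto)
  show "expectation (\<lambda>\<omega>. \<bar>\<theta> \<bullet> W n k \<omega>\<bar> ^ 3) \<le> 2 ^ 3 * (2 * 2 ^ s + 2 * \<rho>)"
    by (rule order_trans[OF integral_mono[OF i i3 le] e3])
  show "expectation (\<lambda>\<omega>. \<theta> \<bullet> W n k \<omega>) = 0" by (rule W_mean[OF n])
next
  show "block_approx M (nb n) (\<lambda>k \<omega>. \<theta> \<bullet> W n k \<omega>) (\<lambda>k \<omega>. \<theta> \<bullet> V k \<omega>) g \<eta>"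
    by (rule block_approx_inner[OF app \<theta> W_measurable[OF n]])
qed (use \<eta> \<rho>0 in auto)

end

section \<open>Block approximations from the approximation and mixing conditions\<close>

lemma gen_field_subalgebra:
  assumes D: "\<And>j. subalgebra M (D j)"
  shows "space (gen_field M D J) = space M" "sets (gen_field M D J) = sigma_sets (space M) (\<Union>j\<in>J. sets (D j))"
    "subalgebra M (gen_field M D J)"
proof -
  have sub: "(\<Union>j\<in>J. sets (D j)) \<subseteq> sets M" using D by (auto simp: subalgebra_def)
  also have "sets M \<subseteq> Pow (space M)" by (rule sets.space_closed)
  finally have pow: "(\<Union>j\<in>J. sets (D j)) \<subseteq> Pow (space M)" .
  show sp: "space (gen_field M D J) = space M" unfolding gen_field_def by (rule space_measure_of[OF pow])
  show se: "sets (gen_field M D J) = sigma_sets (space M) (\<Union>j\<in>J. sets (D j))"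
    unfolding gen_field_def by (rule sets_measure_of[OF pow])
  show "subalgebra M (gen_field M D J)"
    unfolding subalgebra_def sp se using sets.sigma_sets_subset[OF sub] by simp
qed

lemma gen_field_measurable_mono:
  assumes D: "\<And>j. subalgebra M (D j)" and J: "J \<subseteq> J'" and f: "f \<in> borel_measurable (gen_field M D J)"
  shows "f \<in> borel_measurable (gen_field M D J')"
proof (rule measurable_from_subalg[OF _ f])
  show "subalgebra (gen_field M D J') (gen_field M D J)"
    unfolding subalgebra_def gen_field_subalgebra[OF D] using J by (auto intro!: sigma_sets_mono')
qed

lemma cond_C4_alpha_mix:
  assumes M: "prob_space M" and D: "\<And>j. subalgebra M (D j)" and C4: "cond_C4 \<kappa> M D" and m: "m \<ge> 1"
    and I: "i + int m \<le> j" and \<alpha>: "(1 / \<kappa>) * exp (- \<kappa> * real m) \<le> \<alpha>"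
  shows "alpha_mix M (gen_field M D {..i}) (gen_field M D {j..}) \<alpha>"
  unfolding alpha_mix_def
proof (intro conjI ballI gen_field_subalgebra(3)[OF D])
  interpret prob_space M by fact
  let ?S = "{\<bar>measure M (A \<inter> B) - measure M A * measure M B\<bar> | A B i.
               A \<in> sets (gen_field M D {..i}) \<and> B \<in> sets (gen_field M D {i + int m ..})}"
  fix A B assume A: "A \<in> sets (gen_field M D {..i})" and B: "B \<in> sets (gen_field M D {j..})"
  have "{j..} \<subseteq> {i + int m..}" using I by auto
  then have "B \<in> sets (gen_field M D {i + int m..})"
    using B unfolding gen_field_subalgebra[OF D] by (meson UN_mono order_refl sigma_sets_mono' subsetD)
  then have mem: "\<bar>prob (A \<inter> B) - prob A * prob B\<bar> \<in> ?S" using A by blast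
  have "bdd_above ?S"
  proof (rule bdd_aboveI[of _ 1])
    fix y assume "y \<in> ?S"
    then obtain A B where y: "y = \<bar>prob (A \<inter> B) - prob A * prob B\<bar>" by blast
    have "0 \<le> prob A * prob B" "prob A * prob B \<le> 1" using mult_le_one[of "prob A" "prob B"] by auto
    moreover have "0 \<le> prob (A \<inter> B)" "prob (A \<inter> B) \<le> 1" by auto
    ultimately show "y \<le> 1" unfolding y by linarith
  qed
  then have "\<bar>prob (A \<inter> B) - prob A * prob B\<bar> \<le> Sup ?S" by (rule cSup_upper[OF mem])
  also have "\<dots> \<le> (1 / \<kappa>) * exp (- \<kappa> * real m)" using C4 m unfolding cond_C4_def by blast
  also have "\<dots> \<le> \<alpha>" by (rule \<alpha>)
  finally show "\<bar>prob (A \<inter> B) - prob A * prob B\<bar> \<le> \<alpha>" .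
qed

lemma block_approx_mono:
  assumes "block_approx M b W V g \<eta>" "\<eta> \<le> \<eta>'" "g \<le> g'" shows "block_approx M b W V g' \<eta>'"
proof -
  obtain Past Fut where PF:
    "\<And>k. k \<in> {1..b} \<Longrightarrow> V k \<in> borel_measurable M"
    "\<And>k. k \<in> {1..b} \<Longrightarrow> (\<integral>\<^sup>+\<omega>. ennreal (norm (W k \<omega> - V k \<omega>)) \<partial>M) \<le> ennreal \<eta>"
    "\<And>k i. k \<in> {1..b} \<Longrightarrow> int k \<le> i \<Longrightarrow> V k \<in> borel_measurable (Past i)"
    "\<And>k j. k \<in> {1..b} \<Longrightarrow> j \<le> int k \<Longrightarrow> V k \<in> borel_measurable (Fut j)"
    "\<And>i j. i + int g \<le> j \<Longrightarrow> alpha_mix M (Past i) (Fut j) \<eta>"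
    by (rule block_approxE[OF assms(1)], rule that)
  have "(\<integral>\<^sup>+\<omega>. ennreal (norm (W k \<omega> - V k \<omega>)) \<partial>M) \<le> ennreal \<eta>'" if "k \<in> {1..b}" for k
    using PF(2)[OF that] ennreal_leI[OF assms(2)] by (rule order_trans)
  moreover have "alpha_mix M (Past i) (Fut j) \<eta>'" if "i + int g' \<le> j" for i j
    using PF(5)[of i j] that assms(2,3) unfolding alpha_mix_def by (auto intro: order_trans)
  ultimately show ?thesis unfolding block_approx_def using PF(1,3,4)
    by (intro exI[of _ Past] exI[of _ Fut] conjI ballI allI impI) simp_all
qed

context block_process begin

text \<open>
  With m = rl, the approximations of the terms of block k use the fields D_j from block k-1-r to
  block k+1+r; the extra block at the end comes from the window of l observations in
  \<open>Yvar\<close>. Blocks 3r+2 apart thus have windows at distance m.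
\<close>

lemma block_approx_exists:
  assumes C3: "cond_C3 \<kappa>3 M X D l f" and C4: "cond_C4 \<kappa>4 M D" and \<kappa>: "\<kappa>3 \<in> {0<..<1}" "\<kappa>4 \<in> {0<..<1}"
    and n: "real n > 1 / \<kappa>3" and r: "r \<ge> 1" "real r * real (l n) > 1 / \<kappa>3"
  shows "\<exists>V. block_approx M (nb n) (W n) V (3 * r + 2)
      (2 * real (l n) / min \<kappa>3 \<kappa>4 * exp (- min \<kappa>3 \<kappa>4 * (real r * real (l n))))"
proof -
  have n1: "n \<ge> 1" using n \<kappa> by (cases n) (auto simp: divide_less_0_iff)
  have D: "\<And>j. subalgebra M (D j)" using setting by (auto simp: block_setting_def)
  define L where "L = l n"
  define m where "m = r * L"
  define \<kappa> where "\<kappa> = min \<kappa>3 \<kappa>4"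
  define e where "e = (1 / \<kappa>3) * exp (- \<kappa>3 * real m)"
  define \<eta> where "\<eta> = 2 * real L / \<kappa> * exp (- \<kappa> * real m)"
  have \<kappa>0: "\<kappa> > 0" using \<kappa> by (simp add: \<kappa>_def)
  have L1: "L \<ge> 1" "real L \<ge> 1" using l_bounds(1)[OF n1] by (auto simp: L_def)
  have m1: "m \<ge> 1" using r L1 by (simp add: m_def)
  have e0: "e \<ge> 0" using \<kappa> by (simp add: e_def)
  have cmp: "(1 / \<kappa>') * exp (- \<kappa>' * real m) \<le> (1 / \<kappa>) * exp (- \<kappa> * real m)" if "\<kappa> \<le> \<kappa>'" for \<kappa>'
    using that \<kappa>0 by (intro mult_mono) (auto simp: divide_simps intro: mult_right_mono)
  have le\<eta>: "2 * real L * e \<le> \<eta>" "(1 / \<kappa>4) * exp (- \<kappa>4 * real m) \<le> \<eta>"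
  proof -
    have "e \<le> (1 / \<kappa>) * exp (- \<kappa> * real m)" unfolding e_def by (rule cmp) (simp add: \<kappa>_def)
    then have "2 * real L * e \<le> 2 * real L * ((1 / \<kappa>) * exp (- \<kappa> * real m))" by (rule mult_left_mono) simp
    then show "2 * real L * e \<le> \<eta>" by (simp add: \<eta>_def)
    have "(1 / \<kappa>4) * exp (- \<kappa>4 * real m) \<le> (1 / \<kappa>) * exp (- \<kappa> * real m)" by (rule cmp) (simp add: \<kappa>_def)
    also have "\<dots> \<le> (2 * real L) * ((1 / \<kappa>) * exp (- \<kappa> * real m))"
      using mult_right_mono[of 1 "2 * real L" "(1 / \<kappa>) * exp (- \<kappa> * real m)"] L1 \<kappa>0 by simp
    finally show "(1 / \<kappa>4) * exp (- \<kappa>4 * real m) \<le> \<eta>" by (simp add: \<eta>_def)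
  qed
  have mk: "real m > 1 / \<kappa>3" using r(2) by (simp add: m_def L_def)
  define P where "P = (\<lambda>i Xd Yd. Xd \<in> borel_measurable (gen_field M D {int i - int m .. int i + int m}) \<and>
           Yd \<in> borel_measurable (gen_field M D {int i - int m .. int i + int m + int L}) \<and>
           max (\<integral>\<^sup>+\<omega>. ennreal (norm (X (int i) \<omega> - Xd \<omega>)) \<partial>M)
               (ennreal (1 / real L) * (\<integral>\<^sup>+\<omega>. ennreal (norm (Yvar X l f i n \<omega> - Yd \<omega>)) \<partial>M))
             \<le> ennreal e)"
  have "\<forall>i\<in>{1..n}. \<exists>Z. P i (fst Z) (snd Z)"
  proof
    fix i assume "i \<in> {1..n}"
    then have "\<exists>Xd Yd. P i Xd Yd" using C3 mk n unfolding cond_C3_def L_def e_def P_def by simp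
    then obtain Xd Yd where "P i Xd Yd" by (elim exE)
    then show "\<exists>Z. P i (fst Z) (snd Z)" by (intro exI[of _ "(Xd, Yd)"]) simp
  qed
  from bchoice[OF this] obtain Z where Z: "\<forall>i\<in>{1..n}. P i (fst (Z i)) (snd (Z i))" by (elim exE)
  define Xd where "Xd = (\<lambda>i. fst (Z i))"
  define Yd where "Yd = (\<lambda>i. snd (Z i))"
  have PXY: "P i (Xd i) (Yd i)" if "i \<in> {1..n}" for i using bspec[OF Z that] by (simp add: Xd_def Yd_def)
  have XY:
    "Xd i \<in> borel_measurable (gen_field M D {int i - int m .. int i + int m})"
    "Yd i \<in> borel_measurable (gen_field M D {int i - int m .. int i + int m + int L})"
    "max (\<integral>\<^sup>+\<omega>. ennreal (norm (X (int i) \<omega> - Xd i \<omega>)) \<partial>M)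
               (ennreal (1 / real L) * (\<integral>\<^sup>+\<omega>. ennreal (norm (Yvar X l f i n \<omega> - Yd i \<omega>)) \<partial>M))
             \<le> ennreal e" if "i \<in> {1..n}" for i
    using PXY[OF that] unfolding P_def by simp_all
  define R where "R = (\<lambda>k. {(k - 1) * L + 1..min (k * L) n})"
  have R: "i \<in> {1..n}" "(k - 1) * L + 1 \<le> i" "i \<le> k * L" if "i \<in> R k" for i k using that by (auto simp: R_def)
  have cR: "card (R k) \<le> L" if "k \<ge> 1" for k
  proof -
    have "R k \<subseteq> {(k - 1) * L + 1..k * L}" by (auto simp: R_def)
    then have "card (R k) \<le> card {(k - 1) * L + 1..k * L}" by (rule card_mono[rotated]) simp
    also have "\<dots> \<le> L" using that by (cases k) auto
    finally show ?thesis .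
  qed
  define V where "V = (\<lambda>k \<omega>. stack (sqrt (real L) *\<^sub>R ((1 / real L) *\<^sub>R (\<Sum>i\<in>R k. Xd i \<omega>))) ((1 / real L) *\<^sub>R (\<Sum>i\<in>R k. Yd i \<omega>)))"
  have Vm: "V k \<in> borel_measurable (gen_field M D J)"
    if "\<And>i. i \<in> R k \<Longrightarrow> {int i - int m .. int i + int m + int L} \<subseteq> J" for k J
  proof -
    have [measurable]: "Xd i \<in> borel_measurable (gen_field M D J)" if "i \<in> R k" for i
      by (rule gen_field_measurable_mono[OF D _ XY(1)[OF R(1)[OF that]]])
         (use \<open>\<And>i. i \<in> R k \<Longrightarrow> {int i - int m .. int i + int m + int L} \<subseteq> J\<close>[OF that] in auto)
    have [measurable]: "Yd i \<in> borel_measurable (gen_field M D J)" if "i \<in> R k" for i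
      by (rule gen_field_measurable_mono[OF D _ XY(2)[OF R(1)[OF that]]])
         (use \<open>\<And>i. i \<in> R k \<Longrightarrow> {int i - int m .. int i + int m + int L} \<subseteq> J\<close>[OF that] in auto)
    have "(\<lambda>\<omega>. \<Sum>i\<in>R k. Xd i \<omega>) \<in> borel_measurable (gen_field M D J)"
      "(\<lambda>\<omega>. \<Sum>i\<in>R k. Yd i \<omega>) \<in> borel_measurable (gen_field M D J)" by (intro borel_measurable_sum; measurable)+
    then show ?thesis unfolding V_def by (intro stack_measurable borel_measurable_scaleR) auto
  qed
  \<comment> \<open>everything up to the end of the window of block i, and from the start of the window of block j\<close>
  define Past where "Past = (\<lambda>i::int. gen_field M D {..(i + 1 + int r) * int L})"
  define Fut where "Fut = (\<lambda>j::int. gen_field M D {(j - 1 - int r) * int L..})"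
  have VP: "V k \<in> borel_measurable (Past i)" if "k \<in> {1..nb n}" "int k \<le> i" for k i
    unfolding Past_def
  proof (rule Vm)
    fix j assume "j \<in> R k"
    then have "int j \<le> int k * int L" using R(3)[of j k] by (simp flip: of_nat_mult)
    then have "int j + int m + int L \<le> (int k + 1 + int r) * int L" by (simp add: m_def algebra_simps)
    also have "\<dots> \<le> (i + 1 + int r) * int L" using that by (intro mult_right_mono) auto
    finally show "{int j - int m .. int j + int m + int L} \<subseteq> {..(i + 1 + int r) * int L}" by auto
  qed
  have VF: "V k \<in> borel_measurable (Fut j)" if "k \<in> {1..nb n}" "j \<le> int k" for k j
    unfolding Fut_def
  proof (rule Vm)
    fix i assume "i \<in> R k"
    then have "int ((k - 1) * L + 1) \<le> int i" using R(2)[of i k] by linarith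
    then have "(int k - 1) * int L + 1 \<le> int i" using that by (simp add: of_nat_diff)
    then have "(int k - 1 - int r) * int L \<le> int i - int m" by (simp add: m_def algebra_simps)
    moreover have "(j - 1 - int r) * int L \<le> (int k - 1 - int r) * int L" using that by (intro mult_right_mono) auto
    ultimately show "{int i - int m .. int i + int m + int L} \<subseteq> {(j - 1 - int r) * int L..}" by auto
  qed
  have mix: "alpha_mix M (Past i) (Fut j) \<eta>" if "i + int (3 * r + 2) \<le> j" for i j
    unfolding Past_def Fut_def
  proof (rule cond_C4_alpha_mix[OF prob_space_axioms D C4 m1 _ le\<eta>(2)])
    have "(i + 1 + int r) * int L + int m = (i + 1 + 2 * int r) * int L" by (simp add: m_def algebra_simps)
    also have "\<dots> \<le> (j - 1 - int r) * int L" using that by (intro mult_right_mono) auto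
    finally show "(i + 1 + int r) * int L + int m \<le> (j - 1 - int r) * int L" .
  qed
  have dist: "(\<integral>\<^sup>+\<omega>. ennreal (norm (W n k \<omega> - V k \<omega>)) \<partial>M) \<le> ennreal \<eta>" if k: "k \<in> {1..nb n}" for k
  proof -
    have Xm: "(\<lambda>\<omega>. ennreal (norm (X (int i) \<omega> - Xd i \<omega>))) \<in> borel_measurable M" if "i \<in> R k" for i
    proof -
      have [measurable]: "Xd i \<in> borel_measurable M" using measurable_from_subalg[OF gen_field_subalgebra(3)[OF D] XY(1)[OF R(1)[OF that]]] .
      have [measurable]: "X (int i) \<in> borel_measurable M" by (rule X_integrable)
      show ?thesis by measurable
    qed
    have Ym: "(\<lambda>\<omega>. ennreal (norm (Yvar X l f i n \<omega> - Yd i \<omega>))) \<in> borel_measurable M" if "i \<in> R k" for i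
    proof -
      have [measurable]: "Yd i \<in> borel_measurable M" using measurable_from_subalg[OF gen_field_subalgebra(3)[OF D] XY(2)[OF R(1)[OF that]]] .
      have [measurable]: "Yvar X l f i n \<in> borel_measurable M" by (rule Y_integrable) (use R(1)[OF that] n1 in auto)
      show ?thesis by measurable
    qed
    have "(\<integral>\<^sup>+\<omega>. ennreal (norm (W n k \<omega> - V k \<omega>)) \<partial>M) \<le>
      (\<integral>\<^sup>+\<omega>. (\<Sum>i\<in>R k. ennreal (norm (X (int i) \<omega> - Xd i \<omega>)) + ennreal (1 / real L) * ennreal (norm (Yvar X l f i n \<omega> - Yd i \<omega>))) \<partial>M)"
    proof (rule nn_integral_mono)
      fix \<omega>
      have "W n k \<omega> - V k \<omega> = stack (sqrt (real L) *\<^sub>R ((1 / real L) *\<^sub>R (\<Sum>i\<in>R k. X (int i) \<omega> - Xd i \<omega>)))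
           ((1 / real L) *\<^sub>R (\<Sum>i\<in>R k. Yvar X l f i n \<omega> - Yd i \<omega>))"
        unfolding V_def Wblock_def Xbar_def Ybar_def stack_diff R_def L_def
        by (simp only: sum_subtractf scaleR_diff_right)
      then have "norm (W n k \<omega> - V k \<omega>) \<le> norm (sqrt (real L) *\<^sub>R ((1 / real L) *\<^sub>R (\<Sum>i\<in>R k. X (int i) \<omega> - Xd i \<omega>)))
         + norm ((1 / real L) *\<^sub>R (\<Sum>i\<in>R k. Yvar X l f i n \<omega> - Yd i \<omega>))" by (simp only: norm_stack_le)
      also have "\<dots> \<le> (\<Sum>i\<in>R k. norm (X (int i) \<omega> - Xd i \<omega>)) + (1 / real L) * (\<Sum>i\<in>R k. norm (Yvar X l f i n \<omega> - Yd i \<omega>))"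
      proof (rule add_mono)
        have "sqrt (real L) * 1 \<le> sqrt (real L) * sqrt (real L)" using L1 by (intro mult_left_mono) auto
        then have "sqrt (real L) * (1 / real L) \<le> 1" using L1 by (simp add: divide_le_eq)
        then have "sqrt (real L) * (1 / real L) * norm (\<Sum>i\<in>R k. X (int i) \<omega> - Xd i \<omega>) \<le> 1 * (\<Sum>i\<in>R k. norm (X (int i) \<omega> - Xd i \<omega>))"
          by (intro mult_mono norm_sum) auto
        then show "norm (sqrt (real L) *\<^sub>R ((1 / real L) *\<^sub>R (\<Sum>i\<in>R k. X (int i) \<omega> - Xd i \<omega>))) \<le> (\<Sum>i\<in>R k. norm (X (int i) \<omega> - Xd i \<omega>))"
          by simp
        show "norm ((1 / real L) *\<^sub>R (\<Sum>i\<in>R k. Yvar X l f i n \<omega> - Yd i \<omega>)) \<le> (1 / real L) * (\<Sum>i\<in>R k. norm (Yvar X l f i n \<omega> - Yd i \<omega>))"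
          using norm_sum[of "\<lambda>i. Yvar X l f i n \<omega> - Yd i \<omega>" "R k"] by (simp add: divide_right_mono)
      qed
      also have "\<dots> = (\<Sum>i\<in>R k. norm (X (int i) \<omega> - Xd i \<omega>) + (1 / real L) * norm (Yvar X l f i n \<omega> - Yd i \<omega>))"
        by (simp only: sum.distrib sum_distrib_left)
      finally have "ennreal (norm (W n k \<omega> - V k \<omega>)) \<le> ennreal (\<Sum>i\<in>R k. norm (X (int i) \<omega> - Xd i \<omega>) + (1 / real L) * norm (Yvar X l f i n \<omega> - Yd i \<omega>))"
        by (rule ennreal_leI)
      also have "\<dots> = (\<Sum>i\<in>R k. ennreal (norm (X (int i) \<omega> - Xd i \<omega>) + (1 / real L) * norm (Yvar X l f i n \<omega> - Yd i \<omega>)))"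
        by (rule sum_ennreal[symmetric]) simp
      also have "\<dots> = (\<Sum>i\<in>R k. ennreal (norm (X (int i) \<omega> - Xd i \<omega>)) + ennreal (1 / real L) * ennreal (norm (Yvar X l f i n \<omega> - Yd i \<omega>)))"
        by (intro sum.cong refl) (simp add: ennreal_mult[symmetric] del: times_divide_eq_left)
      finally show "ennreal (norm (W n k \<omega> - V k \<omega>)) \<le> (\<Sum>i\<in>R k. ennreal (norm (X (int i) \<omega> - Xd i \<omega>)) + ennreal (1 / real L) * ennreal (norm (Yvar X l f i n \<omega> - Yd i \<omega>)))" .
    qed
    also have "\<dots> = (\<Sum>i\<in>R k. (\<integral>\<^sup>+\<omega>. ennreal (norm (X (int i) \<omega> - Xd i \<omega>)) \<partial>M) + ennreal (1 / real L) * (\<integral>\<^sup>+\<omega>. ennreal (norm (Yvar X l f i n \<omega> - Yd i \<omega>)) \<partial>M))"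
    proof -
      have "(\<integral>\<^sup>+\<omega>. (\<Sum>i\<in>R k. ennreal (norm (X (int i) \<omega> - Xd i \<omega>)) + ennreal (1 / real L) * ennreal (norm (Yvar X l f i n \<omega> - Yd i \<omega>))) \<partial>M)
        = (\<Sum>i\<in>R k. (\<integral>\<^sup>+\<omega>. ennreal (norm (X (int i) \<omega> - Xd i \<omega>)) + ennreal (1 / real L) * ennreal (norm (Yvar X l f i n \<omega> - Yd i \<omega>)) \<partial>M))"
        using Xm Ym by (intro nn_integral_sum borel_measurable_add borel_measurable_times_ennreal) auto
      also have "\<dots> = (\<Sum>i\<in>R k. (\<integral>\<^sup>+\<omega>. ennreal (norm (X (int i) \<omega> - Xd i \<omega>)) \<partial>M) + ennreal (1 / real L) * (\<integral>\<^sup>+\<omega>. ennreal (norm (Yvar X l f i n \<omega> - Yd i \<omega>)) \<partial>M))"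
        by (intro sum.cong refl, subst nn_integral_add) (use Xm Ym in \<open>auto simp: nn_integral_cmult\<close>)
      finally show ?thesis .
    qed
    also have "\<dots> \<le> (\<Sum>i\<in>R k. ennreal e + ennreal e)"
      using XY(3) R(1) by (intro sum_mono add_mono) auto
    also have "\<dots> = ennreal (\<Sum>i\<in>R k. e + e)" unfolding ennreal_plus[OF e0 e0, symmetric] by (rule sum_ennreal) (use e0 in simp)
    also have "\<dots> \<le> ennreal \<eta>"
    proof (rule ennreal_leI)
      have "(\<Sum>i\<in>R k. e + e) = real (card (R k)) * (2 * e)" by simp
      also have "\<dots> \<le> real L * (2 * e)" using cR[of k] k e0 by (intro mult_right_mono) auto
      finally show "(\<Sum>i\<in>R k. e + e) \<le> \<eta>" using le\<eta>(1) by simp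
    qed
    finally show ?thesis .
  qed
  have VM: "V k \<in> borel_measurable M" for k
    by (rule measurable_from_subalg[OF gen_field_subalgebra(3)[OF D, where J = UNIV]], rule Vm) auto
  have "block_approx M (nb n) (W n) V (3 * r + 2) \<eta>"
    unfolding block_approx_def
    by (intro exI[of _ Past] exI[of _ Fut] conjI ballI allI impI) (simp_all only: VM dist VP VF mix)
  then show ?thesis unfolding \<eta>_def \<kappa>_def L_def m_def by (auto simp: mult.assoc)
qed

end

section \<open>Splitting the tail moment\<close>

context block_process begin

text \<open>
  If |S| > x, then some \<theta> in the net has (1-\<epsilon>)|S| \<le> \<theta> \<bullet> S,
  which is at most the clipped sum plus aZ. Hence either a block exceeds c, or the clipped sum
  exceeds (1-\<epsilon>)x. The clipped sum itself is below y outside an event so rare that the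
  trivial bound 2n may be used on it.
\<close>

lemma tail_moment_split:
  fixes \<Theta> :: "(real^('p + 'q)) set" and \<epsilon> x y c q1 q2 p0 qZ :: real and n u :: nat
  defines "a \<equiv> sqrt (real (l n) / real n)"
  assumes n: "n \<ge> 1" and u: "u \<ge> 1"
    and fin: "finite \<Theta>" and unit: "\<And>\<theta>. \<theta> \<in> \<Theta> \<Longrightarrow> norm \<theta> = 1"
    and net: "\<And>v. v \<noteq> 0 \<Longrightarrow> \<exists>\<theta>\<in>\<Theta>. (1 - \<epsilon>) * norm v \<le> \<theta> \<bullet> v" and \<epsilon>: "\<epsilon> \<le> 1 / 2"
    and x: "x \<ge> 0" and y: "y \<ge> 0" and c: "c > 0" and abc: "a * (real (nb n) * c) \<le> 2 * real n"
    and P1: "\<And>\<theta>. \<theta> \<in> \<Theta> \<Longrightarrow> prob {\<omega>\<in>space M. a * (\<Sum>k=1..nb n. clip c (\<theta> \<bullet> W n k \<omega>)) > (1 - \<epsilon>) * x} \<le> q1"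
    and P2: "\<And>\<theta>. \<theta> \<in> \<Theta> \<Longrightarrow> prob {\<omega>\<in>space M. a * (\<Sum>k=1..nb n. clip c (\<theta> \<bullet> W n k \<omega>)) > y} \<le> q2"
    and P0: "\<And>k. k \<in> {1..nb n} \<Longrightarrow> prob {\<omega>\<in>space M. norm (W n k \<omega>) > c} \<le> p0"
    and Z: "(\<integral>\<^sup>+\<omega>. ennreal ((\<Sum>k=1..nb n. if norm (W n k \<omega>) > c then norm (W n k \<omega>) else 0) ^ u) \<partial>M) \<le> ennreal qZ"
    and q0: "q1 \<ge> 0" "q2 \<ge> 0" "p0 \<ge> 0" "qZ \<ge> 0"
  shows "(\<integral>\<^sup>+\<omega>. ennreal ((1 + norm (Ssum X l f n \<omega>) ^ u) * indicator {\<omega>. norm (Ssum X l f n \<omega>) > x} \<omega>) \<partial>M)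
    \<le> ennreal ((1 + 6 ^ u * y ^ u) * (real (card \<Theta>) * q1 + real (nb n) * p0)
        + (6 ^ u * (2 * real n) ^ u * (real (card \<Theta>) * q2) + 6 ^ u * a ^ u * qZ))"
proof -
  define b where "b = nb n"
  have a0: "a \<ge> 0" by (simp add: a_def)
  define S where "S = Ssum X l f n"
  define T where "T = (\<lambda>\<theta> \<omega>. a * (\<Sum>k=1..b. clip c (\<theta> \<bullet> W n k \<omega>)))"
  define Zs where "Zs = (\<lambda>\<omega>. \<Sum>k=1..b. if norm (W n k \<omega>) > c then norm (W n k \<omega>) else 0)"
  define A1 where "A1 = (\<Union>\<theta>\<in>\<Theta>. {\<omega>\<in>space M. T \<theta> \<omega> > (1 - \<epsilon>) * x})"
  define A2 where "A2 = (\<Union>\<theta>\<in>\<Theta>. {\<omega>\<in>space M. T \<theta> \<omega> > y})"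
  define A0 where "A0 = (\<Union>k\<in>{1..b}. {\<omega>\<in>space M. norm (W n k \<omega>) > c})"
  have Wm[measurable]: "W n k \<in> borel_measurable M" for k by (rule W_measurable[OF n])
  have Tm[measurable]: "T \<theta> \<in> borel_measurable M" for \<theta> unfolding T_def by measurable
  have Zm[measurable]: "Zs \<in> borel_measurable M" unfolding Zs_def by measurable
  have Sm[measurable]: "S \<in> borel_measurable M" unfolding S_def by (rule S_measurable[OF n])
  have AM: "A1 \<in> sets M" "A2 \<in> sets M" "A0 \<in> sets M"
    unfolding A1_def A2_def A0_def using fin by (auto intro!: sets.finite_UN)
  have PA1: "prob A1 \<le> real (card \<Theta>) * q1"
  proof -
    have "prob A1 \<le> (\<Sum>\<theta>\<in>\<Theta>. prob {\<omega>\<in>space M. T \<theta> \<omega> > (1 - \<epsilon>) * x})"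
      unfolding A1_def by (rule finite_measure_subadditive_finite[OF fin]) auto
    also have "\<dots> \<le> (\<Sum>\<theta>\<in>\<Theta>. q1)" unfolding T_def b_def by (intro sum_mono P1)
    finally show ?thesis by simp
  qed
  have PA2: "prob A2 \<le> real (card \<Theta>) * q2"
  proof -
    have "prob A2 \<le> (\<Sum>\<theta>\<in>\<Theta>. prob {\<omega>\<in>space M. T \<theta> \<omega> > y})"
      unfolding A2_def by (rule finite_measure_subadditive_finite[OF fin]) auto
    also have "\<dots> \<le> (\<Sum>\<theta>\<in>\<Theta>. q2)" unfolding T_def b_def by (intro sum_mono P2)
    finally show ?thesis by simp
  qed
  have PA0: "prob A0 \<le> real b * p0"
  proof -
    have "prob A0 \<le> (\<Sum>k\<in>{1..b}. prob {\<omega>\<in>space M. norm (W n k \<omega>) > c})"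
      unfolding A0_def by (rule finite_measure_subadditive_finite) auto
    also have "\<dots> \<le> (\<Sum>k\<in>{1..b}. p0)" unfolding b_def by (intro sum_mono P0)
    finally show ?thesis by simp
  qed
  have Z0: "0 \<le> Zs \<omega>" for \<omega> unfolding Zs_def by (intro sum_nonneg) auto
  define N1 where "N1 = 1 + 6 ^ u * y ^ u"
  define N2 where "N2 = 6 ^ u * (2 * real n) ^ u"
  define N3 where "N3 = 6 ^ u * a ^ u"
  have N0: "N1 \<ge> 0" "N2 \<ge> 0" "N3 \<ge> 0" using y a0 by (auto simp: N1_def N2_def N3_def)
  have pt: "(1 + norm (S \<omega>) ^ u) * indicator {\<omega>. norm (S \<omega>) > x} \<omega>
      \<le> N1 * (indicator A1 \<omega> + indicator A0 \<omega>) + (N2 * indicator A2 \<omega> + N3 * Zs \<omega> ^ u)"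
    if \<omega>: "\<omega> \<in> space M" for \<omega>
  proof (cases "norm (S \<omega>) > x")
    case False
    then show ?thesis using N0 Z0[of \<omega>] by simp
  next
    case True
    then have "S \<omega> \<noteq> 0" using x by auto
    then obtain \<theta> where \<theta>: "\<theta> \<in> \<Theta>" "(1 - \<epsilon>) * norm (S \<omega>) \<le> \<theta> \<bullet> S \<omega>" using net by blast
    have term_le: "\<theta> \<bullet> W n k \<omega> \<le> clip c (\<theta> \<bullet> W n k \<omega>) + (if norm (W n k \<omega>) > c then norm (W n k \<omega>) else 0)" for k
    proof -
      have le: "\<bar>\<theta> \<bullet> W n k \<omega>\<bar> \<le> norm (W n k \<omega>)"
        using Cauchy_Schwarz_ineq2[of \<theta> "W n k \<omega>"] unit[OF \<theta>(1)] by simp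
      show ?thesis
      proof (cases "norm (W n k \<omega>) > c")
        case True
        then show ?thesis using clip_diff_le[of c "\<theta> \<bullet> W n k \<omega>"] c le by simp
      next
        case False
        then show ?thesis using clip_eq[of "\<theta> \<bullet> W n k \<omega>" c] le by simp
      qed
    qed
    have "\<theta> \<bullet> S \<omega> = a * (\<Sum>k=1..b. \<theta> \<bullet> W n k \<omega>)" unfolding S_def b_def a_def by (rule inner_S[OF n])
    also have "\<dots> \<le> a * (\<Sum>k=1..b. clip c (\<theta> \<bullet> W n k \<omega>) + (if norm (W n k \<omega>) > c then norm (W n k \<omega>) else 0))"
      using a0 term_le by (intro mult_left_mono sum_mono) auto
    also have "\<dots> = T \<theta> \<omega> + a * Zs \<omega>" by (simp add: T_def Zs_def sum.distrib distrib_left)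
    finally have up: "(1 - \<epsilon>) * norm (S \<omega>) \<le> T \<theta> \<omega> + a * Zs \<omega>" using \<theta>(2) by linarith
    have ind: "1 \<le> indicator A1 \<omega> + (indicator A0 \<omega> :: real)"
    proof (cases "\<omega> \<in> A0")
      case False
      then have "Zs \<omega> = 0" unfolding Zs_def A0_def using \<omega> by (intro sum.neutral) auto
      then have "(1 - \<epsilon>) * norm (S \<omega>) \<le> T \<theta> \<omega>" using up by simp
      moreover have "(1 - \<epsilon>) * x < (1 - \<epsilon>) * norm (S \<omega>)" using True \<epsilon> by (intro mult_strict_left_mono) auto
      ultimately have "(1 - \<epsilon>) * x < T \<theta> \<omega>" by linarith
      then have "\<omega> \<in> A1" unfolding A1_def using \<theta>(1) \<omega> by auto
      then show ?thesis by (simp add: indicator_def)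
    qed (simp add: indicator_def)
    have Tle: "T \<theta> \<omega> \<le> y + 2 * real n * indicator A2 \<omega>"
    proof (cases "T \<theta> \<omega> > y")
      case True
      then have "\<omega> \<in> A2" unfolding A2_def using \<theta>(1) \<omega> by auto
      moreover have "T \<theta> \<omega> \<le> a * (\<Sum>k=1..b. c)"
        unfolding T_def using a0 clip_bound[of c] c by (intro mult_left_mono sum_mono) (auto simp: abs_le_iff)
      ultimately show ?thesis using abc y by (simp add: b_def)
    qed (simp add: indicator_def)
    have "norm (S \<omega>) / 2 \<le> (1 - \<epsilon>) * norm (S \<omega>)" using mult_right_mono[of "1/2" "1 - \<epsilon>" "norm (S \<omega>)"] \<epsilon> by simp
    then have half: "norm (S \<omega>) / 2 \<le> T \<theta> \<omega> + a * Zs \<omega>" using up by (rule order_trans)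
    have "norm (S \<omega>) \<le> 2 * (T \<theta> \<omega> + a * Zs \<omega>)" using half by simp
    also have "\<dots> \<le> 2 * (y + 2 * real n * indicator A2 \<omega> + a * Zs \<omega>)" using Tle by (intro mult_left_mono add_right_mono) simp_all
    finally have "norm (S \<omega>) \<le> 2 * (y + 2 * real n * indicator A2 \<omega> + a * Zs \<omega>)" .
    then have "norm (S \<omega>) ^ u \<le> (2 * (y + 2 * real n * indicator A2 \<omega> + a * Zs \<omega>)) ^ u" by (intro power_mono) auto
    also have "\<dots> = 2 ^ u * (\<Sum>i\<in>{0,1,2::nat}. (if i = 0 then y else if i = 1 then 2 * real n * indicator A2 \<omega> else a * Zs \<omega>)) ^ u"
      by (subst power_mult_distrib) (simp add: add.assoc)
    also have "\<dots> \<le> 2 ^ u * (real (card {0,1,2::nat}) ^ u * (\<Sum>i\<in>{0,1,2::nat}. (if i = 0 then y else if i = 1 then 2 * real n * indicator A2 \<omega> else a * Zs \<omega>) ^ u))"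
      using y a0 Z0[of \<omega>] u by (intro mult_left_mono power_sum_le) auto
    also have "\<dots> = (2 ^ u * 3 ^ u) * (y ^ u + ((2 * real n * indicator A2 \<omega>) ^ u + (a * Zs \<omega>) ^ u))" by simp
    also have "(2 * real n * indicator A2 \<omega>) ^ u = (2 * real n) ^ u * indicator A2 \<omega>"
      using u by (simp add: indicator_def power_0_left)
    also have "(2::real) ^ u * 3 ^ u = 6 ^ u" by (simp flip: power_mult_distrib)
    finally have Su: "norm (S \<omega>) ^ u \<le> 6 ^ u * (y ^ u + ((2 * real n) ^ u * indicator A2 \<omega> + (a * Zs \<omega>) ^ u))" .
    have "(1 + norm (S \<omega>) ^ u) * indicator {\<omega>. norm (S \<omega>) > x} \<omega> = 1 + norm (S \<omega>) ^ u" using True by simp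
    also have "\<dots> \<le> N1 + (N2 * indicator A2 \<omega> + N3 * Zs \<omega> ^ u)"
      using Su by (simp add: N1_def N2_def N3_def algebra_simps power_mult_distrib)
    also have "\<dots> = N1 * 1 + (N2 * indicator A2 \<omega> + N3 * Zs \<omega> ^ u)" by simp
    also have "\<dots> \<le> N1 * (indicator A1 \<omega> + indicator A0 \<omega>) + (N2 * indicator A2 \<omega> + N3 * Zs \<omega> ^ u)"
      by (intro add_right_mono mult_left_mono ind N0)
    finally show ?thesis .
  qed
  have "(\<integral>\<^sup>+\<omega>. ennreal ((1 + norm (S \<omega>) ^ u) * indicator {\<omega>. norm (S \<omega>) > x} \<omega>) \<partial>M)
     \<le> (\<integral>\<^sup>+\<omega>. (ennreal N1 * indicator A1 \<omega> + ennreal N1 * indicator A0 \<omega>) + (ennreal N2 * indicator A2 \<omega> + ennreal N3 * ennreal (Zs \<omega> ^ u)) \<partial>M)"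
  proof (rule nn_integral_mono)
    fix \<omega> assume "\<omega> \<in> space M"
    have "ennreal ((1 + norm (S \<omega>) ^ u) * indicator {\<omega>. norm (S \<omega>) > x} \<omega>)
       \<le> ennreal (N1 * (indicator A1 \<omega> + indicator A0 \<omega>) + (N2 * indicator A2 \<omega> + N3 * Zs \<omega> ^ u))"
      by (intro ennreal_leI pt) fact
    also have "\<dots> = (ennreal N1 * indicator A1 \<omega> + ennreal N1 * indicator A0 \<omega>) + (ennreal N2 * indicator A2 \<omega> + ennreal N3 * ennreal (Zs \<omega> ^ u))"
      using N0 Z0[of \<omega>] by (simp add: ennreal_mult ennreal_indicator distrib_left)
    finally show "ennreal ((1 + norm (S \<omega>) ^ u) * indicator {\<omega>. norm (S \<omega>) > x} \<omega>)
      \<le> (ennreal N1 * indicator A1 \<omega> + ennreal N1 * indicator A0 \<omega>) + (ennreal N2 * indicator A2 \<omega> + ennreal N3 * ennreal (Zs \<omega> ^ u))" .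
  qed
  also have "\<dots> = (ennreal N1 * ennreal (prob A1) + ennreal N1 * ennreal (prob A0)) + (ennreal N2 * ennreal (prob A2) + ennreal N3 * (\<integral>\<^sup>+\<omega>. ennreal (Zs \<omega> ^ u) \<partial>M))"
    using AM by (simp add: nn_integral_add nn_integral_cmult nn_integral_cmult_indicator emeasure_eq_measure)
  also have "\<dots> \<le> (ennreal N1 * ennreal (real (card \<Theta>) * q1) + ennreal N1 * ennreal (real b * p0)) + (ennreal N2 * ennreal (real (card \<Theta>) * q2) + ennreal N3 * ennreal qZ)"
    using PA1 PA0 PA2 Z unfolding Zs_def b_def by (intro add_mono mult_left_mono ennreal_leI) auto
  also have "\<dots> = ennreal (N1 * (real (card \<Theta>) * q1) + N1 * (real b * p0) + (N2 * (real (card \<Theta>) * q2) + N3 * qZ))"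
    using N0 q0 by (simp add: ennreal_mult)
  finally show ?thesis unfolding S_def N1_def N2_def N3_def b_def by (simp add: distrib_left mult.assoc)
qed

end

section \<open>The rates of the four error terms\<close>

lemma eventually_root_dominates_log:
  fixes \<kappa> :: real assumes "\<kappa> > 0"
  shows "\<forall>\<^sub>F n in sequentially. real n powr (\<kappa> / 4) \<le> sqrt (\<kappa> * real n powr \<kappa>) / (2 * ln (real n))"
  using assms by real_asymp

lemma eventually_log_power_le:
  fixes e :: real assumes "e > 0"
  shows "\<forall>\<^sub>F n in sequentially. ln (real n) ^ k * real n powr - e \<le> 1"
proof -
  have "((\<lambda>n. ln (real n) powr real k * real n powr - e) \<longlongrightarrow> 0) sequentially"
    using assms by real_asymp
  then have "\<forall>\<^sub>F n in sequentially. ln (real n) powr real k * real n powr - e < 1" by (rule order_tendstoD(2)) simp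
  then show ?thesis using eventually_ge_at_top[of 3]
  proof eventually_elim
    case (elim n)
    then have "ln (real n) > 0" by simp
    then show ?case using elim by (simp add: powr_realpow)
  qed
qed

lemma sqrt_power_eq_powr: "b > 0 \<Longrightarrow> sqrt b ^ k = b powr (real k / 2)"
  by (simp add: powr_half_sqrt[symmetric] powr_realpow[symmetric] powr_powr)

text \<open>
  The truncation level 2^m is of the order of b^(1/2)/L, and its inverse powers turn into powers
  of b at the cost of powers of the logarithm L.
\<close>

lemma inverse_dyadic_le:
  fixes b L :: real
  assumes "b > 0" "L \<ge> 1" "sqrt b / (2 * L) \<le> 2 ^ m"
  shows "1 / 2 ^ (m * k) \<le> (2 * L) ^ k * b powr - (real k / 2)"
proof -
  have "(sqrt b / (2 * L)) ^ k \<le> (2 ^ m) ^ k" using assms by (intro power_mono) auto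
  then have "b powr (real k / 2) / (2 * L) ^ k \<le> 2 ^ (m * k)"
    using assms by (simp add: power_divide sqrt_power_eq_powr power_mult)
  then show ?thesis using assms by (simp add: powr_minus divide_simps mult_ac)
qed

text \<open>
  The probability that some block exceeds the truncation level: the factor m^(-2s^2) in
  \<open>level_rate\<close> is of the order of L^(-2s^2) and beats the factor L^(2s) from the
  moment and from the truncation level.
\<close>

lemma rate_term_level:
  fixes b L Q :: real
  assumes s: "s \<ge> 3" and b: "b > 0" and L: "L \<ge> 1" and m: "sqrt b / (2 * L) \<le> 2 ^ m" and Q: "Q \<ge> 1" "L \<le> Q * real m"
  shows "L ^ s * (b * level_rate s m) \<le> 2 ^ s * Q ^ (2 * s\<^sup>2) * (b powr (- (real s - 2) / 2) / L\<^sup>2)"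
proof -
  have m0: "real m > 0" using Q L by (cases m) auto
  have inv: "1 / real m ^ (2 * s\<^sup>2) \<le> Q ^ (2 * s\<^sup>2) / L ^ (2 * s\<^sup>2)"
  proof -
    have "L ^ (2 * s\<^sup>2) \<le> (Q * real m) ^ (2 * s\<^sup>2)" using L Q by (intro power_mono) auto
    then show ?thesis using m0 L by (simp add: power_mult_distrib divide_simps mult_ac)
  qed
  have "level_rate s m = (1 / 2 ^ (m * s)) * (1 / real m ^ (2 * s\<^sup>2))" by (simp add: level_rate_def)
  also have "\<dots> \<le> ((2 * L) ^ s * b powr - (real s / 2)) * (Q ^ (2 * s\<^sup>2) / L ^ (2 * s\<^sup>2))"
    using inverse_dyadic_le[OF b L m, of s] inv L by (intro mult_mono) auto
  finally have "L ^ s * (b * level_rate s m) \<le> L ^ s * (b * (((2 * L) ^ s * b powr - (real s / 2)) * (Q ^ (2 * s\<^sup>2) / L ^ (2 * s\<^sup>2))))"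
    using b L by (intro mult_left_mono) auto
  also have "\<dots> = 2 ^ s * Q ^ (2 * s\<^sup>2) * ((b * b powr - (real s / 2)) * (L ^ (2 * s) * (1 / L ^ (2 * s\<^sup>2))))"
  proof -
    have "(2 * L) ^ s = 2 ^ s * L ^ s" by (rule power_mult_distrib)
    moreover have "L ^ (2 * s) = L ^ s * L ^ s" unfolding mult_2 by (rule power_add)
    ultimately have e: "L ^ s * (2 * L) ^ s = 2 ^ s * L ^ (2 * s)" by (simp only: mult_ac)
    have reorder: "x * (c * ((y * p) * (q / r))) = (x * y) * (q * ((c * p) * (1 / r)))" for x y c p q r :: real by simp
    show ?thesis by (subst reorder, subst e) (simp only: mult_ac)
  qed
  also have "b * b powr - (real s / 2) = b powr (- (real s - 2) / 2)"
  proof -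
    have "b powr 1 * b powr - (real s / 2) = b powr (1 + - (real s / 2))" by (simp only: powr_add)
    also have "1 + - (real s / 2) = - (real s - 2) / 2" by (simp add: field_simps)
    finally show ?thesis using b by (simp only: powr_one less_imp_le)
  qed
  also have "2 ^ s * Q ^ (2 * s\<^sup>2) * (b powr (- (real s - 2) / 2) * (L ^ (2 * s) * (1 / L ^ (2 * s\<^sup>2))))
     \<le> 2 ^ s * Q ^ (2 * s\<^sup>2) * (b powr (- (real s - 2) / 2) * (1 / L\<^sup>2))"
  proof (intro mult_left_mono)
    have "s * s \<ge> 3 * s" using s by (intro mult_right_mono) auto
    then have "2 * s + 2 \<le> 2 * s\<^sup>2" using s unfolding power2_eq_square by linarith
    then have "L ^ (2 * s) * L\<^sup>2 \<le> L ^ (2 * s\<^sup>2)" unfolding power_add[symmetric] using L by (rule power_increasing)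
    then show "L ^ (2 * s) * (1 / L ^ (2 * s\<^sup>2)) \<le> 1 / L\<^sup>2" using L by (simp add: divide_simps)
  qed (use Q in auto)
  finally show ?thesis by simp
qed

text \<open>
  Exponents of b: the block count contributes 1, the normalisation -u/2 and the truncation level
  -(s-u)/2.
\<close>

lemma rate_term_excess:
  fixes b L Q a :: real
  assumes u: "u = 2 * (s div 2)" and b: "b > 0" and L: "L \<ge> 1" and m: "sqrt b / (2 * L) \<le> 2 ^ m" and Q: "Q \<ge> 1" "L \<le> Q * real m"
    and a: "a \<ge> 0" "a\<^sup>2 \<le> 2 / b"
  shows "a ^ u * (b / (2 ^ (m * (s - u)) * real m ^ 3)) \<le> 2 ^ s * 2 * Q ^ 3 * (b powr (- (real s - 2) / 2) / L\<^sup>2)"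
proof -
  have m0: "real m > 0" using Q L by (cases m) auto
  define v where "v = s div 2"
  define k where "k = s - u"
  have k: "k \<le> 1" "s = 2 * v + k" unfolding k_def u v_def by linarith+
  have inv: "1 / real m ^ 3 \<le> Q ^ 3 / L ^ 3"
  proof -
    have "L ^ 3 \<le> (Q * real m) ^ 3" using L Q by (intro power_mono) auto
    then show ?thesis using m0 L by (simp add: power_mult_distrib divide_simps mult_ac)
  qed
  have au: "a ^ u \<le> 2 ^ s * b powr - real v"
  proof -
    have "a ^ u = (a\<^sup>2) ^ v" unfolding u v_def by (rule power_mult)
    also have "\<dots> \<le> (2 / b) ^ v" using a by (intro power_mono) auto
    also have "\<dots> = 2 ^ v * b powr - real v" using b by (simp add: power_divide powr_minus powr_realpow divide_simps)
    also have "\<dots> \<le> 2 ^ s * b powr - real v" using k by (intro mult_right_mono power_increasing) auto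
    finally show ?thesis .
  qed
  have k2: "(2 * L) ^ k \<le> 2 * L"
    using power_increasing[of k 1 "2 * L"] k L by simp
  have "1 / (2 ^ (m * k) * real m ^ 3) = (1 / 2 ^ (m * k)) * (1 / real m ^ 3)" by simp
  also have "\<dots> \<le> ((2 * L) ^ k * b powr - (real k / 2)) * (Q ^ 3 / L ^ 3)"
    using inverse_dyadic_le[OF b L m, of k] inv L by (intro mult_mono) auto
  also have "\<dots> \<le> ((2 * L) * b powr - (real k / 2)) * (Q ^ 3 / L ^ 3)"
    using k2 Q L by (intro mult_right_mono) auto
  finally have hb: "b * (1 / (2 ^ (m * k) * real m ^ 3)) \<le> b * (((2 * L) * b powr - (real k / 2)) * (Q ^ 3 / L ^ 3))"
    using b by (intro mult_left_mono) auto
  have "a ^ u * (b * (1 / (2 ^ (m * k) * real m ^ 3))) \<le> (2 ^ s * b powr - real v) * (b * (((2 * L) * b powr - (real k / 2)) * (Q ^ 3 / L ^ 3)))"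
    by (rule mult_mono[OF au hb]) (use b in auto)
  also have "\<dots> = 2 ^ s * 2 * Q ^ 3 * ((b powr - real v * b * b powr - (real k / 2)) * (L / L ^ 3))" by simp
  also have "b powr - real v * b * b powr - (real k / 2) = b powr (- (real s - 2) / 2)"
  proof -
    have "b powr - real v * b powr 1 * b powr - (real k / 2) = b powr (- real v + 1 + - (real k / 2))" by (simp only: powr_add)
    also have "- real v + 1 + - (real k / 2) = - (real s - 2) / 2" unfolding k(2) by (simp add: field_simps)
    finally show ?thesis using b by (simp only: powr_one less_imp_le)
  qed
  also have "L / L ^ 3 = 1 / L\<^sup>2" using L by (simp add: eval_nat_numeral)
  finally show ?thesis by (simp add: k_def)
qed

lemma powr_anti_base: "0 < b \<Longrightarrow> b \<le> n \<Longrightarrow> 0 \<le> p \<Longrightarrow> n powr - p \<le> b powr - (p::real)"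
  by (simp add: powr_minus powr_mono2 le_imp_inverse_le)

text \<open>
  The surplus e in the exponent absorbs the logarithms.
\<close>

lemma rate_term_gaussian:
  fixes b L n E e :: real
  assumes s: "s \<ge> 3" and b: "0 < b" "b \<le> n" and L: "L \<ge> 1" and le: "L ^ (s + 2) * n powr - e \<le> 1" and E: "E = (real s - 2) / 2 + e"
  shows "L ^ s * n powr - E \<le> b powr (- (real s - 2) / 2) / L\<^sup>2"
proof -
  have "L ^ s * n powr - E = n powr - ((real s - 2) / 2) * (L ^ (s + 2) * n powr - e) / L\<^sup>2"
  proof -
    have "n powr - E = n powr - ((real s - 2) / 2) * n powr - e" by (simp add: E powr_add[symmetric])
    moreover have "L ^ (s + 2) = L ^ s * L\<^sup>2" by (rule power_add)
    moreover have "x * (p * q) = p * ((x * r) * q) / r" if "r \<noteq> 0" for x p q r :: real using that by simp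
    moreover have "L\<^sup>2 \<noteq> 0" using L by simp
    ultimately show ?thesis by metis
  qed
  also have "\<dots> \<le> b powr - ((real s - 2) / 2) * 1 / L\<^sup>2"
    using le b s L by (intro divide_right_mono mult_mono powr_anti_base) auto
  finally show ?thesis by (simp add: minus_divide_left)
qed

lemma rate_term_crude:
  fixes b L n :: real
  assumes s: "s \<ge> 3" and u: "u \<le> s" and b: "0 < b" "b \<le> n" and n: "n \<ge> 1" and L: "L \<ge> 1" "L \<le> n"
  shows "n ^ u * n powr - (2 * real s) \<le> b powr (- (real s - 2) / 2) / L\<^sup>2"
proof -
  have "n ^ u \<le> n powr real s" using n power_increasing[OF u n] by (simp add: powr_realpow)
  then have "n ^ u * n powr - (2 * real s) \<le> n powr real s * n powr - (2 * real s)" by (rule mult_right_mono) simp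
  also have "\<dots> = n powr - ((real s - 2) / 2) * n powr - ((real s + 2) / 2)"
    by (simp add: powr_add[symmetric] field_simps)
  also have "\<dots> \<le> b powr - ((real s - 2) / 2) * (1 / L\<^sup>2)"
  proof (intro mult_mono powr_anti_base b)
    have "n powr - ((real s + 2) / 2) \<le> n powr - 2" using n s by (intro powr_mono) auto
    also have "\<dots> = 1 / n\<^sup>2" using n by (simp add: powr_minus powr_numeral divide_simps)
    also have "\<dots> \<le> 1 / L\<^sup>2" using L by (intro divide_left_mono power_mono) auto
    finally show "n powr - ((real s + 2) / 2) \<le> 1 / L\<^sup>2" .
  qed (use s in auto)
  finally show ?thesis by (simp add: minus_divide_left)
qed

section \<open>The excess of the blocks of a process\<close>

lemma exp_minus_le_level_rate:
  assumes "m \<ge> 1" shows "exp (- (real (s + 2 * s\<^sup>2) * real m)) \<le> level_rate s m"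
proof -
  have m: "real m > 0" using assms by simp
  have "(2::real) ^ (m * s) \<le> exp 1 ^ (m * s)" using exp_ge_add_one_self[of 1] by (intro power_mono) auto
  moreover have "real m ^ (2 * s\<^sup>2) \<le> exp (real m) ^ (2 * s\<^sup>2)"
  proof (rule power_mono)
    show "real m \<le> exp (real m)" using exp_ge_add_one_self[of "real m"] by linarith
  qed simp
  ultimately have "2 ^ (m * s) * real m ^ (2 * s\<^sup>2) \<le> exp 1 ^ (m * s) * exp (real m) ^ (2 * s\<^sup>2)"
    by (intro mult_mono) auto
  also have "\<dots> = exp (real (s + 2 * s\<^sup>2) * real m)"
    by (simp add: exp_of_nat_mult[symmetric] exp_add[symmetric] algebra_simps)
  finally have "1 / exp (real (s + 2 * s\<^sup>2) * real m) \<le> 1 / (2 ^ (m * s) * real m ^ (2 * s\<^sup>2))"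
    using m by (intro divide_left_mono) auto
  then show ?thesis by (simp add: level_rate_def exp_minus inverse_eq_divide)
qed

lemma level_rate_le:
  assumes "s \<ge> 3" "m \<ge> 1" shows "4 ^ m * (real m)\<^sup>2 * level_rate s m \<le> 1 / real m"
proof -
  have m: "real m \<ge> 1" using assms by simp
  have "(4::real) ^ m = 2 ^ (2 * m)" by (simp add: power_mult)
  also have "\<dots> \<le> 2 ^ (m * s)" using assms by (intro power_increasing) auto
  finally have 1: "(4::real) ^ m \<le> 2 ^ (m * s)" .
  have "3 \<le> 2 * s\<^sup>2" using assms power_increasing[of 1 2 s] by simp
  then have 2: "real m ^ 3 \<le> real m ^ (2 * s\<^sup>2)" using m by (intro power_increasing)
  have "(4 ^ m * (real m)\<^sup>2) * real m = 4 ^ m * real m ^ 3" by (simp add: eval_nat_numeral)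
  also have "\<dots> \<le> 2 ^ (m * s) * real m ^ (2 * s\<^sup>2)" using 1 2 by (intro mult_mono) auto
  finally show ?thesis using m by (simp add: level_rate_def divide_simps mult_ac)
qed

lemma dyadic_below:
  fixes y :: real assumes "y \<ge> 1" obtains m where "2 ^ m \<le> y" "y < 2 ^ Suc m"
proof -
  define n where "n = (LEAST n. y < 2 ^ n)"
  obtain N where N: "y < 2 ^ N" using real_arch_pow[of 2 y] by auto
  have n1: "y < 2 ^ n" unfolding n_def by (rule LeastI[where P = "\<lambda>n. y < 2 ^ n", OF N])
  have "n \<noteq> 0" using n1 assms by (intro notI) simp
  then obtain m where m: "n = Suc m" by (cases n) auto
  have "\<not> y < 2 ^ m" using not_less_Least[of m "\<lambda>n. y < 2 ^ n"] m by (simp add: n_def)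
  then show ?thesis using that[of m] n1 m by simp
qed

context block_process begin

text \<open>
  The index m0 of the truncation level is at least a multiple of log n, so that n \<le> e^(Qm) at
  every level m \<ge> m0. A gap of rm blocks then gives a mixing error e^(-\<kappa> r m) that
  beats any power of n and of 2^m once the constant r is large.
\<close>

lemma excess_sum_moment:
  fixes Q R :: real and n m0 r u :: nat
  defines "\<rho>' \<equiv> 2 * \<rho> * (4 ^ s * 8 ^ (2 * s\<^sup>2))"
  assumes C3: "cond_C3 \<kappa>3 M X D l f" and C4: "cond_C4 \<kappa>4 M D" and \<kappa>: "\<kappa>3 \<in> {0<..<1}" "\<kappa>4 \<in> {0<..<1}"
    and n: "real n > 1 / \<kappa>3" and u: "1 \<le> u" "u \<le> s"
    and Q: "Q \<ge> 1" "ln (real n) \<le> Q * real m0" "ln (real n) \<ge> 1"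
    and bm: "sqrt (real (nb n)) / ln (real n) < 2 ^ Suc m0"
    and r: "real r > 1 / \<kappa>3" "min \<kappa>3 \<kappa>4 * real r \<ge> Q * real (s + 1) + real (s + 2 * s\<^sup>2) + 6 / min \<kappa>3 \<kappa>4"
    and m0: "m0 \<ge> 3" "real m0 \<ge> 8 * 2 ^ s * (\<rho>' + 1) * Q\<^sup>2"
  shows "(\<integral>\<^sup>+\<omega>. ennreal ((\<Sum>k=1..nb n. if norm (W n k \<omega>) > 2 ^ m0 then norm (W n k \<omega>) else 0) ^ u) \<partial>M)
    \<le> ennreal (2 * 8 ^ u * (real (3 * r + 2) ^ (u + 1) * (2 * 2 ^ u * (\<rho>' + 1)) + 1)
        * (real (nb n) / (2 ^ (m0 * (s - u)) * real m0 ^ 3)))"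
proof (rule excess_moment[where \<eta> = "\<lambda>m. 2 * real (l n) / min \<kappa>3 \<kappa>4 * exp (- min \<kappa>3 \<kappa>4 * (real (r * m) * real (l n)))"])
  define \<kappa> where "\<kappa> = min \<kappa>3 \<kappa>4"
  have \<kappa>0: "\<kappa> > 0" using \<kappa> by (simp add: \<kappa>_def)
  have n1: "n \<ge> 1" using n \<kappa> by (cases n) (auto simp: divide_less_0_iff)
  have lb: "1 \<le> l n" "l n \<le> n" using l_bounds[OF n1] by auto
  have b: "1 \<le> nb n" "nb n \<le> n" using nblocks_bounds(1,2)[of l n, OF lb] by auto
  have r0: "real r > 0"
  proof -
    have "1 / \<kappa>3 > 0" using \<kappa> by simp
    then show ?thesis using r(1) by linarith
  qed
  have \<rho>'0: "\<rho>' \<ge> 0" using \<rho>0 by (simp add: \<rho>'_def)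
  show "prob_space M" by (rule prob_space_axioms)
  show "W n k \<in> borel_measurable M" for k by (rule W_measurable[OF n1])
  show "1 \<le> nb n" "3 \<le> s" "1 \<le> u" "u \<le> s" "1 \<le> 3 * r + 2" "0 \<le> \<rho>'" "2 \<le> m0" using b s3 u \<rho>'0 m0 by auto
  fix m assume m: "m0 \<le> m"
  have m1: "m \<ge> 3" "real m \<ge> 1" using m m0 by auto
  have "Q * real m0 \<le> Q * real m" using Q m by (intro mult_left_mono) auto
  then have Lm: "ln (real n) \<le> Q * real m" using Q(2) by linarith
  show "prob {\<omega>\<in>space M. norm (W n k \<omega>) > 2 ^ (m - 1)} \<le> \<rho>' * level_rate s m" if "k \<in> {1..nb n}" for k
    using W_tail[OF n1 that m1(1)] by (simp add: \<rho>'_def)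
  show "0 \<le> 2 * real (l n) / min \<kappa>3 \<kappa>4 * exp (- min \<kappa>3 \<kappa>4 * (real (r * m) * real (l n)))"
    using \<kappa>0 by (simp add: \<kappa>_def[symmetric])
  have rm: "real (r * m) \<ge> real r" using mult_left_mono[of 1 "real m" "real r"] m1 by simp
  show "\<exists>V. block_approx M (nb n) (W n) V ((3 * r + 2) * m) (2 * real (l n) / min \<kappa>3 \<kappa>4 * exp (- min \<kappa>3 \<kappa>4 * (real (r * m) * real (l n))))"
  proof -
    have "real (r * m) * real (l n) > 1 / \<kappa>3"
    proof -
      have "real (r * m) * 1 \<le> real (r * m) * real (l n)" using lb by (intro mult_left_mono) auto
      then show ?thesis using r(1) rm by linarith
    qed
    moreover have "r * m \<ge> 1" using r0 m1 by simp
    ultimately obtain V where V: "block_approx M (nb n) (W n) V (3 * (r * m) + 2)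
        (2 * real (l n) / min \<kappa>3 \<kappa>4 * exp (- min \<kappa>3 \<kappa>4 * (real (r * m) * real (l n))))"
      using block_approx_exists[OF C3 C4 \<kappa> n] by blast
    have "3 * (r * m) + 2 \<le> (3 * r + 2) * m" using m1 by (simp add: algebra_simps)
    then show ?thesis using block_approx_mono[OF V order_refl] by blast
  qed
  show "2 * real (l n) / min \<kappa>3 \<kappa>4 * exp (- min \<kappa>3 \<kappa>4 * (real (r * m) * real (l n))) * (2 + real (nb n) ^ u) \<le> level_rate s m"
    unfolding \<kappa>_def[symmetric]
  proof -
    have n0: "real n \<ge> 1" using n1 by simp
    have nQ: "real n \<le> exp (Q * real m)"
    proof -
      have "real n = exp (ln (real n))" using n0 by simp
      also have "\<dots> \<le> exp (Q * real m)"
        using Lm by simp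
      finally show ?thesis .
    qed
    have bu: "2 + real (nb n) ^ u \<le> 3 * real n ^ s"
    proof -
      have "real (nb n) ^ u \<le> real n ^ u" using b by (intro power_mono) auto
      also have "\<dots> \<le> real n ^ s" using n0 u by (intro power_increasing) auto
      finally show ?thesis using one_le_power[OF n0, of s] by linarith
    qed
    have ex: "exp (- \<kappa> * (real (r * m) * real (l n))) \<le> exp (- \<kappa> * (real r * real m))"
    proof -
      have "real (r * m) * 1 \<le> real (r * m) * real (l n)" using lb by (intro mult_left_mono) auto
      then have "\<kappa> * (real r * real m) \<le> \<kappa> * (real (r * m) * real (l n))" using \<kappa>0 by (intro mult_left_mono) auto
      then show ?thesis by simp
    qed
    have "2 * real (l n) / \<kappa> * exp (- \<kappa> * (real (r * m) * real (l n))) * (2 + real (nb n) ^ u)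
      \<le> 2 * real n / \<kappa> * exp (- \<kappa> * (real r * real m)) * (3 * real n ^ s)"
      using lb ex bu \<kappa>0 by (intro mult_mono divide_right_mono) auto
    also have "\<dots> = 6 / \<kappa> * exp (- \<kappa> * (real r * real m)) * real n ^ (s + 1)" by simp
    also have "\<dots> \<le> 6 / \<kappa> * exp (- \<kappa> * (real r * real m)) * exp (Q * real m) ^ (s + 1)"
      using nQ n0 \<kappa>0 by (intro mult_left_mono power_mono) auto
    also have "\<dots> = 6 / \<kappa> * exp ((Q * real (s + 1) - \<kappa> * real r) * real m)"
      by (simp add: exp_of_nat_mult[symmetric] exp_add[symmetric] algebra_simps)
    also have "\<dots> \<le> 6 / \<kappa> * exp (- (real (s + 2 * s\<^sup>2) + 6 / \<kappa>) * real m)"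
    proof -
      have "Q * real (s + 1) - \<kappa> * real r \<le> - (real (s + 2 * s\<^sup>2) + 6 / \<kappa>)" using r(2) by (simp add: \<kappa>_def[symmetric])
      then have "(Q * real (s + 1) - \<kappa> * real r) * real m \<le> - (real (s + 2 * s\<^sup>2) + 6 / \<kappa>) * real m" by (rule mult_right_mono) simp
      then show ?thesis using \<kappa>0 by (intro mult_left_mono) auto
    qed
    also have "\<dots> = (6 / \<kappa> * exp (- (6 / \<kappa> * real m))) * exp (- (real (s + 2 * s\<^sup>2) * real m))"
      by (simp add: exp_add[symmetric] algebra_simps)
    also have "\<dots> \<le> 1 * exp (- (real (s + 2 * s\<^sup>2) * real m))"
    proof (rule mult_right_mono)
      have "6 / \<kappa> * 1 \<le> 6 / \<kappa> * real m" using \<kappa>0 m1 by (intro mult_left_mono) auto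
      also have "\<dots> \<le> exp (6 / \<kappa> * real m)" using exp_ge_add_one_self[of "6 / \<kappa> * real m"] by linarith
      finally have "6 / \<kappa> * exp (- (6 / \<kappa> * real m)) \<le> exp (6 / \<kappa> * real m) * exp (- (6 / \<kappa> * real m))"
        by (intro mult_right_mono) auto
      then show "6 / \<kappa> * exp (- (6 / \<kappa> * real m)) \<le> 1" by (simp flip: exp_add)
    qed simp
    also have "\<dots> \<le> level_rate s m" using exp_minus_le_level_rate[of m s] m1 by simp
    finally show "2 * real (l n) / \<kappa> * exp (- \<kappa> * (real (r * m) * real (l n))) * (2 + real (nb n) ^ u) \<le> level_rate s m" .
  qed
  show "2 * 2 ^ u * (real (nb n) * ((\<rho>' + 1) * level_rate s m)) \<le> 1"
  proof -
    define L where "L = ln (real n)"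
    have L: "L \<ge> 1" "L \<le> Q * real m"
      using Q Lm by (auto simp: L_def)
    have "sqrt (real (nb n)) \<le> 2 ^ Suc m0 * L" using bm L by (simp add: L_def[symmetric] divide_less_eq)
    also have "\<dots> \<le> 2 ^ Suc m * (Q * real m)" using L m by (intro mult_mono power_increasing) auto
    finally have "(sqrt (real (nb n)))\<^sup>2 \<le> (2 ^ Suc m * (Q * real m))\<^sup>2" by (intro power_mono) auto
    also have "(2 ^ Suc m * (Q * real m))\<^sup>2 = 4 * Q\<^sup>2 * (4 ^ m * (real m)\<^sup>2)"
    proof -
      have "((2::real) ^ m)\<^sup>2 = 4 ^ m" by (simp add: power_mult[symmetric] mult.commute[of m] power_mult)
      then show ?thesis by (simp add: power_mult_distrib)
    qed
    finally have bb: "real (nb n) \<le> 4 * Q\<^sup>2 * (4 ^ m * (real m)\<^sup>2)" by simp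
    have lev0: "level_rate s m \<ge> 0" by (simp add: level_rate_def)
    have "real (nb n) * level_rate s m \<le> 4 * Q\<^sup>2 * (4 ^ m * (real m)\<^sup>2) * level_rate s m" using bb lev0 by (rule mult_right_mono)
    also have "\<dots> \<le> 4 * Q\<^sup>2 * (1 / real m)"
      using level_rate_le[of s m] s3 m1 by (simp only: mult.assoc) (intro mult_left_mono, simp_all)
    finally have bl: "real (nb n) * level_rate s m \<le> 4 * Q\<^sup>2 / real m" by simp
    have "2 * 2 ^ u * (real (nb n) * ((\<rho>' + 1) * level_rate s m)) = (2 * (\<rho>' + 1)) * 2 ^ u * (real (nb n) * level_rate s m)" by simp
    also have "\<dots> \<le> (2 * (\<rho>' + 1)) * 2 ^ s * (4 * Q\<^sup>2 / real m)"
      using bl \<rho>'0 u lev0 by (intro mult_mono mult_left_mono power_increasing) auto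
    also have "\<dots> \<le> 1"
    proof -
      have "8 * 2 ^ s * (\<rho>' + 1) * Q\<^sup>2 \<le> real m" using m0(2) m by linarith
      then have "8 * 2 ^ s * (\<rho>' + 1) * Q\<^sup>2 / real m \<le> 1" using m1 by (simp add: divide_le_eq)
      moreover have reorder: "(2 * x) * y * (4 * z / w) = 8 * y * x * z / w" for x y z w :: real by simp
      ultimately show ?thesis unfolding reorder by linarith
    qed
    finally show ?thesis .
  qed
qed

end

section \<open>The bound for large and for small sample sizes\<close>

lemma direction_margin:
  fixes lam lam2 :: real
  assumes "0 < lam2" "lam2 < lam"
  obtains \<epsilon> where "0 < \<epsilon>" "\<epsilon> \<le> 1 / 2" "lam2 < (1 - \<epsilon>)\<^sup>2 * lam"
proof (rule that)
  define \<epsilon> where "\<epsilon> = (lam - lam2) / (4 * lam)"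
  have lam: "lam > 0" using assms by simp
  show "0 < (lam - lam2) / (4 * lam)" "(lam - lam2) / (4 * lam) \<le> 1 / 2" using assms lam by (auto simp: divide_simps)
  have "4 * (\<epsilon> * lam) = lam - lam2" using lam by (simp add: \<epsilon>_def)
  moreover have sq: "(1 - \<epsilon>)\<^sup>2 * lam = lam - 2 * (\<epsilon> * lam) + \<epsilon>\<^sup>2 * lam" by (simp add: power2_eq_square algebra_simps)
  moreover have "0 \<le> \<epsilon>\<^sup>2 * lam" using lam by simp
  ultimately have "lam2 < (1 - \<epsilon>)\<^sup>2 * lam" unfolding sq using assms by linarith
  then show "lam2 < (1 - (lam - lam2) / (4 * lam))\<^sup>2 * lam" by (simp add: \<epsilon>_def)
qed

lemma block_process_of_conditions:
  assumes "block_setting M X D l f" "cond_C2 s \<rho> \<kappa>2 \<Xi> M X l f" "s \<ge> 3" "\<rho> > 0"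
  shows "block_process M X D l f s \<rho>"
proof (intro block_process.intro block_process_axioms.intro)
  show "prob_space M" using assms(1) by (simp add: block_setting_def)
qed (use assms in \<open>simp_all add: cond_C2_def\<close>)

text \<open>
  The constants are chosen in this order: \<lambda>1 < \<lambda>2 between max(0,\<lambda>0) and
  \<lambda>; the fineness \<epsilon> of the net of directions such that (1-\<epsilon>)^2\<lambda>
  > \<lambda>2, which leaves a surplus e in the exponent of the tail; k2 such that the clipped
  sums exceed k2 (log n)^(1/2) with probability of order n^(-2s); and the gaps r and R such that
  the mixing errors suffice for the two sources of large values.
\<close>

proposition tail_moment_large_n:
  fixes s :: nat
    and \<rho> \<kappa>1 \<kappa>2 \<kappa>3 \<kappa>4 lam0 lam :: real
    and \<Xi> :: "real^('p::finite + 'q::finite)^('p + 'q)"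
    and \<delta> :: "nat \<Rightarrow> real"
  assumes s: "s \<ge> 3" and \<rho>: "\<rho> > 0"
    and \<kappa>: "\<kappa>1 \<in> {0<..<1}" "\<kappa>3 \<in> {0<..<1}" "\<kappa>4 \<in> {0<..<1}"
    and \<delta>: "\<delta> \<longlonglongrightarrow> 0" and ev: "largest_eigenval \<Xi> lam0" and lam: "lam > lam0" "lam > 0"
  obtains C n0 where "C > 0"
    "\<And>(M :: 'w measure) (X :: int \<Rightarrow> 'w \<Rightarrow> real^'p) D l (f :: nat \<Rightarrow> nat \<Rightarrow> (nat \<Rightarrow> real^'p) \<Rightarrow> real^'q) n.
       block_setting M X D l f \<Longrightarrow> cond_C1 \<kappa>1 l \<Longrightarrow> cond_C2 s \<rho> \<kappa>2 \<Xi> M X l f \<Longrightarrow>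
       cond_C3 \<kappa>3 M X D l f \<Longrightarrow> cond_C4 \<kappa>4 M D \<Longrightarrow> cov_rate \<delta> \<Xi> M X l f \<Longrightarrow> n0 \<le> n \<Longrightarrow>
       (\<integral>\<^sup>+\<omega>. ennreal ((1 + norm (Ssum X l f n \<omega>) ^ (2 * (s div 2))) *
           indicator {\<omega>. norm (Ssum X l f n \<omega>) > sqrt ((real s - 2) * lam * ln (real n))} \<omega>) \<partial>M)
       \<le> ennreal (C * (real (nblocks l n) powr (- (real s - 2) / 2) / (ln (real n))\<^sup>2))"
proof -
  \<comment> \<open>a nonnegative bound for the largest eigenvalue, and two levels between it and lam\<close>
  define mu where "mu = max 0 lam0"
  define lam1 where "lam1 = (2 * mu + lam) / 3"
  define lam2 where "lam2 = (mu + 2 * lam) / 3"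
  have mu: "0 \<le> mu" "lam0 \<le> mu" "mu < lam" using lam by (auto simp: mu_def)
  have lams: "0 < lam1" "lam1 < lam2" "lam2 < lam" "0 < lam2" "mu < lam1" using mu lam by (auto simp: lam1_def lam2_def)
  obtain \<epsilon> where \<epsilon>: "0 < \<epsilon>" "\<epsilon> \<le> 1 / 2" "lam2 < (1 - \<epsilon>)\<^sup>2 * lam" using direction_margin[OF lams(4,3)] .
  \<comment> \<open>k1 is the threshold seen by a net direction; k2 is a level with exponent 2 s\<close>
  define k1 where "k1 = (1 - \<epsilon>) * sqrt ((real s - 2) * lam)"
  define k2 where "k2 = 2 * sqrt (real s * lam2)"
  define E1 where "E1 = k1\<^sup>2 / (2 * lam2)"
  define e where "e = E1 - (real s - 2) / 2"
  have slam: "(real s - 2) * lam > 0" using s lam by simp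
  have k1: "k1 > 0" using \<epsilon> slam by (simp add: k1_def)
  have k2: "k2 > 0" "k2\<^sup>2 / (2 * lam2) = 2 * real s" using s lams by (auto simp: k2_def power_mult_distrib)
  have e0: "e > 0"
  proof -
    have "k1\<^sup>2 = (1 - \<epsilon>)\<^sup>2 * lam * (real s - 2)" using slam by (simp add: k1_def power_mult_distrib)
    moreover have "lam2 * (real s - 2) < (1 - \<epsilon>)\<^sup>2 * lam * (real s - 2)" using \<epsilon>(3) s by (intro mult_strict_right_mono) auto
    ultimately have "lam2 * (real s - 2) / (2 * lam2) < E1" unfolding E1_def using lams by (intro divide_strict_right_mono) auto
    then show ?thesis using lams by (simp add: e_def)
  qed
  define A where "A = 6 + max (k1\<^sup>2 / lam2) (k2\<^sup>2 / lam2)"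
  define \<kappa>m where "\<kappa>m = min \<kappa>3 \<kappa>4"
  have \<kappa>m0: "\<kappa>m > 0" "\<kappa>m < 1" using \<kappa> by (auto simp: \<kappa>m_def)
  have \<kappa>0: "\<kappa>1 > 0" "\<kappa>1 < 1" "\<kappa>3 > 0" using \<kappa> by auto
  define r where "r = nat \<lceil>max (1 / \<kappa>3) ((A + 2) / (\<kappa>m * \<kappa>1))\<rceil> + 1"
  have r: "real r > 1 / \<kappa>3" "\<kappa>m * \<kappa>1 * real r \<ge> A + 2" "r \<ge> 1"
  proof -
    have "max (1 / \<kappa>3) ((A + 2) / (\<kappa>m * \<kappa>1)) \<le> real (nat \<lceil>max (1 / \<kappa>3) ((A + 2) / (\<kappa>m * \<kappa>1))\<rceil>)" by (rule real_nat_ceiling_ge)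
    then have *: "max (1 / \<kappa>3) ((A + 2) / (\<kappa>m * \<kappa>1)) < real r" by (simp add: r_def)
    then show "real r > 1 / \<kappa>3" by simp
    have "(A + 2) / (\<kappa>m * \<kappa>1) \<le> real r" using * by simp
    then show "\<kappa>m * \<kappa>1 * real r \<ge> A + 2" using \<kappa>m0 \<kappa>0 by (simp add: divide_le_eq mult_ac)
    show "r \<ge> 1" by (simp add: r_def)
  qed
  define g where "g = 3 * r + 2"
  define M3 :: real where "M3 = 2 ^ 3 * (2 * 2 ^ s + 2 * \<rho>)"
  have M30: "0 \<le> M3" using \<rho> by (simp add: M3_def)
  have g1: "1 \<le> g" by (simp add: g_def)
  define MD where "MD = (\<lambda>k C n. \<forall>(M :: 'w measure) b w v a c.
       real_block_array M b g w v (real n powr - (6 + k\<^sup>2 / lam2)) M3 \<longrightarrow>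
       \<kappa>1 * real n powr \<kappa>1 \<le> real b \<longrightarrow> b \<le> n \<longrightarrow> 0 < a \<longrightarrow> a\<^sup>2 \<le> 2 / real b \<longrightarrow>
       sqrt (real b) / (2 * ln (real n)) \<le> c \<longrightarrow> c \<le> sqrt (real b) / ln (real n) \<longrightarrow>
       a\<^sup>2 * (\<integral>x. (\<Sum>j=1..b. w j x)\<^sup>2 \<partial>M) \<le> lam1 \<longrightarrow>
       measure M {x\<in>space M. a * (\<Sum>j=1..b. clip c (w j x)) > k * sqrt (ln (real n))}
         \<le> C * real n powr - (k\<^sup>2 / (2 * lam2)))"
  obtain C1 where C1: "C1 > 0" and MD1: "\<forall>\<^sub>F n in sequentially. MD k1 C1 n"
    unfolding MD_def by (rule clipped_sum_moderate_deviation[OF less_imp_le[OF lams(1)] lams(2) \<kappa>0(1) k1 g1 M30])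
  obtain C2 where C2: "C2 > 0" and MD2: "\<forall>\<^sub>F n in sequentially. MD k2 C2 n"
    unfolding MD_def by (rule clipped_sum_moderate_deviation[OF less_imp_le[OF lams(1)] lams(2) \<kappa>0(1) k2(1) g1 M30])
  obtain \<Theta> :: "(real^('p + 'q)) set" where \<Theta>: "finite \<Theta>" "\<And>\<theta>. \<theta> \<in> \<Theta> \<Longrightarrow> norm \<theta> = 1"
    "\<And>v. v \<noteq> 0 \<Longrightarrow> \<exists>\<theta>\<in>\<Theta>. (1 - \<epsilon>) * norm v \<le> \<theta> \<bullet> v"
    using sphere_net[OF \<epsilon>(1)] by blast
  define \<rho>' where "\<rho>' = 2 * \<rho> * (4 ^ s * 8 ^ (2 * s\<^sup>2))"
  have \<rho>'0: "\<rho>' \<ge> 0" using \<rho> by (simp add: \<rho>'_def)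
  \<comment> \<open>2^m0 will be at least n^(\<kappa>1/4), whence log n \<le> Q m0\<close>
  define Q where "Q = 4 / \<kappa>1"
  have Q1: "Q \<ge> 1" using \<kappa>0 by (simp add: Q_def divide_simps)
  define R where "R = nat \<lceil>max (1 / \<kappa>3) ((Q * real (s + 1) + real (s + 2 * s\<^sup>2) + 6 / \<kappa>m) / \<kappa>m)\<rceil> + 1"
  have R: "real R > 1 / \<kappa>3" "\<kappa>m * real R \<ge> Q * real (s + 1) + real (s + 2 * s\<^sup>2) + 6 / \<kappa>m"
  proof -
    let ?y = "(Q * real (s + 1) + real (s + 2 * s\<^sup>2) + 6 / \<kappa>m) / \<kappa>m"
    have "max (1 / \<kappa>3) ?y \<le> real (nat \<lceil>max (1 / \<kappa>3) ?y\<rceil>)" by (rule real_nat_ceiling_ge)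
    then have *: "max (1 / \<kappa>3) ?y < real R" by (simp only: R_def of_nat_add of_nat_1)
    then show "real R > 1 / \<kappa>3" by simp
    have "?y \<le> real R" using * by simp
    then show "\<kappa>m * real R \<ge> Q * real (s + 1) + real (s + 2 * s\<^sup>2) + 6 / \<kappa>m"
      using \<kappa>m0 by (simp add: divide_le_eq mult.commute)
  qed
  define m1 where "m1 = max 3 (8 * 2 ^ s * (\<rho>' + 1) * Q\<^sup>2)"
  define u where "u = 2 * (s div 2)"
  have u: "1 \<le> u" "u \<le> s" using s unfolding u_def by linarith+
  define K3 where "K3 = 2 * 8 ^ u * (real (3 * R + 2) ^ (u + 1) * (2 * 2 ^ u * (\<rho>' + 1)) + 1)"
  have K30: "K3 \<ge> 0" using \<rho>'0 by (simp add: K3_def)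
  define N where "N = real (card \<Theta>)"
  have N0: "N \<ge> 0" by (simp add: N_def)
  define K1 where "K1 = 1 + 6 ^ u * k2 ^ u"
  have K10: "K1 \<ge> 0" using k2 by (simp add: K1_def)
  define C where "C = K1 * (N * C1 + \<rho>' * (2 ^ s * Q ^ (2 * s\<^sup>2))) + (12 ^ u * N * C2 + 6 ^ u * K3 * (2 ^ s * 2 * Q ^ 3)) + 1"
  have C: "C > 0" unfolding C_def using K10 N0 C1 C2 \<rho>'0 Q1 K30
    by (intro add_nonneg_pos add_nonneg_nonneg mult_nonneg_nonneg) auto
  have ev_ln: "\<forall>\<^sub>F n in sequentially. ln (real n) \<ge> B" for B
  proof -
    have "filterlim (\<lambda>n. ln (real n)) at_top sequentially" by real_asymp
    then show ?thesis by (simp add: filterlim_at_top)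
  qed
  have ev_n: "\<forall>\<^sub>F n in sequentially. real n > B" for B :: real
  proof -
    have "filterlim (\<lambda>n. real n) at_top sequentially" by real_asymp
    then show ?thesis by (simp add: filterlim_at_top_dense)
  qed
  have ev_\<delta>: "\<forall>\<^sub>F n in sequentially. \<delta> n < lam1 - mu"
    using \<delta> by (rule order_tendstoD(2)) (use lams in simp)
  have "\<forall>\<^sub>F n in sequentially. MD k1 C1 n \<and>
     MD k2 C2 n \<and>
     real n powr (\<kappa>1 / 4) \<le> sqrt (\<kappa>1 * real n powr \<kappa>1) / (2 * ln (real n)) \<and>
     ln (real n) ^ (s + 2) * real n powr - e \<le> 1 \<and> ln (real n) \<ge> Q * m1 \<and> \<delta> n < lam1 - mu \<and>
     real n > 1 / \<kappa>1 \<and> real n > 1 / \<kappa>3 \<and> real n > 2 / \<kappa>m \<and> real n > 3"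
    by (intro eventually_conj MD1 MD2 eventually_root_dominates_log[OF \<kappa>0(1)] eventually_log_power_le[OF e0] ev_ln ev_\<delta> ev_n)
  then obtain n0 where n0: "\<And>n. n \<ge> n0 \<Longrightarrow> MD k1 C1 n \<and>
     MD k2 C2 n \<and>
     real n powr (\<kappa>1 / 4) \<le> sqrt (\<kappa>1 * real n powr \<kappa>1) / (2 * ln (real n)) \<and>
     ln (real n) ^ (s + 2) * real n powr - e \<le> 1 \<and> ln (real n) \<ge> Q * m1 \<and> \<delta> n < lam1 - mu \<and>
     real n > 1 / \<kappa>1 \<and> real n > 1 / \<kappa>3 \<and> real n > 2 / \<kappa>m \<and> real n > 3"
    unfolding eventually_sequentially by blast
  show ?thesis
  proof (rule that[of C n0, OF C])
    fix M :: "'w measure" and X :: "int \<Rightarrow> 'w \<Rightarrow> real^'p" and D l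
      and f :: "nat \<Rightarrow> nat \<Rightarrow> (nat \<Rightarrow> real^'p) \<Rightarrow> real^'q" and n
    assume set: "block_setting M X D l f" and c1: "cond_C1 \<kappa>1 l" and c2: "cond_C2 s \<rho> \<kappa>2 \<Xi> M X l f"
      and c3: "cond_C3 \<kappa>3 M X D l f" and c4: "cond_C4 \<kappa>4 M D" and rate: "cov_rate \<delta> \<Xi> M X l f" and nn: "n0 \<le> n"
    note big = n0[OF nn]
    note bigMD1 = conjunct1[OF big, unfolded MD_def, rule_format]
    note bigMD2 = conjunct1[OF conjunct2[OF big], unfolded MD_def, rule_format]
    note rest = conjunct2[OF conjunct2[OF big]]
    have nbig: "real n powr (\<kappa>1 / 4) \<le> sqrt (\<kappa>1 * real n powr \<kappa>1) / (2 * ln (real n))"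
      "ln (real n) ^ (s + 2) * real n powr - e \<le> 1" "ln (real n) \<ge> Q * m1" "\<delta> n < lam1 - mu"
      "real n > 1 / \<kappa>1" "real n > 1 / \<kappa>3" "real n > 2 / \<kappa>m" "real n > 3"
      using rest by simp_all
    define L where "L = ln (real n)"
    have L1: "L \<ge> 1"
    proof -
      have "exp 1 \<le> real n" using exp_le nbig by linarith
      then show ?thesis unfolding L_def using nbig by (subst ln_ge_iff) auto
    qed
    have n1: "n \<ge> 1" "real n \<ge> 1" using nbig by auto
    have Ln: "L \<le> real n" unfolding L_def using n1 ln_le_minus_one[of "real n"] by simp
    interpret block_process M X D l f s \<rho> by (rule block_process_of_conditions[OF set c2 s \<rho>])
    have lb: "1 \<le> l n" "l n \<le> n" using l_bounds[OF n1(1)] by auto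
    define b where "b = real (nb n)"
    have nbn: "1 \<le> nb n" "nb n \<le> n" using nblocks_bounds(1,2)[of l n, OF lb] by auto
    have b1: "b \<ge> 1" "b \<le> real n" "b > 0" using nbn by (auto simp: b_def)
    have ell: "\<kappa>1 * L < real (l n)" "real (l n) < (1 / \<kappa>1) * real n powr (1 - \<kappa>1)"
      using c1 nbig(5) by (auto simp: cond_C1_def L_def)
    have b\<kappa>: "\<kappa>1 * real n powr \<kappa>1 \<le> b"
    proof -
      have "real n \<le> real (nb n * l n)" using nblocks_bounds(3)[of l n, OF lb] by (simp only: of_nat_le_iff)
      also have "\<dots> = b * real (l n)" by (simp add: b_def)
      also have "\<dots> \<le> b * ((1 / \<kappa>1) * real n powr (1 - \<kappa>1))" using ell(2) b1 by (intro mult_left_mono) auto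
      finally have "\<kappa>1 * real n \<le> b * real n powr (1 - \<kappa>1)" using \<kappa>0 by (simp add: field_simps)
      moreover have "real n = real n powr \<kappa>1 * real n powr (1 - \<kappa>1)" using n1 by (simp flip: powr_add)
      ultimately have "(\<kappa>1 * real n powr \<kappa>1) * real n powr (1 - \<kappa>1) \<le> b * real n powr (1 - \<kappa>1)" by (metis mult.assoc)
      then show ?thesis using n1 by (simp add: mult_le_cancel_right)
    qed
    define a where "a = sqrt (real (l n) / real n)"
    have a: "a > 0" "a\<^sup>2 \<le> 2 / b"
    proof -
      show "a > 0" using lb n1 by (simp add: a_def)
      have "b * real (l n) \<le> 2 * real n" using nblocks_bounds(4)[of l n, OF lb] by (simp add: b_def)
      then show "a\<^sup>2 \<le> 2 / b" using b1 n1 by (simp add: a_def field_simps)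
    qed
    \<comment> \<open>one approximation by windows of the sigma-fields serves both moderate deviation bounds\<close>
    have "real r * real (l n) > 1 / \<kappa>3"
    proof -
      have "real r * 1 \<le> real r * real (l n)" using lb by (intro mult_left_mono) auto
      then show ?thesis using r(1) by linarith
    qed
    then obtain V where V0: "block_approx M (nb n) (W n) V g (2 * real (l n) / \<kappa>m * exp (- \<kappa>m * (real r * real (l n))))"
      using block_approx_exists[OF c3 c4 \<kappa>(2,3) nbig(6) r(3)] unfolding g_def \<kappa>m_def by blast
    have \<eta>A: "2 * real (l n) / \<kappa>m * exp (- \<kappa>m * (real r * real (l n))) \<le> real n powr - A"
    proof -
      have "2 * real (l n) / \<kappa>m \<le> 2 / \<kappa>m * real n" using lb \<kappa>m0 by (simp add: divide_right_mono)
      also have "\<dots> \<le> real n * real n" using nbig(7) n1 by (intro mult_right_mono) auto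
      also have "\<dots> = real n powr 2" using n1 by (simp add: powr_numeral power2_eq_square)
      finally have 1: "2 * real (l n) / \<kappa>m \<le> real n powr 2" .
      have "A + 2 \<le> \<kappa>m * \<kappa>1 * real r" by (rule r(2))
      then have "(A + 2) * L \<le> \<kappa>m * \<kappa>1 * real r * L" using L1 by (intro mult_right_mono) auto
      also have "\<dots> = (\<kappa>m * real r) * (\<kappa>1 * L)" by simp
      also have "\<dots> \<le> (\<kappa>m * real r) * real (l n)" using ell(1) \<kappa>m0 by (intro mult_left_mono) auto
      finally have "exp (- \<kappa>m * (real r * real (l n))) \<le> exp (- ((A + 2) * L))" by (simp add: mult.assoc)
      also have "\<dots> = real n powr (- (A + 2))" unfolding L_def using n1 by (simp add: powr_def algebra_simps)
      finally have 2: "exp (- \<kappa>m * (real r * real (l n))) \<le> real n powr (- (A + 2))" .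
      have "2 * real (l n) / \<kappa>m * exp (- \<kappa>m * (real r * real (l n))) \<le> real n powr 2 * real n powr (- (A + 2))"
        using 1 2 by (intro mult_mono) auto
      also have "\<dots> = real n powr - A" by (simp only: powr_add[symmetric]) simp
      finally show ?thesis .
    qed
    have V: "block_approx M (nb n) (W n) V g (real n powr - (6 + k\<^sup>2 / lam2))" if "k = k1 \<or> k = k2" for k
    proof (rule block_approx_mono[OF V0 _ order_refl])
      have "6 + k\<^sup>2 / lam2 \<le> A" using that by (auto simp: A_def)
      then have "real n powr - A \<le> real n powr - (6 + k\<^sup>2 / lam2)" using n1 by (intro powr_mono) auto
      then show "2 * real (l n) / \<kappa>m * exp (- \<kappa>m * (real r * real (l n))) \<le> real n powr - (6 + k\<^sup>2 / lam2)" using \<eta>A by linarith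
    qed
    have arr: "real_block_array M (nb n) g (\<lambda>k \<omega>. \<theta> \<bullet> W n k \<omega>) (\<lambda>k \<omega>. \<theta> \<bullet> V k \<omega>) (real n powr - (6 + k\<^sup>2 / lam2)) M3"
      if "\<theta> \<in> \<Theta>" "k = k1 \<or> k = k2" for \<theta> k
      unfolding M3_def by (rule real_block_array_inner[OF n1(1) V[OF that(2)]]) (use \<Theta>(2)[OF that(1)] in auto)
    have var: "a\<^sup>2 * (\<integral>\<omega>. (\<Sum>j=1..nb n. \<theta> \<bullet> W n j \<omega>)\<^sup>2 \<partial>M) \<le> lam1" if "\<theta> \<in> \<Theta>" for \<theta>
    proof -
      have "a\<^sup>2 * (\<integral>\<omega>. (\<Sum>j=1..nb n. \<theta> \<bullet> W n j \<omega>)\<^sup>2 \<partial>M) = (\<integral>\<omega>. (\<theta> \<bullet> Ssum X l f n \<omega>)\<^sup>2 \<partial>M)"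
        unfolding inner_S[OF n1(1)] a_def power_mult_distrib by simp
      also have "\<dots> \<le> lam0 + \<delta> n"
        using c2 by (intro variance_le[OF n1(1) _ ev rate \<Theta>(2)[OF that]]) (simp add: cond_C2_def)
      also have "\<dots> \<le> lam1" using nbig(4) mu by linarith
      finally show ?thesis .
    qed
    \<comment> \<open>the truncation level, a power of two just below sqrt b / ln n\<close>
    have low: "real n powr (\<kappa>1 / 4) \<le> sqrt b / (2 * L)"
    proof -
      have "sqrt (\<kappa>1 * real n powr \<kappa>1) / (2 * L) \<le> sqrt b / (2 * L)" using b\<kappa> L1 by (intro divide_right_mono) auto
      then show ?thesis using nbig(1) by (simp add: L_def)
    qed
    have "1 \<le> real n powr (\<kappa>1 / 4)" using n1 \<kappa>0 by (intro ge_one_powr_ge_zero) auto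
    then have "1 \<le> sqrt b / (2 * L)" using low by linarith
    moreover have "sqrt b / (2 * L) \<le> sqrt b / L" using L1 b1 by (intro divide_left_mono) auto
    ultimately have "1 \<le> sqrt b / L" by linarith
    then obtain m0 where m0: "2 ^ m0 \<le> sqrt b / L" "sqrt b / L < 2 ^ Suc m0" using dyadic_below by blast
    define c :: real where "c = 2 ^ m0"
    have c: "c > 0" "sqrt b / (2 * L) \<le> c" "c \<le> sqrt b / L" using m0 L1 by (auto simp: c_def field_simps)
    have LQ: "L \<le> Q * real m0"
    proof -
      have "real n powr (\<kappa>1 / 4) \<le> 2 ^ m0" using low c(2) by (simp add: c_def)
      then have "ln (real n powr (\<kappa>1 / 4)) \<le> ln (2 ^ m0)" using n1 by (subst ln_le_cancel_iff) auto
      then have "\<kappa>1 / 4 * L \<le> real m0 * ln 2" using n1 by (simp add: ln_powr ln_realpow L_def)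
      also have "\<dots> \<le> real m0 * 1" using ln_2_less_1 by (intro mult_left_mono) auto
      finally show ?thesis using \<kappa>0 by (simp add: Q_def field_simps)
    qed
    have m0big: "real m0 \<ge> m1"
    proof -
      have "Q * m1 \<le> Q * real m0" using LQ nbig(3) by (simp add: L_def)
      then show ?thesis using Q1 by simp
    qed
    then have m03: "m0 \<ge> 3" "real m0 \<ge> 8 * 2 ^ s * (\<rho>' + 1) * Q\<^sup>2" by (auto simp: m1_def)
    have P1: "prob {\<omega>\<in>space M. a * (\<Sum>k=1..nb n. clip c (\<theta> \<bullet> W n k \<omega>)) > k1 * sqrt L} \<le> C1 * real n powr - E1" if "\<theta> \<in> \<Theta>" for \<theta>
      unfolding L_def E1_def
      by (rule bigMD1[OF arr[OF that]]) (use b\<kappa> nbn a c var[OF that] in \<open>simp_all add: b_def L_def\<close>)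
    have P2: "prob {\<omega>\<in>space M. a * (\<Sum>k=1..nb n. clip c (\<theta> \<bullet> W n k \<omega>)) > k2 * sqrt L} \<le> C2 * real n powr - (2 * real s)" if "\<theta> \<in> \<Theta>" for \<theta>
      unfolding L_def k2(2)[symmetric]
      by (rule bigMD2[OF arr[OF that]]) (use b\<kappa> nbn a c var[OF that] in \<open>simp_all add: b_def L_def\<close>)
    have P0: "prob {\<omega>\<in>space M. norm (W n k \<omega>) > c} \<le> \<rho>' * level_rate s m0" if k: "k \<in> {1..nb n}" for k
    proof -
      have [measurable]: "W n k \<in> borel_measurable M" by (rule W_measurable[OF n1(1)])
      have pw: "(2::real) ^ (m0 - 1) \<le> 2 ^ m0" by (intro power_increasing) auto
      have "prob {\<omega>\<in>space M. norm (W n k \<omega>) > c} \<le> prob {\<omega>\<in>space M. norm (W n k \<omega>) > 2 ^ (m0 - 1)}"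
        unfolding c_def by (intro finite_measure_mono Collect_mono conj_mono imp_refl impI le_less_trans[OF pw]) auto
      also have "\<dots> \<le> \<rho>' * level_rate s m0" unfolding \<rho>'_def by (rule W_tail[OF n1(1) k m03(1)])
      finally show ?thesis .
    qed
    define qZ where "qZ = K3 * (b / (2 ^ (m0 * (s - u)) * real m0 ^ 3))"
    have Z: "(\<integral>\<^sup>+\<omega>. ennreal ((\<Sum>k=1..nb n. if norm (W n k \<omega>) > c then norm (W n k \<omega>) else 0) ^ u) \<partial>M) \<le> ennreal qZ"
      unfolding c_def qZ_def K3_def b_def \<rho>'_def
      by (rule excess_sum_moment[OF c3 c4 \<kappa>(2,3) nbig(6) u Q1])
         (use LQ L1 m0(2) R m03 in \<open>simp_all add: L_def b_def \<kappa>m_def \<rho>'_def\<close>)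
    have abc: "a * (real (nb n) * c) \<le> 2 * real n"
    proof -
      have "(a * sqrt b)\<^sup>2 = a\<^sup>2 * b" using b1 by (simp add: power_mult_distrib)
      also have "\<dots> \<le> 2 / b * b" using a b1 by (intro mult_right_mono) auto
      also have "\<dots> \<le> 2\<^sup>2" using b1 by simp
      finally have ab: "a * sqrt b \<le> 2" by (rule power2_le_imp_le) simp
      have "sqrt b / L \<le> sqrt b / 1" using L1 b1 by (intro divide_left_mono) auto
      then have cb: "c \<le> sqrt b" using c(3) by simp
      have "a * (real (nb n) * c) \<le> a * (b * sqrt b)" unfolding b_def[symmetric] using cb a b1 by (intro mult_left_mono) auto
      also have "\<dots> = (a * sqrt b) * b" by simp
      also have "\<dots> \<le> 2 * real n" using ab b1 by (intro mult_mono) auto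
      finally show ?thesis .
    qed
    have x: "(1 - \<epsilon>) * sqrt ((real s - 2) * lam * L) = k1 * sqrt L"
      by (simp add: k1_def real_sqrt_mult)
    have lev0: "level_rate s m0 \<ge> 0" by (simp add: level_rate_def)
    have split: "(\<integral>\<^sup>+\<omega>. ennreal ((1 + norm (Ssum X l f n \<omega>) ^ u) *
        indicator {\<omega>. norm (Ssum X l f n \<omega>) > sqrt ((real s - 2) * lam * L)} \<omega>) \<partial>M)
      \<le> ennreal ((1 + 6 ^ u * (k2 * sqrt L) ^ u) * (real (card \<Theta>) * (C1 * real n powr - E1) + real (nb n) * (\<rho>' * level_rate s m0))
        + (6 ^ u * (2 * real n) ^ u * (real (card \<Theta>) * (C2 * real n powr - (2 * real s))) + 6 ^ u * sqrt (real (l n) / real n) ^ u * qZ))"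
    proof (rule tail_moment_split[OF n1(1) u(1) \<Theta> \<epsilon>(2)])
      show "0 \<le> sqrt ((real s - 2) * lam * L)" using slam L1 by simp
      show "0 \<le> k2 * sqrt L" using k2 L1 by simp
    qed (use c abc P1 P2 P0 Z C1 C2 \<rho>'0 lev0 K30 b1 in \<open>simp_all add: x a_def qZ_def\<close>)
    define B where "B = b powr (- (real s - 2) / 2) / L\<^sup>2"
    have B0: "B \<ge> 0" by (simp add: B_def)
    have sqL: "sqrt L \<le> L"
    proof -
      have "sqrt L * 1 \<le> sqrt L * sqrt L" using L1 by (intro mult_left_mono) auto
      then show ?thesis using L1 by simp
    qed
    have Lu: "1 + 6 ^ u * (k2 * sqrt L) ^ u \<le> K1 * L ^ s"
    proof -
      have "sqrt L ^ u \<le> L ^ u" using sqL L1 by (intro power_mono) auto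
      also have "\<dots> \<le> L ^ s" using L1 u by (intro power_increasing) auto
      finally have "6 ^ u * k2 ^ u * sqrt L ^ u \<le> 6 ^ u * k2 ^ u * L ^ s" using k2 by (intro mult_left_mono) auto
      moreover have "1 \<le> L ^ s" using L1 by (intro one_le_power)
      ultimately show ?thesis by (simp add: K1_def power_mult_distrib algebra_simps)
    qed
    have t1: "L ^ s * real n powr - E1 \<le> B" unfolding B_def
      by (rule rate_term_gaussian[OF s b1(3,2) L1, where e = e]) (use nbig(2) in \<open>simp_all add: L_def e_def\<close>)
    have t2: "L ^ s * (b * level_rate s m0) \<le> 2 ^ s * Q ^ (2 * s\<^sup>2) * B" unfolding B_def
      by (rule rate_term_level[OF s b1(3) L1 _ Q1 LQ]) (use c(2) in \<open>simp add: c_def\<close>)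
    have t3: "real n ^ u * real n powr - (2 * real s) \<le> B" unfolding B_def
      by (rule rate_term_crude[OF s u(2) b1(3,2) n1(2) L1 Ln])
    have t4: "a ^ u * (b / (2 ^ (m0 * (s - u)) * real m0 ^ 3)) \<le> 2 ^ s * 2 * Q ^ 3 * B" unfolding B_def
      by (rule rate_term_excess[OF u_def b1(3) L1 _ Q1 LQ]) (use c(2) a in \<open>simp_all add: c_def\<close>)
    have "(1 + 6 ^ u * (k2 * sqrt L) ^ u) * (N * (C1 * real n powr - E1) + b * (\<rho>' * level_rate s m0))
       \<le> (K1 * L ^ s) * (N * (C1 * real n powr - E1) + b * (\<rho>' * level_rate s m0))"
      using Lu N0 C1 b1 \<rho>'0 lev0 by (intro mult_right_mono) auto
    also have "\<dots> = K1 * (N * C1 * (L ^ s * real n powr - E1) + \<rho>' * (L ^ s * (b * level_rate s m0)))" by (simp add: algebra_simps)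
    also have "\<dots> \<le> K1 * (N * C1 * B + \<rho>' * (2 ^ s * Q ^ (2 * s\<^sup>2) * B))"
      using t1 t2 K10 N0 C1 \<rho>'0 by (intro mult_left_mono add_mono) auto
    finally have f1: "(1 + 6 ^ u * (k2 * sqrt L) ^ u) * (N * (C1 * real n powr - E1) + b * (\<rho>' * level_rate s m0))
      \<le> K1 * (N * C1 + \<rho>' * (2 ^ s * Q ^ (2 * s\<^sup>2))) * B" by (simp add: algebra_simps)
    have "6 ^ u * (2 * real n) ^ u * (N * (C2 * real n powr - (2 * real s))) = 12 ^ u * N * C2 * (real n ^ u * real n powr - (2 * real s))"
    proof -
      have "(12::real) ^ u = 6 ^ u * 2 ^ u" by (simp flip: power_mult_distrib)
      then show ?thesis by (simp add: power_mult_distrib)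
    qed
    also have "\<dots> \<le> 12 ^ u * N * C2 * B" using t3 N0 C2 by (intro mult_left_mono) auto
    finally have f2: "6 ^ u * (2 * real n) ^ u * (N * (C2 * real n powr - (2 * real s))) \<le> 12 ^ u * N * C2 * B" .
    have "6 ^ u * a ^ u * qZ = 6 ^ u * K3 * (a ^ u * (b / (2 ^ (m0 * (s - u)) * real m0 ^ 3)))" by (simp add: qZ_def)
    also have "\<dots> \<le> 6 ^ u * K3 * (2 ^ s * 2 * Q ^ 3 * B)" using t4 K30 by (intro mult_left_mono) auto
    finally have f3: "6 ^ u * a ^ u * qZ \<le> 6 ^ u * K3 * (2 ^ s * 2 * Q ^ 3) * B" by simp
    have "(1 + 6 ^ u * (k2 * sqrt L) ^ u) * (N * (C1 * real n powr - E1) + b * (\<rho>' * level_rate s m0))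
        + (6 ^ u * (2 * real n) ^ u * (N * (C2 * real n powr - (2 * real s))) + 6 ^ u * a ^ u * qZ) \<le> C * B"
    proof -
      have "C * B = K1 * (N * C1 + \<rho>' * (2 ^ s * Q ^ (2 * s\<^sup>2))) * B + (12 ^ u * N * C2 * B + 6 ^ u * K3 * (2 ^ s * 2 * Q ^ 3) * B) + B"
        unfolding C_def by (simp only: distrib_right mult_1)
      then show ?thesis using f1 f2 f3 B0 by linarith
    qed
    then have "ennreal ((1 + 6 ^ u * (k2 * sqrt L) ^ u) * (real (card \<Theta>) * (C1 * real n powr - E1) + real (nb n) * (\<rho>' * level_rate s m0))
        + (6 ^ u * (2 * real n) ^ u * (real (card \<Theta>) * (C2 * real n powr - (2 * real s))) + 6 ^ u * sqrt (real (l n) / real n) ^ u * qZ))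
       \<le> ennreal (C * B)"
      unfolding N_def b_def a_def by (rule ennreal_leI)
    from order_trans[OF split this]
    show "(\<integral>\<^sup>+\<omega>. ennreal ((1 + norm (Ssum X l f n \<omega>) ^ (2 * (s div 2))) *
           indicator {\<omega>. norm (Ssum X l f n \<omega>) > sqrt ((real s - 2) * lam * ln (real n))} \<omega>) \<partial>M)
       \<le> ennreal (C * (real (nblocks l n) powr (- (real s - 2) / 2) / (ln (real n))\<^sup>2))"
      unfolding B_def b_def L_def u_def .
  qed
qed

text \<open>
  For n \<le> n0 the rate on the right is bounded away from 0, and the moment of S_n is at most a
  power of n0 times that of a single block.
\<close>

lemma (in block_process) tail_moment_crude:
  fixes x :: real
  assumes n: "2 \<le> n" "n \<le> n0" and u: "1 \<le> u" "u \<le> s"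
  defines "p \<equiv> (real s - 2) / 2"
  shows "(\<integral>\<^sup>+\<omega>. ennreal ((1 + norm (Ssum X l f n \<omega>) ^ u) * indicator {\<omega>. norm (Ssum X l f n \<omega>) > x} \<omega>) \<partial>M)
    \<le> ennreal ((1 + real n0 ^ (u + 1) * (2 ^ u * (2 * 2 ^ s + 2 * \<rho>))) * (real n0 powr p * (real n0)\<^sup>2)
        * (real (nb n) powr - p / (ln (real n))\<^sup>2))"
proof -
  define K where "K = 2 ^ u * (2 * 2 ^ s + 2 * \<rho>)"
  have K0: "K \<ge> 0" using \<rho>0 by (simp add: K_def)
  have n1: "n \<ge> 1" using n by simp
  have [measurable]: "Ssum X l f n \<in> borel_measurable M" by (rule S_measurable[OF n1])
  have "(\<integral>\<^sup>+\<omega>. ennreal ((1 + norm (Ssum X l f n \<omega>) ^ u) * indicator {\<omega>. norm (Ssum X l f n \<omega>) > x} \<omega>) \<partial>M)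
     \<le> (\<integral>\<^sup>+\<omega>. 1 + ennreal (norm (Ssum X l f n \<omega>) ^ u) \<partial>M)"
  proof (rule nn_integral_mono)
    fix \<omega>
    have "ennreal ((1 + norm (Ssum X l f n \<omega>) ^ u) * indicator {\<omega>. norm (Ssum X l f n \<omega>) > x} \<omega>) \<le> ennreal (1 + norm (Ssum X l f n \<omega>) ^ u)"
      by (intro ennreal_leI) (simp add: indicator_def)
    then show "ennreal ((1 + norm (Ssum X l f n \<omega>) ^ u) * indicator {\<omega>. norm (Ssum X l f n \<omega>) > x} \<omega>) \<le> 1 + ennreal (norm (Ssum X l f n \<omega>) ^ u)"
      by simp
  qed
  also have "\<dots> = 1 + (\<integral>\<^sup>+\<omega>. ennreal (norm (Ssum X l f n \<omega>) ^ u) \<partial>M)"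
    by (subst nn_integral_add) (auto simp: emeasure_space_1)
  also have "\<dots> \<le> 1 + ennreal (real n ^ (u + 1) * K)" unfolding K_def by (intro add_left_mono S_moment n1 u)
  also have "\<dots> = ennreal (1 + real n ^ (u + 1) * K)" using K0 by simp
  also have "\<dots> \<le> ennreal ((1 + real n0 ^ (u + 1) * K) * (real n0 powr p * (real n0)\<^sup>2) * (real (nb n) powr - p / (ln (real n))\<^sup>2))"
  proof (rule ennreal_leI)
    have lb: "1 \<le> l n" "l n \<le> n" using l_bounds n1 by auto
    have bn: "1 \<le> nb n" "nb n \<le> n" using nblocks_bounds(1,2)[of l n, OF lb] by auto
    have p0: "p \<ge> 0" using s3 by (simp add: p_def)
    have L: "0 < ln (real n)" "ln (real n) \<le> real n0" using n ln_le_minus_one[of "real n"] by auto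
    have n00: "real n0 > 0" using n by simp
    have "real n0 powr - p \<le> real (nb n) powr - p" using bn n p0 by (intro powr_anti_base) auto
    moreover have "1 / (real n0)\<^sup>2 \<le> 1 / (ln (real n))\<^sup>2" using L n00 by (intro divide_left_mono power_mono) auto
    ultimately have "real n0 powr - p * (1 / (real n0)\<^sup>2) \<le> real (nb n) powr - p * (1 / (ln (real n))\<^sup>2)" by (intro mult_mono) auto
    then have "(real n0 powr p * (real n0)\<^sup>2) * (real n0 powr - p * (1 / (real n0)\<^sup>2))
        \<le> (real n0 powr p * (real n0)\<^sup>2) * (real (nb n) powr - p * (1 / (ln (real n))\<^sup>2))" by (intro mult_left_mono) auto
    moreover have "(real n0 powr p * (real n0)\<^sup>2) * (real n0 powr - p * (1 / (real n0)\<^sup>2)) = 1"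
      using n00 by (simp add: powr_minus)
    ultimately have one: "1 \<le> (real n0 powr p * (real n0)\<^sup>2) * (real (nb n) powr - p / (ln (real n))\<^sup>2)" by simp
    have "real n ^ (u + 1) * K \<le> real n0 ^ (u + 1) * K" using n K0 by (intro mult_right_mono power_mono) auto
    then have "(1 + real n ^ (u + 1) * K) * 1 \<le> (1 + real n0 ^ (u + 1) * K) * ((real n0 powr p * (real n0)\<^sup>2) * (real (nb n) powr - p / (ln (real n))\<^sup>2))"
      using one K0 by (intro mult_mono) auto
    then show "1 + real n ^ (u + 1) * K \<le> (1 + real n0 ^ (u + 1) * K) * (real n0 powr p * (real n0)\<^sup>2) * (real (nb n) powr - p / (ln (real n))\<^sup>2)"
      by (simp only: mult_1_right mult.assoc)
  qed
  finally show ?thesis by (simp only: K_def)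
qed

theorem theorem2p3:
  fixes s :: nat
    and \<rho> \<kappa>\<^sub>1 \<kappa>\<^sub>2 \<kappa>\<^sub>3 \<kappa>\<^sub>4 \<kappa>\<^sub>5 lam\<^sub>0 lam :: real
    and \<Xi> :: "real^('p::finite + 'q::finite)^('p + 'q)"
    and \<delta> :: "nat \<Rightarrow> real"
  assumes "s \<ge> 3" and "\<rho> > 0"
    and "\<kappa>\<^sub>1 \<in> {0<..<1}" "\<kappa>\<^sub>2 \<in> {0<..<1}" "\<kappa>\<^sub>3 \<in> {0<..<1}" "\<kappa>\<^sub>4 \<in> {0<..<1}" "\<kappa>\<^sub>5 \<in> {0<..<1}"
    and "\<delta> \<longlonglongrightarrow> 0"
    and "largest_eigenval \<Xi> lam\<^sub>0" and "lam > lam\<^sub>0"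
  shows "\<exists>C\<^sub>4>0. \<forall>(M :: 'w measure) (X :: int \<Rightarrow> 'w \<Rightarrow> real^'p) (D :: int \<Rightarrow> 'w measure)
           (l :: nat \<Rightarrow> nat) (f :: nat \<Rightarrow> nat \<Rightarrow> (nat \<Rightarrow> real^'p) \<Rightarrow> real^'q).
         block_setting M X D l f \<longrightarrow>
         cond_C1 \<kappa>\<^sub>1 l \<longrightarrow> cond_C2 s \<rho> \<kappa>\<^sub>2 \<Xi> M X l f \<longrightarrow> cond_C3 \<kappa>\<^sub>3 M X D l f \<longrightarrow>
         cond_C4 \<kappa>\<^sub>4 M D \<longrightarrow> cond_C5 \<kappa>\<^sub>5 M D \<longrightarrow>
         cov_rate \<delta> \<Xi> M X l f \<longrightarrow>
         (\<forall>n\<ge>2.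
            (\<integral>\<^sup>+\<omega>. ennreal ((1 + norm (Ssum X l f n \<omega>) ^ (2 * (s div 2))) *
                 indicator {\<omega>. norm (Ssum X l f n \<omega>) > sqrt ((real s - 2) * lam * ln (real n))} \<omega>) \<partial>M)
            \<le> ennreal (C\<^sub>4 * real (nblocks l n) powr (- (real s - 2) / 2) * (ln (real n)) powi (-2)))"
proof (cases "lam > 0")
  case False
  show ?thesis
  proof (intro exI[of _ 1] conjI allI impI)
    fix M :: "'w measure" and X :: "int \<Rightarrow> 'w \<Rightarrow> real^'p" and D :: "int \<Rightarrow> 'w measure" and l
      and f :: "nat \<Rightarrow> nat \<Rightarrow> (nat \<Rightarrow> real^'p) \<Rightarrow> real^'q" and n :: nat
    assume set: "block_setting M X D l f" and c2: "cond_C2 s \<rho> \<kappa>\<^sub>2 \<Xi> M X l f" and rate: "cov_rate \<delta> \<Xi> M X l f"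
    interpret block_process M X D l f s \<rho> by (rule block_process_of_conditions[OF set c2 assms(1,2)])
    \<comment> \<open>a negative largest eigenvalue contradicts the convergence of covariance matrices, so there is no such process\<close>
    have "\<forall>\<^sub>F n in sequentially. \<delta> n < - lam\<^sub>0"
      using assms(8) by (rule order_tendstoD(2)) (use False assms(10) in simp)
    then have "\<forall>\<^sub>F n in sequentially. \<delta> n < - lam\<^sub>0 \<and> n \<ge> 1" using eventually_ge_at_top[of 1] by eventually_elim simp
    then obtain m where m: "\<delta> m < - lam\<^sub>0" "m \<ge> 1" using eventually_happens'[OF sequentially_bot] by blast
    obtain \<theta> :: "real^('p + 'q)" where \<theta>: "norm \<theta> = 1" using vector_choose_size[of 1] by auto
    have "expectation (\<lambda>\<omega>. (\<theta> \<bullet> Ssum X l f m \<omega>)\<^sup>2) \<le> lam\<^sub>0 + \<delta> m"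
      using c2 by (intro variance_le[OF m(2) _ assms(9) rate \<theta>]) (simp add: cond_C2_def)
    moreover have "0 \<le> expectation (\<lambda>\<omega>. (\<theta> \<bullet> Ssum X l f m \<omega>)\<^sup>2)" by simp
    ultimately have False using m(1) by linarith
    then show "(\<integral>\<^sup>+\<omega>. ennreal ((1 + norm (Ssum X l f n \<omega>) ^ (2 * (s div 2))) *
                 indicator {\<omega>. norm (Ssum X l f n \<omega>) > sqrt ((real s - 2) * lam * ln (real n))} \<omega>) \<partial>M)
            \<le> ennreal (1 * real (nblocks l n) powr (- (real s - 2) / 2) * (ln (real n)) powi (-2))" ..
  qed simp
next
  case True
  define u where "u = 2 * (s div 2)"
  have u: "1 \<le> u" "u \<le> s" using assms(1) unfolding u_def by linarith+
  obtain C n0 where C: "C > 0" and large: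
    "\<And>(M :: 'w measure) (X :: int \<Rightarrow> 'w \<Rightarrow> real^'p) D l (f :: nat \<Rightarrow> nat \<Rightarrow> (nat \<Rightarrow> real^'p) \<Rightarrow> real^'q) n.
       block_setting M X D l f \<Longrightarrow> cond_C1 \<kappa>\<^sub>1 l \<Longrightarrow> cond_C2 s \<rho> \<kappa>\<^sub>2 \<Xi> M X l f \<Longrightarrow>
       cond_C3 \<kappa>\<^sub>3 M X D l f \<Longrightarrow> cond_C4 \<kappa>\<^sub>4 M D \<Longrightarrow> cov_rate \<delta> \<Xi> M X l f \<Longrightarrow> n0 \<le> n \<Longrightarrow>
       (\<integral>\<^sup>+\<omega>. ennreal ((1 + norm (Ssum X l f n \<omega>) ^ (2 * (s div 2))) *
           indicator {\<omega>. norm (Ssum X l f n \<omega>) > sqrt ((real s - 2) * lam * ln (real n))} \<omega>) \<partial>M)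
       \<le> ennreal (C * (real (nblocks l n) powr (- (real s - 2) / 2) / (ln (real n))\<^sup>2))"
    using tail_moment_large_n[OF assms(1-3,5,6,8-10) True] by blast
  define p where "p = (real s - 2) / 2"
  define C' where "C' = (1 + real n0 ^ (u + 1) * (2 ^ u * (2 * 2 ^ s + 2 * \<rho>))) * (real n0 powr p * (real n0)\<^sup>2)"
  have C': "C' \<ge> 0" using assms(2) by (simp add: C'_def)
  show ?thesis
  proof (intro exI[of _ "C + C'"] conjI allI impI)
    show "C + C' > 0" using C C' by simp
    fix M :: "'w measure" and X :: "int \<Rightarrow> 'w \<Rightarrow> real^'p" and D :: "int \<Rightarrow> 'w measure" and l
      and f :: "nat \<Rightarrow> nat \<Rightarrow> (nat \<Rightarrow> real^'p) \<Rightarrow> real^'q" and n :: nat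
    assume set: "block_setting M X D l f" and c1: "cond_C1 \<kappa>\<^sub>1 l" and c2: "cond_C2 s \<rho> \<kappa>\<^sub>2 \<Xi> M X l f"
      and c3: "cond_C3 \<kappa>\<^sub>3 M X D l f" and c4: "cond_C4 \<kappa>\<^sub>4 M D" and rate: "cov_rate \<delta> \<Xi> M X l f" and n2: "2 \<le> n"
    define B where "B = real (nblocks l n) powr - p / (ln (real n))\<^sup>2"
    have B0: "B \<ge> 0" by (simp add: B_def)
    have pB: "(- (real s - 2) / 2) = - p" unfolding p_def by (rule minus_divide_left[symmetric])
    have target: "K * real (nblocks l n) powr (- (real s - 2) / 2) * (ln (real n)) powi (-2) = K * B" for K
      unfolding pB by (simp add: B_def power_int_minus divide_inverse)
    show "(\<integral>\<^sup>+\<omega>. ennreal ((1 + norm (Ssum X l f n \<omega>) ^ (2 * (s div 2))) *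
                 indicator {\<omega>. norm (Ssum X l f n \<omega>) > sqrt ((real s - 2) * lam * ln (real n))} \<omega>) \<partial>M)
            \<le> ennreal ((C + C') * real (nblocks l n) powr (- (real s - 2) / 2) * (ln (real n)) powi (-2))"
      unfolding target
    proof (cases "n0 \<le> n")
      case True
      have "C * B \<le> (C + C') * B" using B0 C' by (intro mult_right_mono) auto
      then have "ennreal (C * B) \<le> ennreal ((C + C') * B)" by (rule ennreal_leI)
      with large[OF set c1 c2 c3 c4 rate True, unfolded pB, folded B_def]
      show "(\<integral>\<^sup>+\<omega>. ennreal ((1 + norm (Ssum X l f n \<omega>) ^ (2 * (s div 2))) *
                 indicator {\<omega>. norm (Ssum X l f n \<omega>) > sqrt ((real s - 2) * lam * ln (real n))} \<omega>) \<partial>M) \<le> ennreal ((C + C') * B)"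
        by (rule order_trans)
    next
      case False
      interpret block_process M X D l f s \<rho> by (rule block_process_of_conditions[OF set c2 assms(1,2)])
      have "C' * B \<le> (C + C') * B" using B0 C by (intro mult_right_mono) auto
      then have "ennreal (C' * B) \<le> ennreal ((C + C') * B)" by (rule ennreal_leI)
      with tail_moment_crude[OF n2 _ u, of n0 "sqrt ((real s - 2) * lam * ln (real n))", folded p_def, folded C'_def B_def, unfolded u_def]
      show "(\<integral>\<^sup>+\<omega>. ennreal ((1 + norm (Ssum X l f n \<omega>) ^ (2 * (s div 2))) *
                 indicator {\<omega>. norm (Ssum X l f n \<omega>) > sqrt ((real s - 2) * lam * ln (real n))} \<omega>) \<partial>M) \<le> ennreal ((C + C') * B)"
        using False by (meson order_trans nat_le_linear)
    qed
  qed
qed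

end
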